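(* Let $m,n\ge 1$ be integers. A distribution $G\in\mathcal O'_C(\mathbb R^n;M_{m\times m})$ is the generating distribution of an i.d.c.s. $(S_t)_{t\ge 0}\subset\mathcal O'_C(\mathbb R^n;M_{m\times m})$ if and only if $\max\{\operatorname{Re}\lambda:\lambda\in\sigma((\mathscr F G)(\xi))\}=O(\log|\xi|)$ as $|\xi|\to\infty$, $\xi\in\mathbb R^n$, in the sense of an upper bound, i.e. if and only if there is $C\in(0,\infty)$ such that $$\operatorname{Re}\lambda\le C(1+\log(1+|\xi|))\quad\text{for every }\xi\in\mathbb R^n\text{ and every }\lambda\in\sigma((\mathscr F G)(\xi)).$$
   Context: $M_{m\times m}$ is the set of $m\times m$ complex matrices; $\sigma(B)$ is the spectrum (set of eigenvalues) of $B\in M_{m\times m}$. $\mathcal S(\mathbb R^n)$ is the Schwartz space and $\mathcal S'(\mathbb R^n)$ the space of tempered distributions. The Fourier transformation is $(\mathscr F\varphi)(\xi)=\int_{\mathbb R^n}e^{-ix\cdot\xi}\varphi(x)\,dx$ for $\varphi\in\mathcal S(\mathbb R^n)$, and $\langle\mathscr F T,\varphi\rangle=\langle T,\mathscr F\varphi\rangle$ for $T\in\mathcal S'(\mathbb R^n)$; it acts entrywise on matrices of distributions. $\mathcal O_M(\mathbb R^n)$ is the algebra of $\phi\in C^\infty(\mathbb R^n)$ such that for every multiindex $\alpha$ there is $m_\alpha\in\mathbb N_0$ with $\sup_{\xi}(1+|\xi|)^{-m_\alpha}|\partial^\alpha\phi(\xi)|<\infty$. $\mathcal O'_C(\mathbb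 R^n)$ is the space of rapidly decreasing distributions: $T\in\mathcal D'(\mathbb R^n)$ such that for every $k\in\mathbb N_0$ there is $m_k\in\mathbb N_0$ with $T=\sum_{|\alpha|\le m_k}\partial^\alpha f_{k,\alpha}$, where the $f_{k,\alpha}$ are continuous and $f_{k,\alpha}(x)=O(|x|^{-k})$ as $|x|\to\infty$. Equivalently, $\mathcal O'_C(\mathbb R^n)=\{T\in\mathcal S'(\mathbb R^n):T*\varphi\in\mathcal S(\mathbb R^n)\ \forall\varphi\in\mathcal S(\mathbb R^n)\}$. It is a convolution algebra, and $\mathscr F$ is an algebra isomorphism of $\mathcal O'_C(\mathbb R^n)$ onto $\mathcal O_M(\mathbb R^n)$. The topology of $\mathcal O'_C(\mathbb R^n)$ is the one induced, via $T\mapsto (T* )|_{\mathcal S(\mathbb R^n)}$, by the space $L(\mathcal S(\mathbb R^n);\mathcal S(\mathbb R^n))$ of continuous linear operators with the compact-open topology. $\mathcal O'_C(\mathbb R^n;M_{m\times m})$ is the space of $m\times m$ matrices with entries in $\mathcal O'_C(\mathbb R^n)$, with the topology of $\mathcal O'_C(\mathbb R^n)^{m^2}$ and the convolution $S*T=(\sum_{j}S_{i,j}*T_{j,k})_{i,k}$. An i.d.c.s. (infinitely differentiable convolution semigroup) in it is an infinitely differentiable mapping $[0,\infty)\ni t\mapsto S_t\in\mathcal O'_C(\mathbb R^n;M_{m\times m})$ (right derivatives at $0$) such that $S_{s+t}=S_s*S_t$ for all $s,t\ge0$ and $S_0=\mathbb 1_{m\times m}\otimes\delta$ (the identity matrix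 times the Dirac distribution). Its generating distribution is $G=\frac{d}{dt}\big|_{t=0}S_t$. *)

theory Defs
  imports "HOL-Analysis.Analysis" "HOL-Library.Landau_Symbols"
begin

text \<open>
  Higher partial derivatives are indexed by lists of coordinates instead of multiindices:
  the list of length \<open>l\<close> with entries \<open>i, j, \<dots>\<close> stands for \<open>\<partial>\<^sub>i \<partial>\<^sub>j \<dots>\<close>, a derivative of order \<open>l\<close>.
  On smooth functions (and on distributions) the order of the entries is irrelevant, so that
  both index sets yield the same derivatives.
\<close>

definition partial :: "'n::finite \<Rightarrow> (real^'n \<Rightarrow> complex) \<Rightarrow> (real^'n \<Rightarrow> complex)" where
  "partial i f = (\<lambda>x. frechet_derivative f (at x) (axis i 1))"

definition partials :: "'n::finite list \<Rightarrow> (real^'n \<Rightarrow> complex) \<Rightarrow> (real^'n \<Rightarrow> complex)" where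
  "partials js f = foldr partial js f"

definition smooth :: "(real^'n::finite \<Rightarrow> complex) \<Rightarrow> bool" where
  "smooth f \<longleftrightarrow> (\<forall>js x. partials js f differentiable (at x))"

definition schwartz :: "(real^'n::finite \<Rightarrow> complex) set" where
  "schwartz = {f. smooth f \<and>
     (\<forall>N js. bdd_above (range (\<lambda>x. (1 + norm x) ^ N * norm (partials js f x))))}"

definition schwartz_seminorm :: "nat \<Rightarrow> 'n::finite list \<Rightarrow> (real^'n \<Rightarrow> complex) \<Rightarrow> real" where
  "schwartz_seminorm N js f = (SUP x. (1 + norm x) ^ N * norm (partials js f x))"

definition schwartz_topology :: "(real^'n::finite \<Rightarrow> complex) topology" where
  "schwartz_topology = topology_generated_by
     {{g \<in> schwartz. schwartz_seminorm N js (\<lambda>x. g x - f x) < e} | f N js e. f \<in> schwartz \<and> 0 < e}"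

definition O_M :: "(real^'n::finite \<Rightarrow> complex) set" where
  "O_M = {g. smooth g \<and>
     (\<forall>js. \<exists>N::nat. bdd_above (range (\<lambda>x. norm (partials js g x) / (1 + norm x) ^ N)))}"

text \<open>
  Functionals are total functions in HOL. All distributions are taken to be \<open>0\<close> outside the
  Schwartz space, so that equality of distributions is equality of functions and
  the vector space operations are the pointwise ones.
\<close>

type_synonym 'n functional = "(real^'n \<Rightarrow> complex) \<Rightarrow> complex"

definition tempered :: "'n::finite functional set" where
  "tempered = {T. (\<forall>\<phi>. \<phi> \<notin> schwartz \<longrightarrow> T \<phi> = 0) \<and>
     (\<forall>\<phi>\<in>schwartz. \<forall>\<psi>\<in>schwartz. \<forall>c. T (\<lambda>x. c * \<phi> x + \<psi> x) = c * T \<phi> + T \<psi>) \<and>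
     continuous_map schwartz_topology euclidean T}"

definition regular_dist :: "(real^'n::finite \<Rightarrow> complex) \<Rightarrow> 'n functional" where
  "regular_dist f = (\<lambda>\<phi>. if \<phi> \<in> schwartz then LINT x|lborel. f x * \<phi> x else 0)"

definition dirac :: "'n::finite functional" where
  "dirac = (\<lambda>\<phi>. if \<phi> \<in> schwartz then \<phi> 0 else 0)"

definition dist_partial :: "'n::finite \<Rightarrow> 'n functional \<Rightarrow> 'n functional" where
  "dist_partial i T = (\<lambda>\<phi>. if \<phi> \<in> schwartz then - T (partial i \<phi>) else 0)"

definition dist_partials :: "'n::finite list \<Rightarrow> 'n functional \<Rightarrow> 'n functional" where
  "dist_partials js T = foldr dist_partial js T"

definition fourier :: "(real^'n::finite \<Rightarrow> complex) \<Rightarrow> (real^'n \<Rightarrow> complex)" where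
  "fourier \<phi> = (\<lambda>\<xi>. LINT x|lborel. exp (- \<i> * complex_of_real (x \<bullet> \<xi>)) * \<phi> x)"

definition fourier_dist :: "'n::finite functional \<Rightarrow> 'n functional" where
  "fourier_dist T = (\<lambda>\<phi>. if \<phi> \<in> schwartz then T (fourier \<phi>) else 0)"

definition O_C' :: "'n::finite functional set" where
  "O_C' = {T \<in> tempered. \<forall>k::nat. \<exists>m::nat. \<exists>f.
     (\<forall>js. length js \<le> m \<longrightarrow> continuous_on UNIV (f js) \<and>
        (\<lambda>x. norm (f js x)) \<in> O[at_infinity](\<lambda>x. 1 / norm x ^ k)) \<and>
     T = (\<lambda>\<phi>. \<Sum>js | length js \<le> m. dist_partials js (regular_dist (f js)) \<phi>)}"

text \<open>
  The Fourier transform of a rapidly decreasing distribution is (given by) a unique function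
  in \<open>O_M\<close>; this is the function whose values \<open>(\<F> T)(\<xi>)\<close> are considered.
\<close>

definition fourier_fun :: "'n::finite functional \<Rightarrow> (real^'n \<Rightarrow> complex)" where
  "fourier_fun T = (THE g. g \<in> O_M \<and> fourier_dist T = regular_dist g)"

text \<open>\<open>(T * \<phi>)(x) = \<langle>T, \<phi>(x - \<cdot>)\<rangle>\<close>\<close>

definition conv_fun ::
  "'n::finite functional \<Rightarrow> (real^'n \<Rightarrow> complex) \<Rightarrow> (real^'n \<Rightarrow> complex)" where
  "conv_fun T \<phi> = (\<lambda>x. T (\<lambda>y. \<phi> (x - y)))"

text \<open>\<open>\<langle>S * T, \<phi>\<rangle> = \<langle>S\<^sub>x, \<langle>T\<^sub>y, \<phi>(x + y)\<rangle>\<rangle>\<close>\<close>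

definition conv :: "'n::finite functional \<Rightarrow> 'n functional \<Rightarrow> 'n functional" where
  "conv S T = (\<lambda>\<phi>. if \<phi> \<in> schwartz then S (\<lambda>x. T (\<lambda>y. \<phi> (x + y))) else 0)"

text \<open>
  Continuous linear operators on the Schwartz space with the compact-open topology; like
  functionals, they are taken to vanish outside the Schwartz space.
\<close>

definition schwartz_operators ::
  "((real^'n::finite \<Rightarrow> complex) \<Rightarrow> (real^'n \<Rightarrow> complex)) set" where
  "schwartz_operators = {A. (\<forall>\<phi>. \<phi> \<notin> schwartz \<longrightarrow> A \<phi> = (\<lambda>x. 0)) \<and>
     (\<forall>\<phi>\<in>schwartz. \<forall>\<psi>\<in>schwartz. \<forall>c.
        A (\<lambda>x. c * \<phi> x + \<psi> x) = (\<lambda>x. c * A \<phi> x + A \<psi> x)) \<and>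
     continuous_map schwartz_topology schwartz_topology A}"

definition operator_topology ::
  "((real^'n::finite \<Rightarrow> complex) \<Rightarrow> (real^'n \<Rightarrow> complex)) topology" where
  "operator_topology = topology_generated_by
     {{A \<in> schwartz_operators. A ` K \<subseteq> U} | K U.
        compactin schwartz_topology K \<and> openin schwartz_topology U}"

definition O_C'_topology :: "'n::finite functional topology" where
  "O_C'_topology = pullback_topology O_C' conv_fun operator_topology"

type_synonym ('n, 'm) dist_matrix = "'m \<Rightarrow> 'm \<Rightarrow> 'n functional"

definition mat_topology :: "('n::finite, 'm::finite) dist_matrix topology" where
  "mat_topology = product_topology (\<lambda>i. product_topology (\<lambda>j. O_C'_topology) UNIV) UNIV"

definition mat_conv ::
  "('n::finite, 'm::finite) dist_matrix \<Rightarrow> ('n, 'm) dist_matrix \<Rightarrow> ('n, 'm) dist_matrix" where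
  "mat_conv S T = (\<lambda>i k \<phi>. \<Sum>j\<in>UNIV. conv (S i j) (T j k) \<phi>)"

definition mat_dirac :: "('n::finite, 'm::finite) dist_matrix" where
  "mat_dirac = (\<lambda>i j. if i = j then dirac else (\<lambda>\<phi>. 0))"

text \<open>Derivative of a curve on \<open>[0,\<infinity>)\<close>; at \<open>t = 0\<close> it is the right derivative.\<close>

definition has_mat_derivative ::
  "(real \<Rightarrow> ('n::finite, 'm::finite) dist_matrix) \<Rightarrow> ('n, 'm) dist_matrix \<Rightarrow> real \<Rightarrow> bool" where
  "has_mat_derivative S D t \<longleftrightarrow>
     limitin mat_topology (\<lambda>u. \<lambda>i j \<phi>. (S u i j \<phi> - S t i j \<phi>) / complex_of_real (u - t)) D
       (at t within {0..})"

definition smooth_curve :: "(real \<Rightarrow> ('n::finite, 'm::finite) dist_matrix) \<Rightarrow> bool" where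
  "smooth_curve S \<longleftrightarrow> (\<forall>t\<ge>0. S t \<in> topspace mat_topology) \<and>
     (\<exists>D :: nat \<Rightarrow> real \<Rightarrow> ('n, 'm) dist_matrix. (\<forall>t\<ge>0. D 0 t = S t) \<and>
        (\<forall>l. \<forall>t\<ge>0. has_mat_derivative (D l) (D (Suc l) t) t))"

definition idcs :: "(real \<Rightarrow> ('n::finite, 'm::finite) dist_matrix) \<Rightarrow> bool" where
  "idcs S \<longleftrightarrow> smooth_curve S \<and> (\<forall>s\<ge>0. \<forall>t\<ge>0. S (s + t) = mat_conv (S s) (S t)) \<and>
     S 0 = mat_dirac"

definition generating_distribution ::
  "(real \<Rightarrow> ('n::finite, 'm::finite) dist_matrix) \<Rightarrow> ('n, 'm) dist_matrix \<Rightarrow> bool" where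
  "generating_distribution S G \<longleftrightarrow> has_mat_derivative S G 0"

definition fourier_matrix :: "('n::finite, 'm::finite) dist_matrix \<Rightarrow> real^'n \<Rightarrow> complex^'m^'m" where
  "fourier_matrix G \<xi> = (\<chi> i j. fourier_fun (G i j) \<xi>)"

definition spectrum :: "complex^'m^'m::finite \<Rightarrow> complex set" where
  "spectrum B = {\<mu>. \<exists>v. v \<noteq> 0 \<and> B *v v = \<mu> *s v}"

end

theory Submission
  imports Defs "HOL-Probability.Sinc_Integral" "HOL-Probability.Characteristic_Functions"
    "HOL-Computational_Algebra.Fundamental_Theorem_Algebra"
begin

text \<open>
  The Fourier transformation turns the convolution algebra of rapidly decreasing distributions into the
  algebra of multipliers with pointwise multiplication. Every \<open>T\<close> in \<open>O_C'\<close> is \<open>symbol_dist a\<close>, the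
  inverse Fourier transform of a symbol \<open>a\<close> in \<open>O_M\<close>, every symbol occurs, and convolution multiplies
  symbols (\<open>O_C'_symbol\<close>, \<open>symbol_dist_O_C'\<close>, \<open>conv_symbol_dist\<close>). Convergence of the symbols, with all
  derivatives and polynomial weights, implies convergence in \<open>O_C'\<close>, which in turn implies pointwise
  convergence of the symbols (\<open>limitin_symbol_dist\<close>, \<open>limitin_symbol_dist_pointwise\<close>). A semigroup whose
  generator has the matrix of symbols \<open>A\<close> can therefore only have the symbols \<open>exp (t A(\<xi>))\<close>, and the
  question is whether the entries of this matrix are multipliers, with bounds that are locally uniform in \<open>t\<close>.

  The spectral bound is necessary: if \<open>A(\<xi>) v = \<mu> v\<close>, then \<open>exp (t A(\<xi>)) v = exp (t \<mu>) v\<close>, so that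
  \<open>exp (Re \<mu>)\<close> is at most the norm of the symbol at time 1, which grows polynomially; taking logarithms
  gives the claim (\<open>generator_spectral_bound\<close>).

  It is sufficient (\<open>spectral_bound_generates\<close>) for two reasons. First, at a fixed frequency every vector is
  annihilated by a product of at most \<open>2 m\<close> factors \<open>A - \<mu>\<^sub>k\<close> with eigenvalues \<open>\<mu>\<^sub>k\<close>. Along the partial
  products the flow satisfies a triangular linear system, which yields the bound
  \<open>exp (t max Re \<mu>) (1 + 2 t |A|)\<^sup>2\<^sup>m\<close> (\<open>E_spectral_bound\<close>). Under the
  logarithmic hypothesis it is polynomial in \<open>\<xi>\<close>. Second, a derivative of \<open>exp (t A)\<close> in \<open>\<xi>\<close> solves the same
  linear differential equation with an inhomogeneity that contains only derivatives of lower order.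
  Variation of constants transfers the polynomial bound to all orders (\<open>tame_E\<close>). The derivatives in \<open>t\<close> are
  \<open>A\<^sup>l exp (t A)\<close>, and Taylor's formula gives the convergence of the difference quotients in the weighted
  norms (\<open>exp_deriv_quotient\<close>).

  All estimates are expressed by \<open>jet_norm\<close>, the sum of the absolute values of all derivatives up to a given
  order at a point, which is submultiplicative up to a constant. Its exchange of decay and smoothness under
  the Fourier transformation (\<open>fourier_jet_bound\<close>) is the analytic core of the distributional part.
\<close>

section \<open>Partial derivatives\<close>

lemma partial_eqI: "(f has_derivative f') (at x) \<Longrightarrow> partial i f x = f' (axis i 1)"
  unfolding partial_def using frechet_derivative_at by metis

lemma has_derivative_frechet: "f differentiable (at x) \<Longrightarrow> (f has_derivative frechet_derivative f (at x)) (at x)"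
  by (simp add: frechet_derivative_works)

lemma partials_Nil [simp]: "partials [] f = f"
  by (simp add: partials_def)

lemma partials_Cons [simp]: "partials (i # js) f = partial i (partials js f)"
  by (simp add: partials_def)

lemma partials_append: "partials (is @ js) f = partials is (partials js f)"
  by (simp add: partials_def)

lemma partials_snoc: "partials (js @ [i]) f = partials js (partial i f)"
  by (simp add: partials_append)

lemma smooth_differentiable: "smooth f \<Longrightarrow> f differentiable (at x)"
  unfolding smooth_def by (metis partials_Nil)

lemma smooth_partials: "smooth f \<Longrightarrow> smooth (partials js f)"
  unfolding smooth_def by (metis partials_append)

lemma smooth_partial: "smooth f \<Longrightarrow> smooth (partial i f)"
  using smooth_partials[of f "[i]"] by simp

lemma smooth_continuous: "smooth f \<Longrightarrow> continuous_on S f"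
  by (meson continuous_at_imp_continuous_on differentiable_imp_continuous_within smooth_differentiable)

text \<open>Closure of smoothness under sums, products and the like follows by exhibiting a class of functions that is
  stable under one differentiation; formulas for higher derivatives of products are avoided.\<close>

lemma smooth_coinduct:
  assumes "f \<in> X" "\<And>g x. g \<in> X \<Longrightarrow> g differentiable (at x)" "\<And>g i. g \<in> X \<Longrightarrow> partial i g \<in> X"
  shows "smooth f"
proof -
  have "partials js f \<in> X" for js by (induction js) (use assms in auto)
  then show ?thesis unfolding smooth_def using assms(2) by blast
qed

lemma partial_const [simp]: "partial i (\<lambda>x. c) = (\<lambda>x. 0)"
  by (rule ext, rule partial_eqI[THEN trans]) (auto intro: derivative_intros)

lemma partial_add:
  assumes "\<And>x. f differentiable (at x)" "\<And>x. g differentiable (at x)"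
  shows "partial i (\<lambda>x. f x + g x) = (\<lambda>x. partial i f x + partial i g x)"
proof
  fix x
  show "partial i (\<lambda>x. f x + g x) x = partial i f x + partial i g x"
    by (rule partial_eqI[THEN trans, OF has_derivative_add[OF has_derivative_frechet[OF assms(1)] has_derivative_frechet[OF assms(2)]]])
       (simp add: partial_def)
qed

lemma partial_mult:
  assumes "\<And>x. f differentiable (at x)" "\<And>x. g differentiable (at x)"
  shows "partial i (\<lambda>x. f x * g x) = (\<lambda>x. partial i f x * g x + f x * partial i g x)"
proof
  fix x
  show "partial i (\<lambda>x. f x * g x) x = partial i f x * g x + f x * partial i g x"
    by (rule partial_eqI[THEN trans, OF has_derivative_mult[OF has_derivative_frechet[OF assms(1)] has_derivative_frechet[OF assms(2)]]])
       (simp add: partial_def algebra_simps)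
qed

lemma partial_cmult:
  assumes "\<And>x. f differentiable (at x)"
  shows "partial i (\<lambda>x. c * f x) = (\<lambda>x. c * partial i f x)"
  using partial_mult[of "\<lambda>_. c" f i] assms by auto

lemma smooth_const [simp]: "smooth (\<lambda>x. c)"
proof (rule smooth_coinduct[where X = "range (\<lambda>c x. c)"])
  fix g :: "real^'a \<Rightarrow> complex" and i assume "g \<in> range (\<lambda>c x. c)"
  then show "partial i g \<in> range (\<lambda>c x. c)" by auto
qed auto

lemma smooth_add:
  assumes "smooth f" "smooth g" shows "smooth (\<lambda>x. f x + g x)"
proof (rule smooth_coinduct[where X = "{\<lambda>x. f x + g x | f g. smooth f \<and> smooth g}"])
  fix h :: "real^'a \<Rightarrow> complex" and i assume "h \<in> {\<lambda>x. f x + g x | f g. smooth f \<and> smooth g}"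
  then obtain f g where h: "h = (\<lambda>x. f x + g x)" "smooth f" "smooth g" by auto
  then have "partial i h = (\<lambda>x. partial i f x + partial i g x)"
    using partial_add smooth_differentiable by blast
  then show "partial i h \<in> {\<lambda>x. f x + g x | f g. smooth f \<and> smooth g}"
    using h smooth_partial by blast
qed (use assms smooth_differentiable in \<open>auto intro!: derivative_intros\<close>)

lemma partials_add:
  assumes "smooth f" "smooth g"
  shows "partials js (\<lambda>x. f x + g x) = (\<lambda>x. partials js f x + partials js g x)"
proof (induction js)
  case (Cons i js)
  show ?case unfolding partials_Cons Cons
    by (rule partial_add; use assms smooth_def in blast)
qed auto

text \<open>Products are not stable under differentiation, but sums of products are.\<close>

inductive_set smooth_products :: "(real^'n::finite \<Rightarrow> complex) set" where
  mult: "smooth f \<Longrightarrow> smooth g \<Longrightarrow> (\<lambda>x. f x * g x) \<in> smooth_products"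
| add: "f \<in> smooth_products \<Longrightarrow> g \<in> smooth_products \<Longrightarrow> (\<lambda>x. f x + g x) \<in> smooth_products"

lemma smooth_mult:
  assumes "smooth f" "smooth g" shows "smooth (\<lambda>x. f x * g x)"
proof (rule smooth_coinduct[where X = smooth_products])
  show diff: "h differentiable (at x)" if "h \<in> smooth_products" for h :: "real^'a \<Rightarrow> complex" and x
    using that by induction (use smooth_differentiable in \<open>auto intro!: derivative_intros\<close>)
  show "partial i h \<in> smooth_products" if "h \<in> smooth_products" for h :: "real^'a \<Rightarrow> complex" and i
    using that
  proof induction
    case (mult f g)
    then have "partial i (\<lambda>x. f x * g x) = (\<lambda>x. partial i f x * g x + f x * partial i g x)"
      using partial_mult smooth_differentiable by blast
    then show ?case using mult by (auto intro!: smooth_products.intros smooth_partial)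
  next
    case (add f g)
    then have "partial i (\<lambda>x. f x + g x) = (\<lambda>x. partial i f x + partial i g x)"
      using partial_add diff by blast
    then show ?case using add by (auto intro!: smooth_products.intros)
  qed
qed (use assms in \<open>auto intro: smooth_products.intros\<close>)

lemma smooth_cmult: "smooth f \<Longrightarrow> smooth (\<lambda>x. c * f x)"
  using smooth_mult[OF smooth_const] .

lemma partials_cmult:
  assumes "smooth f" shows "partials js (\<lambda>x. c * f x) = (\<lambda>x. c * partials js f x)"
proof (induction js)
  case (Cons i js)
  show ?case unfolding partials_Cons Cons
    by (rule partial_cmult; use assms smooth_def in blast)
qed auto

lemma smooth_uminus: "smooth f \<Longrightarrow> smooth (\<lambda>x. - f x)"
  using smooth_cmult[of f "-1"] by simp

lemma smooth_diff: "smooth f \<Longrightarrow> smooth g \<Longrightarrow> smooth (\<lambda>x. f x - g x)"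
  using smooth_add[OF _ smooth_uminus[of g], of f] by simp

lemma partials_diff:
  "smooth f \<Longrightarrow> smooth g \<Longrightarrow> partials js (\<lambda>x. f x - g x) = (\<lambda>x. partials js f x - partials js g x)"
  using partials_add[OF _ smooth_uminus[of g], of f] partials_cmult[of g _ "-1"] by simp

lemma smooth_sum: "(\<And>i. i \<in> I \<Longrightarrow> smooth (f i)) \<Longrightarrow> smooth (\<lambda>x. \<Sum>i\<in>I. f i x)"
  by (induction I rule: infinite_finite_induct) (auto intro: smooth_add)

lemma partials_const: "partials js (\<lambda>x. c) = (\<lambda>x. if js = [] then c else 0)"
  by (induction js) auto

lemma partials_sum:
  "finite I \<Longrightarrow> (\<And>i. i \<in> I \<Longrightarrow> smooth (f i)) \<Longrightarrow> partials js (\<lambda>x. \<Sum>i\<in>I. f i x) = (\<lambda>x. \<Sum>i\<in>I. partials js (f i) x)"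
  by (induction I rule: finite_induct) (auto simp: partials_add smooth_sum partials_const)

lemma partial_affine:
  assumes "\<And>x. f differentiable (at x)"
  shows "partial i (\<lambda>x. f (a + c *\<^sub>R x)) = (\<lambda>x. of_real c * partial i f (a + c *\<^sub>R x))"
proof
  fix x
  have "((\<lambda>x. a + c *\<^sub>R x) has_derivative (\<lambda>h. c *\<^sub>R h)) (at x)"
    by (auto intro!: derivative_eq_intros)
  from has_derivative_compose[OF this has_derivative_frechet[OF assms]]
  have D: "((\<lambda>x. f (a + c *\<^sub>R x)) has_derivative (\<lambda>h. frechet_derivative f (at (a + c *\<^sub>R x)) (c *\<^sub>R h))) (at x)" .
  have "frechet_derivative f (at (a + c *\<^sub>R x)) (c *\<^sub>R axis i 1) = c *\<^sub>R frechet_derivative f (at (a + c *\<^sub>R x)) (axis i 1)"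
    using linear_frechet_derivative[OF assms] linear_scale by blast
  then show "partial i (\<lambda>x. f (a + c *\<^sub>R x)) x = of_real c * partial i f (a + c *\<^sub>R x)"
    using partial_eqI[OF D] by (simp add: partial_def scaleR_conv_of_real)
qed

lemma differentiable_affine:
  assumes "\<And>x. f differentiable (at x)"
  shows "(\<lambda>x. f (a + c *\<^sub>R x)) differentiable (at x)"
  by (rule differentiable_compose[of f "\<lambda>x. a + c *\<^sub>R x"]) (auto intro!: assms derivative_intros)

lemma partials_affine:
  fixes f :: "real^'n \<Rightarrow> complex"
  assumes "smooth f"
  shows "partials js (\<lambda>x. f (a + c *\<^sub>R x)) = (\<lambda>x. of_real c ^ length js * partials js f (a + c *\<^sub>R x))"
proof (induction js)
  case (Cons i js)
  have *: "\<And>x. partials js f differentiable (at x)" using assms smooth_def by blast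
  have "partials (i # js) (\<lambda>x. f (a + c *\<^sub>R x)) = partial i (\<lambda>x. of_real c ^ length js * partials js f (a + c *\<^sub>R x))"
    by (simp add: Cons)
  also have "\<dots> = (\<lambda>x. of_real c ^ length js * partial i (\<lambda>x. partials js f (a + c *\<^sub>R x)) x)"
    by (rule partial_cmult) (intro differentiable_affine *)
  finally show ?case by (simp add: partial_affine * algebra_simps)
qed auto

lemma smooth_affine:
  fixes f :: "real^'n \<Rightarrow> complex"
  assumes "smooth f" shows "smooth (\<lambda>x. f (a + c *\<^sub>R x))"
  unfolding smooth_def partials_affine[OF assms]
  using assms by (auto intro!: derivative_intros differentiable_affine simp: smooth_def)

section \<open>Sums of derivatives and the Leibniz inequality\<close>

text \<open>Lists that are permutations of each other denote the same derivative of a smooth function, so mixed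
  derivatives are counted several times. This changes the norm only by a constant factor.\<close>

definition jet_norm :: "nat \<Rightarrow> (real^'n::finite \<Rightarrow> complex) \<Rightarrow> real^'n \<Rightarrow> real" where
  "jet_norm K f x = (\<Sum>js | length js \<le> K. norm (partials js f x))"

lemma finite_short_lists [simp]: "finite {js :: 'n::finite list. length js \<le> K}"
  using finite_lists_length_le[of "UNIV :: 'n set" K] by simp

lemma jet_norm_nonneg [simp]: "0 \<le> jet_norm K f x"
  by (simp add: jet_norm_def sum_nonneg)

lemma jet_norm_ge: "length js \<le> K \<Longrightarrow> norm (partials js f x) \<le> jet_norm K f x"
  unfolding jet_norm_def by (rule member_le_sum) auto

lemma jet_norm_ge_norm: "norm (f x) \<le> jet_norm K f x"
  using jet_norm_ge[of "[]"] by simp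

lemma jet_norm_mono: "K \<le> L \<Longrightarrow> jet_norm K f x \<le> jet_norm L f x"
  unfolding jet_norm_def by (rule sum_mono2) auto

definition list_count :: "'n::finite itself \<Rightarrow> nat \<Rightarrow> real" where
  "list_count _ K = real (card {js :: 'n list. length js \<le> K})"

lemma list_count_nonneg [simp]: "0 \<le> list_count T K"
  by (simp add: list_count_def)

lemma jet_norm_le:
  fixes f :: "real^'n::finite \<Rightarrow> complex"
  assumes "\<And>js. length js \<le> K \<Longrightarrow> norm (partials js f x) \<le> B"
  shows "jet_norm K f x \<le> list_count TYPE('n) K * B"
  unfolding jet_norm_def list_count_def by (rule sum_bounded_above) (use assms in auto)

lemma jet_norm_partials: "jet_norm K (partials js f) x \<le> jet_norm (K + length js) f x"
proof -
  have "jet_norm K (partials js f) x = (\<Sum>is\<in>(\<lambda>is. is @ js) ` {is. length is \<le> K}. norm (partials is f x))"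
    unfolding jet_norm_def by (subst sum.reindex) (auto simp: inj_on_def partials_append)
  also have "\<dots> \<le> jet_norm (K + length js) f x"
    unfolding jet_norm_def by (rule sum_mono2) auto
  finally show ?thesis .
qed

lemma jet_norm_partial: "jet_norm K (partial i f) x \<le> jet_norm (Suc K) f x"
  using jet_norm_partials[of K "[i]" f x] by simp

lemma jet_norm_add:
  "smooth f \<Longrightarrow> smooth g \<Longrightarrow> jet_norm K (\<lambda>x. f x + g x) x \<le> jet_norm K f x + jet_norm K g x"
  unfolding jet_norm_def by (simp add: partials_add flip: sum.distrib) (intro sum_mono norm_triangle_ineq)

lemma jet_norm_cmult: "smooth f \<Longrightarrow> jet_norm K (\<lambda>x. c * f x) x = norm c * jet_norm K f x"
  unfolding jet_norm_def by (simp add: partials_cmult norm_mult sum_distrib_left)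

lemma jet_norm_const [simp]: "jet_norm K (\<lambda>x. c) (x :: real^'n::finite) = norm c"
proof -
  have "jet_norm K (\<lambda>x. c) x = (\<Sum>js :: 'n list | length js \<le> K. if js = [] then norm c else 0)"
    unfolding jet_norm_def partials_const by (rule sum.cong[OF refl]) simp
  then show ?thesis by simp
qed

lemma jet_norm_sum:
  "finite I \<Longrightarrow> (\<And>i. i \<in> I \<Longrightarrow> smooth (f i)) \<Longrightarrow>
    jet_norm K (\<lambda>x. \<Sum>i\<in>I. f i x) x \<le> (\<Sum>i\<in>I. jet_norm K (f i) x)"
  by (induction I rule: finite_induct)
     (auto intro!: order_trans[OF jet_norm_add] smooth_sum add_left_mono)

text \<open>Each derivative doubles the number of terms in the Leibniz formula. The innermost derivative is split
  off, because then the two factors stay smooth functions to which the induction hypothesis applies.\<close>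

lemma partials_mult_bound:
  assumes "smooth f" "smooth g" "length js \<le> K"
  shows "norm (partials js (\<lambda>x. f x * g x) x) \<le> 2 ^ length js * (jet_norm K f x * jet_norm K g x)"
  using assms
proof (induction js arbitrary: f g K rule: rev_induct)
  case Nil
  then show ?case by (auto simp: norm_mult intro!: mult_mono jet_norm_ge_norm)
next
  case (snoc i js)
  then obtain L where K: "K = Suc L" "length js \<le> L" by (cases K) auto
  note sm = snoc.prems(1,2) smooth_partial[OF snoc.prems(1), of i] smooth_partial[OF snoc.prems(2), of i]
  have "partials (js @ [i]) (\<lambda>x. f x * g x) = partials js (\<lambda>x. partial i f x * g x + f x * partial i g x)"
    by (simp add: partials_snoc partial_mult sm smooth_differentiable)
  also have "\<dots> = (\<lambda>x. partials js (\<lambda>x. partial i f x * g x) x + partials js (\<lambda>x. f x * partial i g x) x)"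
    by (intro partials_add smooth_mult sm)
  finally have "norm (partials (js @ [i]) (\<lambda>x. f x * g x) x)
      \<le> norm (partials js (\<lambda>x. partial i f x * g x) x) + norm (partials js (\<lambda>x. f x * partial i g x) x)"
    by (simp add: norm_triangle_ineq)
  also have "\<dots> \<le> 2 ^ length js * (jet_norm L (partial i f) x * jet_norm L g x)
      + 2 ^ length js * (jet_norm L f x * jet_norm L (partial i g) x)"
    by (intro add_mono snoc.IH K sm)
  also have "\<dots> \<le> 2 ^ length js * (jet_norm K f x * jet_norm K g x)
      + 2 ^ length js * (jet_norm K f x * jet_norm K g x)"
    by (intro add_mono mult_left_mono mult_mono) (auto simp: K jet_norm_partial jet_norm_mono)
  finally show ?case by (simp add: algebra_simps)
qed

lemma jet_norm_mult:
  fixes f :: "real^'n::finite \<Rightarrow> complex"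
  assumes "smooth f" "smooth g"
  shows "jet_norm K (\<lambda>x. f x * g x) x \<le> (list_count TYPE('n) K * 2 ^ K) * (jet_norm K f x * jet_norm K g x)"
proof -
  have "jet_norm K (\<lambda>x. f x * g x) x \<le> list_count TYPE('n) K * (2 ^ K * (jet_norm K f x * jet_norm K g x))"
  proof (rule jet_norm_le)
    fix js :: "'n list" assume "length js \<le> K"
    then have "norm (partials js (\<lambda>x. f x * g x) x) \<le> 2 ^ length js * (jet_norm K f x * jet_norm K g x)"
      using partials_mult_bound assms by blast
    also have "\<dots> \<le> 2 ^ K * (jet_norm K f x * jet_norm K g x)"
      using \<open>length js \<le> K\<close> by (intro mult_right_mono power_increasing) auto
    finally show "norm (partials js (\<lambda>x. f x * g x) x) \<le> 2 ^ K * (jet_norm K f x * jet_norm K g x)" .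
  qed
  then show ?thesis by (simp add: mult.assoc)
qed

text \<open>In the commutator of a differential monomial with multiplication by \<open>f\<close>, at least one derivative falls
  on \<open>f\<close>, so that \<open>g\<close> is differentiated at most \<open>K\<close> times. This gain of one order drives the induction in
  \<open>tame_E\<close>.\<close>

lemma partials_mult_commutator:
  assumes "smooth f" "smooth g" "length js \<le> Suc K"
  shows "norm (partials js (\<lambda>x. f x * g x) x - f x * partials js g x)
    \<le> 2 ^ length js * (jet_norm (Suc K) f x * jet_norm K g x)"
  using assms
proof (induction js arbitrary: f g K rule: rev_induct)
  case (snoc i js)
  note sm = snoc.prems(1,2) smooth_partial[OF snoc.prems(1), of i] smooth_partial[OF snoc.prems(2), of i]
  have js: "length js \<le> K" using snoc.prems by simp
  have "partials (js @ [i]) (\<lambda>x. f x * g x) = partials js (\<lambda>x. partial i f x * g x + f x * partial i g x)"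
    by (simp add: partials_snoc partial_mult sm smooth_differentiable)
  also have "\<dots> = (\<lambda>x. partials js (\<lambda>x. partial i f x * g x) x + partials js (\<lambda>x. f x * partial i g x) x)"
    by (intro partials_add smooth_mult sm)
  finally have "norm (partials (js @ [i]) (\<lambda>x. f x * g x) x - f x * partials (js @ [i]) g x)
      \<le> norm (partials js (\<lambda>x. partial i f x * g x) x)
        + norm (partials js (\<lambda>x. f x * partial i g x) x - f x * partials js (partial i g) x)"
    by (simp add: partials_snoc add_diff_eq[symmetric] norm_triangle_ineq)
  also have "\<dots> \<le> 2 ^ length js * (jet_norm K (partial i f) x * jet_norm K g x)
      + 2 ^ length js * (jet_norm (Suc K) f x * jet_norm K g x)"
  proof (rule add_mono)
    show "norm (partials js (\<lambda>x. partial i f x * g x) x) \<le> 2 ^ length js * (jet_norm K (partial i f) x * jet_norm K g x)"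
      by (intro partials_mult_bound sm js)
    show "norm (partials js (\<lambda>x. f x * partial i g x) x - f x * partials js (partial i g) x)
        \<le> 2 ^ length js * (jet_norm (Suc K) f x * jet_norm K g x)"
    proof (cases K)
      case 0
      then show ?thesis using js by simp
    next
      case (Suc L)
      have "norm (partials js (\<lambda>x. f x * partial i g x) x - f x * partials js (partial i g) x)
          \<le> 2 ^ length js * (jet_norm (Suc L) f x * jet_norm L (partial i g) x)"
        using js Suc by (intro snoc.IH sm) auto
      also have "\<dots> \<le> 2 ^ length js * (jet_norm (Suc K) f x * jet_norm K g x)"
        by (intro mult_left_mono mult_mono) (auto simp: Suc jet_norm_partial jet_norm_mono)
      finally show ?thesis .
    qed
  qed
  also have "\<dots> \<le> 2 ^ length js * (jet_norm (Suc K) f x * jet_norm K g x)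
      + 2 ^ length js * (jet_norm (Suc K) f x * jet_norm K g x)"
    by (intro add_mono mult_left_mono mult_right_mono) (auto simp: jet_norm_partial)
  finally show ?case by (simp add: algebra_simps)
qed auto

section \<open>Weighted bounds for Schwartz functions and multipliers\<close>

lemma one_plus_norm_ge_1: "1 \<le> 1 + norm x" by simp

lemma one_plus_norm_pos [simp]: "0 < 1 + norm x"
  by (simp add: add_pos_nonneg)

lemma one_plus_norm_nonzero [simp]: "1 + norm x \<noteq> 0"
  using one_plus_norm_pos[of x] by linarith

lemma one_plus_norm_power_mono: "M \<le> N \<Longrightarrow> (1 + norm x) ^ M \<le> (1 + norm x) ^ N"
  by (rule power_increasing) auto

lemma schwartz_smooth: "\<phi> \<in> schwartz \<Longrightarrow> smooth \<phi>"
  by (simp add: schwartz_def)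

lemma O_M_smooth: "g \<in> O_M \<Longrightarrow> smooth g"
  by (simp add: O_M_def)

lemma O_M_iff:
  "g \<in> O_M \<longleftrightarrow> smooth g \<and> (\<forall>js. \<exists>N B. \<forall>x. norm (partials js g x) \<le> B * (1 + norm x) ^ N)"
proof -
  have "bdd_above (range (\<lambda>x. norm (partials js g x) / (1 + norm x) ^ N))
    \<longleftrightarrow> (\<exists>B. \<forall>x. norm (partials js g x) \<le> B * (1 + norm x) ^ N)" for js N
    unfolding bdd_above_def by (simp add: pos_divide_le_eq)
  then show ?thesis by (simp add: O_M_def)
qed

lemma O_M_jet_bound:
  assumes "g \<in> O_M"
  obtains N B where "B \<ge> 0" "\<And>x. jet_norm K g x \<le> B * (1 + norm x) ^ N"
proof -
  have "\<forall>js. \<exists>N B. \<forall>x. norm (partials js g x) \<le> B * (1 + norm x) ^ N"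
    using assms O_M_iff by blast
  then obtain N B where NB: "\<And>js x. norm (partials js g x) \<le> B js * (1 + norm x) ^ N js"
    by metis
  define J where "J = {js :: 'a list. length js \<le> K}"
  define N' where "N' = (\<Sum>js\<in>J. N js)"
  have fin: "finite J" by (simp add: J_def)
  have "jet_norm K g x \<le> (\<Sum>js\<in>J. \<bar>B js\<bar>) * (1 + norm x) ^ N'" for x
  proof -
    have "jet_norm K g x \<le> (\<Sum>js\<in>J. \<bar>B js\<bar> * (1 + norm x) ^ N')"
      unfolding jet_norm_def J_def[symmetric]
    proof (rule sum_mono)
      fix js assume "js \<in> J"
      then have "N js \<le> N'" unfolding N'_def using fin by (intro member_le_sum) auto
      have "norm (partials js g x) \<le> \<bar>B js\<bar> * (1 + norm x) ^ N js"
        by (rule order_trans[OF NB]) (intro mult_right_mono, auto)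
      also have "\<dots> \<le> \<bar>B js\<bar> * (1 + norm x) ^ N'"
        using \<open>N js \<le> N'\<close> by (intro mult_left_mono one_plus_norm_power_mono) auto
      finally show "norm (partials js g x) \<le> \<bar>B js\<bar> * (1 + norm x) ^ N'" .
    qed
    then show ?thesis by (simp add: sum_distrib_right)
  qed
  then show ?thesis by (intro that[of "\<Sum>js\<in>J. \<bar>B js\<bar>" N']) (auto simp: sum_nonneg)
qed

lemma O_M_I:
  assumes "smooth g" "\<And>K. \<exists>N B. \<forall>x. jet_norm K g x \<le> B * (1 + norm x) ^ N"
  shows "g \<in> O_M"
  unfolding O_M_iff using assms(1)
proof safe
  fix js :: "'a list"
  obtain N B where "\<And>x. jet_norm (length js) g x \<le> B * (1 + norm x) ^ N" using assms(2) by blast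
  then have "norm (partials js g x) \<le> B * (1 + norm x) ^ N" for x
    using order_trans[OF jet_norm_ge[OF order_refl]] by blast
  then show "\<exists>N B. \<forall>x. norm (partials js g x) \<le> B * (1 + norm x) ^ N" by blast
qed

text \<open>As for smoothness, membership needs only one growth bound for each function of a class that is stable
  under differentiation.\<close>

lemma O_M_coinduct:
  assumes "f \<in> X" "\<And>g x. g \<in> X \<Longrightarrow> g differentiable (at x)" "\<And>g i. g \<in> X \<Longrightarrow> partial i g \<in> X"
    "\<And>g. g \<in> X \<Longrightarrow> \<exists>N B. \<forall>x. norm (g x) \<le> B * (1 + norm x) ^ N"
  shows "f \<in> O_M"
proof -
  have "partials js f \<in> X" for js by (induction js) (use assms in auto)
  then show ?thesis unfolding O_M_iff using smooth_coinduct[OF assms(1-3)] assms(4) by blast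
qed

lemma O_M_partials:
  assumes "g \<in> O_M" shows "partials js g \<in> O_M"
proof -
  have "partials ks (partials js g) = partials (ks @ js) g" for ks by (simp add: partials_append)
  then show ?thesis using assms by (simp add: O_M_iff smooth_partials)
qed

lemma O_M_partial: "g \<in> O_M \<Longrightarrow> partial i g \<in> O_M"
  using O_M_partials[of g "[i]"] by simp

lemma O_M_growth: "g \<in> O_M \<Longrightarrow> \<exists>N B. \<forall>x. norm (g x) \<le> B * (1 + norm x) ^ N"
  by (metis O_M_iff partials_Nil)

lemma O_M_const [simp]: "(\<lambda>x. c) \<in> O_M"
  by (rule O_M_I) (auto intro!: exI[of _ 0] exI[of _ "norm c"])

lemma O_M_mult:
  assumes "f \<in> O_M" "g \<in> O_M" shows "(\<lambda>x. f x * g x) \<in> (O_M :: (real^'n::finite \<Rightarrow> complex) set)"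
proof (rule O_M_I)
  show "smooth (\<lambda>x. f x * g x)" using assms O_M_smooth smooth_mult by blast
  fix K
  obtain N B where f: "B \<ge> 0" "\<And>x. jet_norm K f x \<le> B * (1 + norm x) ^ N" by (rule O_M_jet_bound[OF assms(1), where K=K]) blast
  obtain N' B' where g: "B' \<ge> 0" "\<And>x. jet_norm K g x \<le> B' * (1 + norm x) ^ N'" by (rule O_M_jet_bound[OF assms(2), where K=K]) blast
  let ?C = "list_count TYPE('n) K * 2 ^ K"
  have "jet_norm K (\<lambda>x. f x * g x) x \<le> (?C * B * B') * (1 + norm x) ^ (N + N')" for x
  proof -
    have "jet_norm K (\<lambda>x. f x * g x) x \<le> ?C * (jet_norm K f x * jet_norm K g x)"
      using assms O_M_smooth by (intro jet_norm_mult) auto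
    also have "\<dots> \<le> ?C * ((B * (1 + norm x) ^ N) * (B' * (1 + norm x) ^ N'))"
      by (intro mult_left_mono mult_mono) (auto simp: f g)
    finally show ?thesis by (simp add: power_add algebra_simps)
  qed
  then show "\<exists>N B. \<forall>x. jet_norm K (\<lambda>x. f x * g x) x \<le> B * (1 + norm x) ^ N" by blast
qed

lemma O_M_add:
  assumes "f \<in> O_M" "g \<in> O_M" shows "(\<lambda>x. f x + g x) \<in> O_M"
proof (rule O_M_I)
  show "smooth (\<lambda>x. f x + g x)" using assms O_M_smooth smooth_add by blast
  fix K
  obtain N B where f: "B \<ge> 0" "\<And>x. jet_norm K f x \<le> B * (1 + norm x) ^ N" by (rule O_M_jet_bound[OF assms(1), where K=K]) blast
  obtain N' B' where g: "B' \<ge> 0" "\<And>x. jet_norm K g x \<le> B' * (1 + norm x) ^ N'" by (rule O_M_jet_bound[OF assms(2), where K=K]) blast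
  have "jet_norm K (\<lambda>x. f x + g x) x \<le> (B + B') * (1 + norm x) ^ (N + N')" for x
  proof -
    have "jet_norm K (\<lambda>x. f x + g x) x \<le> B * (1 + norm x) ^ N + B' * (1 + norm x) ^ N'"
      using jet_norm_add[of f g K x] f g assms O_M_smooth by (smt (verit))
    also have "\<dots> \<le> B * (1 + norm x) ^ (N + N') + B' * (1 + norm x) ^ (N + N')"
      by (intro add_mono mult_left_mono one_plus_norm_power_mono f g) auto
    finally show ?thesis by (simp add: algebra_simps)
  qed
  then show "\<exists>N B. \<forall>x. jet_norm K (\<lambda>x. f x + g x) x \<le> B * (1 + norm x) ^ N" by blast
qed

lemma O_M_cmult: "g \<in> O_M \<Longrightarrow> (\<lambda>x. c * g x) \<in> O_M"
  by (rule O_M_mult[OF O_M_const])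

lemma O_M_uminus: "g \<in> O_M \<Longrightarrow> (\<lambda>x. - g x) \<in> O_M"
  using O_M_cmult[of g "-1"] by simp

lemma O_M_diff: "f \<in> O_M \<Longrightarrow> g \<in> O_M \<Longrightarrow> (\<lambda>x. f x - g x) \<in> O_M"
  using O_M_add[OF _ O_M_uminus[of g], of f] by simp

lemma O_M_sum: "(\<And>i. i \<in> I \<Longrightarrow> f i \<in> O_M) \<Longrightarrow> (\<lambda>x. \<Sum>i\<in>I. f i x) \<in> O_M"
  by (induction I rule: infinite_finite_induct) (auto intro: O_M_add)

lemma O_M_prod_list: "(\<And>i. f i \<in> O_M) \<Longrightarrow> (\<lambda>x. prod_list (map (\<lambda>i. f i x) js)) \<in> O_M"
  by (induction js) (auto intro: O_M_mult)

lemma norm_affine_power_le: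
  "(1 + norm (a + c *\<^sub>R x)) ^ N \<le> ((1 + norm a + \<bar>c\<bar>) ^ N) * (1 + norm x) ^ N"
proof -
  have "norm (a + c *\<^sub>R x) \<le> norm a + \<bar>c\<bar> * norm x" using norm_triangle_ineq[of a "c *\<^sub>R x"] by simp
  moreover have "0 \<le> norm a * norm x" by simp
  ultimately have "1 + norm (a + c *\<^sub>R x) \<le> (1 + norm a + \<bar>c\<bar>) * (1 + norm x)"
    by (simp add: algebra_simps) (smt (verit) abs_ge_zero norm_ge_zero mult_nonneg_nonneg)
  then have "(1 + norm (a + c *\<^sub>R x)) ^ N \<le> ((1 + norm a + \<bar>c\<bar>) * (1 + norm x)) ^ N"
    by (intro power_mono) auto
  then show ?thesis by (simp add: power_mult_distrib)
qed

lemma O_M_affine: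
  fixes g :: "real^'n::finite \<Rightarrow> complex"
  assumes "g \<in> O_M" shows "(\<lambda>x. g (a + c *\<^sub>R x)) \<in> O_M"
  unfolding O_M_iff partials_affine[OF O_M_smooth[OF assms]]
proof safe
  show "smooth (\<lambda>x. g (a + c *\<^sub>R x))" using smooth_affine O_M_smooth assms by blast
  fix js
  obtain N B where "\<forall>x. norm (partials js g x) \<le> B * (1 + norm x) ^ N" using assms O_M_iff by blast
  moreover from this have "B \<ge> 0" using norm_ge_zero order_trans by (metis mult_1_right norm_zero power_one add.right_neutral)
  ultimately have "norm (partials js g (a + c *\<^sub>R x)) \<le> B * ((1 + norm a + \<bar>c\<bar>) ^ N * (1 + norm x) ^ N)" for x
    using norm_affine_power_le[of a c x N] by (meson mult_left_mono order_trans)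
  then have "norm (of_real c ^ length js * partials js g (a + c *\<^sub>R x))
      \<le> (\<bar>c\<bar> ^ length js * (B * (1 + norm a + \<bar>c\<bar>) ^ N)) * (1 + norm x) ^ N" for x
    by (auto simp: norm_mult norm_power mult.assoc intro!: mult_left_mono)
  then show "\<exists>N B. \<forall>x. norm (of_real c ^ length js * partials js g (a + c *\<^sub>R x)) \<le> B * (1 + norm x) ^ N"
    by blast
qed

lemma O_M_reflect: "g \<in> O_M \<Longrightarrow> (\<lambda>x. g (- x)) \<in> O_M"
  using O_M_affine[of g 0 "-1"] by simp

lemma has_derivative_coord:
  "((\<lambda>x :: real^'n::finite. complex_of_real (x $ j)) has_derivative (\<lambda>h. complex_of_real (h $ j))) (at x)"
  by (rule bounded_linear_imp_has_derivative)
     (rule bounded_linear_compose[OF bounded_linear_of_real bounded_linear_vec_nth])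

lemma partial_coord: "partial i (\<lambda>x. complex_of_real (x $ j)) = (\<lambda>x. if i = j then 1 else 0)"
  by (rule ext, rule partial_eqI[THEN trans, OF has_derivative_coord]) (auto simp: axis_def)

lemma O_M_coord: "(\<lambda>x. complex_of_real (x $ j)) \<in> O_M"
proof (rule O_M_coinduct[where X = "insert (\<lambda>x. complex_of_real (x $ j)) (range (\<lambda>c x. c))"])
  fix g :: "real^'a \<Rightarrow> complex" and x assume "g \<in> insert (\<lambda>x. complex_of_real (x $ j)) (range (\<lambda>c x. c))"
  then show "g differentiable at x" using has_derivative_coord unfolding differentiable_def by (blast intro: has_derivative_const)
next
  fix g :: "real^'a \<Rightarrow> complex" and i assume "g \<in> insert (\<lambda>x. complex_of_real (x $ j)) (range (\<lambda>c x. c))"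
  then show "partial i g \<in> insert (\<lambda>x. complex_of_real (x $ j)) (range (\<lambda>c x. c))" by (auto simp: partial_coord)
next
  fix g :: "real^'a \<Rightarrow> complex" assume "g \<in> insert (\<lambda>x. complex_of_real (x $ j)) (range (\<lambda>c x. c))"
  then consider "g = (\<lambda>x. complex_of_real (x $ j))" | "\<exists>c. g = (\<lambda>x. c)" by auto
  then show "\<exists>N B. \<forall>x. norm (g x) \<le> B * (1 + norm x) ^ N"
  proof cases
    case 1
    then have "\<forall>x. norm (g x) \<le> 1 * (1 + norm x) ^ 1"
      by (auto intro: order_trans[OF component_le_norm_cart])
    then show ?thesis by blast
  next
    case 2 then obtain c where "g = (\<lambda>x. c)" by blast
    then show ?thesis by (auto intro!: exI[of _ 0] exI[of _ "norm c"])
  qed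
qed auto

lemma smooth_coord: "smooth (\<lambda>x. complex_of_real (x $ j))"
  by (rule O_M_smooth[OF O_M_coord])

text \<open>The weight exponent and the order are tied together, so that the topology is given by one increasing
  sequence of norms.\<close>

definition schwartz_norm :: "nat \<Rightarrow> (real^'n::finite \<Rightarrow> complex) \<Rightarrow> real" where
  "schwartz_norm K f = (\<Sum>js | length js \<le> K. schwartz_seminorm K js f)"

lemma schwartz_bdd: "\<phi> \<in> schwartz \<Longrightarrow> bdd_above (range (\<lambda>x. (1 + norm x) ^ N * norm (partials js \<phi> x)))"
  by (simp add: schwartz_def)

lemma schwartz_seminorm_ge:
  "\<phi> \<in> schwartz \<Longrightarrow> (1 + norm x) ^ N * norm (partials js \<phi> x) \<le> schwartz_seminorm N js \<phi>"
  unfolding schwartz_seminorm_def by (rule cSUP_upper) (auto intro: schwartz_bdd)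

lemma schwartz_seminorm_le:
  "(\<And>x. (1 + norm x) ^ N * norm (partials js \<phi> x) \<le> B) \<Longrightarrow> schwartz_seminorm N js \<phi> \<le> B"
  unfolding schwartz_seminorm_def by (rule cSUP_least) auto

lemma schwartz_seminorm_nonneg: "\<phi> \<in> schwartz \<Longrightarrow> 0 \<le> schwartz_seminorm N js \<phi>"
  by (rule order_trans[OF _ schwartz_seminorm_ge[of \<phi> 0]]) auto

lemma schwartz_norm_nonneg: "\<phi> \<in> schwartz \<Longrightarrow> 0 \<le> schwartz_norm K \<phi>"
  unfolding schwartz_norm_def by (intro sum_nonneg schwartz_seminorm_nonneg)

lemma schwartz_norm_ge:
  assumes "\<phi> \<in> schwartz" "N \<le> K" "L \<le> K"
  shows "(1 + norm x) ^ N * jet_norm L \<phi> x \<le> schwartz_norm K \<phi>"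
proof -
  have "(1 + norm x) ^ N * jet_norm L \<phi> x \<le> (1 + norm x) ^ K * jet_norm K \<phi> x"
    using assms by (intro mult_mono one_plus_norm_power_mono jet_norm_mono) auto
  also have "\<dots> = (\<Sum>js | length js \<le> K. (1 + norm x) ^ K * norm (partials js \<phi> x))"
    by (simp add: jet_norm_def sum_distrib_left)
  also have "\<dots> \<le> schwartz_norm K \<phi>"
    unfolding schwartz_norm_def by (intro sum_mono schwartz_seminorm_ge assms)
  finally show ?thesis .
qed

lemma schwartz_seminorm_le_norm:
  assumes "\<phi> \<in> schwartz" "N \<le> K" "length js \<le> K"
  shows "schwartz_seminorm N js \<phi> \<le> schwartz_norm K \<phi>"
proof (rule schwartz_seminorm_le)
  fix x
  have "(1 + norm x) ^ N * norm (partials js \<phi> x) \<le> (1 + norm x) ^ N * jet_norm (length js) \<phi> x"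
    by (intro mult_left_mono jet_norm_ge) auto
  also have "\<dots> \<le> schwartz_norm K \<phi>" using assms by (intro schwartz_norm_ge)
  finally show "(1 + norm x) ^ N * norm (partials js \<phi> x) \<le> schwartz_norm K \<phi>" .
qed

lemma schwartz_norm_le:
  fixes \<phi> :: "real^'n::finite \<Rightarrow> complex"
  assumes "\<And>x. (1 + norm x) ^ K * jet_norm K \<phi> x \<le> B"
  shows "schwartz_norm K \<phi> \<le> list_count TYPE('n) K * B"
  unfolding schwartz_norm_def list_count_def
proof (rule sum_bounded_above)
  fix js :: "'n list" assume js: "js \<in> {js. length js \<le> K}"
  show "schwartz_seminorm K js \<phi> \<le> B"
  proof (rule schwartz_seminorm_le)
    fix x
    have "(1 + norm x) ^ K * norm (partials js \<phi> x) \<le> (1 + norm x) ^ K * jet_norm K \<phi> x"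
      using js by (intro mult_left_mono jet_norm_ge) auto
    also have "\<dots> \<le> B" by (rule assms)
    finally show "(1 + norm x) ^ K * norm (partials js \<phi> x) \<le> B" .
  qed
qed

lemma schwartz_norm_mono:
  assumes "\<phi> \<in> schwartz" "K \<le> L" shows "schwartz_norm K \<phi> \<le> schwartz_norm L \<phi>"
proof -
  have "schwartz_norm K \<phi> \<le> (\<Sum>js | length js \<le> K. schwartz_seminorm L js \<phi>)"
    unfolding schwartz_norm_def
  proof (intro sum_mono schwartz_seminorm_le)
    fix js :: "'a list" and x
    have "(1 + norm x) ^ K * norm (partials js \<phi> x) \<le> (1 + norm x) ^ L * norm (partials js \<phi> x)"
      using assms by (intro mult_right_mono one_plus_norm_power_mono) auto
    also have "\<dots> \<le> schwartz_seminorm L js \<phi>" using assms by (intro schwartz_seminorm_ge)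
    finally show "(1 + norm x) ^ K * norm (partials js \<phi> x) \<le> schwartz_seminorm L js \<phi>" .
  qed
  also have "\<dots> \<le> schwartz_norm L \<phi>"
    unfolding schwartz_norm_def using assms by (intro sum_mono2) (auto simp: schwartz_seminorm_nonneg)
  finally show ?thesis .
qed

lemma schwartz_I:
  assumes "smooth \<phi>" "\<And>K N. \<exists>B. \<forall>x. (1 + norm x) ^ N * jet_norm K \<phi> x \<le> B"
  shows "\<phi> \<in> schwartz"
  unfolding schwartz_def
proof safe
  fix N and js :: "'a list"
  obtain B where B: "\<And>x. (1 + norm x) ^ N * jet_norm (length js) \<phi> x \<le> B" using assms by blast
  have "(1 + norm x) ^ N * norm (partials js \<phi> x) \<le> B" for x
    by (rule order_trans[OF mult_left_mono[OF jet_norm_ge[OF order_refl]] B]) simp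
  then show "bdd_above (range (\<lambda>x. (1 + norm x) ^ N * norm (partials js \<phi> x)))"
    by (auto simp: bdd_above_def)
qed (use assms in auto)

lemma schwartz_jet_bound:
  "\<phi> \<in> schwartz \<Longrightarrow> (1 + norm x) ^ N * jet_norm K \<phi> x \<le> schwartz_norm (max N K) \<phi>"
  by (rule schwartz_norm_ge) auto

lemma schwartz_mult:
  fixes \<phi> :: "real^'n::finite \<Rightarrow> complex"
  assumes "g \<in> O_M" "\<phi> \<in> schwartz" shows "(\<lambda>x. g x * \<phi> x) \<in> schwartz"
proof (rule schwartz_I)
  show "smooth (\<lambda>x. g x * \<phi> x)" using assms by (simp add: O_M_smooth schwartz_smooth smooth_mult)
  fix K N
  obtain M B where g: "B \<ge> 0" "\<And>x. jet_norm K g x \<le> B * (1 + norm x) ^ M" by (rule O_M_jet_bound[OF assms(1), where K=K]) blast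
  let ?C = "list_count TYPE('n) K * 2 ^ K"
  have "(1 + norm x) ^ N * jet_norm K (\<lambda>x. g x * \<phi> x) x \<le> ?C * B * schwartz_norm (max (N + M) K) \<phi>" for x
  proof -
    have "(1 + norm x) ^ N * jet_norm K (\<lambda>x. g x * \<phi> x) x \<le> (1 + norm x) ^ N * (?C * (jet_norm K g x * jet_norm K \<phi> x))"
      using assms O_M_smooth schwartz_smooth by (intro mult_left_mono jet_norm_mult) auto
    also have "\<dots> \<le> (1 + norm x) ^ N * (?C * ((B * (1 + norm x) ^ M) * jet_norm K \<phi> x))"
      by (intro mult_left_mono mult_right_mono) (auto simp: g)
    also have "\<dots> = (?C * B) * ((1 + norm x) ^ (N + M) * jet_norm K \<phi> x)"
      by (simp add: power_add algebra_simps)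
    also have "\<dots> \<le> (?C * B) * schwartz_norm (max (N + M) K) \<phi>"
      using assms g by (intro mult_left_mono schwartz_jet_bound) auto
    finally show ?thesis .
  qed
  then show "\<exists>B. \<forall>x. (1 + norm x) ^ N * jet_norm K (\<lambda>x. g x * \<phi> x) x \<le> B" by blast
qed

lemma schwartz_cmult: "\<phi> \<in> schwartz \<Longrightarrow> (\<lambda>x. c * \<phi> x) \<in> schwartz"
  by (rule schwartz_mult[OF O_M_const])

lemma schwartz_add:
  assumes "\<phi> \<in> schwartz" "\<psi> \<in> schwartz" shows "(\<lambda>x. \<phi> x + \<psi> x) \<in> schwartz"
proof (rule schwartz_I)
  show "smooth (\<lambda>x. \<phi> x + \<psi> x)" using assms by (simp add: schwartz_smooth smooth_add)
  fix K N
  have "(1 + norm x) ^ N * jet_norm K (\<lambda>x. \<phi> x + \<psi> x) x \<le> schwartz_norm (max N K) \<phi> + schwartz_norm (max N K) \<psi>" for x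
  proof -
    have "(1 + norm x) ^ N * jet_norm K (\<lambda>x. \<phi> x + \<psi> x) x \<le> (1 + norm x) ^ N * (jet_norm K \<phi> x + jet_norm K \<psi> x)"
      using assms schwartz_smooth by (intro mult_left_mono jet_norm_add) auto
    also have "\<dots> \<le> schwartz_norm (max N K) \<phi> + schwartz_norm (max N K) \<psi>"
      unfolding distrib_left using assms by (intro add_mono schwartz_jet_bound)
    finally show ?thesis .
  qed
  then show "\<exists>B. \<forall>x. (1 + norm x) ^ N * jet_norm K (\<lambda>x. \<phi> x + \<psi> x) x \<le> B" by blast
qed

lemma schwartz_diff: "\<phi> \<in> schwartz \<Longrightarrow> \<psi> \<in> schwartz \<Longrightarrow> (\<lambda>x. \<phi> x - \<psi> x) \<in> schwartz"
  using schwartz_add[OF _ schwartz_cmult[of \<psi> "-1"], of \<phi>] by simp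

lemma schwartz_zero [simp]: "(\<lambda>x. 0) \<in> schwartz"
  by (rule schwartz_I) auto

lemma schwartz_partials:
  assumes "\<phi> \<in> schwartz" shows "partials js \<phi> \<in> schwartz"
proof -
  have "partials ks (partials js \<phi>) = partials (ks @ js) \<phi>" for ks by (simp add: partials_append)
  then show ?thesis using assms smooth_partials unfolding schwartz_def by auto
qed

lemma schwartz_partial: "\<phi> \<in> schwartz \<Longrightarrow> partial i \<phi> \<in> schwartz"
  using schwartz_partials[of \<phi> "[i]"] by simp

lemma schwartz_affine:
  fixes \<phi> :: "real^'n::finite \<Rightarrow> complex"
  assumes "\<phi> \<in> schwartz" "c \<noteq> 0" shows "(\<lambda>x. \<phi> (a + c *\<^sub>R x)) \<in> schwartz"
  unfolding schwartz_def mem_Collect_eq partials_affine[OF schwartz_smooth[OF assms(1)]]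
proof (intro conjI allI)
  show "smooth (\<lambda>x. \<phi> (a + c *\<^sub>R x))" using smooth_affine assms schwartz_smooth by blast
  fix N js
  let ?C = "(1 + norm ((- (1 / c)) *\<^sub>R a) + \<bar>1 / c\<bar>) ^ N"
  have "(1 + norm x) ^ N * norm (of_real c ^ length js * partials js \<phi> (a + c *\<^sub>R x))
    \<le> \<bar>c\<bar> ^ length js * (?C * schwartz_seminorm N js \<phi>)" for x
  proof -
    have "x = (- (1 / c)) *\<^sub>R a + (1 / c) *\<^sub>R (a + c *\<^sub>R x)" using assms(2) by (simp add: algebra_simps)
    then have 1: "(1 + norm x) ^ N \<le> ?C * (1 + norm (a + c *\<^sub>R x)) ^ N" using norm_affine_power_le by metis
    have "(1 + norm x) ^ N * norm (of_real c ^ length js * partials js \<phi> (a + c *\<^sub>R x))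
      = \<bar>c\<bar> ^ length js * ((1 + norm x) ^ N * norm (partials js \<phi> (a + c *\<^sub>R x)))"
      by (simp add: norm_mult norm_power)
    also have "\<dots> \<le> \<bar>c\<bar> ^ length js * ((?C * (1 + norm (a + c *\<^sub>R x)) ^ N) * norm (partials js \<phi> (a + c *\<^sub>R x)))"
      by (intro mult_left_mono mult_right_mono 1) auto
    also have "\<dots> \<le> \<bar>c\<bar> ^ length js * (?C * schwartz_seminorm N js \<phi>)"
      unfolding mult.assoc by (intro mult_left_mono schwartz_seminorm_ge assms) auto
    finally show ?thesis .
  qed
  then show "bdd_above (range (\<lambda>x. (1 + norm x) ^ N * norm (of_real c ^ length js * partials js \<phi> (a + c *\<^sub>R x))))"
    unfolding bdd_above_def by blast
qed

lemma schwartz_reflect: "\<phi> \<in> schwartz \<Longrightarrow> (\<lambda>x. \<phi> (- x)) \<in> schwartz"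
  using schwartz_affine[of \<phi> "-1" 0] by simp

lemma schwartz_translate: "\<phi> \<in> schwartz \<Longrightarrow> (\<lambda>x. \<phi> (a + x)) \<in> schwartz"
  using schwartz_affine[of \<phi> 1 a] by simp

lemma schwartz_reflect_translate: "\<phi> \<in> schwartz \<Longrightarrow> (\<lambda>x. \<phi> (a - x)) \<in> schwartz"
  using schwartz_affine[of \<phi> "-1" a] by simp

lemma schwartz_reflect_translate_iff: "(\<lambda>x. \<phi> (a - x)) \<in> schwartz \<longleftrightarrow> \<phi> \<in> schwartz"
  using schwartz_reflect_translate[of \<phi> a] schwartz_reflect_translate[of "\<lambda>x. \<phi> (a - x)" a] by auto

section \<open>The Gaussian\<close>

definition gauss :: "real^'n::finite \<Rightarrow> complex" where
  "gauss x = complex_of_real (exp (- (x \<bullet> x)))"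

lemma has_derivative_gauss: "(gauss has_derivative (\<lambda>h. - 2 * of_real (x \<bullet> h) * gauss x)) (at x)"
  unfolding gauss_def[abs_def]
  by (auto intro!: derivative_eq_intros simp: inner_commute)

lemma partial_gauss: "partial i gauss = (\<lambda>x. - 2 * of_real (x $ i) * gauss x)"
  by (rule ext, rule partial_eqI[THEN trans, OF has_derivative_gauss]) (simp add: inner_axis)

lemma power_le_fact_exp: "y \<ge> 0 \<Longrightarrow> y ^ N \<le> fact N * exp (y :: real)"
proof -
  assume y: "y \<ge> 0"
  have "(\<Sum>n\<in>{N}. y ^ n /\<^sub>R fact n) \<le> exp y"
    unfolding exp_def by (rule sum_le_suminf[OF summable_exp_generic]) (use y in auto)
  then show ?thesis by (simp add: field_simps)
qed

lemma gauss_bound: "(1 + norm x) ^ N * norm (gauss x) \<le> fact N * exp 2"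
proof -
  have "(1 + norm x) ^ N \<le> fact N * exp (1 + norm x)" by (rule power_le_fact_exp) auto
  also have "\<dots> \<le> fact N * exp (2 + x \<bullet> x)"
  proof -
    have "0 \<le> (norm x - 1)\<^sup>2 + (norm x)^2" by simp
    then have "norm x \<le> 1 + x \<bullet> x"
      by (auto simp: power2_norm_eq_inner[symmetric] power2_eq_square algebra_simps)
    then show ?thesis by simp
  qed
  finally have "(1 + norm x) ^ N * exp (- (x \<bullet> x)) \<le> fact N * exp (2 + x \<bullet> x) * exp (- (x \<bullet> x))"
    by (intro mult_right_mono) auto
  then show ?thesis by (simp add: gauss_def mult.assoc flip: exp_add)
qed

text \<open>The products of the Gaussian with multipliers are stable under differentiation, and each of them
  decays faster than any power.\<close>

lemma gauss_schwartz: "gauss \<in> schwartz"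
proof -
  define X where "X = {\<lambda>x. g x * gauss x | g. g \<in> (O_M :: (real^'a \<Rightarrow> complex) set)}"
  have gd: "gauss differentiable (at x)" for x :: "real^'a"
    using has_derivative_gauss by (auto simp: differentiable_def)
  have "(\<lambda>x :: real^'a. 1 * gauss x) \<in> X"
    unfolding X_def by (rule CollectI, rule exI[of _ "\<lambda>x. 1"]) simp
  then have gX: "gauss \<in> X" by simp
  have d: "h differentiable (at x)" if "h \<in> X" for h x
    using that gd smooth_differentiable[OF O_M_smooth] by (auto simp: X_def intro!: derivative_intros)
  have p: "partial i h \<in> X" if h: "h \<in> X" for h i
  proof -
    obtain g where g: "g \<in> O_M" "h = (\<lambda>x. g x * gauss x)" using h by (auto simp: X_def)
    have "partial i h = (\<lambda>x. partial i g x * gauss x + g x * (- 2 * of_real (x $ i) * gauss x))"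
      using g gd by (simp add: partial_mult smooth_differentiable[OF O_M_smooth] partial_gauss)
    also have "\<dots> = (\<lambda>x. (partial i g x + g x * (- 2 * of_real (x $ i))) * gauss x)"
      by (simp add: algebra_simps)
    also have "\<dots> \<in> X"
      unfolding X_def
      by (rule CollectI, rule exI[of _ "\<lambda>x. partial i g x + g x * (- 2 * of_real (x $ i))"])
         (use g in \<open>intro conjI refl O_M_add O_M_mult O_M_coord O_M_partial O_M_const\<close>)
    finally show ?thesis .
  qed
  have b: "bdd_above (range (\<lambda>x. (1 + norm x) ^ N * norm (h x)))" if h: "h \<in> X" for h N
  proof -
    obtain g where g: "g \<in> O_M" "h = (\<lambda>x. g x * gauss x)" using h by (auto simp: X_def)
    obtain M B where B: "\<And>x. norm (g x) \<le> B * (1 + norm x) ^ M" using O_M_growth[OF g(1)] by blast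
    have "0 \<le> B" using order_trans[OF norm_ge_zero B[of 0]] by simp
    have "(1 + norm x) ^ N * norm (h x) \<le> B * (fact (N + M) * exp 2)" for x
    proof -
      have "(1 + norm x) ^ N * norm (h x) \<le> (1 + norm x) ^ N * ((B * (1 + norm x) ^ M) * norm (gauss x))"
        unfolding g norm_mult by (intro mult_left_mono mult_right_mono B) auto
      also have "\<dots> = B * ((1 + norm x) ^ (N + M) * norm (gauss x))" by (simp add: power_add)
      also have "\<dots> \<le> B * (fact (N + M) * exp 2)" by (intro mult_left_mono gauss_bound \<open>0 \<le> B\<close>)
      finally show ?thesis .
    qed
    then show ?thesis by (auto simp: bdd_above_def)
  qed
  have "partials js gauss \<in> X" for js by (induction js) (use gX p in auto)
  then show ?thesis unfolding schwartz_def using smooth_coinduct[OF gX d p] b by auto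
qed

section \<open>The weight \<open>(1 + |x|\<^sup>2)\<^sup>-\<^sup>1\<close>\<close>

text \<open>The inverse square of the Japanese bracket \<open>\<langle>x\<rangle>\<close>; multiplication by its powers turns functions of
  polynomial growth into integrable ones.\<close>

definition bracket :: "real^'n::finite \<Rightarrow> complex" where
  "bracket x = complex_of_real (1 / (1 + x \<bullet> x))"

lemma bracket_denom: "1 + x \<bullet> x > (0::real)"
  by (simp add: add_pos_nonneg)

lemma has_derivative_bracket:
  "(bracket has_derivative (\<lambda>h. - 2 * of_real (x \<bullet> h) * (bracket x)\<^sup>2)) (at x)"
proof -
  have "((\<lambda>x. 1 / (1 + x \<bullet> x)) has_derivative (\<lambda>h. - 2 * (x \<bullet> h) * (1 / (1 + x \<bullet> x))\<^sup>2)) (at x)"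
    using bracket_denom[of x]
    by (auto intro!: derivative_eq_intros simp: inner_commute field_simps power2_eq_square)
  from has_derivative_of_real[OF this] show ?thesis
    unfolding bracket_def[abs_def] of_real_mult of_real_minus of_real_numeral of_real_power .
qed

lemma bracket_differentiable: "bracket differentiable (at x)"
  using has_derivative_bracket by (auto simp: differentiable_def)

lemma partial_bracket: "partial i bracket = (\<lambda>x. - 2 * of_real (x $ i) * (bracket x)\<^sup>2)"
  by (rule ext, rule partial_eqI[THEN trans, OF has_derivative_bracket]) (simp add: inner_axis)

text \<open>The algebra generated by the weight and its products with coordinates consists of bounded functions
  and is stable under differentiation. It contains the quotients of the derivatives of the weight by the
  weight itself, whence these derivatives decay at least as fast as the weight (\<open>bracket_partials\<close>).\<close>

inductive_set bracket_algebra :: "(real^'n::finite \<Rightarrow> complex) set" where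
  const: "(\<lambda>x. c) \<in> bracket_algebra"
| bracket: "bracket \<in> bracket_algebra"
| coord: "(\<lambda>x. of_real (x $ i) * bracket x) \<in> bracket_algebra"
| add: "f \<in> bracket_algebra \<Longrightarrow> g \<in> bracket_algebra \<Longrightarrow> (\<lambda>x. f x + g x) \<in> bracket_algebra"
| mult: "f \<in> bracket_algebra \<Longrightarrow> g \<in> bracket_algebra \<Longrightarrow> (\<lambda>x. f x * g x) \<in> bracket_algebra"

lemma coord_differentiable: "(\<lambda>x :: real^'n::finite. complex_of_real (x $ j)) differentiable (at x)"
  using has_derivative_coord by (auto simp: differentiable_def)

lemma bracket_algebra_differentiable: "f \<in> bracket_algebra \<Longrightarrow> f differentiable (at x)"
  by (induction rule: bracket_algebra.induct) (auto intro!: derivative_intros bracket_differentiable coord_differentiable)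

lemma bracket_algebra_partial: "f \<in> bracket_algebra \<Longrightarrow> partial i f \<in> bracket_algebra"
proof (induction rule: bracket_algebra.induct)
  case (const c)
  then show ?case by (simp add: bracket_algebra.const)
next
  case bracket
  have "partial i bracket = (\<lambda>x. (- 2) * ((of_real (x $ i) * bracket x) * bracket x))"
    by (simp add: partial_bracket power2_eq_square algebra_simps)
  then show ?case by (simp only:) (intro bracket_algebra.intros)
next
  case (coord j)
  have "partial i (\<lambda>x. of_real (x $ j) * bracket x) = (\<lambda>x. (if i = j then 1 else 0) * bracket x
      + (- 2) * ((of_real (x $ j) * bracket x) * (of_real (x $ i) * bracket x)))"
    by (simp add: partial_mult bracket_differentiable coord_differentiable partial_coord partial_bracket power2_eq_square algebra_simps)
  then show ?case by (simp only:) (intro bracket_algebra.intros)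
qed (auto simp: partial_add partial_mult bracket_algebra_differentiable intro!: bracket_algebra.intros)

lemma bracket_algebra_bounded:
  fixes f :: "real^'n::finite \<Rightarrow> complex"
  shows "f \<in> bracket_algebra \<Longrightarrow> \<exists>B. \<forall>x. norm (f x) \<le> B"
proof (induction rule: bracket_algebra.induct)
  case bracket
  have "norm (bracket x :: complex) \<le> 1" for x :: "real^'n"
    using bracket_denom[of x] by (simp add: bracket_def norm_divide del: of_real_divide)
  then show ?case by blast
next
  case (coord i)
  have "norm (of_real (x $ i) * bracket x :: complex) \<le> 1" for x :: "real^'n"
  proof -
    have "\<bar>x $ i\<bar> \<le> norm x" by (rule component_le_norm_cart)
    also have "norm x \<le> 1 + x \<bullet> x"
      using sum_squares_ge_zero[of "norm x - 1" "norm x"] by (simp add: power2_norm_eq_inner[symmetric] power2_eq_square algebra_simps)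
    finally have "\<bar>x $ i\<bar> \<le> 1 + x \<bullet> x" .
    then show ?thesis using bracket_denom[of x] by (simp add: bracket_def norm_mult norm_divide del: of_real_divide)
  qed
  then show ?case by blast
next
  case (add f g)
  then obtain B C where "\<forall>x. norm (f x) \<le> B" "\<forall>x. norm (g x) \<le> C" by blast
  then have "\<forall>x. norm (f x + g x) \<le> B + C" by (meson add_mono norm_triangle_ineq order_trans)
  then show ?case by blast
next
  case (mult f g)
  then obtain B C where "\<forall>x. norm (f x) \<le> B" "\<forall>x. norm (g x) \<le> C" by blast
  then have "\<forall>x. norm (f x * g x) \<le> B * C"
    unfolding norm_mult by (meson mult_mono norm_ge_zero order_trans)
  then show ?case by blast
qed auto

lemma bracket_smooth: "smooth (bracket :: real^'a::finite \<Rightarrow> complex)"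
  and bracket_partials: "\<exists>B. \<forall>x :: real^'a. norm (partials js bracket x) \<le> B * norm (bracket x)"
proof -
  have *: "\<exists>b\<in>bracket_algebra. partials js bracket = (\<lambda>x. bracket x * b x)" for js :: "'a list"
  proof (induction js)
    case Nil
    show ?case using bracket_algebra.const[of 1] by force
  next
    case (Cons i js)
    then obtain b where b: "b \<in> bracket_algebra" "partials js bracket = (\<lambda>x. bracket x * b x)" by blast
    have "partials (i # js) bracket = (\<lambda>x. bracket x * (partial i b x + (- 2) * ((of_real (x $ i) * bracket x) * b x)))"
      using b by (simp add: partial_mult bracket_differentiable bracket_algebra_differentiable partial_bracket
          power2_eq_square algebra_simps)
    moreover have "(\<lambda>x. partial i b x + (- 2) * ((of_real (x $ i) * bracket x) * b x)) \<in> bracket_algebra"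
      by (intro bracket_algebra.add bracket_algebra.mult bracket_algebra.const bracket_algebra.coord bracket_algebra_partial b)
    ultimately show ?case by (rule rev_bexI[rotated])
  qed
  show "smooth (bracket :: real^'a \<Rightarrow> complex)"
    by (rule smooth_coinduct[OF bracket_algebra.bracket])
       (auto simp: bracket_algebra_differentiable bracket_algebra_partial)
  obtain b where b: "b \<in> bracket_algebra" "partials js bracket = (\<lambda>x. bracket x * b x)" using * by blast
  then obtain B where "\<forall>x. norm (b x) \<le> B" using bracket_algebra_bounded by blast
  then have "\<forall>x. norm (partials js bracket x) \<le> B * norm (bracket x)"
    using b by (auto simp: norm_mult mult.commute[of "norm (bracket _)"] intro!: mult_right_mono)
  then show "\<exists>B. \<forall>x :: real^'a. norm (partials js bracket x) \<le> B * norm (bracket x)" by blast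
qed

lemma norm_bracket_le: "norm (bracket x) \<le> 2 / (1 + norm x)\<^sup>2"
proof -
  have "0 \<le> (norm x - 1)\<^sup>2" by simp
  then have "(1 + norm x)\<^sup>2 \<le> 2 * (1 + x \<bullet> x)"
    by (simp add: power2_norm_eq_inner[symmetric] power2_eq_square algebra_simps)
  then show ?thesis using bracket_denom[of x]
    by (simp add: bracket_def norm_divide pos_le_divide_eq pos_divide_le_eq del: of_real_divide)
qed

text \<open>Powers of the weight inherit its decay, for derivatives of any order, by submultiplicativity of the jet
  norm.\<close>

lemma bracket_power_jet:
  "smooth (\<lambda>x :: real^'n::finite. bracket x ^ M) \<and>
    (\<exists>B\<ge>0. \<forall>x :: real^'n. (1 + norm x) ^ (2 * M) * jet_norm K (\<lambda>x. bracket x ^ M) x \<le> B)"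
proof (induction M)
  case 0
  show ?case by (auto intro!: exI[of _ 1])
next
  case (Suc M)
  then obtain B where sm: "smooth (\<lambda>x :: real^'n. bracket x ^ M)" and B: "B \<ge> 0"
    "\<And>x :: real^'n. (1 + norm x) ^ (2 * M) * jet_norm K (\<lambda>x. bracket x ^ M) x \<le> B" by blast
  obtain C where C: "\<And>js (x :: real^'n). norm (partials js bracket x) \<le> C js * norm (bracket x)"
    using bracket_partials by metis
  define C' where "C' = (\<Sum>js :: 'n list | length js \<le> K. \<bar>C js\<bar>)"
  have "0 \<le> C'" by (simp add: C'_def sum_nonneg)
  have 1: "(1 + norm x)\<^sup>2 * jet_norm K bracket x \<le> 2 * C'" for x :: "real^'n"
  proof -
    have "jet_norm K bracket x \<le> C' * norm (bracket x)"
      unfolding jet_norm_def C'_def sum_distrib_right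
      by (intro sum_mono order_trans[OF C]) (auto intro!: mult_right_mono)
    also have "\<dots> \<le> C' * (2 / (1 + norm x)\<^sup>2)"
      by (intro mult_left_mono norm_bracket_le \<open>0 \<le> C'\<close>)
    finally show ?thesis by (simp add: pos_le_divide_eq mult.commute)
  qed
  let ?L = "list_count TYPE('n) K * 2 ^ K"
  have "(1 + norm x) ^ (2 * Suc M) * jet_norm K (\<lambda>x. bracket x ^ Suc M) x \<le> ?L * (2 * C' * B)" for x :: "real^'n"
  proof -
    have "(1 + norm x) ^ (2 * Suc M) * jet_norm K (\<lambda>x. bracket x ^ Suc M) x
      \<le> (1 + norm x) ^ (2 * Suc M) * (?L * (jet_norm K bracket x * jet_norm K (\<lambda>x. bracket x ^ M) x))"
      unfolding power_Suc[of "bracket _"] by (intro mult_left_mono jet_norm_mult bracket_smooth sm) auto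
    also have "\<dots> = ?L * (((1 + norm x)\<^sup>2 * jet_norm K bracket x) * ((1 + norm x) ^ (2 * M) * jet_norm K (\<lambda>x. bracket x ^ M) x))"
      by (simp add: power_add power2_eq_square)
    also have "\<dots> \<le> ?L * (2 * C' * B)"
      by (intro mult_left_mono mult_mono 1 B) (auto simp: \<open>0 \<le> C'\<close>)
    finally show ?thesis .
  qed
  moreover have "0 \<le> ?L * (2 * C' * B)" using \<open>0 \<le> C'\<close> B by simp
  moreover have "smooth (\<lambda>x :: real^'n. bracket x ^ Suc M)"
    using smooth_mult[OF bracket_smooth sm] by simp
  ultimately show ?case by blast
qed

section \<open>Integrable weights\<close>

text \<open>This exponent makes \<open>(1 + |x|)\<close> to the power \<open>- decay_exp\<close> smaller than the product of the functions
  \<open>1 / (1 + x\<^sub>i\<^sup>2)\<close> over all coordinates, whose integral factorizes.\<close>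

abbreviation decay_exp :: "'n::finite itself \<Rightarrow> nat" where
  "decay_exp _ \<equiv> 2 * CARD('n)"

lemma integrable_weight: "integrable lborel (\<lambda>x :: real^'n::finite. 1 / (1 + norm x) ^ decay_exp TYPE('n))"
proof (rule integrableI_bounded)
  have line: "(\<integral>\<^sup>+ t. ennreal (inverse (1 + t\<^sup>2)) \<partial>lborel) < \<infinity>"
  proof -
    have "integrable lborel (\<lambda>t :: real. inverse (1 + t\<^sup>2))"
      using integrable_inverse_1_plus_square by (simp add: set_integrable_def)
    then show ?thesis by (subst nn_integral_eq_integral) auto
  qed
  have "(\<integral>\<^sup>+ x. ennreal (norm (1 / (1 + norm x) ^ decay_exp TYPE('n))) \<partial>(lborel :: (real^'n) measure))
    \<le> (\<integral>\<^sup>+ x. (\<Prod>b\<in>Basis. ennreal (inverse (1 + (x \<bullet> b)\<^sup>2))) \<partial>(lborel :: (real^'n) measure))"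
  proof (rule nn_integral_mono)
    fix x :: "real^'n"
    have "(\<Prod>b\<in>(Basis :: (real^'n) set). 1 + (x \<bullet> b)\<^sup>2) \<le> (\<Prod>b\<in>(Basis :: (real^'n) set). (1 + norm x)\<^sup>2)"
    proof (intro prod_mono conjI)
      fix b :: "real^'n" assume b: "b \<in> Basis"
      have "(x \<bullet> b)\<^sup>2 \<le> (norm x)\<^sup>2" using power_mono[OF Basis_le_norm[OF b, of x], of 2] by simp
      also have "1 + (norm x)\<^sup>2 \<le> (1 + norm x)\<^sup>2" by (simp add: power2_eq_square algebra_simps)
      finally show "1 + (x \<bullet> b)\<^sup>2 \<le> (1 + norm x)\<^sup>2" by simp
    qed auto
    also have "\<dots> = (1 + norm x) ^ decay_exp TYPE('n)" by (simp add: power_mult)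
    finally have "(\<Prod>b\<in>(Basis :: (real^'n) set). 1 + (x \<bullet> b)\<^sup>2) \<le> (1 + norm x) ^ decay_exp TYPE('n)" .
    moreover have "0 < (\<Prod>b\<in>(Basis :: (real^'n) set). 1 + (x \<bullet> b)\<^sup>2)"
      by (intro prod_pos) (auto intro: add_pos_nonneg)
    ultimately have "inverse ((1 + norm x) ^ decay_exp TYPE('n)) \<le> inverse (\<Prod>b\<in>(Basis :: (real^'n) set). 1 + (x \<bullet> b)\<^sup>2)"
      by (rule le_imp_inverse_le)
    then show "ennreal (norm (1 / (1 + norm x) ^ decay_exp TYPE('n))) \<le> (\<Prod>b\<in>Basis. ennreal (inverse (1 + (x \<bullet> b)\<^sup>2)))"
      by (subst prod_ennreal) (auto simp: divide_inverse prod_inversef[symmetric] o_def intro!: ennreal_leI)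
  qed
  also have "\<dots> = (\<Prod>b\<in>(Basis :: (real^'n) set). (\<integral>\<^sup>+ t. ennreal (inverse (1 + t\<^sup>2)) \<partial>lborel))"
    by (rule nn_integral_lborel_prod) auto
  also have "\<dots> < \<infinity>" using line by (simp add: power_less_top_ennreal)
  finally show "(\<integral>\<^sup>+ x. ennreal (norm (1 / (1 + norm (x :: real^'n)) ^ decay_exp TYPE('n))) \<partial>lborel) < \<infinity>" .
qed auto

definition weight_integral :: "'n::finite itself \<Rightarrow> real" where
  "weight_integral _ = (LINT x :: real^'n|lborel. 1 / (1 + norm x) ^ decay_exp TYPE('n))"

lemma weight_integral_nonneg [simp]: "0 \<le> weight_integral T"
  unfolding weight_integral_def by (rule integral_nonneg_AE) auto

lemma
  fixes h :: "real^'n::finite \<Rightarrow> complex"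
  assumes "h \<in> borel_measurable borel" and B: "\<And>x. (1 + norm x) ^ decay_exp TYPE('n) * norm (h x) \<le> B"
  shows integrable_decay: "integrable lborel h"
    and integral_decay_bound: "norm (LINT x|lborel. h x) \<le> weight_integral TYPE('n) * B"
proof -
  have le: "norm (h x) \<le> norm (B * (1 / (1 + norm x) ^ decay_exp TYPE('n)))" for x
  proof -
    have "norm (h x) \<le> B * (1 / (1 + norm x) ^ decay_exp TYPE('n))"
      using B[of x] by (simp add: field_simps)
    then show ?thesis by (metis abs_ge_self order_trans real_norm_def)
  qed
  have i: "integrable lborel (\<lambda>x :: real^'n. B * (1 / (1 + norm x) ^ decay_exp TYPE('n)))"
    by (intro integrable_mult_right integrable_weight)
  show int: "integrable lborel h"
    by (rule Bochner_Integration.integrable_bound[OF i]) (use assms le in auto)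
  have "norm (LINT x|lborel. h x) \<le> (LINT x|lborel. norm (h x))" by (rule integral_norm_bound)
  also have "\<dots> \<le> (LINT x :: real^'n|lborel. B * (1 / (1 + norm x) ^ decay_exp TYPE('n)))"
    by (rule integral_mono[OF integrable_norm[OF int] i]) (use B in \<open>auto simp: field_simps\<close>)
  also have "\<dots> = B * weight_integral TYPE('n)"
    unfolding weight_integral_def by (rule integral_mult_right_zero)
  finally show "norm (LINT x|lborel. h x) \<le> weight_integral TYPE('n) * B" by (simp add: mult.commute)
qed

section \<open>Mean value inequality\<close>

lemma vector_mvt_bound:
  fixes f :: "real \<Rightarrow> 'a::real_normed_vector"
  assumes "\<And>t. t \<in> {a..b} \<Longrightarrow> (f has_vector_derivative f' t) (at t within {a..b})"
    and M: "\<And>t. t \<in> {a..b} \<Longrightarrow> norm (f' t) \<le> M" and s: "s \<in> {a..b}" "t \<in> {a..b}"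
  shows "norm (f s - f t) \<le> M * \<bar>s - t\<bar>"
proof -
  have "norm (f s - f t) \<le> M * norm (s - t)"
  proof (rule differentiable_bound[OF _ _ _ s])
    show "(f has_derivative (\<lambda>h. h *\<^sub>R f' t)) (at t within {a..b})" if "t \<in> {a..b}" for t
      using assms(1)[OF that] by (simp add: has_vector_derivative_def)
    show "onorm (\<lambda>h. h *\<^sub>R f' t) \<le> M" if "t \<in> {a..b}" for t
      using M[OF that] by (intro onorm_bound) (use norm_ge_zero order_trans in blast, simp add: mult.commute[of M] mult_left_mono)
  qed auto
  then show ?thesis by simp
qed

lemma has_vector_derivative_line:
  fixes u :: "real^'n::finite \<Rightarrow> complex"
  assumes "\<And>x. u differentiable (at x)"
  shows "((\<lambda>s. u (x + s *\<^sub>R axis i 1)) has_vector_derivative partial i u (x + s *\<^sub>R axis i 1)) (at s within S)"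
proof -
  have "((\<lambda>s. x + s *\<^sub>R axis i 1) has_derivative (\<lambda>h. h *\<^sub>R axis i 1)) (at s within S)"
    by (auto intro!: derivative_eq_intros)
  from has_derivative_compose[OF this has_derivative_frechet[OF assms]]
  show ?thesis unfolding has_vector_derivative_def partial_def
    by (simp add: linear_scale[OF linear_frechet_derivative[OF assms]])
qed

section \<open>Elementary properties of the Fourier integral\<close>

lemma integral_affine:
  fixes f :: "real^'n::finite \<Rightarrow> complex"
  assumes "f \<in> borel_measurable borel" "c \<noteq> 0"
  shows "(LINT x|lborel. f x) = of_real (\<bar>c\<bar> ^ CARD('n)) * (LINT x|lborel. f (t + c *\<^sub>R x))"
proof -
  have "(LINT x|lborel. f x) = (LINT x|density (distr lborel borel (\<lambda>x. t + c *\<^sub>R x)) (\<lambda>_. \<bar>c\<bar> ^ CARD('n)). f x)"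
    using lborel_affine[OF assms(2), of t] by simp
  also have "\<dots> = (LINT x|distr lborel borel (\<lambda>x. t + c *\<^sub>R x). (\<bar>c\<bar> ^ CARD('n)) *\<^sub>R f x)"
    using assms by (intro integral_density) auto
  also have "\<dots> = (LINT x|lborel. (\<bar>c\<bar> ^ CARD('n)) *\<^sub>R f (t + c *\<^sub>R x))"
    using assms by (intro integral_distr) auto
  finally show ?thesis by (simp add: scaleR_conv_of_real)
qed

lemma integral_translate:
  fixes f :: "real^'n::finite \<Rightarrow> complex"
  assumes "f \<in> borel_measurable borel"
  shows "(LINT x|lborel. f (t + x)) = (LINT x|lborel. f x)"
  using integral_affine[OF assms, of 1 t] by simp

lemma integral_reflect:
  fixes f :: "real^'n::finite \<Rightarrow> complex"
  assumes "f \<in> borel_measurable borel"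
  shows "(LINT x|lborel. f (- x)) = (LINT x|lborel. f x)"
  using integral_affine[OF assms, of "-1" 0] by simp

abbreviation wave :: "real^'n::finite \<Rightarrow> real^'n \<Rightarrow> complex" where
  "wave \<xi> x \<equiv> exp (- \<i> * complex_of_real (x \<bullet> \<xi>))"

lemma wave_alt: "wave \<xi> x = iexp (- (x \<bullet> \<xi>))"
  by simp

lemma norm_wave [simp]: "norm (wave \<xi> x) = 1"
  unfolding wave_alt by (rule norm_exp_i_times)

lemma borel_smooth: "smooth u \<Longrightarrow> u \<in> borel_measurable borel"
  by (rule borel_measurable_continuous_onI[OF smooth_continuous])

lemma borel_wave [measurable]: "wave \<xi> \<in> borel_measurable borel"
  by (intro borel_measurable_continuous_onI continuous_intros)

lemma borel_wave_mult: "h \<in> borel_measurable borel \<Longrightarrow> (\<lambda>x. wave \<xi> x * h x) \<in> borel_measurable borel"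
  by simp

definition decays :: "nat \<Rightarrow> real \<Rightarrow> (real^'n::finite \<Rightarrow> complex) \<Rightarrow> bool" where
  "decays N B h \<longleftrightarrow> (\<forall>x. (1 + norm x) ^ N * norm (h x) \<le> B)"

lemma decaysD: "decays N B h \<Longrightarrow> (1 + norm x) ^ N * norm (h x) \<le> B"
  by (simp add: decays_def)

lemma decays_nonneg: "decays N B h \<Longrightarrow> 0 \<le> B"
  using order_trans[OF norm_ge_zero, of "h 0" B] decaysD[of N B h 0] by simp

lemma decays_mono: "decays N B h \<Longrightarrow> M \<le> N \<Longrightarrow> decays M B h"
  unfolding decays_def
  by (meson mult_right_mono norm_ge_zero one_plus_norm_power_mono order_trans)

lemma decays_coord:
  assumes "decays (Suc N) B h" shows "decays N B (\<lambda>x. - \<i> * of_real (x $ i) * h x)"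
  unfolding decays_def
proof
  fix x
  have "(1 + norm x) ^ N * norm (- \<i> * of_real (x $ i) * h x) = (1 + norm x) ^ N * (\<bar>x $ i\<bar> * norm (h x))"
    by (simp add: norm_mult)
  also have "\<dots> \<le> (1 + norm x) ^ N * ((1 + norm x) * norm (h x))"
    by (intro mult_left_mono mult_right_mono order_trans[OF component_le_norm_cart]) auto
  also have "\<dots> \<le> B" using decaysD[OF assms, of x] by (simp add: algebra_simps)
  finally show "(1 + norm x) ^ N * norm (- \<i> * of_real (x $ i) * h x) \<le> B" .
qed

lemma decays_wave: "decays N B (\<lambda>x. wave \<xi> x * h x) \<longleftrightarrow> decays N B h"
  unfolding decays_def norm_mult norm_wave by simp

lemma integrable_decays:
  fixes h :: "real^'n::finite \<Rightarrow> complex"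
  assumes "h \<in> borel_measurable borel" "decays N B h" "decay_exp TYPE('n) \<le> N"
  shows "integrable lborel h" "norm (LINT x|lborel. h x) \<le> weight_integral TYPE('n) * B"
  using integrable_decay[OF assms(1)] integral_decay_bound[OF assms(1)] decays_mono[OF assms(2,3)]
  by (auto simp: decays_def)

lemma integrable_wave:
  "integrable lborel h \<Longrightarrow> integrable lborel (\<lambda>x. wave \<xi> x * h x)"
  by (rule Bochner_Integration.integrable_bound[of _ h]) (auto simp: norm_mult)

lemma fourier_bound:
  fixes h :: "real^'n::finite \<Rightarrow> complex"
  assumes "h \<in> borel_measurable borel" "decays N B h" "decay_exp TYPE('n) \<le> N"
  shows "norm (fourier h \<xi>) \<le> weight_integral TYPE('n) * B"
  unfolding fourier_def using assms by (intro integrable_decays borel_wave_mult) (simp_all only: decays_wave)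

lemma fourier_add:
  "integrable lborel f \<Longrightarrow> integrable lborel g \<Longrightarrow> fourier (\<lambda>x. f x + g x) \<xi> = fourier f \<xi> + fourier g \<xi>"
  unfolding fourier_def by (simp only: distrib_left) (intro Bochner_Integration.integral_add integrable_wave)

lemma fourier_cmult: "fourier (\<lambda>x. c * f x) \<xi> = c * fourier f \<xi>"
proof -
  have "(\<lambda>x. wave \<xi> x * (c * f x)) = (\<lambda>x. c * (wave \<xi> x * f x))" by (simp add: algebra_simps)
  then show ?thesis unfolding fourier_def by (simp only: integral_mult_right_zero)
qed

text \<open>The remainder \<open>exp(- i x\<cdot>\<eta>) - exp(- i x\<cdot>\<xi>) + i x\<cdot>(\<eta> - \<xi>) exp(- i x\<cdot>\<xi>)\<close> is at most
  \<open>(|x| |\<eta> - \<xi>|)\<^sup>2\<close>, which the two additional orders of decay make integrable.\<close>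

lemma fourier_has_derivative:
  fixes h :: "real^'n::finite \<Rightarrow> complex"
  assumes h: "h \<in> borel_measurable borel" and dec: "decays (decay_exp TYPE('n) + 2) B h"
  shows "(fourier h has_derivative (\<lambda>v. LINT x|lborel. wave \<xi> x * (- \<i> * of_real (x \<bullet> v) * h x))) (at \<xi>)"
proof -
  let ?P = "decay_exp TYPE('n)"
  have inner: "(\<lambda>x. complex_of_real (x \<bullet> v)) \<in> borel_measurable borel" for v :: "real^'n"
    by (intro borel_measurable_continuous_onI continuous_intros)
  have meas: "(\<lambda>x. wave \<xi> x * (- \<i> * of_real (x \<bullet> v) * h x)) \<in> borel_measurable borel" for v
    using inner[of v] h by (intro borel_wave_mult) measurable
  have dec1: "decays (Suc ?P) B h" using dec by (rule decays_mono) simp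
  have decv: "decays ?P (norm v * B) (\<lambda>x. wave \<xi> x * (- \<i> * of_real (x \<bullet> v) * h x))" for v
    unfolding decays_wave unfolding decays_def
  proof
    fix x
    have "(1 + norm x) ^ ?P * norm (- \<i> * of_real (x \<bullet> v) * h x) = (1 + norm x) ^ ?P * (\<bar>x \<bullet> v\<bar> * norm (h x))"
      by (simp add: norm_mult)
    also have "\<dots> \<le> (1 + norm x) ^ ?P * (((1 + norm x) * norm v) * norm (h x))"
      by (intro mult_left_mono mult_right_mono order_trans[OF Cauchy_Schwarz_ineq2]) auto
    also have "\<dots> = norm v * ((1 + norm x) ^ Suc ?P * norm (h x))" by (simp only: power_Suc) (simp add: algebra_simps)
    also have "\<dots> \<le> norm v * B" by (intro mult_left_mono decaysD[OF dec1]) auto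
    finally show "(1 + norm x) ^ ?P * norm (- \<i> * of_real (x \<bullet> v) * h x) \<le> norm v * B" .
  qed
  note intv = integrable_decays[OF meas decv order_refl]
  show ?thesis
  proof (rule has_derivativeI_sandwich[where e = 1 and H = "\<lambda>\<eta>. weight_integral TYPE('n) * B * norm (\<eta> - \<xi>)"])
    show "bounded_linear (\<lambda>v. LINT x|lborel. wave \<xi> x * (- \<i> * of_real (x \<bullet> v) * h x))"
    proof (rule bounded_linear_intro)
      fix v w
      have "(LINT x|lborel. wave \<xi> x * (- \<i> * of_real (x \<bullet> (v + w)) * h x))
        = (LINT x|lborel. wave \<xi> x * (- \<i> * of_real (x \<bullet> v) * h x) + wave \<xi> x * (- \<i> * of_real (x \<bullet> w) * h x))"
        by (simp add: inner_add_right algebra_simps)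
      then show "(LINT x|lborel. wave \<xi> x * (- \<i> * of_real (x \<bullet> (v + w)) * h x))
        = (LINT x|lborel. wave \<xi> x * (- \<i> * of_real (x \<bullet> v) * h x)) + (LINT x|lborel. wave \<xi> x * (- \<i> * of_real (x \<bullet> w) * h x))"
        by (simp only: Bochner_Integration.integral_add[OF intv(1) intv(1)])
    next
      fix r v
      have "(LINT x|lborel. wave \<xi> x * (- \<i> * of_real (x \<bullet> (r *\<^sub>R v)) * h x))
        = (LINT x|lborel. r *\<^sub>R (wave \<xi> x * (- \<i> * of_real (x \<bullet> v) * h x)))"
        by (simp add: scaleR_conv_of_real[where 'a=complex] mult_ac)
      then show "(LINT x|lborel. wave \<xi> x * (- \<i> * of_real (x \<bullet> (r *\<^sub>R v)) * h x))
        = r *\<^sub>R (LINT x|lborel. wave \<xi> x * (- \<i> * of_real (x \<bullet> v) * h x))"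
        by (simp only: integral_scaleR_right)
    next
      fix v
      show "norm (LINT x|lborel. wave \<xi> x * (- \<i> * of_real (x \<bullet> v) * h x)) \<le> norm v * (weight_integral TYPE('n) * B)"
        using intv(2)[of v] by (simp add: algebra_simps)
    qed
  next
    fix \<eta> assume "\<eta> \<noteq> \<xi>"
    let ?v = "\<eta> - \<xi>"
    have ih: "integrable lborel h" by (rule integrable_decays[OF h dec]) simp
    have e: "(LINT x|lborel. (wave \<eta> x * h x - wave \<xi> x * h x) - wave \<xi> x * (- \<i> * of_real (x \<bullet> ?v) * h x))
       = (fourier h \<eta> - fourier h \<xi>) - (LINT x|lborel. wave \<xi> x * (- \<i> * of_real (x \<bullet> ?v) * h x))"
      unfolding fourier_def by (simp only: Bochner_Integration.integral_diff[OF Bochner_Integration.integrable_diff[OF integrable_wave[OF ih] integrable_wave[OF ih]] intv(1)]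
         Bochner_Integration.integral_diff[OF integrable_wave[OF ih] integrable_wave[OF ih]])
    have pt: "norm ((wave \<eta> x * h x - wave \<xi> x * h x) - wave \<xi> x * (- \<i> * of_real (x \<bullet> ?v) * h x))
        \<le> (norm x * norm ?v)\<^sup>2 * norm (h x)" for x
    proof -
      have w: "wave \<eta> x = wave \<xi> x * wave ?v x"
        by (simp add: inner_diff_right algebra_simps flip: exp_add)
      have "(wave \<eta> x * h x - wave \<xi> x * h x) - wave \<xi> x * (- \<i> * of_real (x \<bullet> ?v) * h x)
        = wave \<xi> x * ((iexp (- (x \<bullet> ?v)) - (\<Sum>k\<le>1. (\<i> * of_real (- (x \<bullet> ?v)))^k / fact k)) * h x)"
        unfolding w wave_alt[symmetric] by (simp add: algebra_simps)
      also have "norm \<dots> = norm (iexp (- (x \<bullet> ?v)) - (\<Sum>k\<le>1. (\<i> * of_real (- (x \<bullet> ?v)))^k / fact k)) * norm (h x)"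
        unfolding norm_mult norm_wave by simp
      also have "\<dots> \<le> (\<bar>- (x \<bullet> ?v)\<bar> ^ Suc 1 / fact (Suc 1)) * norm (h x)"
        by (intro mult_right_mono iexp_approx1) auto
      also have "\<dots> \<le> (norm x * norm ?v)\<^sup>2 * norm (h x)"
      proof (rule mult_right_mono)
        have "\<bar>x \<bullet> ?v\<bar>\<^sup>2 \<le> (norm x * norm ?v)\<^sup>2" by (intro power_mono Cauchy_Schwarz_ineq2) auto
        moreover have "0 \<le> \<bar>x \<bullet> ?v\<bar>\<^sup>2" by simp
        ultimately show "\<bar>- (x \<bullet> ?v)\<bar> ^ Suc 1 / fact (Suc 1) \<le> (norm x * norm ?v)\<^sup>2"
          by (simp only: abs_minus_cancel Suc_1 fact_2)
      qed auto
      finally show ?thesis .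
    qed
    have "norm (LINT x|lborel. (wave \<eta> x * h x - wave \<xi> x * h x) - wave \<xi> x * (- \<i> * of_real (x \<bullet> ?v) * h x))
        \<le> weight_integral TYPE('n) * ((norm ?v)\<^sup>2 * B)"
    proof (rule integral_decay_bound)
      show "(\<lambda>x. wave \<eta> x * h x - wave \<xi> x * h x - wave \<xi> x * (- \<i> * of_real (x \<bullet> ?v) * h x)) \<in> borel_measurable borel"
        by (intro borel_measurable_diff meas borel_wave_mult h)
      fix x
      have "(1 + norm x) ^ ?P * norm ((wave \<eta> x * h x - wave \<xi> x * h x) - wave \<xi> x * (- \<i> * of_real (x \<bullet> ?v) * h x))
        \<le> (1 + norm x) ^ ?P * (((1 + norm x) * norm ?v)\<^sup>2 * norm (h x))"
        by (intro mult_left_mono order_trans[OF pt] mult_right_mono power_mono) auto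
      also have "\<dots> = (norm ?v)\<^sup>2 * ((1 + norm x) ^ (?P + 2) * norm (h x))"
        by (simp only: power_add power_mult_distrib) (simp add: algebra_simps)
      also have "\<dots> \<le> (norm ?v)\<^sup>2 * B" by (intro mult_left_mono decaysD[OF dec]) auto
      finally show "(1 + norm x) ^ ?P * norm ((wave \<eta> x * h x - wave \<xi> x * h x) - wave \<xi> x * (- \<i> * of_real (x \<bullet> ?v) * h x)) \<le> (norm ?v)\<^sup>2 * B" .
    qed
    then have "norm ((fourier h \<eta> - fourier h \<xi>) - (LINT x|lborel. wave \<xi> x * (- \<i> * of_real (x \<bullet> ?v) * h x))) / norm ?v
      \<le> (weight_integral TYPE('n) * ((norm ?v)\<^sup>2 * B)) / norm ?v"
      unfolding e by (rule divide_right_mono) simp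
    also have "\<dots> = weight_integral TYPE('n) * B * norm ?v"
      using \<open>\<eta> \<noteq> \<xi>\<close> by (simp add: power2_eq_square)
    finally show "norm ((fourier h \<eta> - fourier h \<xi>) - (LINT x|lborel. wave \<xi> x * (- \<i> * of_real (x \<bullet> ?v) * h x))) / norm ?v
      \<le> weight_integral TYPE('n) * B * norm ?v" .
  next
    show "((\<lambda>\<eta>. weight_integral TYPE('n) * B * norm (\<eta> - \<xi>)) \<longlongrightarrow> 0) (at \<xi>)"
      by (auto intro!: tendsto_eq_intros)
  qed simp
qed

lemma
  fixes h :: "real^'n::finite \<Rightarrow> complex"
  assumes h: "h \<in> borel_measurable borel" and dec: "decays (decay_exp TYPE('n) + 2) B h"
  shows fourier_differentiable: "fourier h differentiable (at \<xi>)"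
    and partial_fourier: "partial i (fourier h) = fourier (\<lambda>x. - \<i> * of_real (x $ i) * h x)"
proof -
  show "fourier h differentiable (at \<xi>)"
    using fourier_has_derivative[OF assms] by (auto simp: differentiable_def)
  show "partial i (fourier h) = fourier (\<lambda>x. - \<i> * of_real (x $ i) * h x)"
    by (rule ext, rule partial_eqI[THEN trans, OF fourier_has_derivative[OF assms]])
       (simp add: inner_axis fourier_def)
qed

text \<open>The factors are those by which a function is multiplied when its Fourier transform is differentiated.\<close>

definition monomial :: "'n::finite list \<Rightarrow> real^'n \<Rightarrow> complex" where
  "monomial js x = prod_list (map (\<lambda>i. - \<i> * of_real (x $ i)) js)"

lemma monomial_simps [simp]:
  "monomial [] x = 1" "monomial (i # js) x = - \<i> * of_real (x $ i) * monomial js x"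
  by (simp_all add: monomial_def)

lemma O_M_monomial: "monomial js \<in> O_M"
proof -
  have "(\<lambda>x. prod_list (map (\<lambda>i. - \<i> * of_real (x $ i)) js)) \<in> (O_M :: (real^'n::finite \<Rightarrow> complex) set)" for js
    by (rule O_M_prod_list) (intro O_M_mult O_M_const O_M_coord)
  then show ?thesis by (simp add: monomial_def[abs_def])
qed

lemma borel_monomial: "monomial js \<in> borel_measurable borel"
  using borel_smooth[OF O_M_smooth[OF O_M_monomial]] .

lemma decays_monomial:
  "decays (N + length js) B h \<Longrightarrow> decays N B (\<lambda>x. monomial js x * h x)"
proof (induction js arbitrary: N)
  case (Cons i js)
  then have "decays (Suc N) B (\<lambda>x. monomial js x * h x)" by simp
  from decays_coord[OF this, of i] show ?case by (simp add: mult.assoc)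
qed simp

lemma
  fixes h :: "real^'n::finite \<Rightarrow> complex"
  assumes h: "h \<in> borel_measurable borel" and dec: "decays (decay_exp TYPE('n) + 2 + length js) B h"
  shows partials_fourier: "partials js (fourier h) = fourier (\<lambda>x. monomial js x * h x)"
    and partials_fourier_differentiable: "partials js (fourier h) differentiable (at \<xi>)"
proof -
  have *: "partials js (fourier h) = fourier (\<lambda>x. monomial js x * h x) \<and> (\<forall>\<xi>. partials js (fourier h) differentiable (at \<xi>))"
    using dec
  proof (induction js)
    case Nil
    then show ?case using fourier_differentiable[OF h, of B] by simp
  next
    case (Cons i js)
    have d1: "decays (decay_exp TYPE('n) + 2 + length js) B h" using Cons.prems by (rule decays_mono) simp
    have d2: "decays (decay_exp TYPE('n) + 2) B (\<lambda>x. monomial js x * h x)"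
      by (rule decays_monomial[OF d1])
    have d3: "decays (decay_exp TYPE('n) + 2) B (\<lambda>x. monomial (i # js) x * h x)"
      by (rule decays_monomial) (use Cons.prems in simp)
    have m: "(\<lambda>x. monomial js x * h x) \<in> borel_measurable borel" for js
      by (intro borel_measurable_times h borel_monomial)
    have "partials (i # js) (fourier h) = partial i (fourier (\<lambda>x. monomial js x * h x))"
      using Cons.IH[OF d1] by simp
    also have "\<dots> = fourier (\<lambda>x. monomial (i # js) x * h x)"
      using partial_fourier[OF m d2] by (simp add: mult.assoc)
    finally have eq: "partials (i # js) (fourier h) = fourier (\<lambda>x. monomial (i # js) x * h x)" .
    show ?case unfolding eq using fourier_differentiable[OF m d3] by blast
  qed
  show "partials js (fourier h) = fourier (\<lambda>x. monomial js x * h x)" using * by blast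
  show "partials js (fourier h) differentiable (at \<xi>)" using * by blast
qed

section \<open>Integration by parts\<close>

text \<open>The difference quotients of \<open>u\<close> in a coordinate direction have integral zero by translation
  invariance, and they converge dominatedly to the partial derivative.\<close>

lemma integral_partial_zero:
  fixes u :: "real^'n::finite \<Rightarrow> complex"
  assumes u: "smooth u" and d0: "decays (decay_exp TYPE('n)) B0 u" and d1: "decays (decay_exp TYPE('n)) B (partial i u)"
  shows "(LINT x|lborel. partial i u x) = 0"
proof -
  let ?P = "decay_exp TYPE('n)"
  define e where "e = (axis i 1 :: real^'n)"
  have ne: "norm e = 1" by (simp add: e_def)
  define r where "r k = 1 / real (Suc k)" for k
  have r: "0 < r k" "r k \<le> 1" for k by (auto simp: r_def)
  define D where "D k x = (u (r k *\<^sub>R e + x) - u x) /\<^sub>R r k" for k x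
  have mu: "u \<in> borel_measurable borel" by (rule borel_smooth[OF u])
  have mt: "(\<lambda>x. u (t + x)) \<in> borel_measurable borel" for t
    using mu by (rule measurable_compose_rev) (intro borel_measurable_continuous_onI continuous_intros)
  have iu: "integrable lborel u" by (rule integrable_decays[OF mu d0 order_refl])
  have it: "integrable lborel (\<lambda>x. u (t + x))" for t
  proof -
    have "integrable (distr lborel borel ((+) t)) u" using iu by (simp add: lborel_distr_plus)
    then show ?thesis by (subst (asm) integrable_distr_eq) (auto simp: mu)
  qed
  have zero: "(LINT x|lborel. D k x) = 0" for k
  proof -
    have "(LINT x|lborel. D k x) = (LINT x|lborel. u (r k *\<^sub>R e + x) - u x) /\<^sub>R r k"
      unfolding D_def by (rule integral_scaleR_right)
    also have "(LINT x|lborel. u (r k *\<^sub>R e + x) - u x) = 0"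
      using Bochner_Integration.integral_diff[OF it iu] integral_translate[OF mu] by simp
    finally show ?thesis by simp
  qed
  have "0 \<le> B" using d1 by (rule decays_nonneg)
  have bound: "norm (D k x) \<le> B * 2 ^ ?P * (1 / (1 + norm x) ^ ?P)" for k x
  proof -
    have "norm (u (x + r k *\<^sub>R e) - u (x + 0 *\<^sub>R e)) \<le> (B * 2 ^ ?P * (1 / (1 + norm x) ^ ?P)) * \<bar>r k - 0\<bar>"
    proof (rule vector_mvt_bound[where a = 0 and b = "r k"])
      show "((\<lambda>s. u (x + s *\<^sub>R e)) has_vector_derivative partial i u (x + s *\<^sub>R e)) (at s within {0..r k})" for s
        unfolding e_def by (rule has_vector_derivative_line[OF smooth_differentiable[OF u]])
      fix s assume s: "s \<in> {0..r k}"
      \<comment> \<open>a shift by at most 1 changes the weight by at most a factor 2\<close>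
      have "norm x \<le> norm (x + s *\<^sub>R e) + norm (s *\<^sub>R e)" using norm_triangle_ineq4[of "x + s *\<^sub>R e" "s *\<^sub>R e"] by simp
      moreover have "norm (s *\<^sub>R e) \<le> 1" using s r(2)[of k] ne by simp
      moreover have "1 + a \<le> 2 * (1 + b)" if "a \<le> b + c" "c \<le> 1" "0 \<le> b" for a b c :: real
        using that by (simp add: algebra_simps)
      ultimately have "1 + norm x \<le> 2 * (1 + norm (x + s *\<^sub>R e))" using norm_ge_zero by blast
      then have "(1 + norm x) ^ ?P \<le> 2 ^ ?P * (1 + norm (x + s *\<^sub>R e)) ^ ?P"
        unfolding power_mult_distrib[symmetric] by (intro power_mono) auto
      then have "(1 + norm x) ^ ?P * norm (partial i u (x + s *\<^sub>R e))
        \<le> 2 ^ ?P * ((1 + norm (x + s *\<^sub>R e)) ^ ?P * norm (partial i u (x + s *\<^sub>R e)))"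
        unfolding mult.assoc[symmetric] by (intro mult_right_mono) auto
      also have "\<dots> \<le> 2 ^ ?P * B" by (intro mult_left_mono decaysD[OF d1]) auto
      finally show "norm (partial i u (x + s *\<^sub>R e)) \<le> B * 2 ^ ?P * (1 / (1 + norm x) ^ ?P)"
        by (simp add: pos_le_divide_eq mult.commute)
    qed (use r in \<open>auto simp: less_imp_le\<close>)
    then have "norm (u (r k *\<^sub>R e + x) - u x) \<le> (B * 2 ^ ?P * (1 / (1 + norm x) ^ ?P)) * r k"
      using r(1)[of k] by (simp add: add.commute)
    then show ?thesis unfolding D_def norm_scaleR using r(1)[of k]
      by (simp add: pos_divide_le_eq divide_inverse_commute[symmetric])
  qed
  have lim: "(\<lambda>k. D k x) \<longlonglongrightarrow> partial i u x" for x
  proof -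
    have "((\<lambda>s. u (x + s *\<^sub>R e)) has_vector_derivative partial i u (x + 0 *\<^sub>R axis i 1)) (at 0)"
      unfolding e_def by (rule has_vector_derivative_line[OF smooth_differentiable[OF u]])
    then have "((\<lambda>h. norm (u (x + (0 + h) *\<^sub>R e) - u (x + 0 *\<^sub>R e) - h *\<^sub>R partial i u x) / norm h) \<longlongrightarrow> 0) (at 0)"
      unfolding has_vector_derivative_def has_derivative_at by simp
    then have "((\<lambda>h. norm ((u (x + h *\<^sub>R e) - u x) /\<^sub>R h - partial i u x)) \<longlongrightarrow> 0) (at 0)"
    proof (rule Lim_transform_eventually)
      have "norm ((u (x + h *\<^sub>R e) - u x) /\<^sub>R h - partial i u x)
        = norm (u (x + h *\<^sub>R e) - u x - h *\<^sub>R partial i u x) / norm h" if "h \<noteq> 0" for h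
      proof -
        have "(u (x + h *\<^sub>R e) - u x) /\<^sub>R h - partial i u x = (u (x + h *\<^sub>R e) - u x - h *\<^sub>R partial i u x) /\<^sub>R h"
          using that by (simp add: scaleR_diff_right)
        then show ?thesis by (simp add: divide_inverse_commute)
      qed
      then show "\<forall>\<^sub>F h in at 0. norm (u (x + (0 + h) *\<^sub>R e) - u (x + 0 *\<^sub>R e) - h *\<^sub>R partial i u x) / norm h
        = norm ((u (x + h *\<^sub>R e) - u x) /\<^sub>R h - partial i u x)"
        by (auto simp: eventually_at_filter)
    qed
    then have "((\<lambda>h. (u (x + h *\<^sub>R e) - u x) /\<^sub>R h) \<longlongrightarrow> partial i u x) (at 0)"
      by (simp add: tendsto_norm_zero_iff Lim_null[symmetric])
    moreover have "filterlim r (at 0) sequentially"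
      unfolding filterlim_at r_def using LIMSEQ_inverse_real_of_nat by (simp add: inverse_eq_divide)
    ultimately show ?thesis
      unfolding D_def by (rule_tac filterlim_compose[of "\<lambda>h. (u (h *\<^sub>R e + x) - u x) /\<^sub>R h" _ "at 0"]) (simp_all add: add.commute)
  qed
  have "(\<lambda>k. LINT x|lborel. D k x) \<longlonglongrightarrow> (LINT x|lborel. partial i u x)"
  proof (rule integral_dominated_convergence[where w = "\<lambda>x. B * 2 ^ ?P * (1 / (1 + norm x) ^ ?P)"])
    show "integrable lborel (\<lambda>x :: real^'n. B * 2 ^ ?P * (1 / (1 + norm x) ^ ?P))"
      by (intro integrable_mult_right integrable_weight)
    show "partial i u \<in> borel_measurable lborel" using borel_smooth[OF smooth_partial[OF u]] by simp
    show "D k \<in> borel_measurable lborel" for k unfolding D_def using mt mu by simp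
  qed (use lim bound in auto)
  then show ?thesis unfolding zero using LIMSEQ_unique tendsto_const by metis
qed

lemma partial_wave: "partial i (wave \<xi>) = (\<lambda>x. (- \<i> * of_real (\<xi> $ i)) * wave \<xi> x)"
  and wave_differentiable: "wave \<xi> differentiable (at x)"
proof -
  have *: "(wave \<xi> has_derivative (\<lambda>h. (- \<i> * of_real (h \<bullet> \<xi>)) * wave \<xi> x)) (at x)" for x :: "real^'a"
  proof -
    have "bounded_linear (\<lambda>h. - \<i> * complex_of_real (h \<bullet> \<xi>))"
      by (intro bounded_linear_const_mult bounded_linear_compose[OF bounded_linear_of_real bounded_linear_inner_left])
    from has_derivative_compose[OF bounded_linear_imp_has_derivative[OF this, of "at x"] DERIV_exp[unfolded has_field_derivative_def]]
    show ?thesis by (simp only: mult.commute)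
  qed
  show "wave \<xi> differentiable (at x)" using * by (auto simp: differentiable_def)
  show "partial i (wave \<xi>) = (\<lambda>x. (- \<i> * of_real (\<xi> $ i)) * wave \<xi> x)"
    by (rule ext, rule partial_eqI[THEN trans, OF *]) (simp add: inner_axis')
qed

lemma O_M_wave: "wave \<xi> \<in> O_M"
proof (rule O_M_coinduct[where X = "range (\<lambda>c x. c * wave \<xi> x)"])
  show "wave \<xi> \<in> range (\<lambda>c x. c * wave \<xi> x)" by (rule image_eqI[of _ _ 1]) auto
  fix g assume "g \<in> range (\<lambda>c x. c * wave \<xi> x)"
  then obtain c where g: "g = (\<lambda>x. c * wave \<xi> x)" by blast
  show "g differentiable (at x)" for x unfolding g by (intro derivative_intros wave_differentiable)
  have "partial i g = (\<lambda>x. (c * (- \<i> * of_real (\<xi> $ i))) * wave \<xi> x)" for i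
    unfolding g partial_cmult[OF wave_differentiable] partial_wave by (simp only: mult.assoc)
  then show "partial i g \<in> range (\<lambda>c x. c * wave \<xi> x)" for i by blast
  have "\<forall>x. norm (g x) \<le> norm c * (1 + norm x) ^ 0" unfolding g norm_mult norm_wave by simp
  then show "\<exists>N B. \<forall>x. norm (g x) \<le> B * (1 + norm x) ^ N" by blast
qed

text \<open>Integration by parts for the product of \<open>u\<close> with the exponential \<open>wave \<xi>\<close>.\<close>

lemma fourier_partial:
  fixes u :: "real^'n::finite \<Rightarrow> complex"
  assumes u: "smooth u" and d0: "decays (decay_exp TYPE('n)) B0 u" and d1: "decays (decay_exp TYPE('n)) B (partial i u)"
  shows "fourier (partial i u) \<xi> = \<i> * of_real (\<xi> $ i) * fourier u \<xi>"
proof -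
  let ?P = "decay_exp TYPE('n)"
  let ?v = "\<lambda>x. wave \<xi> x * u x"
  have pv: "partial i ?v = (\<lambda>x. (- \<i> * of_real (\<xi> $ i)) * (wave \<xi> x * u x) + wave \<xi> x * partial i u x)"
    unfolding partial_mult[OF wave_differentiable smooth_differentiable[OF u]] partial_wave by (simp add: algebra_simps)
  have "smooth ?v" by (intro smooth_mult O_M_smooth[OF O_M_wave] u)
  moreover have "decays ?P B0 ?v" using d0 by (simp only: decays_wave)
  moreover have "decays ?P (\<bar>\<xi> $ i\<bar> * B0 + B) (partial i ?v)"
    unfolding pv decays_def
  proof
    fix x
    have "(1 + norm x) ^ ?P * norm ((- \<i> * of_real (\<xi> $ i)) * (wave \<xi> x * u x) + wave \<xi> x * partial i u x)
      \<le> (1 + norm x) ^ ?P * (\<bar>\<xi> $ i\<bar> * norm (u x) + norm (partial i u x))"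
      by (intro mult_left_mono order_trans[OF norm_triangle_ineq]) (simp_all add: norm_mult del: exp_minus)
    also have "\<dots> = \<bar>\<xi> $ i\<bar> * ((1 + norm x) ^ ?P * norm (u x)) + (1 + norm x) ^ ?P * norm (partial i u x)"
      by (simp add: algebra_simps)
    also have "\<dots> \<le> \<bar>\<xi> $ i\<bar> * B0 + B"
      by (intro add_mono mult_left_mono decaysD[OF d0] decaysD[OF d1]) auto
    finally show "(1 + norm x) ^ ?P * norm ((- \<i> * of_real (\<xi> $ i)) * (wave \<xi> x * u x) + wave \<xi> x * partial i u x)
      \<le> \<bar>\<xi> $ i\<bar> * B0 + B" .
  qed
  ultimately have "(LINT x|lborel. partial i ?v x) = 0" by (rule integral_partial_zero)
  moreover have "integrable lborel ?v" "integrable lborel (\<lambda>x. wave \<xi> x * partial i u x)"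
    using integrable_decays(1)[OF borel_smooth[OF u] d0] integrable_decays(1)[OF borel_smooth[OF smooth_partial[OF u]] d1]
    by (intro integrable_wave; simp)+
  ultimately have "(- \<i> * of_real (\<xi> $ i)) * (LINT x|lborel. wave \<xi> x * u x) + (LINT x|lborel. wave \<xi> x * partial i u x) = 0"
    unfolding pv by (simp only: Bochner_Integration.integral_add[OF integrable_mult_right] integral_mult_right_zero)
  then show ?thesis unfolding fourier_def by (simp add: add_eq_0_iff)
qed

lemma fourier_partials_replicate:
  fixes u :: "real^'n::finite \<Rightarrow> complex"
  assumes u: "smooth u" and d: "\<And>j. j \<le> k \<Longrightarrow> decays (decay_exp TYPE('n)) B (partials (replicate j i) u)"
  shows "fourier (partials (replicate k i) u) \<xi> = (\<i> * of_real (\<xi> $ i)) ^ k * fourier u \<xi>"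
  using d
proof (induction k)
  case (Suc k)
  have "fourier (partials (replicate (Suc k) i) u) \<xi> = \<i> * of_real (\<xi> $ i) * fourier (partials (replicate k i) u) \<xi>"
    unfolding replicate_Suc partials_Cons
    by (rule fourier_partial[where ?B0.0 = B and B = B])
      (use smooth_partials[OF u] Suc.prems[of k] Suc.prems[of "Suc k"] in auto)
  also have "\<dots> = \<i> * of_real (\<xi> $ i) * ((\<i> * of_real (\<xi> $ i)) ^ k * fourier u \<xi>)"
    by (subst Suc.IH) (use Suc.prems in auto)
  finally show ?case by (simp add: algebra_simps)
qed simp

lemma one_plus_norm_power_le_coords:
  fixes \<xi> :: "real^'n::finite"
  shows "(1 + norm \<xi>) ^ N \<le> (real CARD('n) + 1) ^ N * (1 + (\<Sum>i\<in>UNIV. \<bar>\<xi> $ i\<bar> ^ N))"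
proof -
  \<comment> \<open>the largest coordinate, or 1 if all coordinates are smaller\<close>
  define m where "m = Max (insert 1 (range (\<lambda>i. \<bar>\<xi> $ i\<bar>)))"
  have m: "1 \<le> m" "\<bar>\<xi> $ i\<bar> \<le> m" for i unfolding m_def by (intro Max_ge; simp)+
  have "1 + norm \<xi> \<le> m + (\<Sum>i\<in>(UNIV :: 'n set). m)"
    by (intro add_mono m order_trans[OF norm_le_l1_cart] sum_mono)
  then have "1 + norm \<xi> \<le> (real CARD('n) + 1) * m" by (simp add: algebra_simps)
  then have "(1 + norm \<xi>) ^ N \<le> (real CARD('n) + 1) ^ N * m ^ N"
    unfolding power_mult_distrib[symmetric] by (intro power_mono) auto
  also have "m ^ N \<le> 1 + (\<Sum>i\<in>UNIV. \<bar>\<xi> $ i\<bar> ^ N)"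
  proof -
    have "m \<in> insert 1 (range (\<lambda>i. \<bar>\<xi> $ i\<bar>))" unfolding m_def by (rule Max_in) auto
    then consider "m = 1" | i where "m = \<bar>\<xi> $ i\<bar>" by auto
    then show ?thesis
    proof cases
      case 1 then show ?thesis by (simp add: sum_nonneg)
    next
      case (2 i)
      have "\<bar>\<xi> $ i\<bar> ^ N \<le> (\<Sum>i\<in>UNIV. \<bar>\<xi> $ i\<bar> ^ N)" by (rule member_le_sum) auto
      then show ?thesis using 2 by simp
    qed
  qed
  finally show ?thesis by (simp add: mult_left_mono)
qed

text \<open>A derivative of the transform is the transform of \<open>u\<close> times a monomial, and \<open>\<xi>\<^sub>i\<^sup>N\<close> times a transform is,
  up to a unit, the transform of the \<open>N\<close>-th derivative; so decay and smoothness are exchanged. The constants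
  are independent of \<open>u\<close>: for Schwartz functions this gives continuity of the Fourier transformation, while
  a finite \<open>N\<close> covers multipliers times a negative power of \<open>1 + |x|\<^sup>2\<close>, where only finite decay is at hand.\<close>

lemma fourier_jet_bound:
  fixes N L :: nat
  shows "\<exists>C M. 0 \<le> C \<and> (\<forall>(u :: real^'n::finite \<Rightarrow> complex) B. smooth u \<longrightarrow> (\<forall>x. (1 + norm x) ^ M * jet_norm N u x \<le> B) \<longrightarrow>
    (\<forall>js \<xi>. length js \<le> L \<longrightarrow> partials js (fourier u) differentiable (at \<xi>)) \<and>
    (\<forall>\<xi>. (1 + norm \<xi>) ^ N * jet_norm L (fourier u) \<xi> \<le> C * B))"
proof -
  let ?P = "decay_exp TYPE('n)"
  have "\<exists>c m. 0 \<le> c \<and> (\<forall>x :: real^'n. jet_norm N (monomial js) x \<le> c * (1 + norm x) ^ m)" for js :: "'n list"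
    by (rule O_M_jet_bound[OF O_M_monomial]) blast
  then obtain c m where c: "\<And>js. 0 \<le> c js" and cm: "\<And>js (x :: real^'n). jet_norm N (monomial js) x \<le> c js * (1 + norm x) ^ m js"
    by metis
  define A where "A = (\<Sum>js :: 'n list | length js \<le> L. c js)"
  \<comment> \<open>decay for integrability, for differentiability, for \<open>L\<close> monomial factors, and against the growth of the jets of monomials\<close>
  define M where "M = ?P + 2 + L + (\<Sum>js :: 'n list | length js \<le> L. m js)"
  define E where "E = list_count TYPE('n) N * 2 ^ N * A"
  have A: "c js \<le> A" "0 \<le> A" if "length js \<le> L" for js
    unfolding A_def using c that by (auto intro!: member_le_sum sum_nonneg)
  have "0 \<le> A" using A(2)[of "[]"] by simp
  have mM: "?P + m js \<le> M" if "length js \<le> L" for js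
  proof -
    have "m js \<le> (\<Sum>js :: 'n list | length js \<le> L. m js)" using that by (intro member_le_sum) auto
    then show ?thesis by (simp add: M_def)
  qed
  have E: "0 \<le> E" by (simp add: E_def \<open>0 \<le> A\<close>)
  define C where "C = list_count TYPE('n) L * ((real CARD('n) + 1) ^ N * ((real CARD('n) + 1) * (weight_integral TYPE('n) * E)))"
  have "0 \<le> C" unfolding C_def using E by simp
  moreover have "(\<forall>js \<xi>. length js \<le> L \<longrightarrow> partials js (fourier u) differentiable (at \<xi>)) \<and>
    (\<forall>\<xi>. (1 + norm \<xi>) ^ N * jet_norm L (fourier u) \<xi> \<le> C * B)"
    if u: "smooth u" and B: "\<And>x. (1 + norm x) ^ M * jet_norm N u x \<le> B" for u :: "real^'n \<Rightarrow> complex" and B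
  proof -
    have mu: "u \<in> borel_measurable borel" by (rule borel_smooth[OF u])
    have du: "decays M B u" unfolding decays_def
      by (intro allI order_trans[OF mult_left_mono[OF jet_norm_ge_norm] B]) auto
    have du': "decays (?P + 2 + length js) B u" if "length js \<le> L" for js :: "'n list"
      using du by (rule decays_mono) (use that in \<open>simp add: M_def\<close>)
    have main: "(1 + norm \<xi>) ^ N * norm (partials js (fourier u) \<xi>)
      \<le> (real CARD('n) + 1) ^ N * ((real CARD('n) + 1) * (weight_integral TYPE('n) * (E * B)))"
      if js: "length js \<le> L" for js \<xi>
    proof -
      let ?v = "\<lambda>x. monomial js x * u x"
      have v: "smooth ?v" by (intro smooth_mult u O_M_smooth[OF O_M_monomial])
      have dv: "decays ?P (E * B) (partials ks ?v)" if "length ks \<le> N" for ks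
        unfolding decays_def
      proof
        fix x
        have "(1 + norm x) ^ ?P * norm (partials ks ?v x) \<le> (1 + norm x) ^ ?P * jet_norm N ?v x"
          by (intro mult_left_mono jet_norm_ge that) auto
        also have "\<dots> \<le> (1 + norm x) ^ ?P * ((list_count TYPE('n) N * 2 ^ N) * (jet_norm N (monomial js) x * jet_norm N u x))"
          by (intro mult_left_mono jet_norm_mult u O_M_smooth[OF O_M_monomial]) auto
        also have "\<dots> \<le> (1 + norm x) ^ ?P * ((list_count TYPE('n) N * 2 ^ N) * ((A * (1 + norm x) ^ m js) * jet_norm N u x))"
          by (intro mult_left_mono mult_right_mono order_trans[OF cm]) (auto simp: A js)
        also have "\<dots> = E * ((1 + norm x) ^ (?P + m js) * jet_norm N u x)"
          unfolding E_def power_add by (simp only: mult_ac)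
        also have "\<dots> \<le> E * ((1 + norm x) ^ M * jet_norm N u x)"
          by (intro mult_left_mono mult_right_mono one_plus_norm_power_mono mM js E) auto
        also have "\<dots> \<le> E * B" by (intro mult_left_mono B E)
        finally show "(1 + norm x) ^ ?P * norm (partials ks ?v x) \<le> E * B" .
      qed
      have Fb: "norm (fourier (partials ks ?v) \<xi>) \<le> weight_integral TYPE('n) * (E * B)" if "length ks \<le> N" for ks
        using dv[OF that] by (intro fourier_bound[OF borel_smooth[OF smooth_partials[OF v]]]) auto
      have co: "\<bar>\<xi> $ i\<bar> ^ N * norm (fourier ?v \<xi>) \<le> weight_integral TYPE('n) * (E * B)" for i
      proof -
        have "fourier (partials (replicate N i) ?v) \<xi> = (\<i> * of_real (\<xi> $ i)) ^ N * fourier ?v \<xi>"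
          by (rule fourier_partials_replicate[OF v]) (rule dv, simp)
        then have "\<bar>\<xi> $ i\<bar> ^ N * norm (fourier ?v \<xi>) = norm (fourier (partials (replicate N i) ?v) \<xi>)"
          by (simp add: norm_mult norm_power)
        then show ?thesis using Fb[of "replicate N i"] by simp
      qed
      have "(1 + norm \<xi>) ^ N * norm (fourier ?v \<xi>)
        \<le> ((real CARD('n) + 1) ^ N * (1 + (\<Sum>i\<in>UNIV. \<bar>\<xi> $ i\<bar> ^ N))) * norm (fourier ?v \<xi>)"
        by (intro mult_right_mono one_plus_norm_power_le_coords) auto
      also have "\<dots> = (real CARD('n) + 1) ^ N * (norm (fourier ?v \<xi>) + (\<Sum>i\<in>UNIV. \<bar>\<xi> $ i\<bar> ^ N * norm (fourier ?v \<xi>)))"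
        by (simp add: algebra_simps sum_distrib_left)
      also have "\<dots> \<le> (real CARD('n) + 1) ^ N * (weight_integral TYPE('n) * (E * B) + (\<Sum>i\<in>(UNIV :: 'n set). weight_integral TYPE('n) * (E * B)))"
        using Fb[of "[]"] by (intro mult_left_mono add_mono sum_mono co) auto
      also have "\<dots> = (real CARD('n) + 1) ^ N * ((real CARD('n) + 1) * (weight_integral TYPE('n) * (E * B)))"
        by (simp add: algebra_simps)
      finally show ?thesis unfolding partials_fourier[OF mu du'[OF js]] .
    qed
    have "(1 + norm \<xi>) ^ N * jet_norm L (fourier u) \<xi> \<le> C * B" for \<xi>
    proof -
      have "(1 + norm \<xi>) ^ N * jet_norm L (fourier u) \<xi>
        = (\<Sum>js | length js \<le> L. (1 + norm \<xi>) ^ N * norm (partials js (fourier u) \<xi>))"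
        by (simp add: jet_norm_def sum_distrib_left)
      also have "\<dots> \<le> list_count TYPE('n) L * ((real CARD('n) + 1) ^ N * ((real CARD('n) + 1) * (weight_integral TYPE('n) * (E * B))))"
        unfolding list_count_def by (rule sum_bounded_above) (use main in auto)
      also have "\<dots> = C * B" by (simp add: C_def mult_ac)
      finally show ?thesis .
    qed
    moreover have "partials js (fourier u) differentiable (at \<xi>)" if "length js \<le> L" for js \<xi>
      by (rule partials_fourier_differentiable[OF mu du'[OF that]])
    ultimately show ?thesis by blast
  qed
  ultimately show ?thesis by blast
qed

lemma fourier_schwartz_norm:
  "\<exists>C M. 0 \<le> C \<and> (\<forall>\<phi> :: real^'n::finite \<Rightarrow> complex. \<phi> \<in> schwartz \<longrightarrow> schwartz_norm K (fourier \<phi>) \<le> C * schwartz_norm M \<phi>)"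
proof -
  obtain C M where C: "0 \<le> C" and Q: "\<And>(u :: real^'n \<Rightarrow> complex) B \<xi>. smooth u \<Longrightarrow> (\<And>x. (1 + norm x) ^ M * jet_norm K u x \<le> B) \<Longrightarrow>
    (1 + norm \<xi>) ^ K * jet_norm K (fourier u) \<xi> \<le> C * B"
    using fourier_jet_bound[of K K] by blast
  have "schwartz_norm K (fourier \<phi>) \<le> (list_count TYPE('n) K * C) * schwartz_norm (max M K) \<phi>" if \<phi>: "\<phi> \<in> schwartz" for \<phi> :: "real^'n \<Rightarrow> complex"
    unfolding mult.assoc by (intro schwartz_norm_le Q schwartz_smooth schwartz_jet_bound \<phi>)
  moreover have "0 \<le> list_count TYPE('n) K * C" using C by simp
  ultimately show ?thesis by blast
qed

lemma fourier_schwartz: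
  fixes \<phi> :: "real^'n::finite \<Rightarrow> complex"
  assumes \<phi>: "\<phi> \<in> schwartz" shows "fourier \<phi> \<in> schwartz"
proof (rule schwartz_I)
  show "smooth (fourier \<phi>)"
    unfolding smooth_def
  proof (intro allI)
    fix js :: "'n list" and \<xi>
    obtain M where "\<And>(u :: real^'n \<Rightarrow> complex) B. smooth u \<Longrightarrow> (\<And>x. (1 + norm x) ^ M * jet_norm 0 u x \<le> B) \<Longrightarrow>
      partials js (fourier u) differentiable (at \<xi>)"
      using fourier_jet_bound[of 0 "length js"] by blast
    from this[OF schwartz_smooth[OF \<phi>] schwartz_jet_bound[OF \<phi>]]
    show "partials js (fourier \<phi>) differentiable (at \<xi>)" .
  qed
  fix K N
  obtain C M where "\<And>(u :: real^'n \<Rightarrow> complex) B \<xi>. smooth u \<Longrightarrow> (\<And>x. (1 + norm x) ^ M * jet_norm N u x \<le> B) \<Longrightarrow>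
    (1 + norm \<xi>) ^ N * jet_norm K (fourier u) \<xi> \<le> C * B"
    using fourier_jet_bound[of N K] by blast
  from this[OF schwartz_smooth[OF \<phi>] schwartz_jet_bound[OF \<phi>]]
  show "\<exists>B. \<forall>x. (1 + norm x) ^ N * jet_norm K (fourier \<phi>) x \<le> B" by blast
qed

section \<open>The multiplication formula\<close>

text \<open>Fubini's theorem for \<open>f(x) h(y) exp(- i x\<cdot>y)\<close>.\<close>

lemma fourier_multiplication_formula:
  fixes f h :: "real^'n::finite \<Rightarrow> complex"
  assumes f: "integrable lborel f" and h: "integrable lborel h"
  shows "(LINT x|lborel. f x * fourier h x) = (LINT y|lborel. fourier f y * h y)"
proof -
  define k where "k x y = exp (- \<i> * complex_of_real (y \<bullet> x)) * f x * h y" for x y :: "real^'n"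
  have mf: "f \<in> borel_measurable borel" "h \<in> borel_measurable borel" using f h by auto
  have me: "(\<lambda>(x, y). exp (- \<i> * complex_of_real (y \<bullet> x))) \<in> borel_measurable (lborel \<Otimes>\<^sub>M (lborel :: (real^'n) measure))"
  proof -
    have "(\<lambda>(x, y). exp (- \<i> * complex_of_real (y \<bullet> x))) \<in> borel_measurable (borel :: ((real^'n) \<times> (real^'n)) measure)"
      by (intro borel_measurable_continuous_onI) (auto simp: case_prod_unfold intro!: continuous_intros)
    then show ?thesis by (simp add: lborel_prod)
  qed
  have mk: "case_prod k \<in> borel_measurable (lborel \<Otimes>\<^sub>M lborel)"
  proof -
    have "case_prod k = (\<lambda>p. (case p of (x, y) \<Rightarrow> exp (- \<i> * complex_of_real (y \<bullet> x))) * f (fst p) * h (snd p))"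
      by (auto simp: k_def fun_eq_iff)
    moreover have "(\<lambda>p :: (real^'n) \<times> (real^'n). f (fst p)) \<in> borel_measurable (lborel \<Otimes>\<^sub>M lborel)"
      by (rule measurable_compose[OF measurable_fst]) (use mf in simp)
    moreover have "(\<lambda>p :: (real^'n) \<times> (real^'n). h (snd p)) \<in> borel_measurable (lborel \<Otimes>\<^sub>M lborel)"
      by (rule measurable_compose[OF measurable_snd]) (use mf in simp)
    ultimately show ?thesis using me by (simp only: borel_measurable_times)
  qed
  have nk: "norm (k x y) = norm (f x) * norm (h y)" for x y
    using norm_wave[of x y] unfolding k_def norm_mult by simp
  have hy: "integrable lborel (k x)" for x
  proof -
    have "k x = (\<lambda>y. f x * (wave x y * h y))" by (auto simp: k_def)
    then show ?thesis by (simp only: integrable_mult_right integrable_wave[OF h])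
  qed
  have ik: "integrable (lborel \<Otimes>\<^sub>M lborel) (case_prod k)"
  proof (rule lborel_pair.Fubini_integrable[OF mk])
    show "integrable lborel (\<lambda>x. LINT y|lborel. norm (case (x, y) of (x, y) \<Rightarrow> k x y))"
      using f by (simp add: nk)
    show "AE x in lborel. integrable lborel (\<lambda>y. case (x, y) of (x, y) \<Rightarrow> k x y)"
      using hy by simp
  qed
  have "(LINT x|lborel. f x * fourier h x) = (LINT x|lborel. (LINT y|lborel. k x y))"
  proof -
    have "f x * fourier h x = (LINT y|lborel. k x y)" for x
      unfolding fourier_def k_def by (subst integral_mult_right_zero[symmetric]) (simp add: mult_ac)
    then show ?thesis by simp
  qed
  also have "\<dots> = (LINT y|lborel. (LINT x|lborel. k x y))"
    by (rule lborel_pair.Fubini_integral[OF ik, symmetric])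
  also have "\<dots> = (LINT y|lborel. fourier f y * h y)"
  proof -
    have "(LINT x|lborel. k x y) = fourier f y * h y" for y
      unfolding fourier_def k_def by (subst integral_mult_left_zero[symmetric]) (simp add: inner_commute)
    then show ?thesis by simp
  qed
  finally show ?thesis .
qed

lemma schwartz_decays: "\<phi> \<in> schwartz \<Longrightarrow> decays N (schwartz_norm N \<phi>) \<phi>"
  unfolding decays_def
  by (intro allI order_trans[OF mult_left_mono[OF jet_norm_ge_norm[of _ _ N]] schwartz_norm_ge]) auto

lemma schwartz_O_M:
  assumes "\<phi> \<in> schwartz" shows "\<phi> \<in> O_M"
proof (rule O_M_I[OF schwartz_smooth[OF assms]])
  fix K
  have "jet_norm K \<phi> x \<le> schwartz_norm (max 0 K) \<phi> * (1 + norm x) ^ 0" for x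
    using schwartz_jet_bound[OF assms, where N = 0 and K = K and x = x] by simp
  then show "\<exists>N B. \<forall>x. jet_norm K \<phi> x \<le> B * (1 + norm x) ^ N" by blast
qed

lemma schwartz_borel: "\<phi> \<in> schwartz \<Longrightarrow> \<phi> \<in> borel_measurable borel"
  by (rule borel_smooth[OF schwartz_smooth])

lemma schwartz_integrable: "\<phi> \<in> schwartz \<Longrightarrow> integrable lborel \<phi>"
  by (rule integrable_decays(1)[OF schwartz_borel schwartz_decays order_refl])

lemma schwartz_continuous: "\<phi> \<in> schwartz \<Longrightarrow> continuous_on S \<phi>"
  by (rule smooth_continuous[OF schwartz_smooth])

lemma fourier_reflect:
  fixes h :: "real^'n::finite \<Rightarrow> complex"
  assumes "h \<in> borel_measurable borel"
  shows "fourier (\<lambda>x. h (- x)) \<xi> = fourier h (- \<xi>)"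
  using integral_reflect[OF borel_wave_mult[OF assms, of "- \<xi>"]] unfolding fourier_def by simp

lemma fourier_translate:
  fixes h :: "real^'n::finite \<Rightarrow> complex"
  assumes "h \<in> borel_measurable borel"
  shows "fourier (\<lambda>x. h (a + x)) \<xi> = wave (- a) \<xi> * fourier h \<xi>"
proof -
  have "wave (- a) \<xi> * fourier h \<xi> = (LINT x|lborel. wave (- a) \<xi> * (wave \<xi> x * h x))"
    unfolding fourier_def by simp
  also have "\<dots> = (LINT x|lborel. wave (- a) \<xi> * (wave \<xi> (a + x) * h (a + x)))"
    by (rule integral_translate[symmetric]) (intro borel_measurable_times borel_wave_mult assms borel_measurable_const)
  also have "\<dots> = fourier (\<lambda>x. h (a + x)) \<xi>"
    unfolding fourier_def mult.assoc[symmetric] exp_add[symmetric]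
    by (simp add: inner_add_left inner_commute algebra_simps)
  finally show ?thesis by simp
qed

section \<open>Approximate identities\<close>

text \<open>Dominated convergence; for scaling factors at most 1, the growth of \<open>d\<close> costs \<open>N\<close> orders of the decay
  of \<open>h\<close>.\<close>

lemma approximate_identity:
  fixes d h :: "real^'n::finite \<Rightarrow> complex"
  assumes d: "continuous_on UNIV d" "\<And>x. norm (d x) \<le> C * (1 + norm x) ^ N"
    and h: "h \<in> borel_measurable borel" "decays (decay_exp TYPE('n) + N) B h"
  shows "(\<lambda>k. LINT y|lborel. d (a + (1 / real (Suc k)) *\<^sub>R y) * h y) \<longlonglongrightarrow> d a * (LINT y|lborel. h y)"
proof -
  let ?P = "decay_exp TYPE('n)"
  let ?r = "\<lambda>k. 1 / real (Suc k)"
  have C: "0 \<le> C" using order_trans[OF norm_ge_zero d(2)[of 0]] by simp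
  have "(\<lambda>k. LINT y|lborel. d (a + ?r k *\<^sub>R y) * h y) \<longlonglongrightarrow> (LINT y|lborel. d a * h y)"
  proof (rule integral_dominated_convergence[where w = "\<lambda>y. (C * (1 + norm a + 1) ^ N * B) * (1 / (1 + norm y) ^ ?P)"])
    show "integrable lborel (\<lambda>y :: real^'n. (C * (1 + norm a + 1) ^ N * B) * (1 / (1 + norm y) ^ ?P))"
      by (intro integrable_mult_right integrable_weight)
    show "(\<lambda>y. d a * h y) \<in> borel_measurable lborel" using h by simp
    show "(\<lambda>y. d (a + ?r k *\<^sub>R y) * h y) \<in> borel_measurable lborel" for k
    proof -
      have "continuous_on UNIV (\<lambda>y. d (a + ?r k *\<^sub>R y))"
        by (rule continuous_on_compose2[OF d(1)]) (auto intro!: continuous_intros)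
      then have "(\<lambda>y. d (a + ?r k *\<^sub>R y)) \<in> borel_measurable borel" by (rule borel_measurable_continuous_onI)
      from borel_measurable_times[OF this h(1)] show ?thesis by simp
    qed
    show "AE y in lborel. (\<lambda>k. d (a + ?r k *\<^sub>R y) * h y) \<longlonglongrightarrow> d a * h y"
    proof (rule AE_I2)
      fix y :: "real^'n"
      have "?r \<longlonglongrightarrow> 0" using LIMSEQ_inverse_real_of_nat by (simp add: inverse_eq_divide)
      then have "(\<lambda>k. a + ?r k *\<^sub>R y) \<longlonglongrightarrow> a + 0 *\<^sub>R y" by (intro tendsto_intros)
      moreover have "isCont d a" using d(1) by (simp add: continuous_on_eq_continuous_at)
      ultimately have "(\<lambda>k. d (a + ?r k *\<^sub>R y)) \<longlonglongrightarrow> d a" using isCont_tendsto_compose by fastforce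
      then show "(\<lambda>k. d (a + ?r k *\<^sub>R y) * h y) \<longlonglongrightarrow> d a * h y" by (intro tendsto_intros)
    qed
    show "AE y in lborel. norm (d (a + ?r k *\<^sub>R y) * h y) \<le> (C * (1 + norm a + 1) ^ N * B) * (1 / (1 + norm y) ^ ?P)" for k
    proof (rule AE_I2)
      fix y :: "real^'n"
      have "(1 + norm (a + ?r k *\<^sub>R y)) ^ N \<le> (1 + norm a + \<bar>?r k\<bar>) ^ N * (1 + norm y) ^ N"
        by (rule norm_affine_power_le)
      also have "\<dots> \<le> (1 + norm a + 1) ^ N * (1 + norm y) ^ N"
        by (intro mult_right_mono power_mono) auto
      finally have "norm (d (a + ?r k *\<^sub>R y)) \<le> C * ((1 + norm a + 1) ^ N * (1 + norm y) ^ N)"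
        using C by (intro order_trans[OF d(2)] mult_left_mono)
      then have "(1 + norm y) ^ ?P * norm (d (a + ?r k *\<^sub>R y) * h y)
        \<le> (1 + norm y) ^ ?P * ((C * ((1 + norm a + 1) ^ N * (1 + norm y) ^ N)) * norm (h y))"
        unfolding norm_mult by (intro mult_left_mono mult_right_mono) auto
      also have "\<dots> = C * (1 + norm a + 1) ^ N * ((1 + norm y) ^ (?P + N) * norm (h y))"
        by (simp only: power_add mult_ac)
      also have "\<dots> \<le> C * (1 + norm a + 1) ^ N * B"
        using C by (intro mult_left_mono decaysD[OF h(2)]) auto
      finally show "norm (d (a + ?r k *\<^sub>R y) * h y) \<le> (C * (1 + norm a + 1) ^ N * B) * (1 / (1 + norm y) ^ ?P)"
        by (simp add: pos_le_divide_eq mult.commute)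
    qed
  qed
  then show ?thesis by simp
qed

lemma integral_continuous_eq_0:
  fixes f :: "real^'n::finite \<Rightarrow> real"
  assumes "continuous_on UNIV f" "\<And>x. 0 \<le> f x" "integrable lborel f" "(LINT x|lborel. f x) = 0"
  shows "f x = 0"
proof -
  have "AE x in lborel. f x = 0"
    using integral_nonneg_eq_0_iff_AE[OF assms(3)] assms(2,4) by simp
  then have "AE x in lebesgue. f x = 0" by (rule AE_completion)
  then have "negligible {x. f x \<noteq> 0}"
    using AE_iff_null_sets[of "{x. f x \<noteq> 0}" lebesgue] assms(1)
    by (simp add: negligible_iff_null_sets eventually_ae_filter) (metis (mono_tags, lifting) Collect_mono_iff null_sets_completion_subset UNIV_I space_lborel space_completion mem_Collect_eq)
  moreover have "open {x. f x \<noteq> 0}"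
    using open_Collect_neq[OF assms(1) continuous_on_const] .
  ultimately show ?thesis using open_not_negligible by blast
qed

lemma gauss_integral_nonzero: "(LINT x :: real^'n::finite|lborel. gauss x) \<noteq> 0"
proof
  assume *: "(LINT x :: real^'n|lborel. gauss x) = 0"
  have "integrable lborel (\<lambda>x :: real^'n. complex_of_real (exp (- (x \<bullet> x))))"
    using schwartz_integrable[OF gauss_schwartz] by (simp add: gauss_def[abs_def])
  then have i: "integrable lborel (\<lambda>x :: real^'n. exp (- (x \<bullet> x)))"
    by (simp only: complex_of_real_integrable_eq)
  have "(LINT x :: real^'n|lborel. exp (- (x \<bullet> x))) = 0"
    using * unfolding gauss_def integral_complex_of_real by simp
  from integral_continuous_eq_0[OF _ _ i this, of 0]
  show False by (simp add: continuous_intros)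
qed

text \<open>Tested against dilated Gaussians that concentrate at \<open>a\<close>, the integrals converge to a nonzero multiple
  of \<open>d(a)\<close>.\<close>

lemma continuous_zero_of_regular:
  fixes d :: "real^'n::finite \<Rightarrow> complex"
  assumes d: "continuous_on UNIV d" "\<And>x. norm (d x) \<le> C * (1 + norm x) ^ N"
    and zero: "\<And>\<phi>. \<phi> \<in> schwartz \<Longrightarrow> (LINT x|lborel. d x * \<phi> x) = 0"
  shows "d a = 0"
proof -
  have "(LINT y|lborel. d (a + (1 / real (Suc k)) *\<^sub>R y) * gauss y) = 0" for k
  proof -
    let ?r = "1 / real (Suc k)"
    \<comment> \<open>the Gaussian dilated by \<open>1 / (k + 1)\<close> and centred at \<open>a\<close>\<close>
    let ?\<phi> = "\<lambda>x. gauss ((- (real (Suc k))) *\<^sub>R a + real (Suc k) *\<^sub>R x)"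
    have "?\<phi> \<in> schwartz" by (rule schwartz_affine[OF gauss_schwartz]) simp
    then have z: "(LINT x|lborel. d x * ?\<phi> x) = 0" by (rule zero)
    have m: "(\<lambda>x. d x * ?\<phi> x) \<in> borel_measurable borel"
      using d(1) \<open>?\<phi> \<in> schwartz\<close> by (intro borel_measurable_times schwartz_borel borel_measurable_continuous_onI)
    have "(- s) *\<^sub>R a + s *\<^sub>R (a + (1 / s) *\<^sub>R y) = y" if "s \<noteq> 0" for s :: real and y
      using that by (simp add: scaleR_add_right)
    then have inv: "?\<phi> (a + ?r *\<^sub>R y) = gauss y" for y by (metis of_nat_eq_0_iff nat.distinct(2))
    have "(LINT x|lborel. d x * ?\<phi> x) = of_real (\<bar>?r\<bar> ^ CARD('n)) * (LINT y|lborel. d (a + ?r *\<^sub>R y) * ?\<phi> (a + ?r *\<^sub>R y))"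
      by (rule integral_affine[OF m]) simp
    moreover have "complex_of_real (\<bar>?r\<bar> ^ CARD('n)) \<noteq> 0"
      unfolding of_real_eq_0_iff by simp
    ultimately show ?thesis unfolding z inv by (metis mult_eq_0_iff)
  qed
  moreover have "(\<lambda>k. LINT y|lborel. d (a + (1 / real (Suc k)) *\<^sub>R y) * gauss y) \<longlonglongrightarrow> d a * (LINT y :: real^'n|lborel. gauss y)"
    by (rule approximate_identity[OF d schwartz_borel[OF gauss_schwartz] schwartz_decays[OF gauss_schwartz]])
  ultimately have "(\<lambda>k. 0) \<longlonglongrightarrow> d a * (LINT y :: real^'n|lborel. gauss y)" by (simp only:)
  then have "0 = d a * (LINT y :: real^'n|lborel. gauss y)"
    by (rule LIMSEQ_unique[OF tendsto_const])
  then show ?thesis using gauss_integral_nonzero[where 'n = 'n] by simp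
qed

section \<open>Fourier inversion\<close>

text \<open>By Fourier inversion at the origin for the Gaussian, this is \<open>(2\<pi>)\<^sup>n\<close>.\<close>

definition inversion_const :: "'n::finite itself \<Rightarrow> complex" where
  "inversion_const _ = (LINT y :: real^'n|lborel. fourier gauss y)"

lemma schwartz_bounded: "\<phi> \<in> schwartz \<Longrightarrow> norm (\<phi> x) \<le> schwartz_norm 0 \<phi> * (1 + norm x) ^ 0"
  using decaysD[OF schwartz_decays, where N = 0 and x = x] by fastforce

lemma fourier_dilate:
  fixes h :: "real^'n::finite \<Rightarrow> complex"
  assumes "h \<in> borel_measurable borel" "r \<noteq> 0"
  shows "of_real (\<bar>r\<bar> ^ CARD('n)) * fourier (\<lambda>\<xi>. h (r *\<^sub>R \<xi>)) (r *\<^sub>R y) = fourier h y"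
  using integral_affine[OF borel_wave_mult[OF assms(1), of y] assms(2), of 0]
  unfolding fourier_def by (simp add: mult.commute inner_commute mult_ac)

text \<open>In the multiplication formula for \<open>\<phi>\<close> and a dilated Gaussian, a change of variables moves the dilation
  to \<open>\<phi>\<close>; both sides then converge as the dilation factor tends to zero.\<close>

lemma integral_fourier:
  fixes \<phi> :: "real^'n::finite \<Rightarrow> complex"
  assumes \<phi>: "\<phi> \<in> schwartz"
  shows "(LINT \<xi>|lborel. fourier \<phi> \<xi>) = inversion_const TYPE('n) * \<phi> 0"
proof -
  let ?r = "\<lambda>k. 1 / real (Suc k)"
  have F: "fourier \<phi> \<in> schwartz" "fourier (gauss :: real^'n \<Rightarrow> complex) \<in> schwartz"
    by (intro fourier_schwartz \<phi> gauss_schwartz)+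
  have eq: "(LINT \<xi>|lborel. gauss (0 + ?r k *\<^sub>R \<xi>) * fourier \<phi> \<xi>) = (LINT y|lborel. \<phi> (0 + ?r k *\<^sub>R y) * fourier gauss y)" for k
  proof -
    let ?g = "\<lambda>\<xi> :: real^'n. gauss (?r k *\<^sub>R \<xi>)"
    have g: "?g \<in> schwartz" using schwartz_affine[OF gauss_schwartz, of "?r k" 0] by simp
    have "(LINT \<xi>|lborel. ?g \<xi> * fourier \<phi> \<xi>) = (LINT y|lborel. fourier ?g y * \<phi> y)"
      by (rule fourier_multiplication_formula[OF schwartz_integrable[OF g] schwartz_integrable[OF \<phi>]])
    also have "\<dots> = of_real (\<bar>?r k\<bar> ^ CARD('n)) * (LINT y|lborel. fourier ?g (0 + ?r k *\<^sub>R y) * \<phi> (0 + ?r k *\<^sub>R y))"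
      by (rule integral_affine) (intro borel_measurable_times schwartz_borel fourier_schwartz g \<phi>, simp)
    also have "\<dots> = (LINT y|lborel. (of_real (\<bar>?r k\<bar> ^ CARD('n)) * fourier ?g (?r k *\<^sub>R y)) * \<phi> (?r k *\<^sub>R y))"
      by (subst integral_mult_right_zero[symmetric]) (simp add: mult.assoc)
    also have "\<dots> = (LINT y|lborel. \<phi> (0 + ?r k *\<^sub>R y) * fourier gauss y)"
      by (subst fourier_dilate[OF schwartz_borel[OF gauss_schwartz]]) (simp_all add: mult.commute)
    finally show ?thesis by simp
  qed
  have "(\<lambda>k. LINT \<xi>|lborel. gauss (0 + ?r k *\<^sub>R \<xi>) * fourier \<phi> \<xi>) \<longlonglongrightarrow> gauss (0 :: real^'n) * (LINT \<xi>|lborel. fourier \<phi> \<xi>)"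
    by (rule approximate_identity[OF schwartz_continuous[OF gauss_schwartz] schwartz_bounded[OF gauss_schwartz]
        schwartz_borel[OF F(1)] schwartz_decays[OF F(1)]])
  moreover have "(\<lambda>k. LINT y|lborel. \<phi> (0 + ?r k *\<^sub>R y) * fourier gauss y) \<longlonglongrightarrow> \<phi> 0 * (LINT y :: real^'n|lborel. fourier gauss y)"
    by (rule approximate_identity[OF schwartz_continuous[OF \<phi>] schwartz_bounded[OF \<phi>]
        schwartz_borel[OF F(2)] schwartz_decays[OF F(2)]])
  ultimately have "gauss (0 :: real^'n) * (LINT \<xi>|lborel. fourier \<phi> \<xi>) = \<phi> 0 * (LINT y :: real^'n|lborel. fourier gauss y)"
    unfolding eq using LIMSEQ_unique by blast
  then show ?thesis by (simp add: gauss_def[of 0] inversion_const_def mult.commute)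
qed

text \<open>Translations reduce inversion at an arbitrary point to inversion at the origin.\<close>

lemma fourier_fourier:
  fixes \<phi> :: "real^'n::finite \<Rightarrow> complex"
  assumes \<phi>: "\<phi> \<in> schwartz"
  shows "fourier (fourier \<phi>) x = inversion_const TYPE('n) * \<phi> (- x)"
proof -
  have "(LINT \<xi>|lborel. fourier (\<lambda>y. \<phi> (- x + y)) \<xi>) = inversion_const TYPE('n) * \<phi> (- x + 0)"
    by (rule integral_fourier[OF schwartz_translate[OF \<phi>]])
  moreover have "fourier (\<lambda>y. \<phi> (- x + y)) \<xi> = wave x \<xi> * fourier \<phi> \<xi>" for \<xi>
    using fourier_translate[OF schwartz_borel[OF \<phi>], of "- x"] by simp
  ultimately show ?thesis by (simp add: fourier_def[of "fourier \<phi>"])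
qed

lemma cnj_fourier_gauss:
  fixes \<xi> :: "real^'a::finite"
  shows "cnj (fourier gauss \<xi>) = fourier gauss \<xi>"
proof -
  have "cnj (fourier gauss \<xi>) = (LINT x|lborel. wave (- \<xi>) x * gauss x)"
  proof -
    have conj: "cnj (wave \<xi> x * gauss x) = wave (- \<xi>) x * gauss x" for x by (simp add: gauss_def exp_cnj)
    have "cnj (fourier gauss \<xi>) = (LINT x|lborel. cnj (wave \<xi> x * gauss x))"
      unfolding fourier_def by (rule Bochner_Integration.integral_cnj[symmetric])
    also have "\<dots> = (LINT x|lborel. wave (- \<xi>) x * gauss x)"
      by (rule Bochner_Integration.integral_cong[OF refl]) (rule conj)
    finally show ?thesis .
  qed
  also have "\<dots> = fourier gauss (- \<xi>)" by (simp add: fourier_def)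
  also have "\<dots> = fourier gauss \<xi>"
  proof -
    have "(\<lambda>x :: real^'a. gauss (- x)) = gauss" by (simp add: gauss_def fun_eq_iff)
    then show ?thesis using fourier_reflect[OF schwartz_borel[OF gauss_schwartz], of \<xi>] by simp
  qed
  finally show ?thesis .
qed

text \<open>If the constant were zero, then \<open>\<integral> |\<F> gauss|\<^sup>2 = \<integral> gauss \<cdot> \<F> (\<F> gauss) = 0\<close>, since \<open>\<F> gauss\<close> is real.
  But \<open>(\<F> gauss)(0)\<close> is the integral of the Gaussian.\<close>

lemma inversion_const_nonzero [simp]: "inversion_const TYPE('n::finite) \<noteq> 0"
proof
  assume zero: "inversion_const TYPE('n) = 0"
  let ?g = "gauss :: real^'n \<Rightarrow> complex"
  have F: "fourier ?g \<in> schwartz" by (rule fourier_schwartz[OF gauss_schwartz])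
  have sq: "fourier ?g y * fourier ?g y = of_real ((norm (fourier ?g y))\<^sup>2)" for y
    using complex_norm_square[of "fourier ?g y"] by (simp add: cnj_fourier_gauss)
  have "integrable lborel (\<lambda>y. fourier ?g y * fourier ?g y)"
    by (intro schwartz_integrable schwartz_mult schwartz_O_M F)
  then have i: "integrable lborel (\<lambda>y. (norm (fourier ?g y))\<^sup>2)"
    unfolding sq by (simp only: complex_of_real_integrable_eq)
  have "(LINT y|lborel. fourier ?g y * fourier ?g y) = (LINT x|lborel. ?g x * fourier (fourier ?g) x)"
    by (rule fourier_multiplication_formula[OF schwartz_integrable[OF gauss_schwartz] schwartz_integrable[OF F], symmetric])
  also have "\<dots> = 0" by (simp add: fourier_fourier[OF gauss_schwartz] zero)
  finally have "(LINT y|lborel. (norm (fourier ?g y))\<^sup>2) = 0"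
    unfolding sq integral_complex_of_real by simp
  then have "(norm (fourier ?g 0))\<^sup>2 = 0"
    by (rule integral_continuous_eq_0[OF _ _ i, rotated -1]) (auto intro!: continuous_intros schwartz_continuous[OF F])
  then have "fourier ?g 0 = 0" by simp
  then show False using gauss_integral_nonzero[where 'n = 'n] by (simp add: fourier_def)
qed

definition inv_fourier :: "(real^'n::finite \<Rightarrow> complex) \<Rightarrow> real^'n \<Rightarrow> complex" where
  "inv_fourier \<phi> x = (1 / inversion_const TYPE('n)) * fourier \<phi> (- x)"

lemma inv_fourier_schwartz: "\<phi> \<in> schwartz \<Longrightarrow> inv_fourier \<phi> \<in> schwartz"
  unfolding inv_fourier_def[abs_def] by (intro schwartz_cmult schwartz_reflect fourier_schwartz)

lemma inv_fourier_fourier: "\<phi> \<in> schwartz \<Longrightarrow> inv_fourier (fourier \<phi>) = \<phi>"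
  by (auto simp: inv_fourier_def fourier_fourier)

lemma fourier_inv_fourier:
  fixes \<phi> :: "real^'n::finite \<Rightarrow> complex"
  assumes "\<phi> \<in> schwartz" shows "fourier (inv_fourier \<phi>) = \<phi>"
proof
  fix x
  have "fourier (inv_fourier \<phi>) x = (1 / inversion_const TYPE('n)) * fourier (\<lambda>x. fourier \<phi> (- x)) x"
    unfolding inv_fourier_def[abs_def] by (rule fourier_cmult)
  also have "\<dots> = \<phi> x"
    using fourier_reflect[OF schwartz_borel[OF fourier_schwartz[OF assms]], of x] by (simp add: fourier_fourier[OF assms])
  finally show "fourier (inv_fourier \<phi>) x = \<phi> x" .
qed

section \<open>Distributions with a given symbol\<close>

text \<open>The inverse Fourier transform of the distribution \<open>g\<close>, written as a pairing of \<open>g\<close> with the inverse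
  transform of the test function.\<close>

definition symbol_dist :: "(real^'n::finite \<Rightarrow> complex) \<Rightarrow> 'n functional" where
  "symbol_dist g = (\<lambda>\<phi>. if \<phi> \<in> schwartz then LINT \<xi>|lborel. g \<xi> * inv_fourier \<phi> \<xi> else 0)"

lemma fourier_dist_symbol_dist: "fourier_dist (symbol_dist g) = regular_dist g"
  by (rule ext) (simp add: fourier_dist_def symbol_dist_def regular_dist_def fourier_schwartz inv_fourier_fourier)

lemma symbol_dist_eqI:
  assumes "\<And>\<phi>. \<phi> \<notin> schwartz \<Longrightarrow> T \<phi> = 0" "fourier_dist T = regular_dist g"
  shows "T = symbol_dist g"
proof
  fix \<phi>
  show "T \<phi> = symbol_dist g \<phi>"
  proof (cases "\<phi> \<in> schwartz")
    case True
    then have "T \<phi> = fourier_dist T (inv_fourier \<phi>)"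
      by (simp add: fourier_dist_def inv_fourier_schwartz fourier_inv_fourier)
    then show ?thesis using True by (simp add: assms(2) regular_dist_def symbol_dist_def inv_fourier_schwartz)
  qed (use assms in \<open>simp add: symbol_dist_def\<close>)
qed

lemma O_M_schwartz_integrable:
  assumes "g \<in> O_M" "\<phi> \<in> schwartz" shows "integrable lborel (\<lambda>x. g x * \<phi> x)"
  by (intro schwartz_integrable schwartz_mult assms)

lemma regular_dist_inj:
  fixes f g :: "real^'n::finite \<Rightarrow> complex"
  assumes f: "continuous_on UNIV f" "\<And>x. norm (f x) \<le> B * (1 + norm x) ^ N"
    and g: "continuous_on UNIV g" "\<And>x. norm (g x) \<le> C * (1 + norm x) ^ M"
    and eq: "regular_dist f = regular_dist g"
  shows "f = g"
proof
  fix a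
  have nn: "0 \<le> B" "0 \<le> C"
    using order_trans[OF norm_ge_zero f(2)[of 0]] order_trans[OF norm_ge_zero g(2)[of 0]] by auto
  have i: "integrable lborel (\<lambda>x. h x * \<phi> x)"
    if h: "continuous_on UNIV h" "\<And>x. norm (h x) \<le> D * (1 + norm x) ^ K" and \<phi>: "\<phi> \<in> schwartz" for h \<phi> :: "real^'n \<Rightarrow> complex" and D K
  proof -
    have "0 \<le> D" using order_trans[OF norm_ge_zero h(2)[of 0]] by auto
    show ?thesis
    proof (rule integrable_decays(1)[OF _ _ order_refl])
      show "(\<lambda>x. h x * \<phi> x) \<in> borel_measurable borel"
        by (intro borel_measurable_times schwartz_borel \<phi> borel_measurable_continuous_onI h)
      show "decays (decay_exp TYPE('n)) (D * schwartz_norm (decay_exp TYPE('n) + K) \<phi>) (\<lambda>x. h x * \<phi> x)"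
        unfolding decays_def
      proof
        fix x
        have "(1 + norm x) ^ decay_exp TYPE('n) * norm (h x * \<phi> x)
          \<le> (1 + norm x) ^ decay_exp TYPE('n) * ((D * (1 + norm x) ^ K) * norm (\<phi> x))"
          unfolding norm_mult by (intro mult_left_mono mult_right_mono h) auto
        also have "\<dots> = D * ((1 + norm x) ^ (decay_exp TYPE('n) + K) * norm (\<phi> x))"
          by (simp only: power_add mult_ac)
        also have "\<dots> \<le> D * schwartz_norm (decay_exp TYPE('n) + K) \<phi>"
          by (intro mult_left_mono decaysD schwartz_decays \<phi> \<open>0 \<le> D\<close>)
        finally show "(1 + norm x) ^ decay_exp TYPE('n) * norm (h x * \<phi> x) \<le> D * schwartz_norm (decay_exp TYPE('n) + K) \<phi>" .
      qed
    qed
  qed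
  have "f a - g a = 0"
  proof (rule continuous_zero_of_regular)
    show "continuous_on UNIV (\<lambda>x. f x - g x)" by (intro continuous_intros f g)
    fix x
    have "norm (f x - g x) \<le> norm (f x) + norm (g x)" by (rule norm_triangle_ineq4)
    also have "\<dots> \<le> B * (1 + norm x) ^ (N + M) + C * (1 + norm x) ^ (N + M)"
      by (intro add_mono order_trans[OF f(2)] order_trans[OF g(2)] mult_left_mono one_plus_norm_power_mono nn) auto
    finally show "norm (f x - g x) \<le> (B + C) * (1 + norm x) ^ (N + M)" by (simp add: algebra_simps)
  next
    fix \<phi> :: "real^'n \<Rightarrow> complex" assume \<phi>: "\<phi> \<in> schwartz"
    have "(LINT x|lborel. (f x - g x) * \<phi> x) = (LINT x|lborel. f x * \<phi> x) - (LINT x|lborel. g x * \<phi> x)"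
      using Bochner_Integration.integral_diff[OF i[OF f \<phi>] i[OF g \<phi>]] by (simp add: left_diff_distrib)
    also have "\<dots> = 0" using fun_cong[OF eq, of \<phi>] \<phi> by (simp add: regular_dist_def)
    finally show "(LINT x|lborel. (f x - g x) * \<phi> x) = 0" .
  qed
  then show "f a = g a" by simp
qed

lemma fourier_fun_symbol_dist:
  assumes g: "g \<in> O_M" shows "fourier_fun (symbol_dist g) = g"
  unfolding fourier_fun_def fourier_dist_symbol_dist
proof (rule the_equality)
  fix h assume h: "h \<in> O_M \<and> regular_dist g = regular_dist h"
  obtain N B where "\<And>x. norm (h x) \<le> B * (1 + norm x) ^ N" using O_M_growth h by blast
  moreover obtain M C where "\<And>x. norm (g x) \<le> C * (1 + norm x) ^ M" using O_M_growth g by blast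
  ultimately show "h = g"
    using h g by (intro regular_dist_inj[of h _ _ g]) (auto intro!: smooth_continuous O_M_smooth)
qed (use g in simp)

lemma inv_fourier_linear:
  fixes \<phi> \<psi> :: "real^'n::finite \<Rightarrow> complex"
  assumes "\<phi> \<in> schwartz" "\<psi> \<in> schwartz"
  shows "inv_fourier (\<lambda>x. c * \<phi> x + \<psi> x) \<xi> = c * inv_fourier \<phi> \<xi> + inv_fourier \<psi> \<xi>"
  unfolding inv_fourier_def fourier_add[OF schwartz_integrable[OF schwartz_cmult[OF assms(1)]] schwartz_integrable[OF assms(2)]]
      fourier_cmult by (simp add: add_divide_distrib)

lemma symbol_dist_linear:
  assumes "g \<in> O_M" "\<phi> \<in> schwartz" "\<psi> \<in> schwartz"
  shows "symbol_dist g (\<lambda>x. c * \<phi> x + \<psi> x) = c * symbol_dist g \<phi> + symbol_dist g \<psi>"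
proof -
  have "(\<lambda>x. c * \<phi> x + \<psi> x) \<in> schwartz" by (intro schwartz_add schwartz_cmult assms)
  moreover have "(LINT \<xi>|lborel. g \<xi> * inv_fourier (\<lambda>x. c * \<phi> x + \<psi> x) \<xi>)
    = (LINT \<xi>|lborel. c * (g \<xi> * inv_fourier \<phi> \<xi>) + g \<xi> * inv_fourier \<psi> \<xi>)"
    unfolding inv_fourier_linear[OF assms(2,3)] by (simp add: algebra_simps)
  moreover have "\<dots> = c * (LINT \<xi>|lborel. g \<xi> * inv_fourier \<phi> \<xi>) + (LINT \<xi>|lborel. g \<xi> * inv_fourier \<psi> \<xi>)"
    by (subst Bochner_Integration.integral_add)
       (auto intro!: integrable_mult_right O_M_schwartz_integrable assms inv_fourier_schwartz simp del: mult_eq_0_iff)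
  ultimately show ?thesis using assms by (simp add: symbol_dist_def)
qed

lemma symbol_dist_cmult: "symbol_dist (\<lambda>\<xi>. c * g \<xi>) \<phi> = c * symbol_dist g \<phi>"
  unfolding symbol_dist_def by (simp add: mult.assoc)

lemma symbol_dist_diff:
  "f \<in> O_M \<Longrightarrow> g \<in> O_M \<Longrightarrow> symbol_dist (\<lambda>\<xi>. f \<xi> - g \<xi>) \<phi> = symbol_dist f \<phi> - symbol_dist g \<phi>"
  unfolding symbol_dist_def
  by (auto simp: left_diff_distrib inv_fourier_schwartz O_M_schwartz_integrable)

lemma symbol_dist_sum:
  "finite I \<Longrightarrow> (\<And>i. i \<in> I \<Longrightarrow> f i \<in> O_M) \<Longrightarrow> symbol_dist (\<lambda>\<xi>. \<Sum>i\<in>I. f i \<xi>) \<phi> = (\<Sum>i\<in>I. symbol_dist (f i) \<phi>)"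
  unfolding symbol_dist_def
  by (auto simp: sum_distrib_right inv_fourier_schwartz O_M_schwartz_integrable Bochner_Integration.integral_sum)

lemma symbol_dist_0: "symbol_dist (\<lambda>\<xi>. 0) = (\<lambda>\<phi>. 0)"
  by (auto simp: symbol_dist_def)

lemma symbol_dist_1: "symbol_dist (\<lambda>\<xi>. 1) = dirac"
proof
  fix \<phi> :: "real^'a \<Rightarrow> complex"
  show "symbol_dist (\<lambda>\<xi>. 1) \<phi> = dirac \<phi>"
  proof (cases "\<phi> \<in> schwartz")
    case True
    have "(LINT \<xi>|lborel. inv_fourier \<phi> \<xi>) = fourier (inv_fourier \<phi>) 0" by (simp add: fourier_def)
    then show ?thesis using True by (simp add: symbol_dist_def dirac_def fourier_inv_fourier)
  qed (simp add: symbol_dist_def dirac_def)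
qed

section \<open>Convolution\<close>

text \<open>The inverse transform of \<open>y \<mapsto> \<phi>(x - y)\<close> is a multiple of \<open>exp(i x\<cdot>\<xi>) (\<F> \<phi>)(\<xi>)\<close>, so that convolution is the
  Fourier multiplier with symbol \<open>g\<close>.\<close>

lemma conv_fun_symbol_dist:
  fixes g :: "real^'n::finite \<Rightarrow> complex"
  shows "conv_fun (symbol_dist g) \<phi> = (if \<phi> \<in> schwartz then inv_fourier (\<lambda>\<xi>. g \<xi> * fourier \<phi> \<xi>) else (\<lambda>x. 0))"
proof (cases "\<phi> \<in> schwartz")
  case True
  have "symbol_dist g (\<lambda>y. \<phi> (x - y)) = inv_fourier (\<lambda>\<xi>. g \<xi> * fourier \<phi> \<xi>) x" for x
  proof -
    have "inv_fourier (\<lambda>y. \<phi> (x - y)) \<xi> = (1 / inversion_const TYPE('n)) * (wave (- x) \<xi> * fourier \<phi> \<xi>)" for \<xi>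
    proof -
      have "fourier (\<lambda>y. \<phi> (x - y)) (- \<xi>) = fourier (\<lambda>y. \<phi> (x + y)) \<xi>"
        using fourier_reflect[OF schwartz_borel[OF schwartz_translate[OF True, of x]], of "- \<xi>"] by simp
      also have "\<dots> = wave (- x) \<xi> * fourier \<phi> \<xi>"
        by (rule fourier_translate[OF schwartz_borel[OF True]])
      finally show ?thesis by (simp add: inv_fourier_def)
    qed
    then have "symbol_dist g (\<lambda>y. \<phi> (x - y))
      = (LINT \<xi>|lborel. (1 / inversion_const TYPE('n)) * (wave (- x) \<xi> * (g \<xi> * fourier \<phi> \<xi>)))"
      using schwartz_reflect_translate[OF True, of x] by (simp add: symbol_dist_def mult_ac)
    also have "\<dots> = (1 / inversion_const TYPE('n)) * (LINT \<xi>|lborel. wave (- x) \<xi> * (g \<xi> * fourier \<phi> \<xi>))"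
      by (rule integral_mult_right_zero)
    finally show ?thesis by (simp add: inv_fourier_def fourier_def)
  qed
  then show ?thesis using True by (simp add: conv_fun_def)
next
  case False
  then show ?thesis by (simp add: conv_fun_def symbol_dist_def schwartz_reflect_translate_iff)
qed

lemma conv_symbol_dist:
  fixes g h :: "real^'n::finite \<Rightarrow> complex"
  assumes "h \<in> O_M"
  shows "conv (symbol_dist g) (symbol_dist h) = symbol_dist (\<lambda>\<xi>. g \<xi> * h \<xi>)"
proof
  fix \<phi> :: "real^'n \<Rightarrow> complex"
  show "conv (symbol_dist g) (symbol_dist h) \<phi> = symbol_dist (\<lambda>\<xi>. g \<xi> * h \<xi>) \<phi>"
  proof (cases "\<phi> \<in> schwartz")
    case True
    have "symbol_dist h (\<lambda>y. \<phi> (x + y)) = fourier (\<lambda>\<xi>. h \<xi> * inv_fourier \<phi> \<xi>) x" for x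
    proof -
      have "inv_fourier (\<lambda>y. \<phi> (x + y)) \<xi> = wave x \<xi> * inv_fourier \<phi> \<xi>" for \<xi>
        by (simp add: inv_fourier_def fourier_translate[OF schwartz_borel[OF True]])
      then show ?thesis using schwartz_translate[OF True, of x] by (simp add: symbol_dist_def fourier_def mult_ac)
    qed
    moreover have "(\<lambda>\<xi>. h \<xi> * inv_fourier \<phi> \<xi>) \<in> schwartz" by (intro schwartz_mult assms inv_fourier_schwartz True)
    ultimately show ?thesis using True
      by (simp add: conv_def symbol_dist_def[of g] symbol_dist_def[of "\<lambda>\<xi>. g \<xi> * h \<xi>"] fourier_schwartz inv_fourier_fourier mult_ac)
  qed (simp add: conv_def symbol_dist_def)
qed

section \<open>Rapidly decreasing distributions have symbols in the multiplier space\<close>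

text \<open>The analogue of \<open>O_M\<close> with differentiability of finite order. A representation of a distribution by
  functions with a fixed rate of decay gives its symbol only finitely many derivatives.\<close>

fun symbol_class :: "nat \<Rightarrow> (real^'n::finite \<Rightarrow> complex) \<Rightarrow> bool" where
  "symbol_class 0 g \<longleftrightarrow> (\<forall>x. g differentiable (at x)) \<and> (\<exists>N B. \<forall>x. norm (g x) \<le> B * (1 + norm x) ^ N)"
| "symbol_class (Suc L) g \<longleftrightarrow> symbol_class 0 g \<and> (\<forall>i. symbol_class L (partial i g))"

lemma symbol_class_0: "symbol_class L g \<Longrightarrow> symbol_class 0 g"
  by (cases L) auto

lemma symbol_class_Suc: "symbol_class (Suc L) g \<Longrightarrow> symbol_class L g"
  by (induction L arbitrary: g) auto

lemma symbol_class_add: "symbol_class L f \<Longrightarrow> symbol_class L g \<Longrightarrow> symbol_class L (\<lambda>x. f x + g x)"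
proof (induction L arbitrary: f g)
  case 0
  then obtain N B M C where "\<forall>x. norm (f x) \<le> B * (1 + norm x) ^ N" "\<forall>x. norm (g x) \<le> C * (1 + norm x) ^ M"
    by auto
  moreover have "B * (1 + norm x) ^ N \<le> \<bar>B\<bar> * (1 + norm x) ^ (N + M)" "C * (1 + norm x) ^ M \<le> \<bar>C\<bar> * (1 + norm x) ^ (N + M)" for x :: "real^'a"
    by (intro mult_mono one_plus_norm_power_mono; simp)+
  ultimately have "norm (f x + g x) \<le> (\<bar>B\<bar> + \<bar>C\<bar>) * (1 + norm x) ^ (N + M)" for x
    unfolding distrib_right by (meson add_mono norm_triangle_ineq order_trans)
  then have "\<exists>N B. \<forall>x. norm (f x + g x) \<le> B * (1 + norm x) ^ N" by blast
  then show ?case using 0 by (auto intro!: derivative_intros)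
next
  case (Suc L)
  have d: "\<And>x. f differentiable (at x)" "\<And>x. g differentiable (at x)" using Suc.prems by auto
  have "symbol_class L f" "symbol_class L g" using Suc.prems symbol_class_Suc by blast+
  then have "symbol_class 0 (\<lambda>x. f x + g x)" using Suc.IH symbol_class_0 by blast
  moreover have "symbol_class L (partial i (\<lambda>x. f x + g x))" for i
    unfolding partial_add[OF d] using Suc by auto
  ultimately show ?case by simp
qed

lemma symbol_class_mult: "symbol_class L f \<Longrightarrow> symbol_class L g \<Longrightarrow> symbol_class L (\<lambda>x. f x * g x)"
proof (induction L arbitrary: f g)
  case 0
  then obtain N B M C where "\<forall>x. norm (f x) \<le> B * (1 + norm x) ^ N" "\<forall>x. norm (g x) \<le> C * (1 + norm x) ^ M"
    by auto
  then have "norm (f x * g x) \<le> (B * (1 + norm x) ^ N) * (C * (1 + norm x) ^ M)" for x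
    unfolding norm_mult by (meson mult_mono norm_ge_zero order_trans)
  then have "norm (f x * g x) \<le> (B * C) * (1 + norm x) ^ (N + M)" for x
    by (simp add: power_add mult_ac)
  then have "\<exists>N B. \<forall>x. norm (f x * g x) \<le> B * (1 + norm x) ^ N" by blast
  then show ?case using 0 by (auto intro!: derivative_intros)
next
  case (Suc L)
  have d: "\<And>x. f differentiable (at x)" "\<And>x. g differentiable (at x)" using Suc.prems by auto
  have "symbol_class L f" "symbol_class L g" using Suc.prems symbol_class_Suc by blast+
  then have "symbol_class 0 (\<lambda>x. f x * g x)" using Suc.IH symbol_class_0 by blast
  moreover have "symbol_class L (partial i (\<lambda>x. f x * g x))" for i
    unfolding partial_mult[OF d] using Suc \<open>symbol_class L f\<close> \<open>symbol_class L g\<close> by (intro symbol_class_add Suc.IH) auto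
  ultimately show ?case by simp
qed

lemma O_M_symbol_class: "g \<in> O_M \<Longrightarrow> symbol_class L g"
  by (induction L arbitrary: g) (auto simp: smooth_differentiable O_M_smooth O_M_growth O_M_partial)

lemma symbol_class_sum: "finite I \<Longrightarrow> (\<And>i. i \<in> I \<Longrightarrow> symbol_class L (f i)) \<Longrightarrow> symbol_class L (\<lambda>x. \<Sum>i\<in>I. f i x)"
  by (induction I rule: finite_induct) (auto intro: symbol_class_add O_M_symbol_class)

lemma symbol_class_O_M:
  assumes "\<And>L. symbol_class L g" shows "g \<in> O_M"
proof (rule O_M_coinduct[where X = "{g. \<forall>L. symbol_class L g}"])
  fix g :: "real^'a \<Rightarrow> complex" and i assume "g \<in> {g. \<forall>L. symbol_class L g}"
  then have "symbol_class L (partial i g)" for L using symbol_class.simps(2) by blast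
  then show "partial i g \<in> {g. \<forall>L. symbol_class L g}" by blast
next
  fix g :: "real^'a \<Rightarrow> complex" assume "g \<in> {g. \<forall>L. symbol_class L g}"
  then have "symbol_class 0 g" by blast
  then show "\<exists>N B. \<forall>x. norm (g x) \<le> B * (1 + norm x) ^ N" by simp
next
  fix g :: "real^'a \<Rightarrow> complex" and x assume "g \<in> {g. \<forall>L. symbol_class L g}"
  then have "symbol_class 0 g" by blast
  then show "g differentiable (at x)" by simp
qed (use assms in auto)

lemma symbol_class_fourier:
  fixes h :: "real^'n::finite \<Rightarrow> complex"
  assumes "h \<in> borel_measurable borel" "decays (decay_exp TYPE('n) + 2 + L) B h"
  shows "symbol_class L (fourier h)"
  using assms
proof (induction L arbitrary: h)
  case 0
  have "norm (fourier h x) \<le> (weight_integral TYPE('n) * B) * (1 + norm x) ^ 0" for x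
    using fourier_bound[OF 0] by simp
  then show ?case using fourier_differentiable[OF 0(1), of B] 0(2) unfolding symbol_class.simps add_0_right by blast
next
  case (Suc L)
  have d: "decays (decay_exp TYPE('n) + 2) B h" "decays (decay_exp TYPE('n)) B h"
    "decays (Suc (decay_exp TYPE('n) + 2 + L)) B h" using Suc.prems(2) by (auto elim: decays_mono)
  have "norm (fourier h x) \<le> (weight_integral TYPE('n) * B) * (1 + norm x) ^ 0" for x
    using fourier_bound[OF Suc.prems(1) d(2)] by simp
  then have "symbol_class 0 (fourier h)"
    using fourier_differentiable[OF Suc.prems(1) d(1)] unfolding symbol_class.simps by blast
  moreover have "symbol_class L (partial i (fourier h))" for i
    unfolding partial_fourier[OF Suc.prems(1) d(1)]
    by (rule Suc.IH[OF _ decays_coord[OF d(3)]])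
       (intro borel_measurable_times Suc.prems borel_smooth smooth_coord borel_measurable_const)
  ultimately show ?case by simp
qed

lemma dist_partials_regular:
  assumes "\<phi> \<in> schwartz"
  shows "dist_partials js (regular_dist f) \<phi> = (- 1) ^ length js * (LINT x|lborel. f x * partials (rev js) \<phi> x)"
  using assms
proof (induction js arbitrary: \<phi>)
  case Nil
  then show ?case by (simp add: dist_partials_def regular_dist_def)
next
  case (Cons i js)
  have "dist_partials (i # js) (regular_dist f) \<phi> = - dist_partials js (regular_dist f) (partial i \<phi>)"
    using Cons.prems by (simp add: dist_partials_def dist_partial_def)
  then show ?case using Cons.IH[OF schwartz_partial[OF Cons.prems]] by (simp add: partials_append)
qed

lemma continuous_bigo_decays:
  fixes f :: "real^'n::finite \<Rightarrow> complex"
  assumes "continuous_on UNIV f" "(\<lambda>x. norm (f x)) \<in> O[at_infinity](\<lambda>x. 1 / norm x ^ k)"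
  shows "\<exists>B. decays k B f"
proof -
  obtain c where c: "\<forall>\<^sub>F x in at_infinity. norm (norm (f x)) \<le> c * norm (1 / norm x ^ k)"
    using landau_o.bigE[OF assms(2)] by blast
  then obtain R where R: "\<And>x. R \<le> norm x \<Longrightarrow> norm (f x) \<le> c * (1 / norm x ^ k)"
    unfolding eventually_at_infinity by auto
  define R' where "R' = max 1 R"
  have "compact (cball 0 R' :: (real^'n) set)" by simp
  then have "bounded ((\<lambda>x. (1 + norm x) ^ k * norm (f x)) ` cball 0 R')"
    by (intro compact_imp_bounded compact_continuous_image) (auto intro!: continuous_intros continuous_on_subset[OF assms(1)])
  then obtain D where D: "\<And>x. norm x \<le> R' \<Longrightarrow> (1 + norm x) ^ k * norm (f x) \<le> D"
    unfolding bounded_iff by (fastforce simp: norm_mult)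
  have "(1 + norm x) ^ k * norm (f x) \<le> max D (\<bar>c\<bar> * 2 ^ k)" for x
  proof (cases "norm x \<le> R'")
    case True
    then show ?thesis using D[of x] by simp
  next
    case False
    then have x: "1 \<le> norm x" "R \<le> norm x" by (auto simp: R'_def)
    have "(1 + norm x) ^ k * norm (f x) \<le> (2 * norm x) ^ k * (\<bar>c\<bar> * (1 / norm x ^ k))"
    proof (rule mult_mono)
      show "(1 + norm x) ^ k \<le> (2 * norm x) ^ k" using x by (intro power_mono) auto
      have "c * (1 / norm x ^ k) \<le> \<bar>c\<bar> * (1 / norm x ^ k)" by (intro mult_right_mono) auto
      then show "norm (f x) \<le> \<bar>c\<bar> * (1 / norm x ^ k)" using R[OF x(2)] by linarith
    qed auto
    also have "\<dots> = \<bar>c\<bar> * 2 ^ k" using x(1) by (auto simp: power_mult_distrib)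
    finally show ?thesis by simp
  qed
  then show ?thesis unfolding decays_def by blast
qed

lemma fourier_partials_monomial:
  fixes \<phi> :: "real^'n::finite \<Rightarrow> complex"
  assumes "\<phi> \<in> schwartz"
  shows "partials js (fourier \<phi>) = fourier (\<lambda>x. monomial js x * \<phi> x)"
  by (rule partials_fourier[OF schwartz_borel[OF assms] schwartz_decays[OF assms]])

text \<open>A representation \<open>T = \<Sum> \<partial>\<^sup>\<alpha> f\<^sub>\<alpha>\<close> with decay of order \<open>k\<close> gives \<open>\<F> T = \<Sum> (i\<xi>)\<^sup>\<alpha> \<F> f\<^sub>\<alpha>\<close>, and the regularity of this
  function increases with \<open>k\<close>. By uniqueness of the density all these functions coincide, so that the
  common symbol has derivatives of every order.\<close>

theorem O_C'_symbol:
  fixes T :: "'n::finite functional"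
  assumes T: "T \<in> O_C'"
  obtains g where "g \<in> O_M" "T = symbol_dist g"
proof -
  have finite_reg: "\<exists>g. symbol_class L g \<and> fourier_dist T = regular_dist g" for L
  proof -
    \<comment> \<open>decay that makes the Fourier transform of the densities differentiable to order \<open>L + 1\<close>\<close>
    let ?k = "decay_exp TYPE('n) + 2 + L"
    obtain m f where f: "\<And>js. length js \<le> m \<Longrightarrow> continuous_on UNIV (f js)"
        "\<And>js. length js \<le> m \<Longrightarrow> (\<lambda>x. norm (f js x)) \<in> O[at_infinity](\<lambda>x. 1 / norm x ^ ?k)"
      and Tf: "T = (\<lambda>\<phi>. \<Sum>js | length js \<le> m. dist_partials js (regular_dist (f js)) \<phi>)"
      using T unfolding O_C'_def by blast
    have mf: "f js \<in> borel_measurable borel" if "length js \<le> m" for js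
      using f(1)[OF that] by (rule borel_measurable_continuous_onI)
    have df: "\<exists>B. decays ?k B (f js)" if "length js \<le> m" for js
      by (rule continuous_bigo_decays[OF f[OF that]])
    \<comment> \<open>the lists are reversed because \<open>dist_partials\<close> moves the outermost derivative first\<close>
    define g where "g = (\<lambda>\<xi>. \<Sum>js | length js \<le> m. ((- 1) ^ length js * monomial (rev js) \<xi>) * fourier (f js) \<xi>)"
    have "symbol_class L g"
      unfolding g_def
    proof (intro symbol_class_sum symbol_class_mult O_M_symbol_class[OF O_M_cmult[OF O_M_monomial]] finite_short_lists)
      fix js :: "'n list" assume js: "js \<in> {js. length js \<le> m}"
      then obtain B where "decays ?k B (f js)" using df by auto
      then show "symbol_class L (fourier (f js))" using js mf by (intro symbol_class_fourier) auto
    qed (auto intro: O_M_symbol_class O_M_monomial)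
    moreover have "fourier_dist T \<phi> = regular_dist g \<phi>" for \<phi>
    proof (cases "\<phi> \<in> schwartz")
      case True
      have termwise: "dist_partials js (regular_dist (f js)) (fourier \<phi>)
        = (LINT \<xi>|lborel. (((- 1) ^ length js * monomial (rev js) \<xi>) * fourier (f js) \<xi>) * \<phi> \<xi>)"
        and int: "integrable lborel (\<lambda>\<xi>. (((- 1) ^ length js * monomial (rev js) \<xi>) * fourier (f js) \<xi>) * \<phi> \<xi>)"
        if js: "length js \<le> m" for js
      proof -
        obtain B where B: "decays ?k B (f js)" using df[OF js] by blast
        let ?m = "\<lambda>x. monomial (rev js) x * \<phi> x"
        have ms: "?m \<in> schwartz" by (intro schwartz_mult O_M_monomial True)
        have fi: "integrable lborel (f js)" by (rule integrable_decays(1)[OF mf[OF js] B]) simp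
        have "dist_partials js (regular_dist (f js)) (fourier \<phi>) = (- 1) ^ length js * (LINT x|lborel. f js x * fourier ?m x)"
          unfolding dist_partials_regular[OF fourier_schwartz[OF True]] fourier_partials_monomial[OF True] ..
        also have "(LINT x|lborel. f js x * fourier ?m x) = (LINT \<xi>|lborel. fourier (f js) \<xi> * ?m \<xi>)"
          by (rule fourier_multiplication_formula[OF fi schwartz_integrable[OF ms]])
        also have "(- 1) ^ length js * \<dots> = (LINT \<xi>|lborel. (((- 1) ^ length js * monomial (rev js) \<xi>) * fourier (f js) \<xi>) * \<phi> \<xi>)"
          by (subst integral_mult_right_zero[symmetric]) (simp add: mult_ac)
        finally show "dist_partials js (regular_dist (f js)) (fourier \<phi>)
          = (LINT \<xi>|lborel. (((- 1) ^ length js * monomial (rev js) \<xi>) * fourier (f js) \<xi>) * \<phi> \<xi>)" .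
        have fb: "symbol_class 0 (fourier (f js))"
          by (rule symbol_class_fourier[OF mf[OF js], of _ B]) (rule decays_mono[OF B], simp)
        then have bf: "fourier (f js) \<in> borel_measurable borel"
          by (intro borel_measurable_continuous_onI continuous_at_imp_continuous_on ballI differentiable_imp_continuous_within) simp
        let ?c = "(- 1) ^ length js :: complex"
        have "integrable lborel (\<lambda>\<xi>. fourier (f js) \<xi> * (?c * ?m \<xi>))"
        proof (rule Bochner_Integration.integrable_bound)
          show "integrable lborel (\<lambda>\<xi>. of_real (weight_integral TYPE('n) * B) * (?c * ?m \<xi>))"
            by (intro integrable_mult_right schwartz_integrable ms)
          show "(\<lambda>\<xi>. fourier (f js) \<xi> * (?c * ?m \<xi>)) \<in> borel_measurable lborel"
            using borel_measurable_times[OF bf schwartz_borel[OF schwartz_cmult[OF ms]]] by simp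
          have "norm (fourier (f js) \<xi> * z) \<le> norm (of_real (weight_integral TYPE('n) * B) * z)" for \<xi> z
            using fourier_bound[OF mf[OF js] B, of \<xi>] unfolding norm_mult norm_of_real
            by (intro mult_right_mono) auto
          then show "AE \<xi> in lborel. norm (fourier (f js) \<xi> * (?c * ?m \<xi>)) \<le> norm (of_real (weight_integral TYPE('n) * B) * (?c * ?m \<xi>))"
            by blast
        qed
        then show "integrable lborel (\<lambda>\<xi>. (((- 1) ^ length js * monomial (rev js) \<xi>) * fourier (f js) \<xi>) * \<phi> \<xi>)"
          by (simp add: mult_ac)
      qed
      have "fourier_dist T \<phi> = (\<Sum>js | length js \<le> m. dist_partials js (regular_dist (f js)) (fourier \<phi>))"
        using True by (simp add: fourier_dist_def Tf)
      also have "\<dots> = (\<Sum>js | length js \<le> m. LINT \<xi>|lborel. (((- 1) ^ length js * monomial (rev js) \<xi>) * fourier (f js) \<xi>) * \<phi> \<xi>)"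
        by (rule sum.cong) (auto simp: termwise)
      also have "\<dots> = (LINT \<xi>|lborel. (\<Sum>js | length js \<le> m. (((- 1) ^ length js * monomial (rev js) \<xi>) * fourier (f js) \<xi>) * \<phi> \<xi>))"
        by (rule Bochner_Integration.integral_sum[symmetric]) (use int in auto)
      also have "\<dots> = regular_dist g \<phi>"
        using True unfolding regular_dist_def g_def sum_distrib_right by simp
      finally show ?thesis .
    qed (simp add: fourier_dist_def regular_dist_def)
    ultimately show ?thesis by blast
  qed
  then obtain g where g: "\<And>L. symbol_class L (g L)" "\<And>L. fourier_dist T = regular_dist (g L)" by metis
  \<comment> \<open>both are continuous densities of the same distribution\<close>
  have "g L = g 0" for L
  proof -
    have 0: "symbol_class 0 (g L)" "symbol_class 0 (g 0)" using g(1) symbol_class_0 by blast+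
    then obtain N B M C where "\<And>x. norm (g L x) \<le> B * (1 + norm x) ^ N" "\<And>x. norm (g 0 x) \<le> C * (1 + norm x) ^ M"
      by auto
    then show ?thesis using 0 g(2)
      by (intro regular_dist_inj[of "g L" _ _ "g 0"])
         (auto intro!: continuous_at_imp_continuous_on differentiable_imp_continuous_within)
  qed
  then have "symbol_class L (g 0)" for L using g(1)[of L] by metis
  then have "g 0 \<in> O_M" by (rule symbol_class_O_M)
  moreover have "T = symbol_dist (g 0)"
    by (rule symbol_dist_eqI[OF _ g(2)]) (use T in \<open>auto simp: O_C'_def tempered_def\<close>)
  ultimately show ?thesis by (rule that)
qed

section \<open>The topology of the Schwartz space\<close>

lemma schwartz_seminorm_triangle:
  assumes "\<phi> \<in> schwartz" "\<psi> \<in> schwartz" "\<eta> \<in> schwartz"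
  shows "schwartz_seminorm N js (\<lambda>x. \<phi> x - \<eta> x)
    \<le> schwartz_seminorm N js (\<lambda>x. \<phi> x - \<psi> x) + schwartz_seminorm N js (\<lambda>x. \<psi> x - \<eta> x)"
proof (rule schwartz_seminorm_le)
  fix x
  note d = schwartz_diff[OF assms(1,2)] schwartz_diff[OF assms(2,3)]
  have "(\<lambda>x. \<phi> x - \<eta> x) = (\<lambda>x. (\<phi> x - \<psi> x) + (\<psi> x - \<eta> x))" by simp
  then have "partials js (\<lambda>x. \<phi> x - \<eta> x) = (\<lambda>x. partials js (\<lambda>x. \<phi> x - \<psi> x) x + partials js (\<lambda>x. \<psi> x - \<eta> x) x)"
    using partials_add[OF schwartz_smooth[OF d(1)] schwartz_smooth[OF d(2)]] by metis
  then have "(1 + norm x) ^ N * norm (partials js (\<lambda>x. \<phi> x - \<eta> x) x)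
    \<le> (1 + norm x) ^ N * (norm (partials js (\<lambda>x. \<phi> x - \<psi> x) x) + norm (partials js (\<lambda>x. \<psi> x - \<eta> x) x))"
    by (simp add: norm_triangle_ineq)
  also have "\<dots> \<le> schwartz_seminorm N js (\<lambda>x. \<phi> x - \<psi> x) + schwartz_seminorm N js (\<lambda>x. \<psi> x - \<eta> x)"
    unfolding distrib_left by (intro add_mono schwartz_seminorm_ge d)
  finally show "(1 + norm x) ^ N * norm (partials js (\<lambda>x. \<phi> x - \<eta> x) x)
    \<le> schwartz_seminorm N js (\<lambda>x. \<phi> x - \<psi> x) + schwartz_seminorm N js (\<lambda>x. \<psi> x - \<eta> x)" .
qed

lemma schwartz_norm_triangle:
  assumes "\<phi> \<in> schwartz" "\<psi> \<in> schwartz" "\<eta> \<in> schwartz"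
  shows "schwartz_norm K (\<lambda>x. \<phi> x - \<eta> x)
    \<le> schwartz_norm K (\<lambda>x. \<phi> x - \<psi> x) + schwartz_norm K (\<lambda>x. \<psi> x - \<eta> x)"
  unfolding schwartz_norm_def sum.distrib[symmetric] by (intro sum_mono schwartz_seminorm_triangle assms)

lemma schwartz_norm_zero [simp]: "schwartz_norm K (\<lambda>x. 0) = 0"
  by (simp add: schwartz_norm_def schwartz_seminorm_def partials_const)

lemma schwartz_norm_cmult:
  assumes "\<phi> \<in> schwartz" shows "schwartz_norm K (\<lambda>x. c * \<phi> x) \<le> norm c * schwartz_norm K \<phi>"
  unfolding schwartz_norm_def sum_distrib_left
proof (intro sum_mono schwartz_seminorm_le)
  fix js :: "'a list" and x
  have "(1 + norm x) ^ K * norm (partials js (\<lambda>x. c * \<phi> x) x) = norm c * ((1 + norm x) ^ K * norm (partials js \<phi> x))"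
    by (simp add: partials_cmult schwartz_smooth assms norm_mult)
  also have "\<dots> \<le> norm c * schwartz_seminorm K js \<phi>" by (intro mult_left_mono schwartz_seminorm_ge assms) auto
  finally show "(1 + norm x) ^ K * norm (partials js (\<lambda>x. c * \<phi> x) x) \<le> norm c * schwartz_seminorm K js \<phi>" .
qed

lemma topspace_schwartz_topology [simp]: "topspace schwartz_topology = schwartz"
proof -
  have "\<phi> \<in> {g \<in> schwartz. schwartz_seminorm 0 [] (\<lambda>x. g x - \<phi> x) < 1}" if "\<phi> \<in> schwartz" for \<phi> :: "real^'a \<Rightarrow> complex"
    using that by (simp add: schwartz_seminorm_def)
  note mem = this
  show ?thesis
    unfolding schwartz_topology_def topology_generated_by_topspace
  proof (intro equalityI subsetI)
    fix \<phi> :: "real^'a \<Rightarrow> complex" assume \<phi>: "\<phi> \<in> schwartz"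
    show "\<phi> \<in> \<Union>{{g \<in> schwartz. schwartz_seminorm N js (\<lambda>x. g x - f x) < e} | f N js e. f \<in> schwartz \<and> 0 < e}"
      by (rule UnionI[OF _ mem[OF \<phi>]]) (use \<phi> zero_less_one in blast)
  qed blast
qed

text \<open>Balls of single norms form a neighbourhood base because the norms increase.\<close>

definition schwartz_ball :: "nat \<Rightarrow> (real^'n::finite \<Rightarrow> complex) \<Rightarrow> real \<Rightarrow> (real^'n \<Rightarrow> complex) set" where
  "schwartz_ball K \<phi> e = {\<psi> \<in> schwartz. schwartz_norm K (\<lambda>x. \<psi> x - \<phi> x) < e}"

lemma schwartz_ball_mono:
  assumes "\<phi> \<in> schwartz" "K \<le> L" "d \<le> e" shows "schwartz_ball L \<phi> d \<subseteq> schwartz_ball K \<phi> e"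
  unfolding schwartz_ball_def using schwartz_norm_mono[OF schwartz_diff[OF _ assms(1)] assms(2)] assms(3) by fastforce

lemma schwartz_ball_center: "\<phi> \<in> schwartz \<Longrightarrow> 0 < e \<Longrightarrow> \<phi> \<in> schwartz_ball K \<phi> e"
  by (simp add: schwartz_ball_def)

text \<open>Finite intersections of the generating seminorm balls contain a ball of one sufficiently large norm,
  which removes the intersections from all continuity arguments below.\<close>

lemma openin_schwartz_topology:
  "openin schwartz_topology U \<longleftrightarrow> U \<subseteq> schwartz \<and> (\<forall>\<phi>\<in>U. \<exists>K e. 0 < e \<and> schwartz_ball K \<phi> e \<subseteq> U)"
proof
  assume U: "openin schwartz_topology U"
  have sub: "U \<subseteq> schwartz" using openin_subset[OF U] by simp
  have "generate_topology_on {{g \<in> schwartz. schwartz_seminorm N js (\<lambda>x. g x - f x) < e} | f N js e. f \<in> schwartz \<and> 0 < e} U"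
    using U by (simp add: schwartz_topology_def openin_topology_generated_by_iff)
  then have "\<forall>\<phi>\<in>U. \<phi> \<in> schwartz \<longrightarrow> (\<exists>K e. 0 < e \<and> schwartz_ball K \<phi> e \<subseteq> U)"
  proof induction
    case (Int a b)
    show ?case
    proof (intro ballI impI)
      fix \<phi> assume \<phi>: "\<phi> \<in> a \<inter> b" "\<phi> \<in> schwartz"
      obtain K d where 1: "0 < d" "schwartz_ball K \<phi> d \<subseteq> a" using Int.IH(1) \<phi> by blast
      obtain L e where 2: "0 < e" "schwartz_ball L \<phi> e \<subseteq> b" using Int.IH(2) \<phi> by blast
      have "schwartz_ball (max K L) \<phi> (min d e) \<subseteq> a \<inter> b"
        using schwartz_ball_mono[OF \<phi>(2), of K "max K L" "min d e" d] schwartz_ball_mono[OF \<phi>(2), of L "max K L" "min d e" e] 1 2 by auto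
      then show "\<exists>K e. 0 < e \<and> schwartz_ball K \<phi> e \<subseteq> a \<inter> b" using 1 2 by (intro exI[of _ "max K L"] exI[of _ "min d e"]) auto
    qed
  next
    case (UN C)
    then show ?case by (meson Union_iff Union_upper order_trans)
  next
    case (Basis s)
    then obtain f N js e where f: "f \<in> schwartz" "0 < e" and s: "s = {g \<in> schwartz. schwartz_seminorm N js (\<lambda>x. g x - f x) < e}"
      by blast
    show ?case
    proof (intro ballI impI)
      fix \<phi> assume \<phi>: "\<phi> \<in> s" "\<phi> \<in> schwartz"
      define K where "K = max N (length js)"
      define d where "d = e - schwartz_seminorm N js (\<lambda>x. \<phi> x - f x)"
      have "0 < d" using \<phi> by (simp add: d_def s)
      moreover have "schwartz_ball K \<phi> d \<subseteq> s"
      proof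
        fix \<psi> assume \<psi>: "\<psi> \<in> schwartz_ball K \<phi> d"
        then have ps: "\<psi> \<in> schwartz" by (simp add: schwartz_ball_def)
        have "schwartz_seminorm N js (\<lambda>x. \<psi> x - f x) \<le> schwartz_seminorm N js (\<lambda>x. \<psi> x - \<phi> x) + schwartz_seminorm N js (\<lambda>x. \<phi> x - f x)"
          by (rule schwartz_seminorm_triangle[OF ps \<phi>(2) f(1)])
        also have "schwartz_seminorm N js (\<lambda>x. \<psi> x - \<phi> x) \<le> schwartz_norm K (\<lambda>x. \<psi> x - \<phi> x)"
          by (rule schwartz_seminorm_le_norm[OF schwartz_diff[OF ps \<phi>(2)]]) (auto simp: K_def)
        also have "\<dots> < d" using \<psi> by (simp add: schwartz_ball_def)
        finally show "\<psi> \<in> s" using ps by (simp add: s d_def)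
      qed
      ultimately show "\<exists>K e. 0 < e \<and> schwartz_ball K \<phi> e \<subseteq> s" by blast
    qed
  qed auto
  then show "U \<subseteq> schwartz \<and> (\<forall>\<phi>\<in>U. \<exists>K e. 0 < e \<and> schwartz_ball K \<phi> e \<subseteq> U)" using sub by blast
next
  assume R: "U \<subseteq> schwartz \<and> (\<forall>\<phi>\<in>U. \<exists>K e. 0 < e \<and> schwartz_ball K \<phi> e \<subseteq> U)"
  show "openin schwartz_topology U"
  proof (subst openin_subopen, intro ballI)
    fix \<phi> assume "\<phi> \<in> U"
    then obtain K e where K: "0 < e" "schwartz_ball K \<phi> e \<subseteq> U" and \<phi>: "\<phi> \<in> schwartz" using R by blast
    define J where "J = {js :: 'a list. length js \<le> K}"
    \<comment> \<open>the norm is a sum over the elements of \<open>J\<close>\<close>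
    define d where "d = e / (card J + 1)"
    have d: "0 < d" using K by (simp add: d_def)
    let ?B = "\<lambda>js. {g \<in> schwartz. schwartz_seminorm K js (\<lambda>x. g x - \<phi> x) < d}"
    have "openin schwartz_topology (\<Inter>js\<in>J. ?B js)"
    proof (rule openin_INT2)
      show "finite J" by (simp add: J_def)
      show "J \<noteq> {}" by (auto simp: J_def intro: exI[of _ "[]"])
      fix js
      show "openin schwartz_topology (?B js)"
        unfolding schwartz_topology_def openin_topology_generated_by_iff
        by (rule generate_topology_on.Basis) (use \<phi> d in blast)
    qed
    moreover have "\<phi> \<in> (\<Inter>js\<in>J. ?B js)" using \<phi> d by (simp add: schwartz_seminorm_def partials_const)
    moreover have "(\<Inter>js\<in>J. ?B js) \<subseteq> schwartz_ball K \<phi> e"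
    proof
      fix \<psi> assume \<psi>: "\<psi> \<in> (\<Inter>js\<in>J. ?B js)"
      have "[] \<in> J" by (simp add: J_def)
      then have ps: "\<psi> \<in> schwartz" using \<psi> by blast
      have "schwartz_norm K (\<lambda>x. \<psi> x - \<phi> x) \<le> (\<Sum>js\<in>J. d)"
        unfolding schwartz_norm_def J_def[symmetric] using \<psi> by (intro sum_mono) fastforce
      also have "\<dots> < e" using K by (simp add: d_def field_simps)
      finally show "\<psi> \<in> schwartz_ball K \<phi> e" using ps by (simp add: schwartz_ball_def)
    qed
    ultimately show "\<exists>T. openin schwartz_topology T \<and> \<phi> \<in> T \<and> T \<subseteq> U" using K by blast
  qed
qed

lemma openin_schwartz_ball:
  assumes \<phi>: "\<phi> \<in> schwartz" shows "openin schwartz_topology (schwartz_ball K \<phi> e)"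
  unfolding openin_schwartz_topology
proof (intro conjI ballI)
  show "schwartz_ball K \<phi> e \<subseteq> schwartz" by (auto simp: schwartz_ball_def)
  fix \<psi> assume \<psi>: "\<psi> \<in> schwartz_ball K \<phi> e"
  then have ps: "\<psi> \<in> schwartz" by (simp add: schwartz_ball_def)
  have "schwartz_ball K \<psi> (e - schwartz_norm K (\<lambda>x. \<psi> x - \<phi> x)) \<subseteq> schwartz_ball K \<phi> e"
    unfolding schwartz_ball_def using schwartz_norm_triangle[OF _ ps \<phi>, of _ K] by fastforce
  then show "\<exists>L d. 0 < d \<and> schwartz_ball L \<psi> d \<subseteq> schwartz_ball K \<phi> e"
    using \<psi> by (intro exI[of _ K] exI[of _ "e - schwartz_norm K (\<lambda>x. \<psi> x - \<phi> x)"]) (auto simp: schwartz_ball_def)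
qed

lemma continuous_map_schwartz_functional:
  fixes T :: "'n::finite functional"
  assumes "0 \<le> C" and T: "\<And>\<phi> \<psi>. \<phi> \<in> schwartz \<Longrightarrow> \<psi> \<in> schwartz \<Longrightarrow> norm (T \<psi> - T \<phi>) \<le> C * schwartz_norm K (\<lambda>x. \<psi> x - \<phi> x)"
  shows "continuous_map schwartz_topology euclidean T"
  unfolding continuous_map_def
proof (intro conjI allI impI)
  fix U :: "complex set" assume "openin euclidean U"
  then have U: "open U" by simp
  show "openin schwartz_topology {\<phi> \<in> topspace schwartz_topology. T \<phi> \<in> U}"
    unfolding openin_schwartz_topology
  proof (intro conjI ballI)
    fix \<phi> assume "\<phi> \<in> {\<phi> \<in> topspace schwartz_topology. T \<phi> \<in> U}"
    then have \<phi>: "\<phi> \<in> schwartz" "T \<phi> \<in> U" by auto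
    then obtain e where e: "0 < e" "ball (T \<phi>) e \<subseteq> U" using U openE by blast
    have "schwartz_ball K \<phi> (e / (C + 1)) \<subseteq> {\<phi> \<in> topspace schwartz_topology. T \<phi> \<in> U}"
    proof
      fix \<psi> assume \<psi>: "\<psi> \<in> schwartz_ball K \<phi> (e / (C + 1))"
      then have ps: "\<psi> \<in> schwartz" and lt: "schwartz_norm K (\<lambda>x. \<psi> x - \<phi> x) < e / (C + 1)" by (auto simp: schwartz_ball_def)
      have "norm (T \<psi> - T \<phi>) \<le> C * schwartz_norm K (\<lambda>x. \<psi> x - \<phi> x)" by (rule T[OF \<phi>(1) ps])
      also have "\<dots> \<le> (C + 1) * schwartz_norm K (\<lambda>x. \<psi> x - \<phi> x)"
        by (intro mult_right_mono schwartz_norm_nonneg schwartz_diff ps \<phi>) auto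
      also have "\<dots> < e" using lt assms(1) by (simp add: pos_less_divide_eq mult.commute)
      finally have "T \<psi> \<in> ball (T \<phi>) e" by (simp add: dist_norm norm_minus_commute)
      then show "\<psi> \<in> {\<phi> \<in> topspace schwartz_topology. T \<phi> \<in> U}" using e ps by auto
    qed
    moreover have "0 < e / (C + 1)" using e assms(1) by simp
    ultimately show "\<exists>K e. 0 < e \<and> schwartz_ball K \<phi> e \<subseteq> {\<phi> \<in> topspace schwartz_topology. T \<phi> \<in> U}" by blast
  qed auto
qed auto

lemma continuous_map_schwartz_operator:
  fixes A :: "(real^'n::finite \<Rightarrow> complex) \<Rightarrow> (real^'n \<Rightarrow> complex)"
  assumes A: "\<And>\<phi>. \<phi> \<in> schwartz \<Longrightarrow> A \<phi> \<in> schwartz"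
    and bound: "\<And>K. \<exists>C M. 0 \<le> C \<and> (\<forall>\<phi>\<in>schwartz. \<forall>\<psi>\<in>schwartz. schwartz_norm K (\<lambda>x. A \<psi> x - A \<phi> x) \<le> C * schwartz_norm M (\<lambda>x. \<psi> x - \<phi> x))"
  shows "continuous_map schwartz_topology schwartz_topology A"
  unfolding continuous_map_def
proof (intro conjI allI impI)
  fix U :: "(real^'n \<Rightarrow> complex) set" assume U: "openin schwartz_topology U"
  show "openin schwartz_topology {\<phi> \<in> topspace schwartz_topology. A \<phi> \<in> U}"
    unfolding openin_schwartz_topology
  proof (intro conjI ballI)
    fix \<phi> assume "\<phi> \<in> {\<phi> \<in> topspace schwartz_topology. A \<phi> \<in> U}"
    then have \<phi>: "\<phi> \<in> schwartz" "A \<phi> \<in> U" by auto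
    then obtain K e where e: "0 < e" "schwartz_ball K (A \<phi>) e \<subseteq> U" using U unfolding openin_schwartz_topology by blast
    obtain C M where C: "0 \<le> C" and CM: "\<And>\<psi>. \<psi> \<in> schwartz \<Longrightarrow> schwartz_norm K (\<lambda>x. A \<psi> x - A \<phi> x) \<le> C * schwartz_norm M (\<lambda>x. \<psi> x - \<phi> x)"
      using bound \<phi>(1) by meson
    have "schwartz_ball M \<phi> (e / (C + 1)) \<subseteq> {\<phi> \<in> topspace schwartz_topology. A \<phi> \<in> U}"
    proof
      fix \<psi> assume \<psi>: "\<psi> \<in> schwartz_ball M \<phi> (e / (C + 1))"
      then have ps: "\<psi> \<in> schwartz" and lt: "schwartz_norm M (\<lambda>x. \<psi> x - \<phi> x) < e / (C + 1)" by (auto simp: schwartz_ball_def)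
      have "schwartz_norm K (\<lambda>x. A \<psi> x - A \<phi> x) \<le> C * schwartz_norm M (\<lambda>x. \<psi> x - \<phi> x)" by (rule CM[OF ps])
      also have "\<dots> \<le> (C + 1) * schwartz_norm M (\<lambda>x. \<psi> x - \<phi> x)"
        by (intro mult_right_mono schwartz_norm_nonneg schwartz_diff ps \<phi>) auto
      also have "\<dots> < e" using lt C by (simp add: pos_less_divide_eq mult.commute)
      finally have "A \<psi> \<in> schwartz_ball K (A \<phi>) e" using A[OF ps] by (simp add: schwartz_ball_def)
      then show "\<psi> \<in> {\<phi> \<in> topspace schwartz_topology. A \<phi> \<in> U}" using e ps by auto
    qed
    moreover have "0 < e / (C + 1)" using e C by simp
    ultimately show "\<exists>K e. 0 < e \<and> schwartz_ball K \<phi> e \<subseteq> {\<phi> \<in> topspace schwartz_topology. A \<phi> \<in> U}" by blast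
  qed auto
qed (use A in auto)

lemma compactin_finite_subcover:
  assumes S: "compactin X S" and V: "\<And>i. i \<in> I \<Longrightarrow> openin X (V i)" "S \<subseteq> (\<Union>i\<in>I. V i)"
  shows "\<exists>J\<subseteq>I. finite J \<and> S \<subseteq> (\<Union>i\<in>J. V i)"
proof -
  have "\<forall>\<U>. (\<forall>U\<in>\<U>. openin X U) \<and> S \<subseteq> \<Union>\<U> \<longrightarrow> (\<exists>\<F>. finite \<F> \<and> \<F> \<subseteq> \<U> \<and> S \<subseteq> \<Union>\<F>)"
    using S unfolding compactin_def by (rule conjunct2)
  then have "(\<forall>U\<in>V ` I. openin X U) \<and> S \<subseteq> \<Union>(V ` I) \<longrightarrow> (\<exists>\<F>. finite \<F> \<and> \<F> \<subseteq> V ` I \<and> S \<subseteq> \<Union>\<F>)"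
    by (rule spec)
  moreover have "(\<forall>U\<in>V ` I. openin X U) \<and> S \<subseteq> \<Union>(V ` I)" using V by simp
  ultimately obtain \<F> where \<F>: "finite \<F>" "\<F> \<subseteq> V ` I" "S \<subseteq> \<Union>\<F>" by blast
  from finite_subset_image[OF \<F>(1,2)] obtain J where "J \<subseteq> I" "finite J" "\<F> = V ` J" by blast
  then show ?thesis using \<F>(3) by blast
qed

text \<open>The balls of integer radius around the origin cover the compact set.\<close>

lemma compactin_schwartz_bounded:
  assumes K: "compactin schwartz_topology K"
  shows "\<exists>B. 0 \<le> B \<and> (\<forall>\<phi>\<in>K. schwartz_norm N \<phi> \<le> B)"
proof -
  let ?U = "\<lambda>j :: nat. schwartz_ball N (\<lambda>x :: real^'a. 0) (real j)"
  have "K \<subseteq> (\<Union>j\<in>UNIV. ?U j)"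
  proof
    fix \<phi> assume "\<phi> \<in> K"
    then have \<phi>: "\<phi> \<in> schwartz" using compactin_subset_topspace[OF K] by auto
    obtain j :: nat where "schwartz_norm N \<phi> < real j" using reals_Archimedean2 by blast
    then show "\<phi> \<in> (\<Union>j\<in>UNIV. ?U j)" using \<phi> by (auto simp: schwartz_ball_def)
  qed
  then have "\<exists>J\<subseteq>UNIV. finite J \<and> K \<subseteq> (\<Union>j\<in>J. ?U j)"
    by (intro compactin_finite_subcover[OF K] openin_schwartz_ball schwartz_zero)
  then obtain J where J: "finite J" "K \<subseteq> (\<Union>j\<in>J. ?U j)"
    by (elim exE conjE)
  have "schwartz_norm N \<phi> \<le> real (\<Sum>J)" if \<phi>: "\<phi> \<in> K" for \<phi>
  proof -
    obtain j where j: "j \<in> J" "\<phi> \<in> ?U j" using \<phi> J by blast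
    have "j \<le> \<Sum>J" using j J by (intro member_le_sum[of j J "\<lambda>j. j"]) auto
    then have "real j \<le> real (\<Sum>J)" by (simp only: of_nat_le_iff)
    then show ?thesis using j by (simp add: schwartz_ball_def)
  qed
  moreover have "0 \<le> real (\<Sum>J)" by (rule of_nat_0_le_iff)
  ultimately show ?thesis by blast
qed

text \<open>A Lebesgue number argument: finitely many balls of half the admissible radius cover the compact set, and
  the smallest half radius together with a common norm works at every point.\<close>

lemma compactin_schwartz_uniform:
  assumes K: "compactin schwartz_topology K" and U: "openin schwartz_topology U" "K \<subseteq> U"
  shows "\<exists>N e. 0 < e \<and> (\<forall>\<phi>\<in>K. schwartz_ball N \<phi> e \<subseteq> U)"
proof -
  have Ks: "\<phi> \<in> schwartz" if "\<phi> \<in> K" for \<phi> using compactin_subset_topspace[OF K] that by auto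
  have "\<forall>\<phi>\<in>K. \<exists>M e. 0 < e \<and> schwartz_ball M \<phi> e \<subseteq> U" using U unfolding openin_schwartz_topology by blast
  then obtain M e where M: "\<And>\<phi>. \<phi> \<in> K \<Longrightarrow> 0 < e \<phi> \<and> schwartz_ball (M \<phi>) \<phi> (e \<phi>) \<subseteq> U" by metis
  let ?U = "\<lambda>\<phi>. schwartz_ball (M \<phi>) \<phi> (e \<phi> / 2)"
  have "K \<subseteq> (\<Union>\<phi>\<in>K. ?U \<phi>)"
  proof
    fix \<phi> assume "\<phi> \<in> K"
    then show "\<phi> \<in> (\<Union>\<phi>\<in>K. ?U \<phi>)" using M Ks by (intro UN_I[of \<phi>] schwartz_ball_center) auto
  qed
  then have "\<exists>J\<subseteq>K. finite J \<and> K \<subseteq> (\<Union>\<phi>\<in>J. ?U \<phi>)"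
    by (intro compactin_finite_subcover[OF K] openin_schwartz_ball Ks)
  then obtain J where J: "finite J" "J \<subseteq> K" "K \<subseteq> (\<Union>\<phi>\<in>J. ?U \<phi>)"
    by (elim exE conjE)
  define N where "N = (\<Sum>\<phi>\<in>J. M \<phi>)"
  define d where "d = Min (insert 1 ((\<lambda>\<phi>. e \<phi> / 2) ` J))"
  have d: "0 < d" unfolding d_def using J M by (subst Min_gr_iff) auto
  have "schwartz_ball N \<phi> d \<subseteq> U" if \<phi>: "\<phi> \<in> K" for \<phi>
  proof
    fix \<psi> assume \<psi>: "\<psi> \<in> schwartz_ball N \<phi> d"
    then have ps: "\<psi> \<in> schwartz" by (simp add: schwartz_ball_def)
    obtain \<eta> where \<eta>: "\<eta> \<in> J" "\<phi> \<in> ?U \<eta>" using J \<phi> by blast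
    have cs: "\<eta> \<in> schwartz" using \<eta> J Ks by blast
    have MN: "M \<eta> \<le> N" unfolding N_def using \<eta> J by (intro member_le_sum) auto
    have de: "d \<le> e \<eta> / 2" unfolding d_def using \<eta> J by (intro Min_le) auto
    have "schwartz_norm (M \<eta>) (\<lambda>x. \<psi> x - \<eta> x) \<le> schwartz_norm (M \<eta>) (\<lambda>x. \<psi> x - \<phi> x) + schwartz_norm (M \<eta>) (\<lambda>x. \<phi> x - \<eta> x)"
      by (rule schwartz_norm_triangle[OF ps Ks[OF \<phi>] cs])
    also have "schwartz_norm (M \<eta>) (\<lambda>x. \<psi> x - \<phi> x) \<le> schwartz_norm N (\<lambda>x. \<psi> x - \<phi> x)"
      by (rule schwartz_norm_mono[OF schwartz_diff[OF ps Ks[OF \<phi>]] MN])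
    also have "\<dots> < e \<eta> / 2" using \<psi> de by (simp add: schwartz_ball_def)
    also have "schwartz_norm (M \<eta>) (\<lambda>x. \<phi> x - \<eta> x) < e \<eta> / 2" using \<eta> by (simp add: schwartz_ball_def)
    finally have "\<psi> \<in> schwartz_ball (M \<eta>) \<eta> (e \<eta>)" using ps by (simp add: schwartz_ball_def)
    then show "\<psi> \<in> U" using M J \<eta> by blast
  qed
  then show ?thesis using d by blast
qed

section \<open>The topology of operators\<close>

lemma topspace_operator_topology [simp]: "topspace operator_topology = schwartz_operators"
proof -
  have "schwartz_operators = {A \<in> schwartz_operators. A ` {} \<subseteq> ({} :: (real^'a \<Rightarrow> complex) set)}" by auto
  then have "(schwartz_operators :: ((real^'a \<Rightarrow> complex) \<Rightarrow> (real^'a \<Rightarrow> complex)) set) \<in> {{A \<in> schwartz_operators. A ` K \<subseteq> U} | K U.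
        compactin schwartz_topology K \<and> openin schwartz_topology U}" by blast
  then show ?thesis unfolding operator_topology_def topology_generated_by_topspace by blast
qed

text \<open>Smallness relative to a norm of the argument is uniform smallness on compact sets, since these are
  bounded; and the compact image of \<open>K\<close> has a uniform neighbourhood inside \<open>U\<close>.\<close>

lemma limitin_operator_topology:
  assumes A: "A \<in> schwartz_operators" "\<forall>\<^sub>F u in F. B u \<in> schwartz_operators"
    and conv: "\<And>N. \<exists>M. \<forall>e>0. \<forall>\<^sub>F u in F. \<forall>\<phi>\<in>schwartz. schwartz_norm N (\<lambda>x. B u \<phi> x - A \<phi> x) \<le> e * schwartz_norm M \<phi>"
  shows "limitin operator_topology B A F"
  unfolding limitin_def
proof (intro conjI allI impI)
  show "A \<in> topspace operator_topology" using A by simp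
  fix V assume V: "openin operator_topology V \<and> A \<in> V"
  then have "generate_topology_on {{A \<in> schwartz_operators. A ` K \<subseteq> U} | K U.
        compactin schwartz_topology K \<and> openin schwartz_topology U} V"
    by (simp add: operator_topology_def openin_topology_generated_by_iff)
  then have "A \<in> V \<longrightarrow> (\<forall>\<^sub>F u in F. B u \<in> V)"
  proof induction
    case (Int a b)
    then show ?case by (auto intro: eventually_conj)
  next
    case (UN C)
    show ?case
    proof
      assume "A \<in> \<Union>C"
      then obtain k where k: "k \<in> C" "A \<in> k" by blast
      then have "\<forall>\<^sub>F u in F. B u \<in> k" using UN.IH by blast
      then show "\<forall>\<^sub>F u in F. B u \<in> \<Union>C" by (rule eventually_mono) (use k in blast)
    qed
  next
    case (Basis s)
    then obtain K U where K: "compactin schwartz_topology K" "openin schwartz_topology U"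
      and s: "s = {A \<in> schwartz_operators. A ` K \<subseteq> U}" by blast
    show ?case
    proof
      assume "A \<in> s"
      then have AK: "A ` K \<subseteq> U" by (simp add: s)
      have Ac: "continuous_map schwartz_topology schwartz_topology A" using A by (simp add: schwartz_operators_def)
      obtain N e where e: "0 < e" "\<And>\<psi>. \<psi> \<in> A ` K \<Longrightarrow> schwartz_ball N \<psi> e \<subseteq> U"
        using compactin_schwartz_uniform[OF image_compactin[OF K(1) Ac] K(2) AK] by blast
      obtain M where M: "\<And>e. 0 < e \<Longrightarrow> \<forall>\<^sub>F u in F. \<forall>\<phi>\<in>schwartz. schwartz_norm N (\<lambda>x. B u \<phi> x - A \<phi> x) \<le> e * schwartz_norm M \<phi>"
        using conv by blast
      obtain D where D: "0 \<le> D" "\<And>\<phi>. \<phi> \<in> K \<Longrightarrow> schwartz_norm M \<phi> \<le> D" using compactin_schwartz_bounded[OF K(1)] by blast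
      have "0 < e / (D + 1)" using e D by simp
      from M[OF this] A(2) show "\<forall>\<^sub>F u in F. B u \<in> s"
      proof eventually_elim
        case (elim u)
        have "B u \<phi> \<in> U" if \<phi>: "\<phi> \<in> K" for \<phi>
        proof -
          have ps: "\<phi> \<in> schwartz" using compactin_subset_topspace[OF K(1)] \<phi> by auto
          have "schwartz_norm N (\<lambda>x. B u \<phi> x - A \<phi> x) \<le> (e / (D + 1)) * schwartz_norm M \<phi>" using elim ps by blast
          also have "\<dots> \<le> (e / (D + 1)) * D" using e D \<phi> by (intro mult_left_mono D) auto
          also have "\<dots> < e" using e D by (simp add: field_simps)
          finally have "schwartz_norm N (\<lambda>x. B u \<phi> x - A \<phi> x) < e" .
          moreover have "B u \<phi> \<in> schwartz"
            using elim ps continuous_map_image_subset_topspace[of schwartz_topology schwartz_topology "B u"] unfolding schwartz_operators_def by auto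
          ultimately have "B u \<phi> \<in> schwartz_ball N (A \<phi>) e" by (simp add: schwartz_ball_def)
          then show ?thesis using e(2) \<phi> by blast
        qed
        then show ?case using elim by (auto simp: s)
      qed
    qed
  qed auto
  then show "\<forall>\<^sub>F u in F. B u \<in> V" using V by blast
qed

text \<open>One-point sets are compact.\<close>

lemma limitin_operator_topology_pointwise:
  assumes L: "limitin operator_topology B A F" and \<phi>: "\<phi> \<in> schwartz" and e: "0 < e"
  shows "\<forall>\<^sub>F u in F. B u \<phi> \<in> schwartz_ball N (A \<phi>) e"
proof -
  have A: "A \<in> schwartz_operators" using L by (simp add: limitin_def)
  then have As: "A \<phi> \<in> schwartz"
    using \<phi> continuous_map_image_subset_topspace[of schwartz_topology schwartz_topology A] unfolding schwartz_operators_def by auto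
  let ?V = "{A \<in> schwartz_operators. A ` {\<phi>} \<subseteq> schwartz_ball N (A \<phi>) e}"
  let ?W = "{B \<in> schwartz_operators. B ` {\<phi>} \<subseteq> schwartz_ball N (A \<phi>) e}"
  have "compactin schwartz_topology {\<phi>}" using \<phi> by simp
  then have "openin operator_topology ?W"
    unfolding operator_topology_def openin_topology_generated_by_iff
    by (intro generate_topology_on.Basis) (use openin_schwartz_ball[OF As] in blast)
  moreover have "A \<in> ?W" using A schwartz_ball_center[OF As e] by simp
  ultimately have "\<forall>\<^sub>F u in F. B u \<in> ?W" using L unfolding limitin_def by blast
  then show ?thesis by (rule eventually_mono) simp
qed

section \<open>Continuity of convolution operators in the symbol\<close>

lemma schwartz_norm_reflect:
  fixes \<phi> :: "real^'n::finite \<Rightarrow> complex"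
  assumes "\<phi> \<in> schwartz" shows "schwartz_norm K (\<lambda>x. \<phi> (- x)) \<le> schwartz_norm K \<phi>"
  unfolding schwartz_norm_def
proof (intro sum_mono schwartz_seminorm_le)
  fix js :: "'n list" and x
  have "(1 + norm x) ^ K * norm (partials js (\<lambda>x. \<phi> (- x)) x) = (1 + norm (- x)) ^ K * norm (partials js \<phi> (- x))"
    using partials_affine[OF schwartz_smooth[OF assms], of js 0 "-1"] by (simp add: norm_mult norm_power)
  also have "\<dots> \<le> schwartz_seminorm K js \<phi>" by (rule schwartz_seminorm_ge[OF assms])
  finally show "(1 + norm x) ^ K * norm (partials js (\<lambda>x. \<phi> (- x)) x) \<le> schwartz_seminorm K js \<phi>" .
qed

lemma inv_fourier_schwartz_norm:
  fixes K :: nat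
  shows "\<exists>C M. 0 \<le> C \<and> (\<forall>\<phi> :: real^'n::finite \<Rightarrow> complex. \<phi> \<in> schwartz \<longrightarrow> schwartz_norm K (inv_fourier \<phi>) \<le> C * schwartz_norm M \<phi>)"
proof -
  obtain C M where C: "0 \<le> C" "\<And>\<phi> :: real^'n \<Rightarrow> complex. \<phi> \<in> schwartz \<Longrightarrow> schwartz_norm K (fourier \<phi>) \<le> C * schwartz_norm M \<phi>"
    using fourier_schwartz_norm[of K] by blast
  let ?c = "norm (1 / inversion_const TYPE('n))"
  have "schwartz_norm K (inv_fourier \<phi>) \<le> (?c * C) * schwartz_norm M \<phi>" if \<phi>: "\<phi> \<in> schwartz" for \<phi> :: "real^'n \<Rightarrow> complex"
  proof -
    note F = fourier_schwartz[OF \<phi>]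
    have "schwartz_norm K (inv_fourier \<phi>) \<le> ?c * schwartz_norm K (\<lambda>x. fourier \<phi> (- x))"
      unfolding inv_fourier_def[abs_def] by (rule schwartz_norm_cmult[OF schwartz_reflect[OF F]])
    also have "\<dots> \<le> ?c * (C * schwartz_norm M \<phi>)"
      by (intro mult_left_mono order_trans[OF schwartz_norm_reflect[OF F] C(2)[OF \<phi>]]) auto
    finally show ?thesis by simp
  qed
  moreover have "0 \<le> ?c * C" using C by simp
  ultimately show ?thesis by blast
qed

text \<open>The order \<open>J\<close> of the required derivatives of the symbol depends only on \<open>K\<close>, while its polynomial growth
  is absorbed by the norm of the argument. The bound is linear in \<open>B\<close>, so that small symbols give small
  operators.\<close>

lemma symbol_operator_bound:
  fixes K :: nat
  shows "\<exists>J. \<forall>N. \<exists>C M. 0 \<le> C \<and> (\<forall>g (\<phi> :: real^'n::finite \<Rightarrow> complex) B. g \<in> O_M \<longrightarrow> \<phi> \<in> schwartz \<longrightarrow>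
    (\<forall>x. jet_norm J g x \<le> B * (1 + norm x) ^ N) \<longrightarrow>
    schwartz_norm K (inv_fourier (\<lambda>\<xi>. g \<xi> * fourier \<phi> \<xi>)) \<le> C * B * schwartz_norm M \<phi>)"
proof -
  obtain C1 J where C1: "0 \<le> C1" "\<And>\<phi> :: real^'n \<Rightarrow> complex. \<phi> \<in> schwartz \<Longrightarrow> schwartz_norm K (inv_fourier \<phi>) \<le> C1 * schwartz_norm J \<phi>"
    using inv_fourier_schwartz_norm[of K] by blast
  show ?thesis
  proof (intro exI[of _ J] allI)
    fix N
    obtain C2 M where C2: "0 \<le> C2" "\<And>\<phi> :: real^'n \<Rightarrow> complex. \<phi> \<in> schwartz \<Longrightarrow> schwartz_norm (J + N) (fourier \<phi>) \<le> C2 * schwartz_norm M \<phi>"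
      using fourier_schwartz_norm[of "J + N"] by blast
    define L where "L = list_count TYPE('n) J * 2 ^ J"
    have L: "0 \<le> L" by (simp add: L_def)
    define C where "C = C1 * (list_count TYPE('n) J * (L * C2))"
    have "0 \<le> C" using C1 C2 L by (simp add: C_def)
    moreover have "schwartz_norm K (inv_fourier (\<lambda>\<xi>. g \<xi> * fourier \<phi> \<xi>)) \<le> C * B * schwartz_norm M \<phi>"
      if g: "g \<in> O_M" and \<phi>: "\<phi> \<in> schwartz" and B: "\<And>x. jet_norm J g x \<le> B * (1 + norm x) ^ N" for g \<phi> :: "real^'n \<Rightarrow> complex" and B
    proof -
      note F = fourier_schwartz[OF \<phi>]
      have B0: "0 \<le> B" using order_trans[OF jet_norm_nonneg B[of 0]] by simp
      let ?u = "\<lambda>\<xi>. g \<xi> * fourier \<phi> \<xi>"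
      have u: "?u \<in> schwartz" by (intro schwartz_mult g F)
      have "schwartz_norm J ?u \<le> list_count TYPE('n) J * (L * B * (C2 * schwartz_norm M \<phi>))"
      proof (rule schwartz_norm_le)
        fix x
        have "(1 + norm x) ^ J * jet_norm J ?u x \<le> (1 + norm x) ^ J * (L * (jet_norm J g x * jet_norm J (fourier \<phi>) x))"
          unfolding L_def by (intro mult_left_mono jet_norm_mult O_M_smooth g schwartz_smooth F) auto
        also have "\<dots> \<le> (1 + norm x) ^ J * (L * ((B * (1 + norm x) ^ N) * jet_norm J (fourier \<phi>) x))"
          by (intro mult_left_mono mult_right_mono B L) auto
        also have "\<dots> = L * B * ((1 + norm x) ^ (J + N) * jet_norm J (fourier \<phi>) x)"
          by (simp only: power_add mult_ac)
        also have "\<dots> \<le> L * B * (C2 * schwartz_norm M \<phi>)"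
          by (intro mult_left_mono order_trans[OF schwartz_norm_ge[OF F] C2(2)[OF \<phi>]]) (auto simp: L B0)
        finally show "(1 + norm x) ^ J * jet_norm J ?u x \<le> L * B * (C2 * schwartz_norm M \<phi>)" .
      qed
      then have "C1 * schwartz_norm J ?u \<le> C1 * (list_count TYPE('n) J * (L * B * (C2 * schwartz_norm M \<phi>)))"
        by (intro mult_left_mono C1)
      with C1(2)[OF u] have "schwartz_norm K (inv_fourier ?u) \<le> C1 * (list_count TYPE('n) J * (L * B * (C2 * schwartz_norm M \<phi>)))"
        by (rule order_trans)
      also have "\<dots> = C * B * schwartz_norm M \<phi>" by (simp only: C_def mult_ac)
      finally show ?thesis .
    qed
    ultimately show "\<exists>C M. 0 \<le> C \<and> (\<forall>g (\<phi> :: real^'n \<Rightarrow> complex) B. g \<in> O_M \<longrightarrow> \<phi> \<in> schwartz \<longrightarrow>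
      (\<forall>x. jet_norm J g x \<le> B * (1 + norm x) ^ N) \<longrightarrow>
      schwartz_norm K (inv_fourier (\<lambda>\<xi>. g \<xi> * fourier \<phi> \<xi>)) \<le> C * B * schwartz_norm M \<phi>)" by blast
  qed
qed

lemma symbol_operator_continuous:
  fixes g :: "real^'n::finite \<Rightarrow> complex"
  assumes g: "g \<in> O_M"
  shows "\<exists>C M. 0 \<le> C \<and> (\<forall>\<phi>\<in>schwartz. schwartz_norm K (inv_fourier (\<lambda>\<xi>. g \<xi> * fourier \<phi> \<xi>)) \<le> C * schwartz_norm M \<phi>)"
proof -
  obtain J where J: "\<And>N. \<exists>C M. 0 \<le> C \<and> (\<forall>g (\<phi> :: real^'n \<Rightarrow> complex) B. g \<in> O_M \<longrightarrow> \<phi> \<in> schwartz \<longrightarrow>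
    (\<forall>x. jet_norm J g x \<le> B * (1 + norm x) ^ N) \<longrightarrow>
    schwartz_norm K (inv_fourier (\<lambda>\<xi>. g \<xi> * fourier \<phi> \<xi>)) \<le> C * B * schwartz_norm M \<phi>)"
    using symbol_operator_bound by blast
  obtain N B where B: "0 \<le> B" "\<And>x. jet_norm J g x \<le> B * (1 + norm x) ^ N" by (rule O_M_jet_bound[OF g, of J]) blast
  obtain C M where "0 \<le> C" and C: "\<forall>g (\<phi> :: real^'n \<Rightarrow> complex) B. g \<in> O_M \<longrightarrow> \<phi> \<in> schwartz \<longrightarrow>
    (\<forall>x. jet_norm J g x \<le> B * (1 + norm x) ^ N) \<longrightarrow>
    schwartz_norm K (inv_fourier (\<lambda>\<xi>. g \<xi> * fourier \<phi> \<xi>)) \<le> C * B * schwartz_norm M \<phi>"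
    using J[of N] by blast
  have "0 \<le> C * B" using \<open>0 \<le> C\<close> B by simp
  moreover have "\<forall>\<phi>\<in>schwartz. schwartz_norm K (inv_fourier (\<lambda>\<xi>. g \<xi> * fourier \<phi> \<xi>)) \<le> C * B * schwartz_norm M \<phi>"
    using C g B by blast
  ultimately show ?thesis by blast
qed

lemma symbol_operator_linear:
  fixes g :: "real^'n::finite \<Rightarrow> complex"
  assumes g: "g \<in> O_M" and \<phi>: "\<phi> \<in> schwartz" and \<psi>: "\<psi> \<in> schwartz"
  shows "inv_fourier (\<lambda>\<xi>. g \<xi> * fourier (\<lambda>x. c * \<phi> x + \<psi> x) \<xi>) x
    = c * inv_fourier (\<lambda>\<xi>. g \<xi> * fourier \<phi> \<xi>) x + inv_fourier (\<lambda>\<xi>. g \<xi> * fourier \<psi> \<xi>) x"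
proof -
  have "(\<lambda>\<xi>. g \<xi> * fourier (\<lambda>x. c * \<phi> x + \<psi> x) \<xi>) = (\<lambda>\<xi>. c * (g \<xi> * fourier \<phi> \<xi>) + g \<xi> * fourier \<psi> \<xi>)"
    unfolding fourier_add[OF schwartz_integrable[OF schwartz_cmult[OF \<phi>]] schwartz_integrable[OF \<psi>]] fourier_cmult
    by (simp add: algebra_simps)
  then show ?thesis
    by (simp only: inv_fourier_linear[OF schwartz_mult[OF g fourier_schwartz[OF \<phi>]] schwartz_mult[OF g fourier_schwartz[OF \<psi>]]])
qed

lemma symbol_operator_diff:
  fixes g :: "real^'n::finite \<Rightarrow> complex"
  assumes g: "g \<in> O_M" and \<phi>: "\<phi> \<in> schwartz" and \<psi>: "\<psi> \<in> schwartz"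
  shows "inv_fourier (\<lambda>\<xi>. g \<xi> * fourier \<psi> \<xi>) x - inv_fourier (\<lambda>\<xi>. g \<xi> * fourier \<phi> \<xi>) x
    = inv_fourier (\<lambda>\<xi>. g \<xi> * fourier (\<lambda>x. \<psi> x - \<phi> x) \<xi>) x"
proof -
  have "(\<lambda>x. \<psi> x - \<phi> x) = (\<lambda>x. (- 1) * \<phi> x + \<psi> x)" by simp
  then show ?thesis using symbol_operator_linear[OF assms, of "- 1" x] by simp
qed

lemma conv_fun_symbol_dist_operator:
  fixes g :: "real^'n::finite \<Rightarrow> complex"
  assumes g: "g \<in> O_M" shows "conv_fun (symbol_dist g) \<in> schwartz_operators"
proof -
  let ?A = "conv_fun (symbol_dist g)"
  have A: "?A \<phi> = inv_fourier (\<lambda>\<xi>. g \<xi> * fourier \<phi> \<xi>)" if "\<phi> \<in> schwartz" for \<phi>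
    using that by (simp add: conv_fun_symbol_dist)
  have "continuous_map schwartz_topology schwartz_topology ?A"
  proof (rule continuous_map_schwartz_operator)
    show "?A \<phi> \<in> schwartz" if "\<phi> \<in> schwartz" for \<phi>
      unfolding A[OF that] by (intro inv_fourier_schwartz schwartz_mult g fourier_schwartz that)
    fix K
    obtain C M where "0 \<le> C" and C: "\<And>\<phi>. \<phi> \<in> schwartz \<Longrightarrow> schwartz_norm K (inv_fourier (\<lambda>\<xi>. g \<xi> * fourier \<phi> \<xi>)) \<le> C * schwartz_norm M \<phi>"
      using symbol_operator_continuous[OF g] by meson
    have "schwartz_norm K (\<lambda>x. ?A \<psi> x - ?A \<phi> x) \<le> C * schwartz_norm M (\<lambda>x. \<psi> x - \<phi> x)" if "\<phi> \<in> schwartz" "\<psi> \<in> schwartz" for \<phi> \<psi>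
      unfolding A[OF that(1)] A[OF that(2)] symbol_operator_diff[OF g that] by (rule C[OF schwartz_diff[OF that(2,1)]])
    then show "\<exists>C M. 0 \<le> C \<and> (\<forall>\<phi>\<in>schwartz. \<forall>\<psi>\<in>schwartz. schwartz_norm K (\<lambda>x. ?A \<psi> x - ?A \<phi> x) \<le> C * schwartz_norm M (\<lambda>x. \<psi> x - \<phi> x))"
      using \<open>0 \<le> C\<close> by blast
  qed
  moreover have "?A (\<lambda>x. c * \<phi> x + \<psi> x) = (\<lambda>x. c * ?A \<phi> x + ?A \<psi> x)" if "\<phi> \<in> schwartz" "\<psi> \<in> schwartz" for \<phi> \<psi> c
    unfolding A[OF that(1)] A[OF that(2)] A[OF schwartz_add[OF schwartz_cmult[OF that(1)] that(2)]] symbol_operator_linear[OF g that] ..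
  ultimately show ?thesis unfolding schwartz_operators_def by (auto simp: conv_fun_symbol_dist)
qed

text \<open>The value at \<open>\<phi>\<close> is the convolution with the reflection of \<open>\<phi>\<close>, evaluated at the origin.\<close>

lemma symbol_dist_tempered:
  fixes g :: "real^'n::finite \<Rightarrow> complex"
  assumes g: "g \<in> O_M" shows "symbol_dist g \<in> tempered"
proof -
  let ?T = "symbol_dist g"
  obtain C M where C: "0 \<le> C" and CM: "\<And>\<phi>. \<phi> \<in> schwartz \<Longrightarrow> schwartz_norm 0 (inv_fourier (\<lambda>\<xi>. g \<xi> * fourier \<phi> \<xi>)) \<le> C * schwartz_norm M \<phi>"
    using symbol_operator_continuous[OF g] by meson
  have bound: "norm (?T \<phi>) \<le> C * schwartz_norm M \<phi>" if \<phi>: "\<phi> \<in> schwartz" for \<phi>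
  proof -
    let ?r = "\<lambda>x. \<phi> (- x)"
    have r: "?r \<in> schwartz" by (rule schwartz_reflect[OF \<phi>])
    have "?T \<phi> = inv_fourier (\<lambda>\<xi>. g \<xi> * fourier ?r \<xi>) 0"
      using fun_cong[OF conv_fun_symbol_dist[of g ?r], of 0] r by (simp add: conv_fun_def)
    also have "norm \<dots> \<le> schwartz_norm 0 (inv_fourier (\<lambda>\<xi>. g \<xi> * fourier ?r \<xi>))"
      using schwartz_bounded[OF inv_fourier_schwartz[OF schwartz_mult[OF g fourier_schwartz[OF r]]], of 0] by simp
    also have "\<dots> \<le> C * schwartz_norm M ?r" by (rule CM[OF r])
    also have "\<dots> \<le> C * schwartz_norm M \<phi>" by (intro mult_left_mono schwartz_norm_reflect \<phi> C)
    finally show ?thesis .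
  qed
  have "continuous_map schwartz_topology euclidean ?T"
  proof (rule continuous_map_schwartz_functional[OF C])
    fix \<phi> \<psi> :: "real^'n \<Rightarrow> complex" assume s: "\<phi> \<in> schwartz" "\<psi> \<in> schwartz"
    have "(\<lambda>x. \<psi> x - \<phi> x) = (\<lambda>x. (- 1) * \<phi> x + \<psi> x)" by simp
    then have "?T \<psi> - ?T \<phi> = ?T (\<lambda>x. \<psi> x - \<phi> x)" using symbol_dist_linear[OF g s, of "- 1"] by simp
    then show "norm (?T \<psi> - ?T \<phi>) \<le> C * schwartz_norm M (\<lambda>x. \<psi> x - \<phi> x)"
      using bound[OF schwartz_diff[OF s(2,1)]] by simp
  qed
  moreover have "?T \<phi> = 0" if "\<phi> \<notin> schwartz" for \<phi> using that by (simp add: symbol_dist_def)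
  ultimately show ?thesis unfolding tempered_def using symbol_dist_linear[OF g] by blast
qed

section \<open>Multipliers are symbols of rapidly decreasing distributions\<close>

text \<open>The operator \<open>1 - \<Delta>\<close>, whose symbol \<open>1 + |\<xi>|\<^sup>2\<close> is inverse to \<open>bracket\<close>.\<close>

definition bessel :: "(real^'n::finite \<Rightarrow> complex) \<Rightarrow> real^'n \<Rightarrow> complex" where
  "bessel \<phi> x = \<phi> x - (\<Sum>i\<in>UNIV. partials [i, i] \<phi> x)"

lemma bessel_schwartz:
  assumes "\<phi> \<in> schwartz" shows "bessel \<phi> \<in> schwartz"
proof -
  have sum: "(\<lambda>x. \<Sum>i\<in>I. partials [i, i] \<phi> x) \<in> schwartz" if "finite I" for I
    using that by (induction I rule: finite_induct)
      (auto simp del: partials_Cons intro!: schwartz_add schwartz_partials assms)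
  show ?thesis unfolding bessel_def[abs_def] by (intro schwartz_diff assms sum) simp
qed

lemma bessel_power_schwartz: "\<phi> \<in> schwartz \<Longrightarrow> (bessel ^^ M) \<phi> \<in> schwartz"
  by (induction M) (auto intro: bessel_schwartz)

lemma schwartz_sum: "finite I \<Longrightarrow> (\<And>i. i \<in> I \<Longrightarrow> f i \<in> schwartz) \<Longrightarrow> (\<lambda>x. \<Sum>i\<in>I. f i x) \<in> schwartz"
  by (induction I rule: finite_induct) (auto intro: schwartz_add)

lemma fourier_sum:
  "finite I \<Longrightarrow> (\<And>i. i \<in> I \<Longrightarrow> f i \<in> schwartz) \<Longrightarrow> fourier (\<lambda>x. \<Sum>i\<in>I. f i x) \<xi> = (\<Sum>i\<in>I. fourier (f i) \<xi>)"
proof (induction I rule: finite_induct)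
  case empty
  then show ?case by (simp add: fourier_def)
next
  case (insert i I)
  then have "fourier (\<lambda>x. f i x + (\<Sum>i\<in>I. f i x)) \<xi> = fourier (f i) \<xi> + fourier (\<lambda>x. \<Sum>i\<in>I. f i x) \<xi>"
    by (intro fourier_add schwartz_integrable schwartz_sum) auto
  then show ?case using insert by simp
qed

lemma fourier_partial_schwartz:
  "\<phi> \<in> schwartz \<Longrightarrow> fourier (partial i \<phi>) \<xi> = \<i> * of_real (\<xi> $ i) * fourier \<phi> \<xi>"
  by (rule fourier_partial[OF schwartz_smooth schwartz_decays schwartz_decays[OF schwartz_partial]])

lemma fourier_bessel:
  fixes \<phi> :: "real^'n::finite \<Rightarrow> complex"
  assumes \<phi>: "\<phi> \<in> schwartz" shows "bracket \<xi> * fourier (bessel \<phi>) \<xi> = fourier \<phi> \<xi>"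
proof -
  have s: "(\<lambda>x. \<Sum>i\<in>UNIV. partials [i, i] \<phi> x) \<in> schwartz" by (intro schwartz_sum schwartz_partials \<phi>) simp
  have "fourier (bessel \<phi>) \<xi> = fourier (\<lambda>x. \<phi> x + (- 1) * (\<Sum>i\<in>UNIV. partials [i, i] \<phi> x)) \<xi>"
    by (simp add: bessel_def[abs_def])
  also have "\<dots> = fourier \<phi> \<xi> + (- 1) * fourier (\<lambda>x. \<Sum>i\<in>UNIV. partials [i, i] \<phi> x) \<xi>"
    by (subst fourier_add[OF schwartz_integrable[OF \<phi>] schwartz_integrable[OF schwartz_cmult[OF s]]]) (simp only: fourier_cmult)
  also have "fourier (\<lambda>x. \<Sum>i\<in>UNIV. partials [i, i] \<phi> x) \<xi> = (\<Sum>i\<in>UNIV. fourier (partials [i, i] \<phi>) \<xi>)"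
    by (rule fourier_sum) (auto intro!: schwartz_partial \<phi>)
  also have "\<dots> = (\<Sum>i\<in>UNIV. - of_real ((\<xi> $ i)\<^sup>2) * fourier \<phi> \<xi>)"
  proof (rule sum.cong[OF refl])
    fix i
    have "fourier (partials [i, i] \<phi>) \<xi> = \<i> * of_real (\<xi> $ i) * (\<i> * of_real (\<xi> $ i) * fourier \<phi> \<xi>)"
      by (simp only: partials_Cons partials_Nil fourier_partial_schwartz schwartz_partial \<phi>)
    also have "\<dots> = (\<i> * \<i>) * of_real ((\<xi> $ i)\<^sup>2) * fourier \<phi> \<xi>"
      by (simp only: of_real_mult power2_eq_square mult_ac)
    finally show "fourier (partials [i, i] \<phi>) \<xi> = - of_real ((\<xi> $ i)\<^sup>2) * fourier \<phi> \<xi>" by simp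
  qed
  also have "\<dots> = - of_real (\<xi> \<bullet> \<xi>) * fourier \<phi> \<xi>"
    by (simp add: inner_vec_def power2_eq_square sum_distrib_right sum_negf)
  finally have "fourier (bessel \<phi>) \<xi> = of_real (1 + \<xi> \<bullet> \<xi>) * fourier \<phi> \<xi>" by (simp add: algebra_simps)
  moreover have "bracket \<xi> * of_real (1 + \<xi> \<bullet> \<xi>) = 1"
    using bracket_denom[of \<xi>] unfolding bracket_def of_real_mult[symmetric] by simp
  ultimately show ?thesis by (simp add: mult.assoc[symmetric])
qed

lemma fourier_bessel_power:
  "\<phi> \<in> schwartz \<Longrightarrow> bracket \<xi> ^ M * fourier ((bessel ^^ M) \<phi>) \<xi> = fourier \<phi> \<xi>"
proof (induction M)
  case (Suc M)
  have "bracket \<xi> ^ Suc M * fourier ((bessel ^^ Suc M) \<phi>) \<xi>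
    = bracket \<xi> ^ M * (bracket \<xi> * fourier (bessel ((bessel ^^ M) \<phi>)) \<xi>)" by simp
  also have "\<dots> = fourier \<phi> \<xi>" using Suc fourier_bessel[OF bessel_power_schwartz[OF Suc.prems, of M], of \<xi>] by simp
  finally show ?case .
qed simp

text \<open>The lists are reversed so that the expansion matches the order in which derivatives of a regular
  distribution are moved to the test function.\<close>

lemma bessel_power_expansion:
  "\<exists>m a. \<forall>\<phi> :: real^'n::finite \<Rightarrow> complex. \<phi> \<in> schwartz \<longrightarrow> (\<forall>x. (bessel ^^ M) \<phi> x = (\<Sum>js | length js \<le> m. a js * partials (rev js) \<phi> x))"
proof (induction M)
  case 0
  have "(\<Sum>js | length js \<le> 0. 1 * partials (rev js) \<phi> x) = \<phi> x" for \<phi> :: "real^'n \<Rightarrow> complex" and x by simp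
  then show ?case by (intro exI[of _ 0] exI[of _ "\<lambda>_. 1"]) simp
next
  case (Suc M)
  then obtain m a where IH: "\<And>(\<phi> :: real^'n \<Rightarrow> complex) x. \<phi> \<in> schwartz \<Longrightarrow> (bessel ^^ M) \<phi> x = (\<Sum>js | length js \<le> m. a js * partials (rev js) \<phi> x)"
    by blast
  define J where "J = {js :: 'n list. length js \<le> m}"
  define J' where "J' = {js :: 'n list. length js \<le> Suc (Suc m)}"
  \<comment> \<open>the terms produced by \<open>\<Delta>\<close>\<close>
  define ins where "ins p = (case p of (i, js) \<Rightarrow> i # i # js)" for p :: "'n \<times> 'n list"
  define b where "b ks = (if ks \<in> J then a ks else 0) - (if ks \<in> ins ` (UNIV \<times> J) then a (drop 2 ks) else 0)" for ks
  have fin: "finite J" "finite J'" by (auto simp: J_def J'_def)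
  have "(bessel ^^ Suc M) \<phi> x = (\<Sum>js\<in>J'. b js * partials (rev js) \<phi> x)" if \<phi>: "\<phi> \<in> schwartz" for \<phi> :: "real^'n \<Rightarrow> complex" and x
  proof -
    have ii: "smooth (\<lambda>x. \<Sum>i\<in>UNIV. partials [i, i] \<phi> x)"
      by (intro smooth_sum smooth_partials schwartz_smooth \<phi>)
    have pb: "partials (rev js) (bessel \<phi>) x = partials (rev js) \<phi> x - (\<Sum>i\<in>UNIV. partials (rev (ins (i, js))) \<phi> x)" for js
    proof -
      have "partials (rev js) (bessel \<phi>) x = partials (rev js) \<phi> x - partials (rev js) (\<lambda>x. \<Sum>i\<in>UNIV. partials [i, i] \<phi> x) x"
        unfolding bessel_def[abs_def] by (subst partials_diff[OF schwartz_smooth[OF \<phi>] ii]) simp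
      also have "partials (rev js) (\<lambda>x. \<Sum>i\<in>UNIV. partials [i, i] \<phi> x) x = (\<Sum>i\<in>UNIV. partials (rev js) (partials [i, i] \<phi>) x)"
        by (subst partials_sum) (auto intro!: smooth_partial schwartz_smooth[OF \<phi>])
      finally show ?thesis by (simp add: ins_def partials_append)
    qed
    have "(bessel ^^ Suc M) \<phi> x = (bessel ^^ M) (bessel \<phi>) x" by (simp only: funpow_Suc_right o_apply)
    also have "\<dots> = (\<Sum>js\<in>J. a js * partials (rev js) (bessel \<phi>) x)" unfolding J_def by (rule IH[OF bessel_schwartz[OF \<phi>]])
    also have "\<dots> = (\<Sum>js\<in>J. a js * partials (rev js) \<phi> x) - (\<Sum>js\<in>J. \<Sum>i\<in>UNIV. a js * partials (rev (ins (i, js))) \<phi> x)"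
      unfolding pb by (simp add: right_diff_distrib sum_subtractf sum_distrib_left)
    also have "(\<Sum>js\<in>J. \<Sum>i\<in>UNIV. a js * partials (rev (ins (i, js))) \<phi> x)
      = (\<Sum>p\<in>UNIV \<times> J. a (drop 2 (ins p)) * partials (rev (ins p)) \<phi> x)"
      by (subst sum.swap) (simp add: sum.cartesian_product ins_def case_prod_unfold)
    also have "\<dots> = (\<Sum>ks\<in>ins ` (UNIV \<times> J). a (drop 2 ks) * partials (rev ks) \<phi> x)"
      by (subst sum.reindex) (auto simp: inj_on_def ins_def)
    also have "\<dots> = (\<Sum>ks\<in>J'. (if ks \<in> ins ` (UNIV \<times> J) then a (drop 2 ks) else 0) * partials (rev ks) \<phi> x)"
      using fin by (intro sum.mono_neutral_cong_left) (auto simp: J_def J'_def ins_def)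
    also have "(\<Sum>js\<in>J. a js * partials (rev js) \<phi> x) = (\<Sum>js\<in>J'. (if js \<in> J then a js else 0) * partials (rev js) \<phi> x)"
      using fin by (intro sum.mono_neutral_cong_left) (auto simp: J_def J'_def)
    finally show ?thesis by (simp add: b_def left_diff_distrib sum_subtractf)
  qed
  then show ?case unfolding J'_def by blast
qed

text \<open>The symbol \<open>g(-\<xi>)\<close> times a high power of \<open>bracket\<close> has a continuous Fourier transform with the prescribed
  decay, since decay of the transform only costs derivatives of a function that is integrable together with
  them. The power of \<open>bracket\<close> is undone by the same power of \<open>1 - \<Delta>\<close>, expanded into derivatives.\<close>

theorem symbol_dist_O_C':
  fixes g :: "real^'n::finite \<Rightarrow> complex"
  assumes g: "g \<in> O_M" shows "symbol_dist g \<in> O_C'"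
proof -
  let ?T = "symbol_dist g"
  have "\<exists>m f. (\<forall>js. length js \<le> m \<longrightarrow> continuous_on UNIV (f js) \<and>
        (\<lambda>x. norm (f js x)) \<in> O[at_infinity](\<lambda>x. 1 / norm x ^ k)) \<and>
     ?T = (\<lambda>\<phi>. \<Sum>js | length js \<le> m. dist_partials js (regular_dist (f js)) \<phi>)" for k
  proof -
    obtain C M where C: "0 \<le> C" and Q: "\<And>(u :: real^'n \<Rightarrow> complex) B. smooth u \<Longrightarrow> (\<And>x. (1 + norm x) ^ M * jet_norm k u x \<le> B) \<Longrightarrow>
      (\<forall>js \<xi>. length js \<le> 0 \<longrightarrow> partials js (fourier u) differentiable (at \<xi>)) \<and>
      (\<forall>\<xi>. (1 + norm \<xi>) ^ k * jet_norm 0 (fourier u) \<xi> \<le> C * B)"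
      using fourier_jet_bound[of k 0] by blast
    let ?g = "\<lambda>\<xi>. g (- \<xi>)"
    have gr: "?g \<in> O_M" by (rule O_M_reflect[OF g])
    obtain N A where A: "0 \<le> A" "\<And>x. jet_norm k ?g x \<le> A * (1 + norm x) ^ N" by (rule O_M_jet_bound[OF gr, of k]) blast
    \<comment> \<open>\<open>N\<close> against the growth of the symbol, \<open>M\<close> for the decay of the transform, the rest for integrability\<close>
    define P where "P = M + N + decay_exp TYPE('n)"
    obtain W where W: "0 \<le> W" "\<And>x :: real^'n. (1 + norm x) ^ (2 * P) * jet_norm k (\<lambda>x. bracket x ^ P) x \<le> W"
      and smP: "smooth (\<lambda>x :: real^'n. bracket x ^ P)"
      using bracket_power_jet[of P k] by blast
    define h where "h \<xi> = ?g \<xi> * bracket \<xi> ^ P" for \<xi>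
    define L where "L = list_count TYPE('n) k * 2 ^ k"
    have L: "0 \<le> L" by (simp add: L_def)
    have hs: "smooth h" unfolding h_def[abs_def] by (intro smooth_mult O_M_smooth[OF gr] smP)
    have hb: "(1 + norm x) ^ (M + decay_exp TYPE('n)) * jet_norm k h x \<le> L * A * W" for x
    proof -
      have "(1 + norm x) ^ (M + decay_exp TYPE('n)) * jet_norm k h x
        \<le> (1 + norm x) ^ (M + decay_exp TYPE('n)) * (L * (jet_norm k ?g x * jet_norm k (\<lambda>x. bracket x ^ P) x))"
        unfolding h_def[abs_def] L_def by (intro mult_left_mono jet_norm_mult O_M_smooth[OF gr] smP) auto
      also have "\<dots> \<le> (1 + norm x) ^ (M + decay_exp TYPE('n)) * (L * ((A * (1 + norm x) ^ N) * jet_norm k (\<lambda>x. bracket x ^ P) x))"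
        by (intro mult_left_mono mult_right_mono A L) auto
      also have "\<dots> = L * A * ((1 + norm x) ^ P * jet_norm k (\<lambda>x. bracket x ^ P) x)"
        unfolding P_def by (simp only: power_add mult_ac)
      also have "\<dots> \<le> L * A * ((1 + norm x) ^ (2 * P) * jet_norm k (\<lambda>x. bracket x ^ P) x)"
        by (intro mult_left_mono mult_right_mono one_plus_norm_power_mono) (auto simp: L A)
      also have "\<dots> \<le> L * A * W" by (intro mult_left_mono W) (auto simp: L A)
      finally show ?thesis .
    qed
    have hbM: "(1 + norm x) ^ M * jet_norm k h x \<le> L * A * W" for x
      by (rule order_trans[OF mult_right_mono[OF one_plus_norm_power_mono] hb]) auto
    have hi: "integrable lborel h"
    proof (rule integrable_decays(1)[OF borel_smooth[OF hs] _ order_refl])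
      show "decays (decay_exp TYPE('n)) (L * A * W) h"
        unfolding decays_def
      proof
        fix x
        have "(1 + norm x) ^ decay_exp TYPE('n) * norm (h x) \<le> (1 + norm x) ^ (M + decay_exp TYPE('n)) * jet_norm k h x"
          by (intro mult_mono one_plus_norm_power_mono jet_norm_ge_norm) auto
        then show "(1 + norm x) ^ decay_exp TYPE('n) * norm (h x) \<le> L * A * W" using hb[of x] by linarith
      qed
    qed
    note Qh = Q[OF hs hbM]
    have Fd: "fourier h differentiable (at \<xi>)" for \<xi> using Qh by (metis list.size(3) order_refl partials_Nil)
    have Fc: "continuous_on UNIV (fourier h)"
      by (intro continuous_at_imp_continuous_on ballI differentiable_imp_continuous_within Fd)
    have Fb: "(1 + norm \<xi>) ^ k * norm (fourier h \<xi>) \<le> C * (L * A * W)" for \<xi>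
      using Qh order_trans[OF mult_left_mono[OF jet_norm_ge_norm[of "fourier h" \<xi> 0]]] by (meson one_plus_norm_pos zero_le_power less_imp_le)
    obtain m a where exp: "\<And>(\<phi> :: real^'n \<Rightarrow> complex) x. \<phi> \<in> schwartz \<Longrightarrow> (bessel ^^ P) \<phi> x = (\<Sum>js | length js \<le> m. a js * partials (rev js) \<phi> x)"
      using bessel_power_expansion[of P] by blast
    define c where "c = 1 / inversion_const TYPE('n)"
    define f where "f js x = (c * (- 1) ^ length js * a js) * fourier h x" for js x
    have fc: "continuous_on UNIV (f js)" for js unfolding f_def[abs_def] by (intro continuous_intros Fc)
    have fO: "(\<lambda>x. norm (f js x)) \<in> O[at_infinity](\<lambda>x. 1 / norm x ^ k)" for js
    proof (rule landau_o.bigI)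
      let ?D = "norm (c * (- 1) ^ length js * a js) * (C * (L * A * W)) + 1"
      have nn: "0 \<le> C * (L * A * W)" using C L A W by simp
      show "0 < ?D" using nn by (simp add: add_nonneg_pos)
      show "\<forall>\<^sub>F x in at_infinity. norm (norm (f js x)) \<le> ?D * norm (1 / norm x ^ k)"
        unfolding eventually_at_infinity
      proof (intro exI[of _ 1] allI impI)
        fix x :: "real^'n" assume x: "1 \<le> norm x"
        have "norm x ^ k * norm (fourier h x) \<le> (1 + norm x) ^ k * norm (fourier h x)"
          by (intro mult_right_mono power_mono) auto
        then have "norm x ^ k * norm (fourier h x) \<le> C * (L * A * W)" using Fb[of x] by linarith
        then have "norm (c * (- 1) ^ length js * a js) * (norm x ^ k * norm (fourier h x)) \<le> norm (c * (- 1) ^ length js * a js) * (C * (L * A * W))"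
          by (intro mult_left_mono) auto
        then have "norm x ^ k * norm (f js x) \<le> ?D" unfolding f_def norm_mult by (simp add: mult_ac)
        moreover have "0 < norm x ^ k" using x by (intro zero_less_power) linarith
        ultimately show "norm (norm (f js x)) \<le> ?D * norm (1 / norm x ^ k)" by (simp add: field_simps)
      qed
    qed
    have "?T \<phi> = (\<Sum>js | length js \<le> m. dist_partials js (regular_dist (f js)) \<phi>)" for \<phi>
    proof (cases "\<phi> \<in> schwartz")
      case True
      let ?\<psi> = "(bessel ^^ P) \<phi>"
      have ps: "?\<psi> \<in> schwartz" by (rule bessel_power_schwartz[OF True])
      have "?T \<phi> = c * (LINT \<xi>|lborel. g \<xi> * fourier \<phi> (- \<xi>))"
        using True by (simp add: symbol_dist_def inv_fourier_def c_def)
      also have "(LINT \<xi>|lborel. g \<xi> * fourier \<phi> (- \<xi>)) = (LINT \<xi>|lborel. ?g \<xi> * fourier \<phi> \<xi>)"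
      proof -
        have "(\<lambda>\<xi>. g \<xi> * fourier \<phi> (- \<xi>)) \<in> borel_measurable borel"
          by (intro borel_measurable_times borel_smooth O_M_smooth[OF g] schwartz_smooth schwartz_reflect fourier_schwartz True)
        from integral_reflect[OF this] show ?thesis by simp
      qed
      also have "\<dots> = (LINT \<xi>|lborel. h \<xi> * fourier ?\<psi> \<xi>)"
        unfolding h_def mult.assoc fourier_bessel_power[OF True] ..
      also have "\<dots> = (LINT x|lborel. fourier h x * ?\<psi> x)"
        by (rule fourier_multiplication_formula[OF hi schwartz_integrable[OF ps]])
      also have "\<dots> = (LINT x|lborel. (\<Sum>js | length js \<le> m. a js * (fourier h x * partials (rev js) \<phi> x)))"
        unfolding exp[OF True] by (simp add: sum_distrib_left mult_ac)
      also have "\<dots> = (\<Sum>js | length js \<le> m. LINT x|lborel. a js * (fourier h x * partials (rev js) \<phi> x))"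
      proof (rule Bochner_Integration.integral_sum)
        fix js :: "'n list"
        have "integrable lborel (\<lambda>x. fourier h x * partials (rev js) \<phi> x)"
        proof (rule Bochner_Integration.integrable_bound)
          show "integrable lborel (\<lambda>x. of_real (C * (L * A * W)) * partials (rev js) \<phi> x)"
            by (intro integrable_mult_right schwartz_integrable schwartz_partials True)
          show "(\<lambda>x. fourier h x * partials (rev js) \<phi> x) \<in> borel_measurable lborel"
            using borel_measurable_times[OF borel_measurable_continuous_onI[OF Fc] schwartz_borel[OF schwartz_partials[OF True]]] by simp
          have "norm (fourier h x) \<le> C * (L * A * W)" for x
          proof -
            have "1 * norm (fourier h x) \<le> (1 + norm x) ^ k * norm (fourier h x)"
              by (intro mult_right_mono one_le_power) auto
            then show ?thesis using Fb[of x] by linarith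
          qed
          then have "norm (fourier h x * z) \<le> norm (of_real (C * (L * A * W)) * z)" for x and z :: complex
            unfolding norm_mult norm_of_real by (intro mult_right_mono order_trans[OF _ abs_ge_self]) auto
          then show "AE x in lborel. norm (fourier h x * partials (rev js) \<phi> x) \<le> norm (of_real (C * (L * A * W)) * partials (rev js) \<phi> x)"
            by blast
        qed
        then show "integrable lborel (\<lambda>x. a js * (fourier h x * partials (rev js) \<phi> x))" by (rule integrable_mult_right)
      qed
      also have "c * \<dots> = (\<Sum>js | length js \<le> m. dist_partials js (regular_dist (f js)) \<phi>)"
        unfolding sum_distrib_left
      proof (rule sum.cong[OF refl])
        fix js :: "'n list"
        have "dist_partials js (regular_dist (f js)) \<phi> = (- 1) ^ length js * (LINT x|lborel. (c * (- 1) ^ length js * a js) * (fourier h x * partials (rev js) \<phi> x))"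
          unfolding dist_partials_regular[OF True] f_def by (simp add: mult.assoc)
        also have "\<dots> = ((- 1) ^ length js * (- 1) ^ length js) * (c * (a js * (LINT x|lborel. fourier h x * partials (rev js) \<phi> x)))"
          unfolding integral_mult_right_zero by (simp only: mult_ac)
        also have "(- 1) ^ length js * (- 1) ^ length js = (1 :: complex)" by (simp flip: power_mult_distrib)
        finally show "c * (LINT x|lborel. a js * (fourier h x * partials (rev js) \<phi> x)) = dist_partials js (regular_dist (f js)) \<phi>"
          by simp
      qed
      finally show ?thesis .
    next
      case False
      have "dist_partials js (regular_dist q) \<phi> = 0" for js q
        using False by (cases js) (auto simp: dist_partials_def dist_partial_def regular_dist_def)
      then show ?thesis using False by (simp add: symbol_dist_def)
    qed
    then show ?thesis using fc fO by (intro exI[of _ m] exI[of _ f]) blast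
  qed
  then show ?thesis unfolding O_C'_def using symbol_dist_tempered[OF g] by blast
qed

section \<open>Convergence of distributions in terms of symbols\<close>

lemma topspace_O_C'_topology [simp]: "topspace O_C'_topology = (O_C' :: 'n::finite functional set)"
proof -
  have "conv_fun T \<in> schwartz_operators" if "T \<in> O_C'" for T :: "'n functional"
    by (rule O_C'_symbol[OF that]) (simp add: conv_fun_symbol_dist_operator)
  then show ?thesis by (auto simp: O_C'_topology_def topspace_pullback_topology)
qed

lemma limitin_O_C'_topology:
  assumes "\<forall>\<^sub>F u in F. B u \<in> O_C'" "A \<in> O_C'"
  shows "limitin O_C'_topology B A F \<longleftrightarrow> limitin operator_topology (\<lambda>u. conv_fun (B u)) (conv_fun A) F"
proof
  assume L: "limitin O_C'_topology B A F"
  show "limitin operator_topology (\<lambda>u. conv_fun (B u)) (conv_fun A) F"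
    unfolding limitin_def
  proof (intro conjI allI impI)
    show "conv_fun A \<in> topspace operator_topology"
      using L by (simp add: limitin_def O_C'_topology_def topspace_pullback_topology)
    fix U assume U: "openin operator_topology U \<and> conv_fun A \<in> U"
    then have "openin O_C'_topology (conv_fun -` U \<inter> O_C')"
      unfolding O_C'_topology_def openin_pullback_topology by blast
    then have "\<forall>\<^sub>F u in F. B u \<in> conv_fun -` U \<inter> O_C'" using L U assms(2) unfolding limitin_def by blast
    then show "\<forall>\<^sub>F u in F. conv_fun (B u) \<in> U" by (rule eventually_mono) simp
  qed
next
  assume L: "limitin operator_topology (\<lambda>u. conv_fun (B u)) (conv_fun A) F"
  show "limitin O_C'_topology B A F"
    unfolding limitin_def
  proof (intro conjI allI impI)
    show "A \<in> topspace O_C'_topology" using assms by simp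
    fix V assume V: "openin O_C'_topology V \<and> A \<in> V"
    then obtain U where U: "openin operator_topology U" "V = conv_fun -` U \<inter> O_C'"
      unfolding O_C'_topology_def openin_pullback_topology by blast
    then have "\<forall>\<^sub>F u in F. conv_fun (B u) \<in> U" using L V unfolding limitin_def by blast
    then show "\<forall>\<^sub>F u in F. B u \<in> V" using assms(1) by eventually_elim (simp add: U)
  qed
qed

lemma limitin_symbol_dist:
  fixes g :: "real^'n::finite \<Rightarrow> complex"
  assumes g: "g \<in> O_M" and h: "\<forall>\<^sub>F u in F. h u \<in> O_M"
    and conv: "\<And>K. \<exists>N. \<forall>e>0. \<forall>\<^sub>F u in F. \<forall>x. jet_norm K (\<lambda>x. h u x - g x) x \<le> e * (1 + norm x) ^ N"
  shows "limitin O_C'_topology (\<lambda>u. symbol_dist (h u)) (symbol_dist g) F"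
proof -
  have "limitin operator_topology (\<lambda>u. conv_fun (symbol_dist (h u))) (conv_fun (symbol_dist g)) F"
  proof (rule limitin_operator_topology)
    show "conv_fun (symbol_dist g) \<in> schwartz_operators" by (rule conv_fun_symbol_dist_operator[OF g])
    show "\<forall>\<^sub>F u in F. conv_fun (symbol_dist (h u)) \<in> schwartz_operators"
      using h by (rule eventually_mono) (rule conv_fun_symbol_dist_operator)
    fix K
    obtain J where J: "\<And>N. \<exists>C M. 0 \<le> C \<and> (\<forall>g (\<phi> :: real^'n \<Rightarrow> complex) B. g \<in> O_M \<longrightarrow> \<phi> \<in> schwartz \<longrightarrow>
      (\<forall>x. jet_norm J g x \<le> B * (1 + norm x) ^ N) \<longrightarrow>
      schwartz_norm K (inv_fourier (\<lambda>\<xi>. g \<xi> * fourier \<phi> \<xi>)) \<le> C * B * schwartz_norm M \<phi>)"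
      using symbol_operator_bound by blast
    obtain N where N: "\<And>e. 0 < e \<Longrightarrow> \<forall>\<^sub>F u in F. \<forall>x. jet_norm J (\<lambda>x. h u x - g x) x \<le> e * (1 + norm x) ^ N"
      using conv by blast
    obtain C M where "0 \<le> C" and C: "\<And>g (\<phi> :: real^'n \<Rightarrow> complex) B. g \<in> O_M \<Longrightarrow> \<phi> \<in> schwartz \<Longrightarrow>
      (\<forall>x. jet_norm J g x \<le> B * (1 + norm x) ^ N) \<Longrightarrow>
      schwartz_norm K (inv_fourier (\<lambda>\<xi>. g \<xi> * fourier \<phi> \<xi>)) \<le> C * B * schwartz_norm M \<phi>"
      using J[of N] by blast
    have "\<forall>\<^sub>F u in F. \<forall>\<phi>\<in>schwartz. schwartz_norm K (\<lambda>x. conv_fun (symbol_dist (h u)) \<phi> x - conv_fun (symbol_dist g) \<phi> x) \<le> e * schwartz_norm M \<phi>"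
      if e: "0 < e" for e
    proof -
      have "0 < e / (C + 1)" using e \<open>0 \<le> C\<close> by simp
      from N[OF this] h show ?thesis
      proof eventually_elim
        case (elim u)
        show ?case
        proof
          fix \<phi> :: "real^'n \<Rightarrow> complex" assume \<phi>: "\<phi> \<in> schwartz"
          note F = fourier_schwartz[OF \<phi>]
          have eq: "conv_fun (symbol_dist (h u)) \<phi> x - conv_fun (symbol_dist g) \<phi> x
            = inv_fourier (\<lambda>\<xi>. (h u \<xi> - g \<xi>) * fourier \<phi> \<xi>) x" for x
            using inv_fourier_linear[OF schwartz_mult[OF g F] schwartz_mult[OF elim(2) F], of "- 1" x] \<phi>
            by (simp add: conv_fun_symbol_dist left_diff_distrib)
          have "schwartz_norm K (inv_fourier (\<lambda>\<xi>. (h u \<xi> - g \<xi>) * fourier \<phi> \<xi>)) \<le> C * (e / (C + 1)) * schwartz_norm M \<phi>"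
            by (rule C[OF O_M_diff[OF elim(2) g] \<phi> elim(1)])
          also have "\<dots> \<le> e * schwartz_norm M \<phi>"
            using e \<open>0 \<le> C\<close> by (intro mult_right_mono schwartz_norm_nonneg \<phi>) (simp add: field_simps)
          finally show "schwartz_norm K (\<lambda>x. conv_fun (symbol_dist (h u)) \<phi> x - conv_fun (symbol_dist g) \<phi> x) \<le> e * schwartz_norm M \<phi>"
            unfolding eq .
        qed
      qed
    qed
    then show "\<exists>M. \<forall>e>0. \<forall>\<^sub>F u in F. \<forall>\<phi>\<in>schwartz. schwartz_norm K (\<lambda>x. conv_fun (symbol_dist (h u)) \<phi> x - conv_fun (symbol_dist g) \<phi> x) \<le> e * schwartz_norm M \<phi>"
      by blast
  qed
  moreover have ev: "\<forall>\<^sub>F u in F. symbol_dist (h u) \<in> O_C'" using h by (rule eventually_mono) (rule symbol_dist_O_C')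
  ultimately show ?thesis by (simp add: limitin_O_C'_topology[OF ev symbol_dist_O_C'[OF g]])
qed

text \<open>The test function is chosen with Fourier transform equal to the Gaussian, which vanishes nowhere; the
  Fourier transform of the convolution, evaluated at \<open>\<xi>\<close>, then recovers the symbol at \<open>\<xi>\<close>.\<close>

lemma limitin_symbol_dist_pointwise:
  fixes g :: "real^'n::finite \<Rightarrow> complex"
  assumes g: "g \<in> O_M" and h: "\<forall>\<^sub>F u in F. h u \<in> O_M"
    and L: "limitin O_C'_topology (\<lambda>u. symbol_dist (h u)) (symbol_dist g) F"
  shows "((\<lambda>u. h u \<xi>) \<longlongrightarrow> g \<xi>) F"
proof -
  let ?\<phi> = "inv_fourier gauss :: real^'n \<Rightarrow> complex"
  have \<phi>: "?\<phi> \<in> schwartz" by (intro inv_fourier_schwartz gauss_schwartz)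
  have F\<phi>: "fourier ?\<phi> = gauss" by (rule fourier_inv_fourier[OF gauss_schwartz])
  have g0: "0 < norm (gauss \<xi>)" by (simp add: gauss_def)
  let ?P = "decay_exp TYPE('n)" and ?W = "weight_integral TYPE('n)"
  have L': "limitin operator_topology (\<lambda>u. conv_fun (symbol_dist (h u))) (conv_fun (symbol_dist g)) F"
  proof -
    have ev: "\<forall>\<^sub>F u in F. symbol_dist (h u) \<in> O_C'" using h by (rule eventually_mono) (rule symbol_dist_O_C')
    show ?thesis using L by (simp add: limitin_O_C'_topology[OF ev symbol_dist_O_C'[OF g]])
  qed
  show ?thesis
    unfolding tendsto_iff
  proof (intro allI impI)
    fix e :: real assume e: "0 < e"
    define d where "d = e * norm (gauss \<xi>) / (?W + 1)"
    have d: "0 < d" using e g0 by (simp add: d_def add_nonneg_pos)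
    from limitin_operator_topology_pointwise[OF L' \<phi> d, of ?P] h
    show "\<forall>\<^sub>F u in F. dist (h u \<xi>) (g \<xi>) < e"
    proof eventually_elim
      case (elim u)
      have sg: "(\<lambda>\<xi>. k \<xi> * gauss \<xi>) \<in> schwartz" if "k \<in> O_M" for k :: "real^'n \<Rightarrow> complex"
        by (rule schwartz_mult[OF that gauss_schwartz])
      let ?d = "\<lambda>\<xi>. (h u \<xi> - g \<xi>) * gauss \<xi>"
      have ds: "?d \<in> schwartz" by (rule sg[OF O_M_diff[OF elim(2) g]])
      have "(\<lambda>x. conv_fun (symbol_dist (h u)) ?\<phi> x - conv_fun (symbol_dist g) ?\<phi> x) = inv_fourier ?d"
      proof
        fix x
        show "conv_fun (symbol_dist (h u)) ?\<phi> x - conv_fun (symbol_dist g) ?\<phi> x = inv_fourier ?d x"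
          using inv_fourier_linear[OF sg[OF g] sg[OF elim(2)], of "- 1" x] \<phi>
          by (simp add: conv_fun_symbol_dist F\<phi> left_diff_distrib)
      qed
      then have sn: "schwartz_norm ?P (inv_fourier ?d) < d" using elim(1) by (simp add: schwartz_ball_def)
      have "norm (?d \<xi>) = norm (fourier (inv_fourier ?d) \<xi>)" by (simp add: fourier_inv_fourier[OF ds])
      also have "\<dots> \<le> ?W * schwartz_norm ?P (inv_fourier ?d)"
        by (rule fourier_bound[OF schwartz_borel[OF inv_fourier_schwartz[OF ds]] schwartz_decays[OF inv_fourier_schwartz[OF ds]] order_refl])
      also have "\<dots> \<le> ?W * d" using sn by (intro mult_left_mono) auto
      also have "\<dots> < (?W + 1) * d" using d by simp
      also have "\<dots> = e * norm (gauss \<xi>)" using add_nonneg_pos[OF weight_integral_nonneg[of "TYPE('n)"] zero_less_one] by (simp add: d_def)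
      finally have "norm (h u \<xi> - g \<xi>) < e" using g0 by (simp add: norm_mult)
      then show ?case by (simp add: dist_norm)
    qed
  qed
qed

section \<open>Differentiation of series of smooth functions\<close>

text \<open>The derivative is a combination of the partial derivatives, which are among the terms of order 1 in the
  jet norm.\<close>

lemma frechet_partial_bound:
  fixes f :: "real^'n::finite \<Rightarrow> complex"
  assumes "smooth f"
  shows "norm (frechet_derivative f (at x) h) \<le> jet_norm (Suc K) f x * norm h"
proof -
  have lin: "linear (frechet_derivative f (at x))" by (rule linear_frechet_derivative[OF smooth_differentiable[OF assms]])
  have "h = (\<Sum>i\<in>UNIV. (h $ i) *\<^sub>R axis i 1)"
    by (simp add: vec_eq_iff axis_def if_distrib cong: if_cong)
  then have "frechet_derivative f (at x) h = frechet_derivative f (at x) (\<Sum>i\<in>UNIV. (h $ i) *\<^sub>R axis i 1)" by simp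
  also have "\<dots> = (\<Sum>i\<in>UNIV. (h $ i) *\<^sub>R partial i f x)"
    by (simp only: linear_sum[OF lin] linear_scale[OF lin] partial_def)
  finally have "norm (frechet_derivative f (at x) h) \<le> (\<Sum>i\<in>UNIV. \<bar>h $ i\<bar> * norm (partial i f x))"
    by (simp add: norm_sum order_trans[OF norm_sum])
  also have "\<dots> \<le> (\<Sum>i\<in>UNIV. norm h * norm (partials [i] f x))"
    by (intro sum_mono) (auto intro!: mult_right_mono component_le_norm_cart)
  also have "\<dots> = (\<Sum>js\<in>(\<lambda>i. [i]) ` UNIV. norm (partials js f x)) * norm h"
    by (subst sum.reindex) (auto simp: inj_on_def sum_distrib_left sum_distrib_right mult.commute)
  also have "(\<Sum>js\<in>(\<lambda>i. [i]) ` UNIV. norm (partials js f x)) \<le> jet_norm (Suc K) f x"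
    unfolding jet_norm_def by (rule sum_mono2) auto
  finally show ?thesis by (simp add: mult_right_mono)
qed

text \<open>Unit balls suffice, because differentiability is local, and the condition is inherited by the series of
  partial derivatives.\<close>

definition jet_summable :: "(nat \<Rightarrow> real^'n::finite \<Rightarrow> complex) \<Rightarrow> bool" where
  "jet_summable f \<longleftrightarrow> (\<forall>k. smooth (f k)) \<and>
    (\<forall>K a. \<exists>B. summable B \<and> (\<forall>k. \<forall>x\<in>ball a 1. jet_norm K (f k) x \<le> B k))"

lemma jet_summable_bound:
  assumes "jet_summable f"
  shows "\<exists>B. summable B \<and> (\<forall>k. \<forall>x\<in>ball a 1. jet_norm K (f k) x \<le> B k)"
  using assms by (simp add: jet_summable_def)

lemma jet_summable_partial:
  assumes "jet_summable f" shows "jet_summable (\<lambda>k. partial i (f k))"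
  unfolding jet_summable_def
proof (intro conjI allI)
  show "smooth (partial i (f k))" for k using assms smooth_partial unfolding jet_summable_def by blast
  fix K a
  obtain B where "summable B" "\<And>k x. x \<in> ball a 1 \<Longrightarrow> jet_norm (Suc K) (f k) x \<le> B k"
    using jet_summable_bound[OF assms, of a "Suc K"] by blast
  then show "\<exists>B. summable B \<and> (\<forall>k. \<forall>x\<in>ball a 1. jet_norm K (partial i (f k)) x \<le> B k)"
    by (intro exI[of _ B]) (auto intro: order_trans[OF jet_norm_partial])
qed

lemma jet_summable_summable:
  assumes "jet_summable f" shows "summable (\<lambda>k. f k x)"
proof -
  obtain B where B: "summable B" "\<And>k y. y \<in> ball x 1 \<Longrightarrow> jet_norm 0 (f k) y \<le> B k"
    using jet_summable_bound[OF assms, of x 0] by blast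
  have "norm (f k x) \<le> B k" for k
    by (rule order_trans[OF jet_norm_ge_norm B(2)]) simp
  then have "summable (\<lambda>k. norm (f k x))"
    by (intro summable_comparison_test'[OF B(1), of 0]) simp
  then show ?thesis by (rule summable_norm_cancel)
qed

text \<open>The tails of the differentiated series are bounded by tails of the summable majorant, uniformly on the
  ball.\<close>

lemma jet_summable_has_derivative:
  fixes f :: "nat \<Rightarrow> real^'n::finite \<Rightarrow> complex"
  assumes f: "jet_summable f"
  shows "((\<lambda>x. \<Sum>k. f k x) has_derivative (\<lambda>h. \<Sum>k. frechet_derivative (f k) (at a) h)) (at a)"
proof -
  obtain B where B: "summable B" "\<And>k x. x \<in> ball a 1 \<Longrightarrow> jet_norm 1 (f k) x \<le> B k"
    using jet_summable_bound[OF f, of a 1] by blast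
  have sm: "smooth (f k)" for k using f by (simp add: jet_summable_def)
  have fb: "norm (frechet_derivative (f k) (at x) h) \<le> B k * norm h" if "x \<in> ball a 1" for k x h
    using frechet_partial_bound[OF sm[of k], of x h 0] mult_right_mono[OF B(2)[OF that, of k] norm_ge_zero[of h]] by simp
  have sb: "summable (\<lambda>k. B k * norm h)" for h :: "real^'n" using B(1) by (rule summable_mult2)
  have sf: "summable (\<lambda>k. norm (frechet_derivative (f k) (at x) h))" if "x \<in> ball a 1" for x h
    by (rule summable_comparison_test'[OF sb[of h], of 0]) (use fb[OF that] in simp)
  have "\<exists>g. \<forall>x\<in>ball a 1. (\<lambda>n. f n x) sums g x \<and> (g has_derivative (\<lambda>h. \<Sum>k. frechet_derivative (f k) (at x) h)) (at x within ball a 1)"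
  proof (rule has_derivative_series)
    show "convex (ball a 1)" by simp
    show "(f n has_derivative frechet_derivative (f n) (at x)) (at x within ball a 1)" for n x
      by (rule has_derivative_at_withinI[OF has_derivative_frechet[OF smooth_differentiable[OF sm]]])
    show "a \<in> ball a 1" by simp
    show "(\<lambda>n. f n a) sums (\<Sum>n. f n a)" using jet_summable_summable[OF f] by (rule summable_sums)
    fix e :: real assume e: "0 < e"
    have "(\<lambda>n. \<Sum>i<n. B i) \<longlonglongrightarrow> suminf B" using summable_LIMSEQ[OF B(1)] .
    then have ev: "\<forall>\<^sub>F n in sequentially. dist (\<Sum>i<n. B i) (suminf B) < e" using e by (rule tendstoD)
    show "\<forall>\<^sub>F n in sequentially. \<forall>x\<in>ball a 1. \<forall>h. norm ((\<Sum>i<n. frechet_derivative (f i) (at x) h) - (\<Sum>k. frechet_derivative (f k) (at x) h)) \<le> e * norm h"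
      using ev
    proof eventually_elim
      case (elim n)
      show ?case
      proof (intro ballI allI)
        fix x h assume x: "x \<in> ball a 1"
        let ?f = "\<lambda>k. frechet_derivative (f k) (at x) h"
        have sum1: "summable ?f" by (rule summable_norm_cancel[OF sf[OF x]])
        have "(\<Sum>k. ?f k) = (\<Sum>k. ?f (k + n)) + (\<Sum>i<n. ?f i)" by (rule suminf_split_initial_segment[OF sum1])
        then have "norm ((\<Sum>i<n. ?f i) - (\<Sum>k. ?f k)) = norm (\<Sum>k. ?f (k + n))" by simp
        also have "\<dots> \<le> (\<Sum>k. norm (?f (k + n)))"
          by (rule summable_norm) (use sf[OF x] in \<open>simp add: summable_iff_shift[where f = "\<lambda>k. norm (?f k)"]\<close>)
        also have "\<dots> \<le> (\<Sum>k. B (k + n) * norm h)"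
        proof (rule suminf_le)
          show "summable (\<lambda>k. norm (?f (k + n)))" using sf[OF x] by (simp add: summable_iff_shift[where f = "\<lambda>k. norm (?f k)"])
          show "summable (\<lambda>k. B (k + n) * norm h)" using sb[of h] by (simp add: summable_iff_shift[where f = "\<lambda>k. B k * norm h"])
        qed (use fb[OF x] in simp)
        also have "\<dots> = (\<Sum>k. B (k + n)) * norm h"
          using B(1) by (intro suminf_mult2[symmetric]) (simp add: summable_iff_shift)
        also have "(\<Sum>k. B (k + n)) \<le> e"
        proof -
          have "suminf B = (\<Sum>k. B (k + n)) + (\<Sum>i<n. B i)" by (rule suminf_split_initial_segment[OF B(1)])
          then show ?thesis using elim by (simp add: dist_real_def)
        qed
        finally show "norm ((\<Sum>i<n. ?f i) - (\<Sum>k. ?f k)) \<le> e * norm h" by (simp add: mult_right_mono)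
      qed
    qed
  qed
  then obtain g where G: "\<forall>x\<in>ball a 1. (\<lambda>n. f n x) sums g x \<and> (g has_derivative (\<lambda>h. \<Sum>k. frechet_derivative (f k) (at x) h)) (at x within ball a 1)"
    by (elim exE)
  have g: "(\<lambda>n. f n x) sums g x" if "x \<in> ball a 1" for x
    using bspec[OF G that] by (rule conjunct1)
  have "a \<in> ball a 1" by simp
  from bspec[OF G this] have g2: "(g has_derivative (\<lambda>h. \<Sum>k. frechet_derivative (f k) (at a) h)) (at a within ball a 1)"
    by (rule conjunct2)
  have g3: "(g has_derivative (\<lambda>h. \<Sum>k. frechet_derivative (f k) (at a) h)) (at a)"
    using g2 by (simp add: at_within_open[of a "ball a 1"])
  have "g x = (\<Sum>k. f k x)" if "x \<in> ball a 1" for x using g[OF that] by (simp add: sums_iff)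
  then show ?thesis
    by (rule has_derivative_transform_within_open[OF g3 open_ball \<open>a \<in> ball a 1\<close>])
qed

lemma jet_summable_partial_suminf:
  assumes "jet_summable f" shows "partial i (\<lambda>x. \<Sum>k. f k x) = (\<lambda>x. \<Sum>k. partial i (f k) x)"
  by (rule ext, rule partial_eqI[THEN trans, OF jet_summable_has_derivative[OF assms]]) (simp add: partial_def)

lemma jet_summable_smooth:
  fixes f :: "nat \<Rightarrow> real^'n::finite \<Rightarrow> complex"
  assumes "jet_summable f" shows "smooth (\<lambda>x. \<Sum>k. f k x)"
proof (rule smooth_coinduct[where X = "{\<lambda>x. \<Sum>k. f k x | f. jet_summable f}"])
  fix g :: "real^'n \<Rightarrow> complex" and x i
  assume "g \<in> {\<lambda>x. \<Sum>k. f k x | f. jet_summable f}"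
  then obtain f where f: "g = (\<lambda>x. \<Sum>k. f k x)" "jet_summable f" by blast
  show "g differentiable (at x)" unfolding f(1) using jet_summable_has_derivative[OF f(2)] by (auto simp: differentiable_def)
  show "partial i g \<in> {\<lambda>x. \<Sum>k. f k x | f. jet_summable f}"
    unfolding f(1) jet_summable_partial_suminf[OF f(2)]
    by (rule CollectI, rule exI[of _ "\<lambda>k. partial i (f k)"]) (simp add: jet_summable_partial[OF f(2)])
qed (use assms in blast)

lemma jet_summable_partials:
  assumes "jet_summable f"
  shows "jet_summable (\<lambda>k. partials js (f k))" "partials js (\<lambda>x. \<Sum>k. f k x) = (\<lambda>x. \<Sum>k. partials js (f k) x)"
proof -
  have "jet_summable (\<lambda>k. partials js (f k)) \<and> partials js (\<lambda>x. \<Sum>k. f k x) = (\<lambda>x. \<Sum>k. partials js (f k) x)"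
    by (induction js) (auto simp: assms jet_summable_partial jet_summable_partial_suminf)
  then show "jet_summable (\<lambda>k. partials js (f k))" "partials js (\<lambda>x. \<Sum>k. f k x) = (\<lambda>x. \<Sum>k. partials js (f k) x)" by auto
qed

section \<open>The matrix exponential of a matrix of multipliers\<close>

type_synonym ('n, 'm) symbol_matrix = "'m \<Rightarrow> 'm \<Rightarrow> real^'n \<Rightarrow> complex"

fun mat_power :: "('n::finite, 'm::finite) symbol_matrix \<Rightarrow> nat \<Rightarrow> ('n, 'm) symbol_matrix" where
  "mat_power A 0 i j = (\<lambda>x. if i = j then 1 else 0)"
| "mat_power A (Suc k) i j = (\<lambda>x. \<Sum>l\<in>UNIV. A i l x * mat_power A k l j x)"

lemma mat_power_Suc_right: "mat_power A (Suc k) i j x = (\<Sum>l\<in>UNIV. mat_power A k i l x * A l j x)"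
proof (induction k arbitrary: i j)
  case 0
  have "(\<Sum>l\<in>UNIV. A i l x * (if l = j then 1 else 0)) = (\<Sum>l\<in>UNIV. if l = j then A i l x else 0)"
    "(\<Sum>l\<in>UNIV. (if i = l then 1 else 0) * A l j x) = (\<Sum>l\<in>UNIV. if i = l then A l j x else 0)"
    by (intro sum.cong; simp)+
  then show ?case by simp
next
  case (Suc k)
  have "mat_power A (Suc (Suc k)) i j x = (\<Sum>l\<in>UNIV. A i l x * mat_power A (Suc k) l j x)" by simp
  also have "\<dots> = (\<Sum>l\<in>UNIV. \<Sum>m\<in>UNIV. A i l x * (mat_power A k l m x * A m j x))"
    unfolding Suc.IH by (simp add: sum_distrib_left)
  also have "\<dots> = (\<Sum>m\<in>UNIV. (\<Sum>l\<in>UNIV. A i l x * mat_power A k l m x) * A m j x)"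
    by (subst sum.swap) (simp add: sum_distrib_right mult.assoc)
  finally show ?case by simp
qed

text \<open>The matrix of entries of \<open>A\<^sup>l exp (t A)\<close>, the \<open>l\<close>-th derivative of the exponential in \<open>t\<close>. A power series
  in \<open>t\<close> with coefficients depending on \<open>\<xi>\<close> can be differentiated termwise in both variables, so that the
  derivatives commute.\<close>

definition exp_deriv :: "('n::finite, 'm::finite) symbol_matrix \<Rightarrow> nat \<Rightarrow> real \<Rightarrow> ('n, 'm) symbol_matrix" where
  "exp_deriv A l t i j = (\<lambda>x. \<Sum>k. mat_power A (k + l) i j x / fact k * of_real t ^ k)"

locale multiplier_matrix =
  fixes A :: "('n::finite, 'm::finite) symbol_matrix"
  assumes A: "\<And>i j. A i j \<in> O_M"
begin

lemma A_smooth: "smooth (A i j)"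
  by (rule O_M_smooth[OF A])

lemma mat_power_O_M: "mat_power A k i j \<in> O_M"
proof (induction k arbitrary: i j)
  case 0
  have "mat_power A 0 i j = (\<lambda>x. (if i = j then 1 else 0))" by simp
  then show ?case by (cases "i = j") simp_all
qed (auto intro!: O_M_sum O_M_mult A)

lemma mat_power_smooth: "smooth (mat_power A k i j)"
  by (rule O_M_smooth[OF mat_power_O_M])

definition total :: "nat \<Rightarrow> real^'n \<Rightarrow> real" where
  "total K x = (\<Sum>i\<in>UNIV. \<Sum>j\<in>UNIV. jet_norm K (A i j) x)"

lemma total_nonneg [simp]: "0 \<le> total K x"
  by (simp add: total_def sum_nonneg)

lemma row_le_total: "(\<Sum>j\<in>UNIV. jet_norm K (A i j) x) \<le> total K x"
  unfolding total_def by (rule member_le_sum) (auto simp: sum_nonneg)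

lemma jet_norm_mat_power: "jet_norm K (mat_power A k i j) x \<le> (list_count TYPE('n) K * 2 ^ K * total K x) ^ k"
proof (induction k arbitrary: i)
  case 0
  show ?case by simp
next
  case (Suc k)
  let ?c = "list_count TYPE('n) K * 2 ^ K"
  have "jet_norm K (mat_power A (Suc k) i j) x \<le> (\<Sum>l\<in>UNIV. jet_norm K (\<lambda>x. A i l x * mat_power A k l j x) x)"
    unfolding mat_power.simps by (rule jet_norm_sum) (auto intro!: smooth_mult A_smooth mat_power_smooth)
  also have "\<dots> \<le> (\<Sum>l\<in>UNIV. ?c * (jet_norm K (A i l) x * (?c * total K x) ^ k))"
    by (intro sum_mono order_trans[OF jet_norm_mult] mult_left_mono Suc.IH A_smooth mat_power_smooth) auto
  also have "\<dots> = ?c * ((\<Sum>l\<in>UNIV. jet_norm K (A i l) x) * (?c * total K x) ^ k)"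
    by (simp add: sum_distrib_left sum_distrib_right)
  also have "\<dots> \<le> ?c * (total K x * (?c * total K x) ^ k)"
    by (intro mult_left_mono mult_right_mono row_le_total) auto
  finally show ?case by (simp add: mult_ac)
qed

lemma jet_norm_continuous: "smooth f \<Longrightarrow> continuous_on UNIV (jet_norm K f)"
  unfolding jet_norm_def[abs_def] by (intro continuous_intros smooth_continuous smooth_partials)

lemma total_locally_bounded: "\<exists>R. 0 \<le> R \<and> (\<forall>x\<in>ball a 1. list_count TYPE('n) K * 2 ^ K * total K x \<le> R)"
proof -
  have "continuous_on (cball a 1) (\<lambda>x. list_count TYPE('n) K * 2 ^ K * total K x)"
    unfolding total_def
    by (intro continuous_intros continuous_on_subset[OF jet_norm_continuous[OF A_smooth]]) auto
  then have "bounded ((\<lambda>x. list_count TYPE('n) K * 2 ^ K * total K x) ` cball a 1)"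
    by (intro compact_imp_bounded compact_continuous_image) auto
  then obtain R where R: "\<forall>y\<in>(\<lambda>x. list_count TYPE('n) K * 2 ^ K * total K x) ` cball a 1. norm y \<le> R"
    unfolding bounded_iff by blast
  have "list_count TYPE('n) K * 2 ^ K * total K x \<le> \<bar>R\<bar>" if "x \<in> ball a 1" for x
  proof -
    have "norm (list_count TYPE('n) K * 2 ^ K * total K x) \<le> R" using R that by auto
    then show ?thesis by simp
  qed
  then show ?thesis by (intro exI[of _ "\<bar>R\<bar>"]) simp
qed

lemma power_bound_shift: "R \<le> Q \<Longrightarrow> 0 \<le> R \<Longrightarrow> R ^ (k + l) \<le> (1 + Q) ^ l * (1 + Q) ^ k" for R Q :: real
  by (metis add.commute add_increasing power_add power_mono zero_le_one)

lemma exp_term_cmult: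
  "(\<lambda>x. mat_power A k i j x / fact m * of_real t ^ m) = (\<lambda>x. (of_real t ^ m / fact m) * mat_power A k i j x)"
  by (simp add: mult.commute)

lemma partials_exp_term:
  "partials js (\<lambda>x. mat_power A k i j x / fact m * of_real t ^ m) x = partials js (mat_power A k i j) x / fact m * of_real t ^ m"
  unfolding exp_term_cmult partials_cmult[OF mat_power_smooth] by simp

text \<open>The jets of \<open>A\<^sup>k\<close> grow at most geometrically in \<open>k\<close>, locally uniformly, and are compensated by \<open>k!\<close>.\<close>

lemma exp_deriv_jet_summable:
  "jet_summable (\<lambda>k x. mat_power A (k + l) i j x / fact k * of_real t ^ k)"
  unfolding jet_summable_def
proof (intro conjI allI)
  note eq = exp_term_cmult
  show "smooth (\<lambda>x. mat_power A (k + l) i j x / fact k * of_real t ^ k)" for k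
    unfolding eq by (rule smooth_cmult[OF mat_power_smooth])
  fix K a
  obtain R where R: "0 \<le> R" "\<And>x. x \<in> ball a 1 \<Longrightarrow> list_count TYPE('n) K * 2 ^ K * total K x \<le> R"
    using total_locally_bounded by blast
  let ?B = "\<lambda>k. (1 + R) ^ l * ((\<bar>t\<bar> * (1 + R)) ^ k / fact k)"
  have "summable ?B" using summable_exp[of "\<bar>t\<bar> * (1 + R)"] by (intro summable_mult) (simp add: divide_inverse mult.commute)
  moreover have "jet_norm K (\<lambda>x. mat_power A (k + l) i j x / fact k * of_real t ^ k) x \<le> ?B k" if x: "x \<in> ball a 1" for k x
  proof -
    have "jet_norm K (\<lambda>x. mat_power A (k + l) i j x / fact k * of_real t ^ k) x = \<bar>t\<bar> ^ k / fact k * jet_norm K (mat_power A (k + l) i j) x"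
      unfolding eq jet_norm_cmult[OF mat_power_smooth] by (simp add: norm_divide norm_power)
    also have "\<dots> \<le> \<bar>t\<bar> ^ k / fact k * ((1 + R) ^ l * (1 + R) ^ k)"
      by (intro mult_left_mono order_trans[OF jet_norm_mat_power] power_bound_shift R x) auto
    finally show ?thesis by (simp add: power_mult_distrib mult_ac)
  qed
  ultimately show "\<exists>B. summable B \<and> (\<forall>k. \<forall>x\<in>ball a 1. jet_norm K (\<lambda>x. mat_power A (k + l) i j x / fact k * of_real t ^ k) x \<le> B k)"
    by blast
qed

lemma exp_deriv_smooth: "smooth (exp_deriv A l t i j)"
  unfolding exp_deriv_def by (rule jet_summable_smooth[OF exp_deriv_jet_summable])

lemma partials_exp_deriv:
  "partials js (exp_deriv A l t i j) x = (\<Sum>k. partials js (mat_power A (k + l) i j) x / fact k * of_real t ^ k)"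
proof -
  show ?thesis unfolding exp_deriv_def jet_summable_partials(2)[OF exp_deriv_jet_summable] partials_exp_term ..
qed

lemma exp_deriv_derivative:
  "((\<lambda>t. partials js (exp_deriv A l t i j) x) has_vector_derivative partials js (exp_deriv A (Suc l) t i j) x) (at t within S)"
proof -
  let ?p = "\<lambda>k. partials js (mat_power A k i j) x"
  let ?c = "\<lambda>k. ?p (k + l) / fact k"
  have summ: "summable (\<lambda>k. ?c k * of_real s ^ k)" for s
    using jet_summable_summable[OF jet_summable_partials(1)[OF exp_deriv_jet_summable[of l i j s], of js], of x]
    unfolding partials_exp_term .
  have "((\<lambda>z. \<Sum>k. ?c k * z ^ k) has_field_derivative (\<Sum>k. diffs ?c k * of_real t ^ k)) (at (of_real t :: complex))"
    by (rule termdiffs_strong[OF summ[of "\<bar>t\<bar> + 1"]]) simp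
  then have "((\<lambda>t. \<Sum>k. ?c k * of_real t ^ k) has_vector_derivative (\<Sum>k. diffs ?c k * of_real t ^ k)) (at t within S)"
    by (rule has_vector_derivative_real_field)
  moreover have "diffs ?c k = ?p (k + Suc l) / fact k" for k
    by (simp add: diffs_def field_simps del: of_nat_Suc)
  ultimately show ?thesis unfolding partials_exp_deriv by simp
qed

lemma exp_deriv_0: "exp_deriv A 0 0 i j x = (if i = j then 1 else 0)"
  unfolding exp_deriv_def using powser_zero[of "\<lambda>k. mat_power A (k + 0) i j x / fact k"] by simp

lemma exp_deriv_summable: "summable (\<lambda>k. mat_power A (k + l) i j x / fact k * of_real t ^ k)"
  by (rule jet_summable_summable[OF exp_deriv_jet_summable])

lemma exp_deriv_Suc: "exp_deriv A (Suc l) t i j = (\<lambda>x. \<Sum>m\<in>UNIV. A i m x * exp_deriv A l t m j x)"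
proof
  fix x
  have "exp_deriv A (Suc l) t i j x = (\<Sum>k. \<Sum>m\<in>UNIV. A i m x * (mat_power A (k + l) m j x / fact k * of_real t ^ k))"
    unfolding exp_deriv_def by (simp add: sum_distrib_right sum_divide_distrib mult.assoc)
  also have "\<dots> = (\<Sum>m\<in>UNIV. \<Sum>k. A i m x * (mat_power A (k + l) m j x / fact k * of_real t ^ k))"
    by (rule suminf_sum) (intro summable_mult exp_deriv_summable)
  also have "\<dots> = (\<Sum>m\<in>UNIV. A i m x * exp_deriv A l t m j x)"
    unfolding exp_deriv_def by (intro sum.cong refl suminf_mult exp_deriv_summable)
  finally show "exp_deriv A (Suc l) t i j x = (\<Sum>m\<in>UNIV. A i m x * exp_deriv A l t m j x)" .
qed

lemma exp_deriv_Suc_right: "exp_deriv A (Suc l) t i j x = (\<Sum>m\<in>UNIV. exp_deriv A l t i m x * A m j x)"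
proof -
  have "exp_deriv A (Suc l) t i j x = (\<Sum>k. \<Sum>m\<in>UNIV. (mat_power A (k + l) i m x / fact k * of_real t ^ k) * A m j x)"
    unfolding exp_deriv_def add_Suc_right mat_power_Suc_right sum_divide_distrib sum_distrib_right by (simp add: mult_ac)
  also have "\<dots> = (\<Sum>m\<in>UNIV. \<Sum>k. (mat_power A (k + l) i m x / fact k * of_real t ^ k) * A m j x)"
    by (rule suminf_sum) (intro summable_mult2 exp_deriv_summable)
  also have "\<dots> = (\<Sum>m\<in>UNIV. exp_deriv A l t i m x * A m j x)"
    unfolding exp_deriv_def by (intro sum.cong refl suminf_mult2[symmetric] exp_deriv_summable)
  finally show ?thesis .
qed

abbreviation E :: "real \<Rightarrow> 'm \<Rightarrow> 'm \<Rightarrow> real^'n \<Rightarrow> complex" where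
  "E \<equiv> exp_deriv A 0"

lemma E_derivative: "((\<lambda>t. E t i j x) has_vector_derivative (\<Sum>l\<in>UNIV. A i l x * E t l j x)) (at t within S)"
  and E_derivative_right: "((\<lambda>t. E t i j x) has_vector_derivative (\<Sum>l\<in>UNIV. E t i l x * A l j x)) (at t within S)"
  using exp_deriv_derivative[of "[]" 0 i j x t S] exp_deriv_Suc_right[of 0 t i j x] by (simp_all add: exp_deriv_Suc)

text \<open>The function \<open>s \<mapsto> exp ((t - s) A) Y(s)\<close> has the derivative \<open>exp ((t - s) A) R(s)\<close>; the mean value inequality
  replaces Duhamel's integral.\<close>

lemma variation_of_constants:
  assumes t: "0 \<le> t"
    and Y: "\<And>s i. s \<in> {0..t} \<Longrightarrow> ((\<lambda>s. Y s i) has_vector_derivative (\<Sum>l\<in>UNIV. A i l x * Y s l) + R s i) (at s within {0..t})"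
    and Q: "\<And>s. s \<in> {0..t} \<Longrightarrow> norm (\<Sum>l\<in>UNIV. E (t - s) i l x * R s l) \<le> Q"
  shows "norm (Y t i - (\<Sum>l\<in>UNIV. E t i l x * Y 0 l)) \<le> Q * t"
proof -
  \<comment> \<open>interpolates between the homogeneous solution at \<open>s = 0\<close> and \<open>Y t\<close> at \<open>s = t\<close>\<close>
  define Z where "Z s = (\<Sum>l\<in>UNIV. E (t - s) i l x * Y s l)" for s
  have dE: "((\<lambda>s. E (t - s) i l x) has_vector_derivative - (\<Sum>m\<in>UNIV. E (t - s) i m x * A m l x)) (at s within {0..t})" for l s
  proof -
    have "((\<lambda>s. t - s) has_vector_derivative - 1) (at s within {0..t})"
      by (auto intro!: derivative_eq_intros)
    from vector_diff_chain_within[OF this E_derivative_right]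
    show ?thesis by (simp add: o_def)
  qed
  have dZ: "(Z has_vector_derivative (\<Sum>l\<in>UNIV. E (t - s) i l x * R s l)) (at s within {0..t})" if s: "s \<in> {0..t}" for s
  proof -
    have "(Z has_vector_derivative (\<Sum>l\<in>UNIV. E (t - s) i l x * ((\<Sum>m\<in>UNIV. A l m x * Y s m) + R s l)
        + (- (\<Sum>m\<in>UNIV. E (t - s) i m x * A m l x)) * Y s l)) (at s within {0..t})"
      unfolding Z_def[abs_def] by (intro has_vector_derivative_sum has_vector_derivative_mult dE Y[OF s])
    moreover have "(\<Sum>l\<in>UNIV. E (t - s) i l x * ((\<Sum>m\<in>UNIV. A l m x * Y s m) + R s l)
        + (- (\<Sum>m\<in>UNIV. E (t - s) i m x * A m l x)) * Y s l)
      = (\<Sum>l\<in>UNIV. \<Sum>m\<in>UNIV. E (t - s) i l x * (A l m x * Y s m)) + (\<Sum>l\<in>UNIV. E (t - s) i l x * R s l)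
        - (\<Sum>l\<in>UNIV. \<Sum>m\<in>UNIV. E (t - s) i m x * (A m l x * Y s l))"
      by (simp add: distrib_left sum.distrib sum_subtractf sum_distrib_left sum_distrib_right mult.assoc)
    moreover have "(\<Sum>l\<in>UNIV. \<Sum>m\<in>UNIV. E (t - s) i m x * (A m l x * Y s l)) = (\<Sum>l\<in>UNIV. \<Sum>m\<in>UNIV. E (t - s) i l x * (A l m x * Y s m))"
      by (rule sum.swap)
    ultimately show ?thesis by simp
  qed
  have "norm (Z t - Z 0) \<le> Q * \<bar>t - 0\<bar>"
    by (rule vector_mvt_bound[OF dZ Q]) (use t in auto)
  moreover have "Z t = Y t i"
  proof -
    have "Z t = (\<Sum>l\<in>UNIV. if i = l then Y t l else 0)"
      unfolding Z_def by (intro sum.cong refl) (simp add: exp_deriv_0)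
    then show ?thesis by simp
  qed
  ultimately show ?thesis using t by (simp add: Z_def)
qed

text \<open>Both sides solve the same linear equation in \<open>s\<close>, and they agree at \<open>s = 0\<close>.\<close>

lemma E_add:
  assumes "0 \<le> s" "0 \<le> r" shows "E (s + r) i j x = (\<Sum>k\<in>UNIV. E s i k x * E r k j x)"
proof -
  define Y where "Y s l = E (s + r) l j x - (\<Sum>k\<in>UNIV. E s l k x * E r k j x)" for s l
  have Y': "((\<lambda>s. Y s l) has_vector_derivative (\<Sum>m\<in>UNIV. A l m x * Y u m) + 0) (at u within {0..s})" for u l
  proof -
    have 1: "((\<lambda>u. E (u + r) l j x) has_vector_derivative (\<Sum>m\<in>UNIV. A l m x * E (u + r) m j x)) (at u within {0..s})"
    proof -
      have "((\<lambda>u. u + r) has_vector_derivative 1) (at u within {0..s})" by (auto intro!: derivative_eq_intros)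
      from vector_diff_chain_within[OF this E_derivative] show ?thesis by (simp add: o_def)
    qed
    have 2: "((\<lambda>u. \<Sum>k\<in>UNIV. E u l k x * E r k j x) has_vector_derivative (\<Sum>k\<in>UNIV. (\<Sum>m\<in>UNIV. A l m x * E u m k x) * E r k j x)) (at u within {0..s})"
      by (intro has_vector_derivative_sum has_vector_derivative_mult_left E_derivative)
    have "(\<Sum>k\<in>UNIV. (\<Sum>m\<in>UNIV. A l m x * E u m k x) * E r k j x) = (\<Sum>m\<in>UNIV. A l m x * (\<Sum>k\<in>UNIV. E u m k x * E r k j x))"
      by (simp add: sum_distrib_left sum_distrib_right mult.assoc) (rule sum.swap)
    with has_vector_derivative_diff[OF 1 2] show ?thesis
      unfolding Y_def by (simp add: right_diff_distrib sum_subtractf)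
  qed
  have "Y 0 l = 0" for l
  proof -
    have "(\<Sum>k\<in>UNIV. E 0 l k x * E r k j x) = (\<Sum>k\<in>UNIV. if l = k then E r k j x else 0)"
      by (intro sum.cong refl) (simp add: exp_deriv_0)
    then show ?thesis by (simp add: Y_def)
  qed
  then have "norm (Y s i) \<le> 0 * s"
    using variation_of_constants[OF assms(1), of Y x "\<lambda>_ _. 0" i 0] Y' by simp
  then show ?thesis by (simp add: Y_def)
qed

end

section \<open>Products of shifted matrices annihilating a vector\<close>

definition shift_op :: "complex^'m^'m::finite \<Rightarrow> complex^'m \<Rightarrow> complex \<Rightarrow> complex^'m" where
  "shift_op B v z = B *v v - z *s v"

definition mat_iter :: "complex^'m^'m::finite \<Rightarrow> nat \<Rightarrow> complex^'m \<Rightarrow> complex^'m" where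
  "mat_iter B k = ((\<lambda>w. B *v w) ^^ k)"

text \<open>The vector \<open>p(B) v\<close>.\<close>

definition poly_act :: "complex^'m^'m::finite \<Rightarrow> complex poly \<Rightarrow> complex^'m \<Rightarrow> complex^'m" where
  "poly_act B p v = (\<Sum>k\<le>degree p. coeff p k *s mat_iter B k v)"

lemma mat_iter_simps [simp]: "mat_iter B 0 v = v" "mat_iter B (Suc k) v = B *v mat_iter B k v"
  by (simp_all add: mat_iter_def)

lemma mat_iter_shift: "mat_iter B k (shift_op B v z) = mat_iter B (Suc k) v - z *s mat_iter B k v"
  by (induction k) (simp_all add: shift_op_def matrix_vector_mult_diff_distrib vector_scalar_commute)

lemma poly_act_degree_le:
  assumes "degree p \<le> N" shows "poly_act B p v = (\<Sum>k\<le>N. coeff p k *s mat_iter B k v)"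
  unfolding poly_act_def using assms
  by (intro sum.mono_neutral_left) (auto simp: coeff_eq_0)

lemma poly_act_linear_factor: "poly_act B ([:- z, 1:] * q) v = poly_act B q (shift_op B v z)"
proof -
  define n where "n = degree q"
  let ?f = "\<lambda>k. mat_iter B k v"
  have "degree ([:- z, 1:] * q) \<le> Suc n" using degree_mult_le[of "[:- z, 1:]" q] by (simp add: n_def)
  then have "poly_act B ([:- z, 1:] * q) v = (\<Sum>k\<le>Suc n. coeff ([:- z, 1:] * q) k *s ?f k)" by (rule poly_act_degree_le)
  also have "\<dots> = (\<Sum>k\<le>Suc n. (- z * coeff q k) *s ?f k) + (\<Sum>k\<le>Suc n. (case k of 0 \<Rightarrow> 0 | Suc j \<Rightarrow> coeff q j) *s ?f k)"
    by (simp add: coeff_pCons vector_sadd_rdistrib flip: sum.distrib split: nat.split) 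
  also have "(\<Sum>k\<le>Suc n. (- z * coeff q k) *s ?f k) = (\<Sum>k\<le>n. (- z * coeff q k) *s ?f k)"
    by (simp add: n_def coeff_eq_0)
  also have "(\<Sum>k\<le>Suc n. (case k of 0 \<Rightarrow> 0 | Suc j \<Rightarrow> coeff q j) *s ?f k) = (\<Sum>k\<le>n. coeff q k *s ?f (Suc k))"
    by (subst sum.atMost_Suc_shift) simp
  also have "(\<Sum>k\<le>n. (- z * coeff q k) *s ?f k) + (\<Sum>k\<le>n. coeff q k *s ?f (Suc k)) = (\<Sum>k\<le>n. coeff q k *s mat_iter B k (shift_op B v z))"
    unfolding mat_iter_shift by (simp add: vec_eq_iff algebra_simps flip: sum.distrib)
  finally show ?thesis by (simp add: poly_act_def n_def)
qed

lemma shift_op_commute: "shift_op B (shift_op B v z) w = shift_op B (shift_op B v w) z"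
  by (simp add: shift_op_def matrix_vector_mult_diff_distrib vector_scalar_commute vec_eq_iff algebra_simps)

lemma foldl_shift_op_commute: "foldl (shift_op B) (shift_op B v z) zs = shift_op B (foldl (shift_op B) v zs) z"
  by (induction zs arbitrary: v) (simp_all add: shift_op_commute[of B _ z])

text \<open>Over the complex numbers \<open>p\<close> splits into linear factors; a factor that does not belong to an eigenvalue
  is injective on vectors, commutes with the others, and can be cancelled.\<close>

lemma poly_act_annihilates:
  assumes "p \<noteq> 0" "poly_act B p v = 0"
  shows "\<exists>zs. length zs \<le> degree p \<and> set zs \<subseteq> spectrum B \<and> foldl (shift_op B) v zs = 0"
  using assms
proof (induction "degree p" arbitrary: p v)
  case 0
  then obtain c where "p = [:c:]" using degree_eq_zeroE by metis
  then have "v = 0" using 0 by (simp add: poly_act_def vec_eq_iff)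
  then show ?case by (intro exI[of _ "[]"]) simp
next
  case (Suc n)
  then have "\<not> constant (poly p)" by (simp add: constant_degree)
  then obtain z where "poly p z = 0" using fundamental_theorem_of_algebra by blast
  then obtain q where p: "p = [:- z, 1:] * q" by (auto simp: poly_eq_0_iff_dvd dvd_def)
  have q: "q \<noteq> 0" using Suc.prems p by auto
  then have deg: "degree p = Suc (degree q)" unfolding p by (subst degree_mult_eq) auto
  have "poly_act B q (shift_op B v z) = 0" using Suc.prems(2) unfolding p poly_act_linear_factor .
  then obtain zs where zs: "length zs \<le> degree q" "set zs \<subseteq> spectrum B" "foldl (shift_op B) (shift_op B v z) zs = 0"
    using Suc.hyps(1)[of q] Suc.hyps(2) deg q by auto
  show ?case
  proof (cases "z \<in> spectrum B")
    case True
    then show ?thesis using zs deg by (intro exI[of _ "z # zs"]) auto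
  next
    case False
    have "shift_op B (foldl (shift_op B) v zs) z = 0" using zs(3) by (simp add: foldl_shift_op_commute)
    then have "foldl (shift_op B) v zs = 0" using False unfolding spectrum_def shift_op_def by auto
    then show ?thesis using zs deg by (intro exI[of _ zs]) auto
  qed
qed

text \<open>The iterates \<open>v, B v, B\<^sup>2 v, \<dots>\<close> up to the real dimension of the space are linearly dependent. The point is
  the bound on the number of factors, which has to be the same for all frequencies.\<close>

lemma vector_annihilated:
  fixes B :: "complex^'m^'m::finite"
  shows "\<exists>zs. length zs \<le> DIM(complex^'m) \<and> set zs \<subseteq> spectrum B \<and> foldl (shift_op B) v zs = 0"
proof -
  let ?D = "DIM(complex^'m)"
  let ?f = "\<lambda>k. mat_iter B k v"
  have "\<exists>c. (\<exists>k\<le>?D. c k \<noteq> 0) \<and> (\<Sum>k\<le>?D. c k *s ?f k) = 0"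
  proof (cases "inj_on ?f {..?D}")
    case True
    have "\<not> independent (?f ` {..?D})"
    proof
      assume "independent (?f ` {..?D})"
      then have "card (?f ` {..?D}) \<le> ?D" by (rule independent_bound[THEN conjunct2])
      moreover have "card (?f ` {..?D}) = Suc ?D" by (subst card_image[OF True]) (rule card_atMost)
      ultimately show False by linarith
    qed
    then obtain u where u: "\<exists>w\<in>?f ` {..?D}. u w \<noteq> 0" "(\<Sum>w\<in>?f ` {..?D}. u w *\<^sub>R w) = 0"
      using dependent_finite[of "?f ` {..?D}"] by auto
    have "(\<Sum>k\<le>?D. complex_of_real (u (?f k)) *s ?f k) = (\<Sum>w\<in>?f ` {..?D}. u w *\<^sub>R w)"
      by (subst sum.reindex[OF True]) (simp add: vec_eq_iff scaleR_conv_of_real[where 'a = complex])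
    then show ?thesis using u by (intro exI[of _ "\<lambda>k. complex_of_real (u (?f k))"]) auto
  next
    case False
    then obtain i j where ij: "i \<le> ?D" "j \<le> ?D" "i \<noteq> j" "?f i = ?f j" by (auto simp: inj_on_def)
    let ?c = "\<lambda>k. (if k = i then 1 else 0) - (if k = j then 1 else (0 :: complex))"
    have "(\<Sum>k\<le>?D. ?c k *s ?f k) = (\<Sum>k\<le>?D. (if k = i then ?f k else 0) - (if k = j then ?f k else 0))"
      by (intro sum.cong refl) (auto simp: vec_eq_iff)
    also have "\<dots> = 0" using ij by (simp add: sum_subtractf)
    finally show ?thesis using ij by (intro exI[of _ ?c]) auto
  qed
  then obtain c where c: "\<exists>k\<le>?D. c k \<noteq> 0" "(\<Sum>k\<le>?D. c k *s ?f k) = 0" by blast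
  \<comment> \<open>the linear relation read as a polynomial\<close>
  define p where "p = (\<Sum>k\<le>?D. monom (c k) k)"
  have cp: "coeff p k = (if k \<le> ?D then c k else 0)" for k
    by (simp add: p_def coeff_sum)
  have deg: "degree p \<le> ?D" by (rule degree_le) (simp add: cp)
  have "p \<noteq> 0"
  proof
    assume "p = 0"
    then have "c k = 0" if "k \<le> ?D" for k using cp[of k] that by simp
    then show False using c(1) by blast
  qed
  moreover have "poly_act B p v = 0" using c(2) by (simp add: poly_act_degree_le[OF deg] cp)
  ultimately obtain zs where "length zs \<le> degree p" "set zs \<subseteq> spectrum B" "foldl (shift_op B) v zs = 0"
    using poly_act_annihilates by blast
  then show ?thesis using order_trans[OF _ deg, of "length zs"] by blast
qed

lemma norm_vector_scalar: "norm (c *s v) = norm c * norm (v :: complex^'m::finite)"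
  by (simp add: norm_vec_def norm_mult L2_set_right_distrib)

section \<open>Polynomial growth of the exponential and its derivatives\<close>

text \<open>Polynomial growth that is uniform in a parameter.\<close>

definition tame :: "'s set \<Rightarrow> ('s \<Rightarrow> real^'n::finite \<Rightarrow> real) \<Rightarrow> bool" where
  "tame S f \<longleftrightarrow> (\<exists>N B. 0 \<le> B \<and> (\<forall>s\<in>S. \<forall>x. f s x \<le> B * (1 + norm x) ^ N))"

lemma tame_mono: "tame S g \<Longrightarrow> (\<And>s x. s \<in> S \<Longrightarrow> f s x \<le> g s x) \<Longrightarrow> tame S f"
  unfolding tame_def by (meson order_trans)

lemma tame_const: "tame S (\<lambda>s x. c)"
  unfolding tame_def by (intro exI[of _ 0] exI[of _ "\<bar>c\<bar>"]) auto

lemma tame_add: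
  assumes "tame S f" "tame S g" shows "tame S (\<lambda>s x. f s x + g s x)"
proof -
  obtain N B M C where *: "0 \<le> B" "\<And>s x. s \<in> S \<Longrightarrow> f s x \<le> B * (1 + norm x) ^ N" "0 \<le> C" "\<And>s x. s \<in> S \<Longrightarrow> g s x \<le> C * (1 + norm x) ^ M"
    using assms unfolding tame_def by blast
  have "f s x + g s x \<le> (B + C) * (1 + norm x) ^ (N + M)" if "s \<in> S" for s x
  proof -
    have "f s x + g s x \<le> B * (1 + norm x) ^ (N + M) + C * (1 + norm x) ^ (N + M)"
      using that * by (intro add_mono order_trans[OF *(2)] order_trans[OF *(4)] mult_left_mono one_plus_norm_power_mono) auto
    then show ?thesis by (simp add: distrib_right)
  qed
  then show ?thesis unfolding tame_def using * by (intro exI[of _ "N + M"] exI[of _ "B + C"]) auto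
qed

lemma tame_mult:
  assumes "tame S f" "tame S g" "\<And>s x. s \<in> S \<Longrightarrow> 0 \<le> f s x" "\<And>s x. s \<in> S \<Longrightarrow> 0 \<le> g s x"
  shows "tame S (\<lambda>s x. f s x * g s x)"
proof -
  obtain N B M C where *: "0 \<le> B" "\<And>s x. s \<in> S \<Longrightarrow> f s x \<le> B * (1 + norm x) ^ N" "0 \<le> C" "\<And>s x. s \<in> S \<Longrightarrow> g s x \<le> C * (1 + norm x) ^ M"
    using assms unfolding tame_def by blast
  have "f s x * g s x \<le> (B * C) * (1 + norm x) ^ (N + M)" if "s \<in> S" for s x
  proof -
    have "f s x * g s x \<le> (B * (1 + norm x) ^ N) * (C * (1 + norm x) ^ M)"
      using that * assms by (intro mult_mono) auto
    then show ?thesis by (simp add: power_add mult_ac)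
  qed
  then show ?thesis unfolding tame_def using * by (intro exI[of _ "N + M"] exI[of _ "B * C"]) auto
qed

lemma tame_sum: "finite I \<Longrightarrow> (\<And>i. i \<in> I \<Longrightarrow> tame S (f i)) \<Longrightarrow> tame S (\<lambda>s x. \<Sum>i\<in>I. f i s x)"
  by (induction I rule: finite_induct) (auto intro: tame_add tame_const)

lemma tame_power: "tame S f \<Longrightarrow> (\<And>s x. s \<in> S \<Longrightarrow> 0 \<le> f s x) \<Longrightarrow> tame S (\<lambda>s x. f s x ^ k)"
proof (induction k)
  case 0
  then show ?case by (simp add: tame_const)
next
  case (Suc k)
  then show ?case by (auto intro!: tame_mult)
qed

lemma tame_jet: "g \<in> O_M \<Longrightarrow> tame S (\<lambda>s. jet_norm K g)"
  unfolding tame_def by (rule O_M_jet_bound[of g K]) blast+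

text \<open>A logarithmic bound in the exponent is a power of \<open>1 + |x|\<close>.\<close>

lemma tame_exp_log:
  assumes "0 \<le> C" "0 \<le> T" shows "tame {0..T} (\<lambda>t (x :: real^'n::finite). exp (C * (1 + ln (1 + norm x)) * t))"
  unfolding tame_def
proof (intro exI conjI ballI allI)
  let ?N = "nat \<lceil>C * T\<rceil>"
  show "0 \<le> exp (C * T)" by simp
  fix t and x :: "real^'n" assume t: "t \<in> {0..T}"
  have ln: "0 \<le> ln (1 + norm x)" by (rule ln_ge_zero) simp
  have "exp (C * (1 + ln (1 + norm x)) * t) \<le> exp (C * (1 + ln (1 + norm x)) * T)"
    using t assms ln by (intro iffD2[OF exp_le_cancel_iff] mult_left_mono mult_nonneg_nonneg) auto
  also have "\<dots> = exp (C * T) * (1 + norm x) powr (C * T)"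
    by (simp add: powr_def algebra_simps flip: exp_add)
  also have "(1 + norm x) powr (C * T) \<le> (1 + norm x) powr (real ?N)"
    by (intro powr_mono) (use one_plus_norm_ge_1 in \<open>simp_all add: real_nat_ceiling_ge\<close>)
  also have "\<dots> = (1 + norm x) ^ ?N" by (rule powr_realpow) simp
  finally show "exp (C * (1 + ln (1 + norm x)) * t) \<le> exp (C * T) * (1 + norm x) ^ ?N" by simp
qed

context multiplier_matrix
begin

definition sym_mat :: "real^'n \<Rightarrow> complex^'m^'m" where
  "sym_mat x = (\<chi> i j. A i j x)"

lemma jet_norm_0: "jet_norm 0 f x = norm (f x)"
  by (simp add: jet_norm_def)

lemma sym_mat_norm: "norm (sym_mat x *v w) \<le> total 0 x * norm w"
proof -
  have "norm (sym_mat x *v w) \<le> (\<Sum>i\<in>UNIV. norm ((sym_mat x *v w) $ i))"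
    by (simp add: norm_vec_def L2_set_le_sum)
  also have "\<dots> \<le> (\<Sum>i\<in>UNIV. \<Sum>j\<in>UNIV. norm (A i j x) * norm w)"
  proof (rule sum_mono)
    fix i
    have "norm ((sym_mat x *v w) $ i) \<le> (\<Sum>j\<in>UNIV. norm (A i j x * w $ j))"
      unfolding sym_mat_def matrix_vector_mult_def by (simp add: norm_sum)
    also have "\<dots> \<le> (\<Sum>j\<in>UNIV. norm (A i j x) * norm w)"
      unfolding norm_mult by (intro sum_mono mult_left_mono Finite_Cartesian_Product.norm_nth_le) auto
    finally show "norm ((sym_mat x *v w) $ i) \<le> (\<Sum>j\<in>UNIV. norm (A i j x) * norm w)" .
  qed
  finally show ?thesis by (simp add: total_def jet_norm_0 sum_distrib_right)
qed

lemma spectrum_norm: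
  assumes "\<mu> \<in> spectrum (sym_mat x)" shows "norm \<mu> \<le> total 0 x"
proof -
  obtain v where v: "v \<noteq> 0" "sym_mat x *v v = \<mu> *s v" using assms by (auto simp: spectrum_def)
  have "norm \<mu> * norm v \<le> total 0 x * norm v" using sym_mat_norm[of x v] by (simp add: v norm_vector_scalar)
  then show ?thesis using v by simp
qed

text \<open>The vector \<open>exp (t A(x)) v\<close>.\<close>

definition flow :: "real^'n \<Rightarrow> complex^'m \<Rightarrow> real \<Rightarrow> 'm \<Rightarrow> complex" where
  "flow x v t i = (\<Sum>j\<in>UNIV. E t i j x * v $ j)"

lemma flow_derivative:
  "((\<lambda>t. flow x v t i) has_vector_derivative z * flow x v t i + flow x (shift_op (sym_mat x) v z) t i) (at t within S)"
proof -
  have "((\<lambda>t. flow x v t i) has_vector_derivative (\<Sum>j\<in>UNIV. (\<Sum>l\<in>UNIV. E t i l x * A l j x) * v $ j)) (at t within S)"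
    unfolding flow_def by (intro has_vector_derivative_sum has_vector_derivative_mult_left E_derivative_right)
  moreover have "(\<Sum>j\<in>UNIV. (\<Sum>l\<in>UNIV. E t i l x * A l j x) * v $ j) = (\<Sum>l\<in>UNIV. E t i l x * (sym_mat x *v v) $ l)"
    unfolding sym_mat_def matrix_vector_mult_def
    by (simp add: sum_distrib_left sum_distrib_right mult.assoc) (rule sum.swap)
  moreover have "\<dots> = z * flow x v t i + flow x (shift_op (sym_mat x) v z) t i"
    unfolding flow_def shift_op_def
    by (simp add: right_diff_distrib sum_subtractf sum_distrib_left mult_ac)
  ultimately show ?thesis by simp
qed

text \<open>Along the chain \<open>v, (A - \<mu>\<^sub>1) v, (A - \<mu>\<^sub>2) (A - \<mu>\<^sub>1) v, \<dots>, 0\<close> the flows \<open>y\<^sub>k\<close> satisfy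
  \<open>y\<^sub>k' = \<mu>\<^sub>k y\<^sub>k + y\<^sub>k\<^sub>+\<^sub>1\<close>. Starting from the last one, which is zero, they are estimated backwards; each step
  costs a factor \<open>1 + 2 |A| T\<close>.\<close>

lemma flow_bound:
  assumes "foldl (shift_op (sym_mat x)) v zs = 0" "\<And>\<mu>. \<mu> \<in> set zs \<Longrightarrow> Re \<mu> \<le> \<beta> \<and> norm \<mu> \<le> total 0 x"
    "t \<in> {0..T}"
  shows "norm (flow x v t i) \<le> exp (\<beta> * t) * (1 + 2 * total 0 x * T) ^ length zs * norm v"
  using assms
proof (induction zs arbitrary: v t)
  case Nil
  then show ?case by (simp add: flow_def)
next
  case (Cons \<mu> zs)
  let ?w = "shift_op (sym_mat x) v \<mu>"
  let ?b = "total 0 x"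
  define K where "K = (1 + 2 * ?b * T) ^ length zs"
  have T: "0 \<le> T" "0 \<le> t" "t \<le> T" using Cons.prems by auto
  have K: "1 \<le> K" unfolding K_def by (rule one_le_power) (simp add: T)
  have \<mu>: "Re \<mu> \<le> \<beta>" "norm \<mu> \<le> ?b" using Cons.prems by auto
  have "norm ?w \<le> norm (sym_mat x *v v) + norm (\<mu> *s v)" unfolding shift_op_def by (rule norm_triangle_ineq4)
  also have "\<dots> \<le> ?b * norm v + ?b * norm v"
    unfolding norm_vector_scalar by (intro add_mono sym_mat_norm mult_right_mono \<mu>) auto
  finally have w: "norm ?w \<le> 2 * ?b * norm v" by (simp add: algebra_simps)
  have IH: "norm (flow x ?w s i) \<le> exp (\<beta> * s) * K * (2 * ?b * norm v)" if "s \<in> {0..T}" for s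
  proof -
    have "norm (flow x ?w s i) \<le> exp (\<beta> * s) * (1 + 2 * ?b * T) ^ length zs * norm ?w"
      using Cons.prems that by (intro Cons.IH) auto
    also have "\<dots> \<le> exp (\<beta> * s) * K * (2 * ?b * norm v)"
      unfolding K_def by (intro mult_left_mono w) (simp add: T)
    finally show ?thesis .
  qed
  \<comment> \<open>the integrating factor removes the term \<open>\<mu> y\<close>\<close>
  define u where "u s = exp (- \<mu> * of_real s) * flow x v s i" for s
  have du: "(u has_vector_derivative exp (- \<mu> * of_real s) * flow x ?w s i) (at s within {0..t})" for s
  proof -
    have "((\<lambda>z. exp (- \<mu> * z)) has_field_derivative - \<mu> * exp (- \<mu> * of_real s)) (at (of_real s))"
      by (auto intro!: derivative_eq_intros)
    then have "((\<lambda>s. exp (- \<mu> * of_real s)) has_vector_derivative - \<mu> * exp (- \<mu> * of_real s)) (at s within {0..t})"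
      by (rule has_vector_derivative_real_field)
    from has_vector_derivative_mult[OF this flow_derivative[of x v i \<mu> s "{0..t}"]]
    show ?thesis unfolding u_def[abs_def] by (simp add: algebra_simps)
  qed
  have ne: "norm (exp (- \<mu> * of_real s)) = exp (- Re \<mu> * s)" for s by (simp add: norm_exp_eq_Re)
  have "norm (u t - u 0) \<le> (exp ((\<beta> - Re \<mu>) * t) * K * (2 * ?b * norm v)) * \<bar>t - 0\<bar>"
  proof (rule vector_mvt_bound[OF du])
    fix s assume s: "s \<in> {0..t}"
    have "norm (exp (- \<mu> * of_real s) * flow x ?w s i) \<le> exp (- Re \<mu> * s) * (exp (\<beta> * s) * K * (2 * ?b * norm v))"
      unfolding norm_mult ne using s T by (intro mult_left_mono IH) auto
    also have "\<dots> = (exp (- Re \<mu> * s) * exp (\<beta> * s)) * (K * (2 * ?b * norm v))"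
      by (simp only: mult.assoc)
    also have "exp (- Re \<mu> * s) * exp (\<beta> * s) = exp ((\<beta> - Re \<mu>) * s)"
      by (simp add: left_diff_distrib flip: exp_add)
    also have "exp ((\<beta> - Re \<mu>) * s) * (K * (2 * ?b * norm v)) \<le> exp ((\<beta> - Re \<mu>) * t) * (K * (2 * ?b * norm v))"
      using s \<mu> K by (intro mult_right_mono iffD2[OF exp_le_cancel_iff] mult_left_mono mult_nonneg_nonneg) auto
    finally show "norm (exp (- \<mu> * of_real s) * flow x ?w s i) \<le> exp ((\<beta> - Re \<mu>) * t) * K * (2 * ?b * norm v)" by (simp add: mult.assoc)
  qed (use T in auto)
  moreover have "norm (u 0) \<le> norm v"
  proof -
    have delta: "(\<Sum>j\<in>UNIV. (if i = j then 1 else 0) * v $ j) = (\<Sum>j\<in>UNIV. if i = j then v $ j else 0)"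
      by (intro sum.cong refl) simp
    have "u 0 = v $ i" unfolding u_def flow_def exp_deriv_0 delta by simp
    then show ?thesis by (simp add: Finite_Cartesian_Product.norm_nth_le)
  qed
  ultimately have ut: "norm (u t) \<le> norm v + (exp ((\<beta> - Re \<mu>) * t) * K * (2 * ?b * norm v)) * t"
    using norm_triangle_ineq2[of "u t" "u 0"] T by simp
  have "flow x v t i = exp (\<mu> * of_real t) * u t"
    unfolding u_def mult.assoc[symmetric] exp_add[symmetric] by simp
  then have "norm (flow x v t i) = exp (Re \<mu> * t) * norm (u t)"
    by (simp add: norm_mult norm_exp_eq_Re)
  also have "\<dots> \<le> exp (Re \<mu> * t) * (norm v + (exp ((\<beta> - Re \<mu>) * t) * K * (2 * ?b * norm v)) * t)"
    by (intro mult_left_mono ut) auto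
  also have "\<dots> = exp (Re \<mu> * t) * norm v + exp (\<beta> * t) * (K * (2 * ?b * t) * norm v)"
  proof -
    have e: "exp (Re \<mu> * t) * exp ((\<beta> - Re \<mu>) * t) = exp (\<beta> * t)"
      by (simp add: left_diff_distrib flip: exp_add)
    show ?thesis unfolding e[symmetric] distrib_left by (simp only: mult_ac)
  qed
  also have "\<dots> \<le> exp (\<beta> * t) * (K * norm v) + exp (\<beta> * t) * (K * (2 * ?b * T) * norm v)"
  proof (rule add_mono)
    have "exp (Re \<mu> * t) \<le> exp (\<beta> * t)" using \<mu> T by (simp add: mult_right_mono)
    moreover have "norm v \<le> K * norm v" using K mult_right_mono[of 1 K "norm v"] by simp
    ultimately show "exp (Re \<mu> * t) * norm v \<le> exp (\<beta> * t) * (K * norm v)" by (intro mult_mono) auto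
    show "exp (\<beta> * t) * (K * (2 * ?b * t) * norm v) \<le> exp (\<beta> * t) * (K * (2 * ?b * T) * norm v)"
      using T K by (intro mult_left_mono mult_right_mono) auto
  qed
  also have "\<dots> = exp (\<beta> * t) * (1 + 2 * ?b * T) ^ length (\<mu> # zs) * norm v"
    by (simp add: K_def algebra_simps)
  finally show ?case .
qed

lemma E_spectral_bound:
  assumes "\<And>\<mu>. \<mu> \<in> spectrum (sym_mat x) \<Longrightarrow> Re \<mu> \<le> \<beta>" "t \<in> {0..T}"
  shows "norm (E t i j x) \<le> exp (\<beta> * t) * (1 + 2 * total 0 x * T) ^ DIM(complex^'m)"
proof -
  obtain zs where zs: "length zs \<le> DIM(complex^'m)" "set zs \<subseteq> spectrum (sym_mat x)" "foldl (shift_op (sym_mat x)) (axis j 1) zs = 0"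
    using vector_annihilated by blast
  have "flow x (axis j 1) t i = (\<Sum>k\<in>UNIV. if j = k then E t i k x else 0)"
    unfolding flow_def by (intro sum.cong refl) (auto simp: axis_def)
  then have "norm (E t i j x) = norm (flow x (axis j 1) t i)" by simp
  also have "\<dots> \<le> exp (\<beta> * t) * (1 + 2 * total 0 x * T) ^ length zs * norm (axis j 1 :: complex^'m)"
    using zs assms spectrum_norm by (intro flow_bound) auto
  also have "\<dots> \<le> exp (\<beta> * t) * (1 + 2 * total 0 x * T) ^ DIM(complex^'m)"
    using zs assms(2) by (auto intro!: mult_left_mono power_increasing)
  finally show ?thesis .
qed

text \<open>Induction on the order of the derivatives: a derivative of order \<open>K + 1\<close> of the exponential solves
  \<open>Y' = A Y + R\<close>, where \<open>R\<close> contains at most \<open>K\<close> derivatives of the exponential. Variation of constants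
  bounds \<open>Y\<close> by the exponential itself and \<open>R\<close>, both of polynomial growth.\<close>

lemma tame_E:
  assumes C: "0 \<le> C" "\<And>x \<mu>. \<mu> \<in> spectrum (sym_mat x) \<Longrightarrow> Re \<mu> \<le> C * (1 + ln (1 + norm x))" and T: "0 \<le> T"
  shows "tame {0..T} (\<lambda>t. jet_norm K (E t i j))"
proof (induction K arbitrary: i j)
  case 0
  have "tame {0..T} (\<lambda>t x. exp (C * (1 + ln (1 + norm x)) * t) * (1 + 2 * total 0 x * T) ^ DIM(complex^'m))"
  proof (intro tame_mult tame_exp_log C T tame_power)
    have "tame {0..T} (\<lambda>t x. 1 + (2 * T) * total 0 x)"
      unfolding total_def by (intro tame_add tame_mult tame_const tame_sum tame_jet A sum_nonneg jet_norm_nonneg) (auto simp: T)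
    then show "tame {0..T} (\<lambda>t x. 1 + 2 * total 0 x * T)" by (simp add: mult_ac)
  qed (auto simp: T)
  then show ?case
  proof (rule tame_mono)
    fix t x assume "t \<in> {0..T}"
    then show "jet_norm 0 (E t i j) x \<le> exp (C * (1 + ln (1 + norm x)) * t) * (1 + 2 * total 0 x * T) ^ DIM(complex^'m)"
      unfolding jet_norm_0 by (intro E_spectral_bound C)
  qed
next
  case (Suc K)
  obtain NM BM where M: "0 \<le> BM" "\<And>t x. t \<in> {0..T} \<Longrightarrow> (\<Sum>k\<in>UNIV. \<Sum>l\<in>UNIV. jet_norm K (E t k l) x) \<le> BM * (1 + norm x) ^ NM"
  proof -
    have "tame {0..T} (\<lambda>t x. \<Sum>k\<in>UNIV. \<Sum>l\<in>UNIV. jet_norm K (E t k l) x)"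
      by (intro tame_sum Suc.IH finite)
    then show ?thesis using that unfolding tame_def by blast
  qed
  have Ele: "jet_norm K (E t k l) x \<le> BM * (1 + norm x) ^ NM" if "t \<in> {0..T}" for t k l x
  proof -
    have "jet_norm K (E t k l) x \<le> (\<Sum>l\<in>UNIV. jet_norm K (E t k l) x)" by (rule member_le_sum) auto
    also have "\<dots> \<le> (\<Sum>k\<in>UNIV. \<Sum>l\<in>UNIV. jet_norm K (E t k l) x)"
      by (rule member_le_sum[of k UNIV "\<lambda>k. \<Sum>l\<in>UNIV. jet_norm K (E t k l) x"]) (auto simp: sum_nonneg)
    finally show ?thesis using M(2)[OF that] by (rule order_trans)
  qed
  \<comment> \<open>\<open>m\<close> bounds the jets of order \<open>K\<close> of the exponential, \<open>r\<close> the inhomogeneity, \<open>q\<close> its image under the exponential\<close>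
  define m where "m x = BM * (1 + norm x) ^ NM" for x :: "real^'n"
  have m0: "0 \<le> m x" for x using M(1) by (simp add: m_def)
  define r where "r x = 2 ^ Suc K * (total (Suc K) x * m x)" for x
  have r0: "0 \<le> r x" for x unfolding r_def by (intro mult_nonneg_nonneg m0) auto
  define q where "q x = real CARD('m) * (m x * r x)" for x
  have bound: "jet_norm (Suc K) (E t i j) x \<le> list_count TYPE('n) (Suc K) * (real CARD('m) * m x + q x * T)"
    if t: "t \<in> {0..T}" for t x
  proof (rule jet_norm_le)
    fix js :: "'n list" assume js: "length js \<le> Suc K"
    define Y where "Y s k = partials js (E s k j) x" for s k
    \<comment> \<open>the commutator part of the Leibniz formula; it involves at most \<open>K\<close> derivatives of the exponential\<close>
    define R where "R s k = (\<Sum>l\<in>UNIV. partials js (\<lambda>x. A k l x * E s l j x) x - A k l x * partials js (E s l j) x)" for s k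
    have dY: "((\<lambda>s. Y s k) has_vector_derivative (\<Sum>l\<in>UNIV. A k l x * Y s l) + R s k) (at s within {0..t})" for s k
    proof -
      have "partials js (exp_deriv A (Suc 0) s k j) x = (\<Sum>l\<in>UNIV. partials js (\<lambda>x. A k l x * E s l j x) x)"
        unfolding exp_deriv_Suc by (subst partials_sum) (auto intro!: smooth_mult A_smooth exp_deriv_smooth)
      also have "\<dots> = (\<Sum>l\<in>UNIV. A k l x * Y s l) + R s k" by (simp add: R_def Y_def sum_subtractf)
      finally show ?thesis unfolding Y_def using exp_deriv_derivative[of js 0 k j x s "{0..t}"] by simp
    qed
    have Rb: "norm (R s k) \<le> r x" if s: "s \<in> {0..T}" for s k
    proof -
      have "norm (R s k) \<le> (\<Sum>l\<in>UNIV. 2 ^ Suc K * (jet_norm (Suc K) (A k l) x * m x))"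
        unfolding R_def
      proof (intro order_trans[OF norm_sum] sum_mono)
        fix l
        have "norm (partials js (\<lambda>x. A k l x * E s l j x) x - A k l x * partials js (E s l j) x)
          \<le> 2 ^ length js * (jet_norm (Suc K) (A k l) x * jet_norm K (E s l j) x)"
          by (rule partials_mult_commutator[OF A_smooth exp_deriv_smooth js])
        also have "\<dots> \<le> 2 ^ Suc K * (jet_norm (Suc K) (A k l) x * m x)"
          unfolding m_def using js by (intro mult_mono power_increasing mult_left_mono Ele s) auto
        finally show "norm (partials js (\<lambda>x. A k l x * E s l j x) x - A k l x * partials js (E s l j) x)
          \<le> 2 ^ Suc K * (jet_norm (Suc K) (A k l) x * m x)" .
      qed
      also have "\<dots> = 2 ^ Suc K * ((\<Sum>l\<in>UNIV. jet_norm (Suc K) (A k l) x) * m x)"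
        by (simp add: sum_distrib_left sum_distrib_right)
      also have "\<dots> \<le> r x" unfolding r_def by (intro mult_left_mono mult_right_mono row_le_total m0) auto
      finally show ?thesis .
    qed
    have Q: "norm (\<Sum>l\<in>UNIV. E (t - s) i l x * R s l) \<le> q x" if s: "s \<in> {0..t}" for s
    proof -
      have "norm (\<Sum>l\<in>UNIV. E (t - s) i l x * R s l) \<le> (\<Sum>l\<in>(UNIV :: 'm set). m x * r x)"
      proof (intro order_trans[OF norm_sum] sum_mono)
        fix l
        have "norm (E (t - s) i l x) \<le> m x"
          unfolding m_def using s t by (intro order_trans[OF jet_norm_ge_norm Ele]) auto
        moreover have "norm (R s l) \<le> r x" using s t by (intro Rb) auto
        ultimately show "norm (E (t - s) i l x * R s l) \<le> m x * r x"
          unfolding norm_mult by (intro mult_mono m0) auto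
      qed
      then show ?thesis by (simp add: q_def)
    qed
    have Y0: "norm (Y 0 l) \<le> 1" for l
    proof -
      have "E 0 l j = (\<lambda>x. if l = j then 1 else 0)" by (rule ext) (rule exp_deriv_0)
      then show ?thesis unfolding Y_def by (simp add: partials_const)
    qed
    have t0: "0 \<le> t" "t \<le> T" using t by auto
    have "norm (Y t i - (\<Sum>l\<in>UNIV. E t i l x * Y 0 l)) \<le> q x * t"
      by (rule variation_of_constants[OF t0(1) dY Q])
    moreover have "norm (\<Sum>l\<in>UNIV. E t i l x * Y 0 l) \<le> (\<Sum>l\<in>(UNIV :: 'm set). m x * 1)"
    proof (intro order_trans[OF norm_sum] sum_mono)
      fix l
      have "norm (E t i l x) \<le> m x" unfolding m_def by (intro order_trans[OF jet_norm_ge_norm Ele] t)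
      then show "norm (E t i l x * Y 0 l) \<le> m x * 1" unfolding norm_mult by (intro mult_mono Y0 m0) auto
    qed
    moreover have "norm (Y t i) \<le> norm (Y t i - (\<Sum>l\<in>UNIV. E t i l x * Y 0 l)) + norm (\<Sum>l\<in>UNIV. E t i l x * Y 0 l)"
      using norm_triangle_ineq[of "Y t i - (\<Sum>l\<in>UNIV. E t i l x * Y 0 l)" "\<Sum>l\<in>UNIV. E t i l x * Y 0 l"] by simp
    moreover have "q x * t \<le> q x * T"
      unfolding q_def using t0 by (intro mult_left_mono mult_nonneg_nonneg m0 r0) auto
    ultimately show "norm (partials js (E t i j) x) \<le> real CARD('m) * m x + q x * T" by (simp add: Y_def)
  qed
  have tm: "tame {0..T} (\<lambda>t. m)" unfolding tame_def m_def using M(1) by blast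
  have tr: "tame {0..T} (\<lambda>t. r)" unfolding r_def total_def
    by (intro tame_mult tm tame_const tame_sum tame_jet A sum_nonneg jet_norm_nonneg m0 mult_nonneg_nonneg) auto
  have "tame {0..T} (\<lambda>t x. list_count TYPE('n) (Suc K) * (real CARD('m) * m x + q x * T))"
    unfolding q_def by (intro tame_mult tame_add tame_const tm tr add_nonneg_nonneg mult_nonneg_nonneg m0 r0) (auto simp: T)
  then show ?case by (rule tame_mono) (rule bound)
qed

lemma tame_exp_deriv:
  assumes C: "0 \<le> C" "\<And>x \<mu>. \<mu> \<in> spectrum (sym_mat x) \<Longrightarrow> Re \<mu> \<le> C * (1 + ln (1 + norm x))" and T: "0 \<le> T"
  shows "tame {0..T} (\<lambda>t. jet_norm K (exp_deriv A l t i j))"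
proof (induction l arbitrary: i j)
  case 0
  show ?case by (rule tame_E[OF C T])
next
  case (Suc l)
  have "tame {0..T} (\<lambda>t x. \<Sum>m\<in>UNIV. (list_count TYPE('n) K * 2 ^ K) * (jet_norm K (A i m) x * jet_norm K (exp_deriv A l t m j) x))"
    by (intro tame_sum tame_mult tame_const tame_jet A Suc.IH mult_nonneg_nonneg jet_norm_nonneg list_count_nonneg) auto
  then show ?case
  proof (rule tame_mono)
    fix t x
    show "jet_norm K (exp_deriv A (Suc l) t i j) x \<le> (\<Sum>m\<in>UNIV. (list_count TYPE('n) K * 2 ^ K) * (jet_norm K (A i m) x * jet_norm K (exp_deriv A l t m j) x))"
      unfolding exp_deriv_Suc
      by (intro order_trans[OF jet_norm_sum] sum_mono jet_norm_mult smooth_mult A_smooth exp_deriv_smooth finite)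
  qed
qed

lemma exp_deriv_O_M:
  assumes C: "0 \<le> C" "\<And>x \<mu>. \<mu> \<in> spectrum (sym_mat x) \<Longrightarrow> Re \<mu> \<le> C * (1 + ln (1 + norm x))" and t: "0 \<le> t"
  shows "exp_deriv A l t i j \<in> O_M"
proof (rule O_M_I[OF exp_deriv_smooth])
  fix K
  have "tame {0..t} (\<lambda>s. jet_norm K (exp_deriv A l s i j))" by (rule tame_exp_deriv[OF C t])
  then show "\<exists>N B. \<forall>x. jet_norm K (exp_deriv A l t i j) x \<le> B * (1 + norm x) ^ N"
    unfolding tame_def using t by (meson atLeastAtMost_iff order_refl)
qed

text \<open>Taylor's formula of second order in \<open>t\<close> for every derivative in \<open>x\<close>: the error is \<open>|u - t|\<close> times the
  second derivative, which has polynomial growth uniformly for \<open>t\<close> in a bounded interval.\<close>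

lemma exp_deriv_quotient:
  assumes C: "0 \<le> C" "\<And>x \<mu>. \<mu> \<in> spectrum (sym_mat x) \<Longrightarrow> Re \<mu> \<le> C * (1 + ln (1 + norm x))" and t: "0 \<le> t"
  shows "\<exists>N. \<forall>e>0. \<forall>\<^sub>F u in at t within {0..}. \<forall>x.
    jet_norm K (\<lambda>x. (1 / of_real (u - t)) * (exp_deriv A l u i j x - exp_deriv A l t i j x) - exp_deriv A (Suc l) t i j x) x \<le> e * (1 + norm x) ^ N"
proof -
  have "0 \<le> t + 1" using t by linarith
  have "tame {0..t + 1} (\<lambda>s. jet_norm K (exp_deriv A (Suc (Suc l)) s i j))"
    by (rule tame_exp_deriv[OF C \<open>0 \<le> t + 1\<close>])
  then obtain N B where B: "0 \<le> B" "\<And>s x. s \<in> {0..t + 1} \<Longrightarrow> jet_norm K (exp_deriv A (Suc (Suc l)) s i j) x \<le> B * (1 + norm x) ^ N"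
    unfolding tame_def by blast
  let ?c = "list_count TYPE('n) K"
  let ?q = "\<lambda>u x. (1 / of_real (u - t)) * (exp_deriv A l u i j x - exp_deriv A l t i j x) - exp_deriv A (Suc l) t i j x"
  have main: "jet_norm K (?q u) x \<le> ?c * (B * (1 + norm x) ^ N * \<bar>u - t\<bar>)" if u: "u \<in> {0..t + 1}" "u \<noteq> t" for u x
  proof (rule jet_norm_le)
    fix js :: "'n list" assume js: "length js \<le> K"
    define f where "f l s = partials js (exp_deriv A l s i j) x" for l s
    define M where "M = B * (1 + norm x) ^ N"
    have df: "(f l has_vector_derivative f (Suc l) s) (at s within S)" for l s S
      unfolding f_def by (rule exp_deriv_derivative)
    define I where "I = {min u t..max u t}"
    have I: "s \<in> {0..t + 1}" "\<bar>s - t\<bar> \<le> \<bar>u - t\<bar>" if "s \<in> I" for s using that u t by (auto simp: I_def)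
    have fM: "norm (f (Suc (Suc l)) s) \<le> M" if "s \<in> I" for s
      unfolding f_def M_def by (rule order_trans[OF jet_norm_ge[OF js] B(2)[OF I(1)[OF that]]])
    have M0: "0 \<le> M" using B by (simp add: M_def)
    have d1: "norm (f (Suc l) s - f (Suc l) t) \<le> M * \<bar>u - t\<bar>" if s: "s \<in> I" for s
    proof -
      have "norm (f (Suc l) s - f (Suc l) t) \<le> M * \<bar>s - t\<bar>"
        by (rule vector_mvt_bound[where a = "min u t" and b = "max u t", OF df]) (use s fM in \<open>auto simp: I_def\<close>)
      also have "\<dots> \<le> M * \<bar>u - t\<bar>" by (intro mult_left_mono I s M0)
      finally show ?thesis .
    qed
    \<comment> \<open>\<open>(h u - h t) / (u - t)\<close> is the difference quotient minus the derivative at \<open>t\<close>\<close>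
    define h where "h s = f l s - s *\<^sub>R f (Suc l) t" for s
    have "norm (h u - h t) \<le> (M * \<bar>u - t\<bar>) * \<bar>u - t\<bar>"
    proof (rule vector_mvt_bound[where a = "min u t" and b = "max u t"])
      show "(h has_vector_derivative f (Suc l) s - f (Suc l) t) (at s within {min u t..max u t})" for s
        unfolding h_def[abs_def] by (auto intro!: derivative_eq_intros df)
      show "norm (f (Suc l) s - f (Suc l) t) \<le> M * \<bar>u - t\<bar>" if "s \<in> {min u t..max u t}" for s
        using d1 that by (simp add: I_def)
    qed auto
    moreover have "partials js (?q u) x = (h u - h t) / of_real (u - t)"
    proof -
      have "partials js (?q u) x = (1 / of_real (u - t)) * (f l u - f l t) - f (Suc l) t"
        unfolding f_def
        by (subst partials_diff, intro smooth_cmult smooth_diff exp_deriv_smooth, rule exp_deriv_smooth)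
           (subst partials_cmult, intro smooth_diff exp_deriv_smooth, simp add: partials_diff[OF exp_deriv_smooth exp_deriv_smooth])
      also have "\<dots> = (h u - h t) / of_real (u - t)"
        using u(2) by (simp add: h_def field_simps scaleR_conv_of_real)
      finally show ?thesis .
    qed
    ultimately show "norm (partials js (?q u) x) \<le> B * (1 + norm x) ^ N * \<bar>u - t\<bar>"
      using u(2) unfolding M_def[symmetric] by (simp add: norm_divide pos_divide_le_eq flip: of_real_diff)
  qed
  have "\<forall>\<^sub>F u in at t within {0..}. \<forall>x. jet_norm K (?q u) x \<le> e * (1 + norm x) ^ N" if e: "0 < e" for e
  proof -
    define d where "d = min 1 (e / (?c * B + 1))"
    have cB: "0 \<le> ?c * B" using B by simp
    then have d: "0 < d" using e by (simp add: d_def add_nonneg_pos)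
    have "\<forall>\<^sub>F u in at t within {0..}. u \<in> {0..} \<and> u \<noteq> t \<and> dist u t < d"
      unfolding eventually_at using d by blast
    then show ?thesis
    proof eventually_elim
      case (elim u)
      have u: "u \<in> {0..t + 1}" "u \<noteq> t" using elim by (auto simp: d_def dist_real_def)
      show ?case
      proof
        fix x :: "real^'n"
        have "(?c * B) * \<bar>u - t\<bar> \<le> (?c * B + 1) * (e / (?c * B + 1))"
          using elim cB by (intro mult_mono) (auto simp: d_def dist_real_def)
        also have "\<dots> = e" using cB by simp
        finally have "((?c * B) * \<bar>u - t\<bar>) * (1 + norm x) ^ N \<le> e * (1 + norm x) ^ N" by (intro mult_right_mono) auto
        moreover have "jet_norm K (?q u) x \<le> ((?c * B) * \<bar>u - t\<bar>) * (1 + norm x) ^ N"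
          using main[OF u, of x] by (simp only: mult_ac)
        ultimately show "jet_norm K (?q u) x \<le> e * (1 + norm x) ^ N" by (rule order_trans[rotated])
      qed
    qed
  qed
  then show ?thesis by blast
qed

end

section \<open>Generators of convolution semigroups\<close>

lemma topspace_mat_topology: "T \<in> topspace mat_topology \<longleftrightarrow> (\<forall>i j. T i j \<in> O_C')"
  by (auto simp: mat_topology_def)

lemma limitin_mat_topology:
  assumes "\<And>i j. limitin O_C'_topology (\<lambda>u. B u i j) (T i j) F"
    and "\<forall>\<^sub>F u in F. \<forall>i j. B u i j \<in> O_C'"
  shows "limitin mat_topology B T F"
proof -
  have "limitin (product_topology (\<lambda>j. O_C'_topology) UNIV) (\<lambda>u. B u i) (T i) F" for i
    unfolding limitin_componentwise using assms by (auto elim: eventually_mono)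
  moreover have "\<forall>\<^sub>F u in F. B u \<in> topspace (product_topology (\<lambda>i. product_topology (\<lambda>j. O_C'_topology) UNIV) UNIV)"
    using assms(2) by (rule eventually_mono) auto
  ultimately show ?thesis unfolding mat_topology_def limitin_componentwise by auto
qed

lemma limitin_mat_topology_component:
  assumes "limitin mat_topology B T F" shows "limitin O_C'_topology (\<lambda>u. B u i j) (T i j) F"
proof -
  have "limitin (product_topology (\<lambda>j. O_C'_topology) UNIV) (\<lambda>u. B u i) (T i) F"
    using assms unfolding mat_topology_def limitin_componentwise[of _ UNIV B] by blast
  then show ?thesis unfolding limitin_componentwise[of _ UNIV "\<lambda>u. B u i"] by blast
qed

text \<open>The difference quotients are distributions whose symbols are the difference quotients of the symbols.\<close>

lemma has_mat_derivative_symbols: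
  fixes g :: "real \<Rightarrow> 'm::finite \<Rightarrow> 'm \<Rightarrow> real^'n::finite \<Rightarrow> complex"
  assumes t: "0 \<le> t" and g: "\<And>u i j. 0 \<le> u \<Longrightarrow> g u i j \<in> O_M" and S: "\<And>u i j. 0 \<le> u \<Longrightarrow> S u i j = symbol_dist (g u i j)"
    and D: "has_mat_derivative S (\<lambda>i j. symbol_dist (d i j)) t" and d: "\<And>i j. d i j \<in> O_M"
  shows "((\<lambda>u. g u i j \<xi>) has_vector_derivative d i j \<xi>) (at t within {0..})"
proof -
  let ?h = "\<lambda>u x. (1 / of_real (u - t)) * (g u i j x - g t i j x)"
  have ev: "\<forall>\<^sub>F u in at t within {0..}. (0 :: real) \<le> u"
    unfolding eventually_at_filter by (rule always_eventually) simp
  have h: "?h u \<in> O_M" if "0 \<le> u" for u by (intro O_M_cmult O_M_diff g that t)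
  have "limitin O_C'_topology (\<lambda>u \<phi>. (S u i j \<phi> - S t i j \<phi>) / complex_of_real (u - t)) (symbol_dist (d i j)) (at t within {0..})"
    using limitin_mat_topology_component[OF D[unfolded has_mat_derivative_def]] .
  moreover have "(\<lambda>\<phi>. (S u i j \<phi> - S t i j \<phi>) / complex_of_real (u - t)) = symbol_dist (?h u)" if "0 \<le> u" for u
    by (rule ext) (simp only: symbol_dist_cmult symbol_dist_diff[OF g[OF that] g[OF t]] S[OF that] S[OF t], simp)
  ultimately have "limitin O_C'_topology (\<lambda>u. symbol_dist (?h u)) (symbol_dist (d i j)) (at t within {0..})"
    using ev by (auto elim!: limitin_transform_eventually[rotated] eventually_mono)
  note lim = this
  have "\<forall>\<^sub>F u in at t within {0..}. ?h u \<in> O_M" using ev by (rule eventually_mono) (rule h)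
  from limitin_symbol_dist_pointwise[OF d this lim, of \<xi>]
  have "((\<lambda>u. ?h u \<xi>) \<longlongrightarrow> d i j \<xi>) (at t within {0..})" .
  then have "((\<lambda>u. (1 / (u - t)) *\<^sub>R (g u i j \<xi> - g t i j \<xi>)) \<longlongrightarrow> d i j \<xi>) (at t within {0..})"
    by (simp add: scaleR_conv_of_real)
  then have "((\<lambda>u. (1 / (u - t)) *\<^sub>R (g u i j \<xi> - g t i j \<xi>) - d i j \<xi>) \<longlongrightarrow> 0) (at t within {0..})"
    by (simp only: Lim_null[symmetric])
  then have "((\<lambda>u. norm ((1 / (u - t)) *\<^sub>R (g u i j \<xi> - g t i j \<xi>) - d i j \<xi>)) \<longlongrightarrow> 0) (at t within {0..})"
    by (rule tendsto_norm_zero)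
  then have "((\<lambda>u. norm (g u i j \<xi> - g t i j \<xi> - (u - t) *\<^sub>R d i j \<xi>) / norm (u - t)) \<longlongrightarrow> 0) (at t within {0..})"
  proof (rule Lim_transform_eventually)
    have "norm ((1 / (u - t)) *\<^sub>R (g u i j \<xi> - g t i j \<xi>) - d i j \<xi>) = norm (g u i j \<xi> - g t i j \<xi> - (u - t) *\<^sub>R d i j \<xi>) / norm (u - t)" if "u \<noteq> t" for u
    proof -
      have "(1 / (u - t)) *\<^sub>R (g u i j \<xi> - g t i j \<xi>) - d i j \<xi> = (1 / (u - t)) *\<^sub>R (g u i j \<xi> - g t i j \<xi> - (u - t) *\<^sub>R d i j \<xi>)"
        using that by (simp add: scaleR_diff_right)
      then show ?thesis by simp
    qed
    then show "\<forall>\<^sub>F u in at t within {0..}. norm ((1 / (u - t)) *\<^sub>R (g u i j \<xi> - g t i j \<xi>) - d i j \<xi>) = norm (g u i j \<xi> - g t i j \<xi> - (u - t) *\<^sub>R d i j \<xi>) / norm (u - t)"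
      by (auto simp: eventually_at_filter)
  qed
  then show ?thesis
    unfolding has_vector_derivative_def has_derivative_iff_norm by (auto intro!: bounded_linear_intros)
qed

text \<open>At each frequency the symbols form a differentiable semigroup of matrices. Its action on an eigenvector
  of the symbol of the generator solves \<open>w' = \<mu> w\<close>, so that \<open>exp \<mu>\<close> is bounded by the symbol at time 1, which
  grows polynomially.\<close>

lemma generator_spectral_bound:
  fixes G :: "('n::finite, 'm::finite) dist_matrix" and a :: "'m \<Rightarrow> 'm \<Rightarrow> real^'n \<Rightarrow> complex"
  assumes a: "\<And>i j. a i j \<in> O_M" and G: "\<And>i j. G i j = symbol_dist (a i j)"
    and S: "idcs S" "generating_distribution S G"
  shows "\<exists>C>0. \<forall>\<xi>. \<forall>\<mu>\<in>spectrum (\<chi> i j. a i j \<xi>). Re \<mu> \<le> C * (1 + ln (1 + norm \<xi>))"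
proof -
  have sm: "smooth_curve S" and semi: "\<And>s t. 0 \<le> s \<Longrightarrow> 0 \<le> t \<Longrightarrow> S (s + t) = mat_conv (S s) (S t)" and S0: "S 0 = mat_dirac"
    using S(1) by (auto simp: idcs_def)
  have SO: "S t i j \<in> O_C'" if "0 \<le> t" for t i j
    using sm that topspace_mat_topology unfolding smooth_curve_def by blast
  have "\<exists>g\<in>O_M. S t i j = symbol_dist g" if "0 \<le> t" for t i j
    by (rule O_C'_symbol[OF SO[OF that]]) blast
  then obtain g where g: "\<And>t i j. 0 \<le> t \<Longrightarrow> g t i j \<in> O_M" "\<And>t i j. 0 \<le> t \<Longrightarrow> S t i j = symbol_dist (g t i j)"
    by metis
  have symbol_inj: "f = h" if "symbol_dist f = symbol_dist h" "f \<in> O_M" "h \<in> O_M" for f h :: "real^'n \<Rightarrow> complex"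
    using that fourier_fun_symbol_dist by metis
  have gadd: "g (s + t) i k \<xi> = (\<Sum>j\<in>UNIV. g s i j \<xi> * g t j k \<xi>)" if st: "0 \<le> s" "0 \<le> t" for s t i k \<xi>
  proof -
    have "symbol_dist (g (s + t) i k) = symbol_dist (\<lambda>\<xi>. \<Sum>j\<in>UNIV. g s i j \<xi> * g t j k \<xi>)"
    proof
      fix \<phi>
      have "symbol_dist (g (s + t) i k) \<phi> = (\<Sum>j\<in>UNIV. conv (S s i j) (S t j k) \<phi>)"
        using st g(2)[of "s + t" i k] fun_cong[OF fun_cong[OF fun_cong[OF semi[OF st]]], of i k \<phi>] by (simp add: mat_conv_def)
      also have "\<dots> = (\<Sum>j\<in>UNIV. symbol_dist (\<lambda>\<xi>. g s i j \<xi> * g t j k \<xi>) \<phi>)"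
        using st by (simp add: g conv_symbol_dist)
      also have "\<dots> = symbol_dist (\<lambda>\<xi>. \<Sum>j\<in>UNIV. g s i j \<xi> * g t j k \<xi>) \<phi>"
        by (rule symbol_dist_sum[symmetric]) (auto intro!: O_M_mult g st)
      finally show "symbol_dist (g (s + t) i k) \<phi> = symbol_dist (\<lambda>\<xi>. \<Sum>j\<in>UNIV. g s i j \<xi> * g t j k \<xi>) \<phi>" .
    qed
    moreover have "g (s + t) i k \<in> O_M" using st by (intro g) simp
    moreover have "(\<lambda>\<xi>. \<Sum>j\<in>UNIV. g s i j \<xi> * g t j k \<xi>) \<in> O_M" by (intro O_M_sum O_M_mult g st)
    ultimately have "g (s + t) i k = (\<lambda>\<xi>. \<Sum>j\<in>UNIV. g s i j \<xi> * g t j k \<xi>)" by (rule symbol_inj)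
    then show ?thesis by (rule fun_cong)
  qed
  have g0: "g 0 i j \<xi> = (if i = j then 1 else 0)" for i j \<xi>
  proof -
    have "symbol_dist (g 0 i j) = symbol_dist (\<lambda>\<xi>. if i = j then 1 else 0)"
      unfolding g(2)[OF order_refl, symmetric] S0
      by (cases "i = j") (simp_all add: mat_dirac_def symbol_dist_1 symbol_dist_0)
    from fun_cong[OF symbol_inj[OF this], of \<xi>] show ?thesis using g(1)[of 0] by simp
  qed
  obtain D where D: "\<And>t. 0 \<le> t \<Longrightarrow> D 0 t = S t" "\<And>l t. 0 \<le> t \<Longrightarrow> has_mat_derivative (D l) (D (Suc l) t) t"
    using sm unfolding smooth_curve_def by blast
  have diff: "\<exists>d. ((\<lambda>u. g u i j \<xi>) has_vector_derivative d) (at t within {0..})" if t: "0 \<le> t" for t i j \<xi>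
  proof -
    have "D (Suc 0) t \<in> topspace mat_topology"
      using D(2)[OF t, of 0] unfolding has_mat_derivative_def limitin_def by blast
    then have "D (Suc 0) t i j \<in> O_C'" for i j by (simp add: topspace_mat_topology)
    then have "\<exists>d\<in>O_M. D (Suc 0) t i j = symbol_dist d" for i j
      by (rule O_C'_symbol) blast
    then obtain d where d: "\<And>i j. d i j \<in> O_M" "\<And>i j. D (Suc 0) t i j = symbol_dist (d i j)" by metis
    then have "D (Suc 0) t = (\<lambda>i j. symbol_dist (d i j))" by blast
    then have hm: "has_mat_derivative (D 0) (\<lambda>i j. symbol_dist (d i j)) t" using D(2)[OF t, of 0] by simp
    have "((\<lambda>u. g u i j \<xi>) has_vector_derivative d i j \<xi>) (at t within {0..})"
      by (rule has_mat_derivative_symbols[where g = g and S = "D 0" and d = d, OF t g(1) _ hm d(1)])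
         (simp_all add: D(1) g(2))
    then show ?thesis by blast
  qed
  have diff0: "((\<lambda>u. g u i j \<xi>) has_vector_derivative a i j \<xi>) (at 0 within {0..})" for i j \<xi>
  proof -
    have "G = (\<lambda>i j. symbol_dist (a i j))" using G by blast
    then have hm: "has_mat_derivative S (\<lambda>i j. symbol_dist (a i j)) 0" using S(2) by (simp add: generating_distribution_def)
    show ?thesis
      by (rule has_mat_derivative_symbols[where g = g and S = S and d = a, OF order_refl g(1) g(2) hm a])
  qed
  have growth: "exp (Re \<mu>) \<le> (\<Sum>i\<in>UNIV. \<Sum>j\<in>UNIV. norm (g 1 i j \<xi>))" if \<mu>: "\<mu> \<in> spectrum (\<chi> i j. a i j \<xi>)" for \<mu> \<xi>
  proof -
    obtain v where v: "v \<noteq> 0" "(\<chi> i j. a i j \<xi>) *v v = \<mu> *s v" using \<mu> by (auto simp: spectrum_def)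
    define w where "w t i = (\<Sum>j\<in>UNIV. g t i j \<xi> * v $ j)" for t i
    \<comment> \<open>the semigroup property transports the right derivative at \<open>0\<close> to \<open>t\<close>\<close>
    have right: "((\<lambda>h. w (t + h) i) has_vector_derivative \<mu> * w t i) (at 0 within {0..})" if t: "0 \<le> t" for t i
    proof -
      have "((\<lambda>h. \<Sum>j\<in>UNIV. (\<Sum>k\<in>UNIV. g t i k \<xi> * g h k j \<xi>) * v $ j) has_vector_derivative
        (\<Sum>j\<in>UNIV. (\<Sum>k\<in>UNIV. g t i k \<xi> * a k j \<xi>) * v $ j)) (at 0 within {0..})"
        by (intro has_vector_derivative_sum has_vector_derivative_mult_left has_vector_derivative_mult_right diff0)
      moreover have "(\<Sum>j\<in>UNIV. (\<Sum>k\<in>UNIV. g t i k \<xi> * a k j \<xi>) * v $ j) = (\<Sum>k\<in>UNIV. g t i k \<xi> * ((\<chi> i j. a i j \<xi>) *v v) $ k)"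
        unfolding matrix_vector_mult_def by (simp add: sum_distrib_left sum_distrib_right mult.assoc) (rule sum.swap)
      moreover have "\<dots> = \<mu> * w t i" by (simp add: v w_def sum_distrib_left mult_ac)
      ultimately have "((\<lambda>h. \<Sum>j\<in>UNIV. (\<Sum>k\<in>UNIV. g t i k \<xi> * g h k j \<xi>) * v $ j) has_vector_derivative \<mu> * w t i) (at 0 within {0..})"
        by simp
      moreover have "(\<Sum>j\<in>UNIV. (\<Sum>k\<in>UNIV. g t i k \<xi> * g h k j \<xi>) * v $ j) = w (t + h) i" if "h \<in> {0..}" for h
        using that t by (simp add: w_def gadd)
      ultimately show ?thesis by (rule_tac has_vector_derivative_transform[of 0 "{0..}"]) auto
    qed
    \<comment> \<open>the curve is differentiable at \<open>t\<close>, so its derivative equals the right derivative\<close>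
    have dw: "((\<lambda>u. w u i) has_vector_derivative \<mu> * w t i) (at t within {0..1})" if t: "t \<in> {0..1}" for t i
    proof -
      have "\<exists>d. \<forall>j. ((\<lambda>u. g u i j \<xi>) has_vector_derivative d j) (at t within {0..})"
      proof (rule choice)
        show "\<forall>j. \<exists>d. ((\<lambda>u. g u i j \<xi>) has_vector_derivative d) (at t within {0..})"
          using diff[of t] t by simp
      qed
      then obtain d where "\<forall>j. ((\<lambda>u. g u i j \<xi>) has_vector_derivative d j) (at t within {0..})" by (elim exE)
      then have d: "((\<lambda>u. g u i j \<xi>) has_vector_derivative d j) (at t within {0..})" for j by (rule spec)
      have dd: "((\<lambda>u. w u i) has_vector_derivative (\<Sum>j\<in>UNIV. d j * v $ j)) (at t within {0..})"
        unfolding w_def by (intro has_vector_derivative_sum has_vector_derivative_mult_left d)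
      have sub: "(\<lambda>h. t + h) ` {0..} \<subseteq> {0..}" using t by auto
      have "((\<lambda>h. t + h) has_vector_derivative 1) (at 0 within {0..})" by (auto intro!: derivative_eq_intros)
      moreover have "((\<lambda>u. w u i) has_vector_derivative (\<Sum>j\<in>UNIV. d j * v $ j)) (at (t + 0) within (\<lambda>h. t + h) ` {0..})"
        unfolding add_0_right by (rule has_vector_derivative_within_subset[OF dd sub])
      ultimately have "((\<lambda>u. w u i) \<circ> (\<lambda>h. t + h) has_vector_derivative 1 *\<^sub>R (\<Sum>j\<in>UNIV. d j * v $ j)) (at 0 within {0..})"
        by (rule vector_diff_chain_within)
      then have "((\<lambda>h. w (t + h) i) has_vector_derivative (\<Sum>j\<in>UNIV. d j * v $ j)) (at 0 within {0..})" by (simp add: o_def)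
      moreover have "((\<lambda>h. w (t + h) i) has_vector_derivative \<mu> * w t i) (at 0 within {0..})" using right t by simp
      moreover have "(at 0 within {0 :: real..}) \<noteq> bot"
        by (simp add: at_within_Ici_at_right)
      ultimately have "(\<Sum>j\<in>UNIV. d j * v $ j) = \<mu> * w t i" by (rule_tac vector_derivative_unique_within)
      then show ?thesis using has_vector_derivative_within_subset[OF dd, of "{0..1}"] by auto
    qed
    have "w 1 i = exp \<mu> * v $ i" for i
    proof -
      define u where "u s = exp (- \<mu> * of_real s) * w s i" for s
      have "(u has_vector_derivative 0) (at s within {0..1})" if s: "s \<in> {0..1}" for s
      proof -
        have "((\<lambda>z. exp (- \<mu> * z)) has_field_derivative - \<mu> * exp (- \<mu> * of_real s)) (at (of_real s))"
          by (auto intro!: derivative_eq_intros)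
        then have "((\<lambda>s. exp (- \<mu> * of_real s)) has_vector_derivative - \<mu> * exp (- \<mu> * of_real s)) (at s within {0..1})"
          by (rule has_vector_derivative_real_field)
        from has_vector_derivative_mult[OF this dw[OF s, of i]] show ?thesis unfolding u_def[abs_def] by (simp add: algebra_simps)
      qed
      from vector_mvt_bound[where a = 0 and b = 1 and s = 1 and t = 0 and M = 0, OF this]
      have "u 1 = u 0" by simp
      moreover have "u 0 = v $ i"
      proof -
        have delta: "(\<Sum>j\<in>UNIV. (if i = j then 1 else 0) * v $ j) = (\<Sum>j\<in>UNIV. if i = j then v $ j else 0)"
          by (intro sum.cong refl) simp
        show ?thesis unfolding u_def w_def g0 delta by simp
      qed
      ultimately have "exp (- \<mu>) * w 1 i = v $ i" by (simp add: u_def)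
      then show ?thesis by (metis exp_minus_inverse mult.assoc mult.left_neutral)
    qed
    then have "exp (Re \<mu>) * norm v = norm (\<chi> i. w 1 i)"
    proof -
      assume "\<And>i. w 1 i = exp \<mu> * v $ i"
      then have "(\<chi> i. w 1 i) = exp \<mu> *s v" by (simp add: vec_eq_iff)
      then show ?thesis by (simp add: norm_vector_scalar)
    qed
    also have "\<dots> \<le> (\<Sum>i\<in>UNIV. norm (w 1 i))" using L2_set_le_sum[of UNIV "\<lambda>i. norm (w 1 i)"] by (simp add: norm_vec_def)
    also have "\<dots> \<le> (\<Sum>i\<in>UNIV. \<Sum>j\<in>UNIV. norm (g 1 i j \<xi>) * norm v)"
    proof (intro sum_mono)
      fix i
      show "norm (w 1 i) \<le> (\<Sum>j\<in>UNIV. norm (g 1 i j \<xi>) * norm v)"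
        unfolding w_def by (intro order_trans[OF norm_sum] sum_mono)
          (simp add: norm_mult mult_left_mono Finite_Cartesian_Product.norm_nth_le)
    qed
    also have "\<dots> = (\<Sum>i\<in>UNIV. \<Sum>j\<in>UNIV. norm (g 1 i j \<xi>)) * norm v" by (simp add: sum_distrib_right)
    finally show ?thesis using v(1) by simp
  qed
  have "tame {0 :: nat} (\<lambda>_ \<xi>. \<Sum>i\<in>UNIV. \<Sum>j\<in>UNIV. jet_norm 0 (g 1 i j) \<xi>)"
    by (intro tame_sum tame_jet g finite) simp
  then obtain N B where B: "0 \<le> B" "\<And>\<xi>. (\<Sum>i\<in>UNIV. \<Sum>j\<in>UNIV. norm (g 1 i j \<xi>)) \<le> B * (1 + norm \<xi>) ^ N"
    unfolding tame_def jet_norm_def by auto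
  \<comment> \<open>from \<open>Re \<mu> \<le> ln (B + 1) + N ln (1 + |\<xi>|)\<close>; adding 1 makes it positive\<close>
  define C where "C = \<bar>ln (B + 1)\<bar> + real N + 1"
  have "Re \<mu> \<le> C * (1 + ln (1 + norm \<xi>))" if "\<mu> \<in> spectrum (\<chi> i j. a i j \<xi>)" for \<mu> \<xi>
  proof -
    have l0: "0 \<le> ln (1 + norm \<xi>)" by (rule ln_ge_zero) simp
    have "exp (Re \<mu>) \<le> (B + 1) * (1 + norm \<xi>) ^ N"
      by (rule order_trans[OF growth[OF that] order_trans[OF B(2)]]) (intro mult_right_mono, auto)
    then have "ln (exp (Re \<mu>)) \<le> ln ((B + 1) * (1 + norm \<xi>) ^ N)" using B(1) by (intro iffD2[OF ln_le_cancel_iff]) auto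
    then have "Re \<mu> \<le> ln (B + 1) + real N * ln (1 + norm \<xi>)" using B(1) by (simp add: ln_mult ln_realpow)
    also have "\<dots> \<le> C * 1 + C * ln (1 + norm \<xi>)" using l0 by (intro add_mono mult_right_mono) (auto simp: C_def)
    finally show ?thesis by (simp add: distrib_left)
  qed
  moreover have "0 < C" by (simp add: C_def add_nonneg_pos)
  ultimately show ?thesis by blast
qed

text \<open>The semigroup with symbols \<open>exp (t A)\<close> has the derivatives with symbols \<open>A\<^sup>l exp (t A)\<close>.\<close>

lemma spectral_bound_generates:
  fixes G :: "('n::finite, 'm::finite) dist_matrix" and a :: "'m \<Rightarrow> 'm \<Rightarrow> real^'n \<Rightarrow> complex"
  assumes a: "\<And>i j. a i j \<in> O_M" and G: "\<And>i j. G i j = symbol_dist (a i j)"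
    and C: "0 < C" "\<And>\<xi> \<mu>. \<mu> \<in> spectrum (\<chi> i j. a i j \<xi>) \<Longrightarrow> Re \<mu> \<le> C * (1 + ln (1 + norm \<xi>))"
  shows "\<exists>S. idcs S \<and> generating_distribution S G"
proof -
  interpret multiplier_matrix a by unfold_locales (rule a)
  have C': "0 \<le> C" "\<And>x \<mu>. \<mu> \<in> spectrum (sym_mat x) \<Longrightarrow> Re \<mu> \<le> C * (1 + ln (1 + norm x))"
    using C by (auto simp: sym_mat_def)
  have OM: "exp_deriv a l t i j \<in> O_M" if "0 \<le> t" for l t i j
    by (rule exp_deriv_O_M[OF C'(1) _ that]) (rule C'(2))
  define D where "D l t = (\<lambda>i j. symbol_dist (exp_deriv a l t i j))" for l t
  have DO: "D l t i j \<in> O_C'" if "0 \<le> t" for l t i j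
    unfolding D_def by (rule symbol_dist_O_C'[OF OM[OF that]])
  have der: "has_mat_derivative (D l) (D (Suc l) t) t" if t: "0 \<le> t" for l t
    unfolding has_mat_derivative_def
  proof (rule limitin_mat_topology)
    let ?h = "\<lambda>u i j x. (1 / of_real (u - t)) * (exp_deriv a l u i j x - exp_deriv a l t i j x)"
    have ev: "\<forall>\<^sub>F u in at t within {0..}. (0 :: real) \<le> u"
      unfolding eventually_at_filter by (rule always_eventually) simp
    have h: "?h u i j \<in> O_M" if "0 \<le> u" for u i j by (intro O_M_cmult O_M_diff OM that t)
    have eq: "symbol_dist (?h u i j) = (\<lambda>\<phi>. (D l u i j \<phi> - D l t i j \<phi>) / complex_of_real (u - t))" if "0 \<le> u" for u i j
      by (rule ext) (simp only: symbol_dist_cmult symbol_dist_diff[OF OM[OF that] OM[OF t]] D_def, simp)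
    have lim: "limitin O_C'_topology (\<lambda>u. symbol_dist (?h u i j)) (D (Suc l) t i j) (at t within {0..})" for i j
      unfolding D_def
    proof (rule limitin_symbol_dist)
      show "exp_deriv a (Suc l) t i j \<in> O_M" by (rule OM[OF t])
      show "\<forall>\<^sub>F u in at t within {0..}. ?h u i j \<in> O_M" using ev by (rule eventually_mono) (rule h)
      fix K
      show "\<exists>N. \<forall>e>0. \<forall>\<^sub>F u in at t within {0..}. \<forall>x. jet_norm K (\<lambda>x. ?h u i j x - exp_deriv a (Suc l) t i j x) x \<le> e * (1 + norm x) ^ N"
        by (rule exp_deriv_quotient[OF C'(1) _ t]) (rule C'(2))
    qed
    have "\<forall>\<^sub>F u in at t within {0..}. symbol_dist (?h u i j) = (\<lambda>\<phi>. (D l u i j \<phi> - D l t i j \<phi>) / complex_of_real (u - t))" for i j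
      using ev by (rule eventually_mono) (rule eq)
    then show "limitin O_C'_topology (\<lambda>u \<phi>. (D l u i j \<phi> - D l t i j \<phi>) / complex_of_real (u - t)) (D (Suc l) t i j) (at t within {0..})" for i j
      by (rule limitin_transform_eventually) (rule lim)
    show "\<forall>\<^sub>F u in at t within {0..}. \<forall>i j. (\<lambda>\<phi>. (D l u i j \<phi> - D l t i j \<phi>) / complex_of_real (u - t)) \<in> O_C'"
      using ev
    proof (rule eventually_mono)
      fix u :: real assume "0 \<le> u"
      then show "\<forall>i j. (\<lambda>\<phi>. (D l u i j \<phi> - D l t i j \<phi>) / complex_of_real (u - t)) \<in> O_C'"
        using symbol_dist_O_C'[OF h] by (simp only: eq[symmetric] simp_thms)
    qed
  qed
  have "smooth_curve (D 0)"
    unfolding smooth_curve_def using DO der by (auto simp: topspace_mat_topology)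
  moreover have "D 0 (s + t) = mat_conv (D 0 s) (D 0 t)" if st: "0 \<le> s" "0 \<le> t" for s t
  proof (intro ext)
    fix i k \<phi>
    have "exp_deriv a 0 (s + t) i k = (\<lambda>x. \<Sum>j\<in>UNIV. exp_deriv a 0 s i j x * exp_deriv a 0 t j k x)"
      by (rule ext) (rule E_add[OF st])
    then have "D 0 (s + t) i k \<phi> = (\<Sum>j\<in>UNIV. symbol_dist (\<lambda>x. exp_deriv a 0 s i j x * exp_deriv a 0 t j k x) \<phi>)"
      unfolding D_def by (simp only:) (rule symbol_dist_sum, auto intro!: O_M_mult OM st)
    also have "\<dots> = mat_conv (D 0 s) (D 0 t) i k \<phi>"
      unfolding mat_conv_def D_def by (simp add: conv_symbol_dist[OF OM[OF st(2)]])
    finally show "D 0 (s + t) i k \<phi> = mat_conv (D 0 s) (D 0 t) i k \<phi>" .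
  qed
  moreover have "D 0 0 = mat_dirac"
  proof (intro ext)
    fix i j \<phi>
    have "exp_deriv a 0 0 i j = (\<lambda>x. if i = j then 1 else 0)" by (rule ext) (rule exp_deriv_0)
    then show "D 0 0 i j \<phi> = mat_dirac i j \<phi>" by (simp add: D_def mat_dirac_def symbol_dist_0 symbol_dist_1)
  qed
  ultimately have "idcs (D 0)" unfolding idcs_def by blast
  moreover have "D (Suc 0) 0 = G"
  proof (intro ext)
    fix i j \<phi>
    have "exp_deriv a (Suc 0) 0 i j = a i j"
    proof
      fix x
      have "exp_deriv a (Suc 0) 0 i j x = (\<Sum>m\<in>UNIV. if m = j then a i m x else 0)"
        unfolding exp_deriv_Suc by (intro sum.cong refl) (simp add: exp_deriv_0)
      then show "exp_deriv a (Suc 0) 0 i j x = a i j x" by simp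
    qed
    then show "D (Suc 0) 0 i j \<phi> = G i j \<phi>" by (simp add: D_def G)
  qed
  then have "generating_distribution (D 0) G" unfolding generating_distribution_def using der[of 0 0] by simp
  ultimately show ?thesis by blast
qed

theorem theorem1:
  fixes G :: "('n::finite, 'm::finite) dist_matrix"
  assumes "\<And>i j. G i j \<in> O_C'"
  shows "(\<exists>S. idcs S \<and> generating_distribution S G) \<longleftrightarrow>
    (\<exists>C>0. \<forall>\<xi>. \<forall>\<mu>\<in>spectrum (fourier_matrix G \<xi>). Re \<mu> \<le> C * (1 + ln (1 + norm \<xi>)))"
proof -
  have "\<exists>g\<in>O_M. G i j = symbol_dist g" for i j by (rule O_C'_symbol[OF assms]) blast
  then obtain a where a: "\<And>i j. a i j \<in> O_M" "\<And>i j. G i j = symbol_dist (a i j)" by metis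
  have symbol: "fourier_matrix G \<xi> = (\<chi> i j. a i j \<xi>)" for \<xi>
    by (simp add: fourier_matrix_def a fourier_fun_symbol_dist)
  show ?thesis
    unfolding symbol
  proof
    assume "\<exists>S. idcs S \<and> generating_distribution S G"
    then show "\<exists>C>0. \<forall>\<xi>. \<forall>\<mu>\<in>spectrum (\<chi> i j. a i j \<xi>). Re \<mu> \<le> C * (1 + ln (1 + norm \<xi>))"
      using generator_spectral_bound[where G = G and a = a, OF a(1) a(2)] by blast
  next
    assume "\<exists>C>0. \<forall>\<xi>. \<forall>\<mu>\<in>spectrum (\<chi> i j. a i j \<xi>). Re \<mu> \<le> C * (1 + ln (1 + norm \<xi>))"
    then obtain C where "0 < C" "\<forall>\<xi>. \<forall>\<mu>\<in>spectrum (\<chi> i j. a i j \<xi>). Re \<mu> \<le> C * (1 + ln (1 + norm \<xi>))" by blast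
    then show "\<exists>S. idcs S \<and> generating_distribution S G"
      by (intro spectral_bound_generates[where G = G and a = a and C = C, OF a(1) a(2)]) auto
  qed
qed

end
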